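(* Let $k$ be a noetherian commutative $\mathbb{Q}$-algebra and let $W\in k[x]$, $V\in k[y]=k[y_1,\dots,y_m]$, $U\in k[z]$ be potentials. The cut operation $(Y,X)\mapsto Y\mid X$ (described in the context) defines a functor $$\mathcal{C}(V,U)\otimes_k\mathcal{C}(W,V)\longrightarrow\mathcal{C}(W,U).$$
   Context: **Conventions.** Commutators are graded, $[a,b]=ab-(-1)^{|a||b|}ba$; operators on tensor products act with Koszul signs, $(f\otimes g)(a\otimes b)=(-1)^{|g||a|}f(a)\otimes g(b)$. A potential $W\in k[x_1,\dots,x_n]$ is a polynomial such that $\partial_{x_1}W,\dots,\partial_{x_n}W$ is quasi-regular, $J_W=k[x]/(\partial_{x_1}W,\dots,\partial_{x_n}W)$ is a finitely generated free $k$-module, and the Koszul complex of the partial derivatives is exact except in degree zero. A matrix factorisation of $W\in R$ is a free $\mathbb{Z}_2$-graded $R$-module with an odd $R$-linear $d$ with $d^2=W$. $\mathrm{hmf}(R,W)$ is the category of finite rank matrix factorisations and homotopy classes of even $R$-linear maps commuting with $d$; homotopy of closed maps means differing by $[d,h]$ with $h$ linear of opposite parity. It carries the shift $\Psi(X,d)=(X[1],-d)$, so odd closed maps are morphisms $X\to\Psi X$. $(-)^\omega$ is idempotent completion: objects $(X,e)$ with $e^2=e$, morphisms $\phi$ with $\phi e=\phi=e\phi$. **Clifford thickening.** $C_n$ is the $\mathbb{Z}_2$-graded $k$-algebra with odd generators $\gamma_i,\gamma_i^\dagger$ ($1\le i\le n$) and relations $[\gamma_i,\gamma_j]=0=[\gamma_i^\dagger,\gamma_j^\dagger]$,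 $[\gamma_i,\gamma_j^\dagger]=\delta_{ij}$; $e_n=\gamma_1\cdots\gamma_n\gamma_n^\dagger\cdots\gamma_1^\dagger$. For $\mathcal{T}=\mathrm{hmf}(R,W)^\omega$, the Clifford thickening $\mathcal{T}^\bullet$ has as objects pairs $(X,n)$, $n\ge0$, with $X\in\mathcal{T}$ equipped with an action of $C_n$ by homotopy classes of closed operators (odd generators acting by odd operators); morphisms $(X,n)\to(Y,n')$ are identified with morphisms $\alpha:X\to Y$ of $\mathcal{T}$ with $\alpha\gamma_i^\dagger=0$ for $1\le i\le n$ and $\gamma_i\alpha=0$ for $1\le i\le n'$; composition is as in $\mathcal{T}$, and the identity of $(X,n)$ is the action of $e_n$. Set $\mathcal{C}(W,V)=\big(\mathrm{hmf}(k[x,y],V-W)^\omega\big)^\bullet$. **Cut.** For finite rank matrix factorisations $X$ of $V-W$ over $k[x,y]$ and $Y$ of $U-V$ over $k[y,z]$, $Y\mid X=Y\otimes_{k[y]}J_V\otimes_{k[y]}X$ with differential induced by $d_{Y\otimes X}=d_Y\otimes1+1\otimes d_X$, a finite rank matrix factorisation of $U-W$ over $k[x,z]$; $\psi\mid\phi$ is the map induced by $\psi\otimes\phi$. Let $t_i=\partial_{y_i}V$ and $\widehat{k[y]}$ the $(t_1,\dots,t_m)$-adic completion. Fix a $k$-linear section $\sigma$ of $\widehat{k[y]}\to J_V$; each $h\in\widehat{k[y]}$ is uniquely $\sum_u\sigma(r_u)t^u$ with $r_u\in J_V$, and $\partial_{t_i}h=\sum_uu_i\sigma(r_u)t^{u-\epsilon_i}$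 ($\epsilon_i$ the $i$th unit vector). Using homogeneous bases extend $\partial_{t_i}$ to $Y\otimes_{k[y]}\widehat{k[y]}\otimes_{k[y]}X$; then $[d_{Y\otimes X},\partial_{t_i}]$ induces an operator $\mathrm{At}_i$ on $Y\mid X$. $C_m$ acts on $Y\mid X$ by $\gamma_i=\mathrm{At}_i$, $\gamma_i^\dagger=-\partial_{y_i}(d_X)-\tfrac12\sum_q\partial_{y_q}\partial_{y_i}(V)\mathrm{At}_q$ (entrywise derivatives in the chosen basis). In general, for objects $(Y,e_Y)$ with $C_r$-action $\{\rho_j,\rho_j^\dagger\}$ and $(X,e_X)$ with $C_s$-action $\{\tau_l,\tau_l^\dagger\}$, the cut is $(Y\mid X,\,e_Y\mid e_X)$ with the action of $C_r\otimes C_m\otimes C_s\cong C_{r+m+s}$ whose generators act by $\rho_j\mid1,\ \rho_j^\dagger\mid1$, then $\gamma_i,\gamma_i^\dagger$, then $1\mid\tau_l,\ 1\mid\tau_l^\dagger$ (all cut down by the idempotent $e_Y\mid e_X$). Let $\psi:(Y,r)\to(Y',r')$ in $\mathcal{C}(V,U)$ and $\phi:(X,s)\to(X',s')$ in $\mathcal{C}(W,V)$ be morphisms, where $Y',X'$ carry Clifford actions $\{\rho'_j,\rho_j'^\dagger\}_{j=1}^{r'}$, $\{\tau'_l,\tau_l'^\dagger\}_{l=1}^{s'}$, and where $\psi,\phi$ are identified with morphisms $\psi:Y\to Y'$ of $\mathrm{hmf}(k[y,z],U-V)^\omega$ satisfying $\psi\rho_j^\dagger=0$ ($1\le j\le r$),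 $\rho'_j\psi=0$ ($1\le j\le r'$), and $\phi:X\to X'$ of $\mathrm{hmf}(k[x,y],V-W)^\omega$ satisfying $\phi\tau_l^\dagger=0$ ($1\le l\le s$), $\tau'_l\phi=0$ ($1\le l\le s'$). Then the cut of $\psi,\phi$ is $(\psi\mid\phi)\,e_m$ with $e_m\in C_m$ acting via $\gamma_i,\gamma_i^\dagger$. *)

theory Defs
  imports
    "HOL-Library.Poly_Mapping"
    "HOL-Algebra.Ring_Divisibility"
    "HOL-Algebra.Algebraic_Closure_Type"
    "Jordan_Normal_Form.Matrix"
begin

no_notation Polynomials.var (\<open>X\<index>\<close>)

section \<open>Polynomials\<close>

text \<open>A polynomial is a finitely supported function from monomials to coefficients.
  The type \<open>'v\<close> of variables is arbitrary; \<open>k[x\<^sub>1,\<dots>,x\<^sub>n]\<close> is \<open>poly_in (set xs)\<close> for a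
  list \<open>xs\<close> of distinct variables, which also fixes the numbering of the variables, starting at 0.\<close>

type_synonym ('v, 'k) mpol = "('v \<Rightarrow>\<^sub>0 nat) \<Rightarrow>\<^sub>0 'k"

definition poly_in :: "'v set \<Rightarrow> ('v, 'k::comm_ring_1) mpol set" where
  "poly_in A = {p. \<forall>a\<in>Poly_Mapping.keys p. Poly_Mapping.keys a \<subseteq> A}"

definition pconst :: "'k \<Rightarrow> ('v, 'k::comm_ring_1) mpol" where
  "pconst c = Poly_Mapping.single 0 c"

definition pdiff :: "'v \<Rightarrow> ('v, 'k::comm_ring_1) mpol \<Rightarrow> ('v, 'k) mpol" where
  "pdiff v p = (\<Sum>a\<in>Poly_Mapping.keys p.
     Poly_Mapping.single (a - Poly_Mapping.single v 1)
       (of_nat (Poly_Mapping.lookup a v) * Poly_Mapping.lookup p a))"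

text \<open>The coefficient in \<open>k[A]\<close> of the monomial \<open>b\<close> in the variables outside \<open>A\<close>,
  and the finite set of monomials with nonzero coefficient.\<close>

definition outer_coeff :: "'v set \<Rightarrow> ('v \<Rightarrow>\<^sub>0 nat) \<Rightarrow> ('v, 'k::comm_ring_1) mpol \<Rightarrow> ('v, 'k) mpol" where
  "outer_coeff A b p = (\<Sum>a\<in>{a \<in> Poly_Mapping.keys p. \<exists>c. Poly_Mapping.keys c \<subseteq> A \<and> a = b + c}.
     Poly_Mapping.single (a - b) (Poly_Mapping.lookup p a))"

definition outer_monos :: "'v set \<Rightarrow> ('v, 'k::comm_ring_1) mpol \<Rightarrow> ('v \<Rightarrow>\<^sub>0 nat) set" where
  "outer_monos A p = {b. Poly_Mapping.keys b \<inter> A = {} \<and> outer_coeff A b p \<noteq> 0}"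

definition rat_algebra :: "'k::comm_ring_1 itself \<Rightarrow> bool" where
  "rat_algebra _ \<longleftrightarrow> (\<exists>h :: rat \<Rightarrow> 'k. h 1 = 1 \<and>
     (\<forall>a b. h (a + b) = h a + h b) \<and> (\<forall>a b. h (a * b) = h a * h b))"

definition half :: "'k::comm_ring_1" where
  "half = (THE c. c + c = 1)"


section \<open>Potentials\<close>

text \<open>Throughout, \<open>R\<close> is (the underlying set of) a subring and \<open>ts\<close> a sequence in it.
  A multi-index is a list of length \<open>length ts\<close>.\<close>

definition exps :: "nat \<Rightarrow> nat \<Rightarrow> nat list set" where
  "exps m n = {u. length u = m \<and> sum_list u = n}"

definition tmon :: "'r::comm_ring_1 list \<Rightarrow> nat list \<Rightarrow> 'r" where
  "tmon ts u = (\<Prod>i<length ts. (ts ! i) ^ (u ! i))"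

text \<open>The \<open>n\<close>-th power of the ideal of \<open>R\<close> generated by \<open>ts\<close>.\<close>

definition ideal_pow :: "'r::comm_ring_1 set \<Rightarrow> 'r list \<Rightarrow> nat \<Rightarrow> 'r set" where
  "ideal_pow R ts n = {p. \<exists>c. (\<forall>u\<in>exps (length ts) n. c u \<in> R) \<and>
     p = (\<Sum>u\<in>exps (length ts) n. c u * tmon ts u)}"

definition quasi_regular :: "'r::comm_ring_1 set \<Rightarrow> 'r list \<Rightarrow> bool" where
  "quasi_regular R ts \<longleftrightarrow> (\<forall>n c.
     (\<forall>u\<in>exps (length ts) n. c u \<in> R) \<and>
     (\<Sum>u\<in>exps (length ts) n. c u * tmon ts u) \<in> ideal_pow R ts (Suc n)
     \<longrightarrow> (\<forall>u\<in>exps (length ts) n. c u \<in> ideal_pow R ts 1))"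

text \<open>Koszul \<open>p\<close>-chains: \<open>c S\<close> is the coefficient of \<open>\<theta>\<^sub>S\<close>, the wedge of the \<open>\<theta>\<^sub>i\<close>, \<open>i \<in> S\<close>, in
  increasing order. The differential is contraction with \<open>\<Sum>\<^sub>i t\<^sub>i \<theta>\<^sub>i\<^sup>*\<close>.\<close>

definition koszul_chains :: "'r::comm_ring_1 set \<Rightarrow> nat \<Rightarrow> nat \<Rightarrow> (nat set \<Rightarrow> 'r) set" where
  "koszul_chains R m p = {c. (\<forall>S. c S \<in> R) \<and> (\<forall>S. c S \<noteq> 0 \<longrightarrow> S \<subseteq> {..<m} \<and> card S = p)}"

definition koszul_d :: "'r::comm_ring_1 list \<Rightarrow> (nat set \<Rightarrow> 'r) \<Rightarrow> nat set \<Rightarrow> 'r" where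
  "koszul_d ts c S = (\<Sum>i\<in>{..<length ts} - S. (-1) ^ card {j\<in>S. j < i} * ts ! i * c (insert i S))"

definition koszul_exact :: "'r::comm_ring_1 set \<Rightarrow> 'r list \<Rightarrow> bool" where
  "koszul_exact R ts \<longleftrightarrow> (\<forall>p\<ge>1. \<forall>c\<in>koszul_chains R (length ts) p.
     koszul_d ts c = (\<lambda>_. 0) \<longrightarrow> (\<exists>b\<in>koszul_chains R (length ts) (Suc p). koszul_d ts b = c))"

definition partials :: "'v list \<Rightarrow> ('v, 'k::comm_ring_1) mpol \<Rightarrow> ('v, 'k) mpol list" where
  "partials xs W = map (\<lambda>v. pdiff v W) xs"

text \<open>\<open>adic_ideal xs W n\<close> is \<open>I\<^sup>n\<close>, where \<open>I\<close> is the ideal of \<open>k[x]\<close> generated by the partial derivatives.\<close>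

definition adic_ideal :: "'v list \<Rightarrow> ('v, 'k::comm_ring_1) mpol \<Rightarrow> nat \<Rightarrow> ('v, 'k) mpol set" where
  "adic_ideal xs W n = ideal_pow (poly_in (set xs)) (partials xs W) n"

text \<open>Coordinates of (the class of) \<open>f\<close> in \<open>J\<^sub>W = k[x]/I\<close> with respect to the classes of \<open>bs\<close>.\<close>

definition jac_coords :: "'v list \<Rightarrow> ('v, 'k::comm_ring_1) mpol \<Rightarrow> ('v, 'k) mpol list \<Rightarrow>
    ('v, 'k) mpol \<Rightarrow> 'k list \<Rightarrow> bool" where
  "jac_coords xs W bs f c \<longleftrightarrow> length c = length bs \<and>
     f - (\<Sum>j<length bs. pconst (c ! j) * bs ! j) \<in> adic_ideal xs W 1"

definition jac_basis :: "'v list \<Rightarrow> ('v, 'k::comm_ring_1) mpol \<Rightarrow> ('v, 'k) mpol list \<Rightarrow> bool" where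
  "jac_basis xs W bs \<longleftrightarrow> set bs \<subseteq> poly_in (set xs) \<and>
     (\<forall>f\<in>poly_in (set xs). \<exists>!c. jac_coords xs W bs f c)"

definition potential :: "'v list \<Rightarrow> ('v, 'k::comm_ring_1) mpol \<Rightarrow> bool" where
  "potential xs W \<longleftrightarrow> W \<in> poly_in (set xs) \<and>
     quasi_regular (poly_in (set xs)) (partials xs W) \<and>
     (\<exists>bs. jac_basis xs W bs) \<and>
     koszul_exact (poly_in (set xs)) (partials xs W)"


section \<open>The completion and the connection\<close>

text \<open>An element of the completion \<open>lim k[y]/I\<^sup>n\<close> is represented by a sequence whose \<open>n\<close>-th member
  represents the component in \<open>k[y]/I\<^sup>n\<close>; the projection to \<open>J\<^sub>V\<close> is the component at 1, and \<open>f \<in> k[y]\<close>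
  is the constant sequence. Equality in the completion is \<open>adic_eq\<close>. Elements of \<open>J\<^sub>V\<close> are
  represented by elements of \<open>k[y]\<close>.\<close>

definition adic_elem :: "'v list \<Rightarrow> ('v, 'k::comm_ring_1) mpol \<Rightarrow> (nat \<Rightarrow> ('v, 'k) mpol) \<Rightarrow> bool" where
  "adic_elem ys V h \<longleftrightarrow> (\<forall>n. h n \<in> poly_in (set ys) \<and> h (Suc n) - h n \<in> adic_ideal ys V n)"

definition adic_eq :: "'v list \<Rightarrow> ('v, 'k::comm_ring_1) mpol \<Rightarrow>
    (nat \<Rightarrow> ('v, 'k) mpol) \<Rightarrow> (nat \<Rightarrow> ('v, 'k) mpol) \<Rightarrow> bool" where
  "adic_eq ys V h h' \<longleftrightarrow> (\<forall>n. h n - h' n \<in> adic_ideal ys V n)"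

text \<open>A \<open>k\<close>-linear section of the projection from the completion to \<open>J\<^sub>V\<close>: the third and fourth
  clauses together with linearity say that it is well defined on \<open>J\<^sub>V\<close>.\<close>

definition jac_section :: "'v list \<Rightarrow> ('v, 'k::comm_ring_1) mpol \<Rightarrow>
    (('v, 'k) mpol \<Rightarrow> nat \<Rightarrow> ('v, 'k) mpol) \<Rightarrow> bool" where
  "jac_section ys V \<sigma> \<longleftrightarrow>
     (\<forall>f\<in>poly_in (set ys). \<forall>g\<in>poly_in (set ys). adic_eq ys V (\<sigma> (f + g)) (\<lambda>n. \<sigma> f n + \<sigma> g n)) \<and>
     (\<forall>c. \<forall>f\<in>poly_in (set ys). adic_eq ys V (\<sigma> (pconst c * f)) (\<lambda>n. pconst c * \<sigma> f n)) \<and>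
     (\<forall>f\<in>poly_in (set ys). adic_elem ys V (\<sigma> f)) \<and>
     (\<forall>f\<in>adic_ideal ys V 1. adic_eq ys V (\<sigma> f) (\<lambda>_. 0)) \<and>
     (\<forall>f\<in>poly_in (set ys). \<sigma> f 1 - f \<in> adic_ideal ys V 1)"

text \<open>Representatives of the \<open>r\<^sub>u \<in> J\<^sub>V\<close> with \<open>h = \<Sum>\<^sub>u \<sigma>(r\<^sub>u) t\<^sup>u\<close>, the limit being tested modulo each
  \<open>I\<^sup>n\<close>. They are unique modulo \<open>I\<close>, so that everything below is independent of the choice.\<close>

definition expansion :: "'v list \<Rightarrow> ('v, 'k::comm_ring_1) mpol \<Rightarrow>
    (('v, 'k) mpol \<Rightarrow> nat \<Rightarrow> ('v, 'k) mpol) \<Rightarrow> (nat \<Rightarrow> ('v, 'k) mpol) \<Rightarrow> nat list \<Rightarrow> ('v, 'k) mpol" where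
  "expansion ys V \<sigma> h = (SOME r. (\<forall>u. length u = length ys \<longrightarrow> r u \<in> poly_in (set ys)) \<and>
     (\<forall>n. h n - (\<Sum>l<n. \<Sum>u\<in>exps (length ys) l. \<sigma> (r u) n * tmon (partials ys V) u)
        \<in> adic_ideal ys V n))"

text \<open>\<open>\<partial>h/\<partial>t\<^sub>i\<close>. Modulo \<open>I\<^sup>n\<close> only the terms with \<open>|u| \<le> n\<close> contribute.\<close>

definition pdt :: "'v list \<Rightarrow> ('v, 'k::comm_ring_1) mpol \<Rightarrow>
    (('v, 'k) mpol \<Rightarrow> nat \<Rightarrow> ('v, 'k) mpol) \<Rightarrow> nat \<Rightarrow>
    (nat \<Rightarrow> ('v, 'k) mpol) \<Rightarrow> nat \<Rightarrow> ('v, 'k) mpol" where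
  "pdt ys V \<sigma> i h n = (\<Sum>l\<le>n. \<Sum>u\<in>exps (length ys) l.
     of_nat (u ! i) * \<sigma> (expansion ys V \<sigma> h u) n * tmon (partials ys V) (u[i := u ! i - 1]))"

text \<open>The extension of \<open>\<partial>/\<partial>t\<^sub>i\<close> to polynomials with coefficients in the completion, linear in the
  variables outside \<open>ys\<close>. Such a polynomial is represented by a sequence of polynomials in which
  only finitely many monomials in the outside variables occur.\<close>

definition pdt_ext :: "'v list \<Rightarrow> ('v, 'k::comm_ring_1) mpol \<Rightarrow>
    (('v, 'k) mpol \<Rightarrow> nat \<Rightarrow> ('v, 'k) mpol) \<Rightarrow> nat \<Rightarrow>
    (nat \<Rightarrow> ('v, 'k) mpol) \<Rightarrow> nat \<Rightarrow> ('v, 'k) mpol" where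
  "pdt_ext ys V \<sigma> i h n = (\<Sum>b\<in>(\<Union>l. outer_monos (set ys) (h l)).
     Poly_Mapping.single b 1 * pdt ys V \<sigma> i (\<lambda>l. outer_coeff (set ys) b (h l)) n)"

text \<open>The \<open>j\<close>-th coordinate of the class of \<open>f\<close> in \<open>J\<^sub>V \<otimes> k[x,z]\<close>, a polynomial in the variables
  outside \<open>ys\<close>.\<close>

definition jac_coord :: "'v list \<Rightarrow> ('v, 'k::comm_ring_1) mpol \<Rightarrow> ('v, 'k) mpol list \<Rightarrow>
    ('v, 'k) mpol \<Rightarrow> nat \<Rightarrow> ('v, 'k) mpol" where
  "jac_coord ys V bs f j = (\<Sum>b\<in>outer_monos (set ys) f.
     Poly_Mapping.single b ((THE c. jac_coords ys V bs (outer_coeff (set ys) b f) c) ! j))"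


section \<open>Matrix factorisations and homotopy classes\<close>

text \<open>A finite rank free \<open>\<int>\<^sub>2\<close>-graded module with a homogeneous basis is given by the list of parities
  of its basis elements (\<open>True\<close> is odd); homogeneous maps are given by their matrices, and their
  parity is passed as a boolean.\<close>

datatype 'r mf = MF (mf_par: "bool list") (mf_d: "'r mat")

definition mf_rank :: "'r mf \<Rightarrow> nat" where
  "mf_rank X = length (mf_par X)"

definition hom_maps :: "'r::comm_ring_1 set \<Rightarrow> bool \<Rightarrow> 'r mf \<Rightarrow> 'r mf \<Rightarrow> 'r mat set" where
  "hom_maps R p X Y = {f \<in> carrier_mat (mf_rank Y) (mf_rank X). elements_mat f \<subseteq> R \<and>
     (\<forall>i<mf_rank Y. \<forall>j<mf_rank X. f $$ (i, j) \<noteq> 0 \<longrightarrow> (mf_par Y ! i \<noteq> mf_par X ! j) = p)}"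

definition matrix_factorisation :: "'r::comm_ring_1 set \<Rightarrow> 'r \<Rightarrow> 'r mf \<Rightarrow> bool" where
  "matrix_factorisation R W X \<longleftrightarrow>
     mf_d X \<in> hom_maps R True X X \<and> mf_d X * mf_d X = W \<cdot>\<^sub>m 1\<^sub>m (mf_rank X)"

text \<open>The graded commutator of the differentials with a map of parity \<open>p\<close>.\<close>

definition dcomm :: "bool \<Rightarrow> 'r::comm_ring_1 mf \<Rightarrow> 'r mf \<Rightarrow> 'r mat \<Rightarrow> 'r mat" where
  "dcomm p X Y f = (if p then mf_d Y * f + f * mf_d X else mf_d Y * f - f * mf_d X)"

definition closed_maps :: "'r::comm_ring_1 set \<Rightarrow> bool \<Rightarrow> 'r mf \<Rightarrow> 'r mf \<Rightarrow> 'r mat set" where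
  "closed_maps R p X Y = {f \<in> hom_maps R p X Y. dcomm p X Y f = 0\<^sub>m (mf_rank Y) (mf_rank X)}"

definition hcl :: "'r::comm_ring_1 set \<Rightarrow> bool \<Rightarrow> 'r mf \<Rightarrow> 'r mf \<Rightarrow> 'r mat \<Rightarrow> 'r mat set" where
  "hcl R p X Y f = {g \<in> closed_maps R p X Y.
     \<exists>h\<in>hom_maps R (\<not> p) X Y. g - f = dcomm (\<not> p) X Y h}"

text \<open>The following lift operations on matrices to homotopy classes. In \<open>hcomp\<close>, \<open>p\<close> is the
  parity of the composite.\<close>

definition hadd :: "'r::comm_ring_1 set \<Rightarrow> bool \<Rightarrow> 'r mf \<Rightarrow> 'r mf \<Rightarrow> 'r mat set \<Rightarrow> 'r mat set \<Rightarrow> 'r mat set" where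
  "hadd R p X Y F G = (\<Union>f\<in>F. \<Union>g\<in>G. hcl R p X Y (f + g))"

definition hscale :: "'r::comm_ring_1 set \<Rightarrow> bool \<Rightarrow> 'r mf \<Rightarrow> 'r mf \<Rightarrow> 'r \<Rightarrow> 'r mat set \<Rightarrow> 'r mat set" where
  "hscale R p X Y c F = (\<Union>f\<in>F. hcl R p X Y (c \<cdot>\<^sub>m f))"

definition hzero :: "'r::comm_ring_1 set \<Rightarrow> bool \<Rightarrow> 'r mf \<Rightarrow> 'r mf \<Rightarrow> 'r mat set" where
  "hzero R p X Y = hcl R p X Y (0\<^sub>m (mf_rank Y) (mf_rank X))"

definition hcomp :: "'r::comm_ring_1 set \<Rightarrow> bool \<Rightarrow> 'r mf \<Rightarrow> 'r mf \<Rightarrow> 'r mat set \<Rightarrow> 'r mat set \<Rightarrow> 'r mat set" where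
  "hcomp R p X Z G F = (\<Union>g\<in>G. \<Union>f\<in>F. hcl R p X Z (g * f))"

text \<open>Idempotent completion: objects \<open>(X, e)\<close>, and (even or odd) morphisms.\<close>

definition idem_obj :: "'r::comm_ring_1 set \<Rightarrow> 'r \<Rightarrow> 'r mf \<Rightarrow> 'r mat set \<Rightarrow> bool" where
  "idem_obj R W X e \<longleftrightarrow> matrix_factorisation R W X \<and>
     e \<in> hcl R False X X ` closed_maps R False X X \<and> hcomp R False X X e e = e"

definition idem_hom :: "'r::comm_ring_1 set \<Rightarrow> bool \<Rightarrow> 'r mf \<Rightarrow> 'r mat set \<Rightarrow> 'r mf \<Rightarrow> 'r mat set \<Rightarrow> 'r mat set set" where
  "idem_hom R p X e Y e' = {F \<in> hcl R p X Y ` closed_maps R p X Y.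
     hcomp R p X Y F e = F \<and> hcomp R p X Y e' F = F}"


section \<open>Linear categories\<close>

text \<open>\<open>cmp C a b c g f\<close> is the composite of \<open>f : a \<rightarrow> b\<close> and \<open>g : b \<rightarrow> c\<close>. In the module
  records the fields \<open>mult\<close> and \<open>one\<close>, which \<open>module\<close> ignores, are left undefined.\<close>

record ('o, 'm, 'k) lincat =
  ob :: "'o set"
  hom_mod :: "'o \<Rightarrow> 'o \<Rightarrow> ('k, 'm) module"
  cmp :: "'o \<Rightarrow> 'o \<Rightarrow> 'o \<Rightarrow> 'm \<Rightarrow> 'm \<Rightarrow> 'm"
  idt :: "'o \<Rightarrow> 'm"

definition linear_map :: "('k::comm_ring_1, 'm) module \<Rightarrow> ('k, 'n) module \<Rightarrow> ('m \<Rightarrow> 'n) \<Rightarrow> bool" where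
  "linear_map M N f \<longleftrightarrow> f \<in> carrier M \<rightarrow> carrier N \<and>
     (\<forall>x\<in>carrier M. \<forall>y\<in>carrier M. f (x \<oplus>\<^bsub>M\<^esub> y) = f x \<oplus>\<^bsub>N\<^esub> f y) \<and>
     (\<forall>c. \<forall>x\<in>carrier M. f (c \<odot>\<^bsub>M\<^esub> x) = c \<odot>\<^bsub>N\<^esub> f x)"

definition linear_category :: "('o, 'm, 'k::comm_ring_1) lincat \<Rightarrow> bool" where
  "linear_category C \<longleftrightarrow>
     (\<forall>a\<in>ob C. \<forall>b\<in>ob C. module (ring_of_type_algebra :: 'k ring) (hom_mod C a b)) \<and>
     (\<forall>a\<in>ob C. \<forall>b\<in>ob C. \<forall>c\<in>ob C. \<forall>g\<in>carrier (hom_mod C b c).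
        linear_map (hom_mod C a b) (hom_mod C a c) (\<lambda>f. cmp C a b c g f)) \<and>
     (\<forall>a\<in>ob C. \<forall>b\<in>ob C. \<forall>c\<in>ob C. \<forall>f\<in>carrier (hom_mod C a b).
        linear_map (hom_mod C b c) (hom_mod C a c) (\<lambda>g. cmp C a b c g f)) \<and>
     (\<forall>a\<in>ob C. idt C a \<in> carrier (hom_mod C a a)) \<and>
     (\<forall>a\<in>ob C. \<forall>b\<in>ob C. \<forall>f\<in>carrier (hom_mod C a b).
        cmp C a b b (idt C b) f = f \<and> cmp C a a b f (idt C a) = f) \<and>
     (\<forall>a\<in>ob C. \<forall>b\<in>ob C. \<forall>c\<in>ob C. \<forall>d\<in>ob C. \<forall>f\<in>carrier (hom_mod C a b).
        \<forall>g\<in>carrier (hom_mod C b c). \<forall>h\<in>carrier (hom_mod C c d).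
        cmp C a c d h (cmp C a b c g f) = cmp C a b d (cmp C b c d h g) f)"

definition linear_functor :: "('o, 'm, 'k::comm_ring_1) lincat \<Rightarrow> ('p, 'n, 'k) lincat \<Rightarrow>
    ('o \<Rightarrow> 'p) \<Rightarrow> ('o \<Rightarrow> 'o \<Rightarrow> 'm \<Rightarrow> 'n) \<Rightarrow> bool" where
  "linear_functor C D Fo Fm \<longleftrightarrow> linear_category C \<and> linear_category D \<and>
     Fo \<in> ob C \<rightarrow> ob D \<and>
     (\<forall>a\<in>ob C. \<forall>b\<in>ob C. linear_map (hom_mod C a b) (hom_mod D (Fo a) (Fo b)) (Fm a b)) \<and>
     (\<forall>a\<in>ob C. Fm a a (idt C a) = idt D (Fo a)) \<and>
     (\<forall>a\<in>ob C. \<forall>b\<in>ob C. \<forall>c\<in>ob C. \<forall>f\<in>carrier (hom_mod C a b). \<forall>g\<in>carrier (hom_mod C b c).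
        Fm a c (cmp C a b c g f) = cmp D (Fo a) (Fo b) (Fo c) (Fm b c g) (Fm a b f))"

text \<open>\<open>M \<otimes>\<^sub>k N\<close> as the free module on \<open>M \<times> N\<close> modulo the submodule \<open>tensor_rel\<close> of bilinearity
  relations; its elements are the cosets \<open>tensor_cl\<close>.\<close>

definition tensor_free :: "('k::comm_ring_1, 'm) module \<Rightarrow> ('k, 'n) module \<Rightarrow> ('m \<times> 'n \<Rightarrow>\<^sub>0 'k) set" where
  "tensor_free M N = {p. Poly_Mapping.keys p \<subseteq> carrier M \<times> carrier N}"

inductive_set tensor_rel :: "('k::comm_ring_1, 'm) module \<Rightarrow> ('k, 'n) module \<Rightarrow> ('m \<times> 'n \<Rightarrow>\<^sub>0 'k) set"
  for M N where
  zero: "0 \<in> tensor_rel M N"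
| add: "p \<in> tensor_rel M N \<Longrightarrow> q \<in> tensor_rel M N \<Longrightarrow> p + q \<in> tensor_rel M N"
| scale: "p \<in> tensor_rel M N \<Longrightarrow> Poly_Mapping.map (\<lambda>a. c * a) p \<in> tensor_rel M N"
| add_left: "x \<in> carrier M \<Longrightarrow> x' \<in> carrier M \<Longrightarrow> y \<in> carrier N \<Longrightarrow>
    Poly_Mapping.single (x \<oplus>\<^bsub>M\<^esub> x', y) 1 - Poly_Mapping.single (x, y) 1 - Poly_Mapping.single (x', y) 1
      \<in> tensor_rel M N"
| add_right: "x \<in> carrier M \<Longrightarrow> y \<in> carrier N \<Longrightarrow> y' \<in> carrier N \<Longrightarrow>
    Poly_Mapping.single (x, y \<oplus>\<^bsub>N\<^esub> y') 1 - Poly_Mapping.single (x, y) 1 - Poly_Mapping.single (x, y') 1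
      \<in> tensor_rel M N"
| scale_left: "x \<in> carrier M \<Longrightarrow> y \<in> carrier N \<Longrightarrow>
    Poly_Mapping.single (c \<odot>\<^bsub>M\<^esub> x, y) 1 - Poly_Mapping.single (x, y) c \<in> tensor_rel M N"
| scale_right: "x \<in> carrier M \<Longrightarrow> y \<in> carrier N \<Longrightarrow>
    Poly_Mapping.single (x, c \<odot>\<^bsub>N\<^esub> y) 1 - Poly_Mapping.single (x, y) c \<in> tensor_rel M N"

definition tensor_cl :: "('k::comm_ring_1, 'm) module \<Rightarrow> ('k, 'n) module \<Rightarrow>
    ('m \<times> 'n \<Rightarrow>\<^sub>0 'k) \<Rightarrow> ('m \<times> 'n \<Rightarrow>\<^sub>0 'k) set" where
  "tensor_cl M N p = {q \<in> tensor_free M N. q - p \<in> tensor_rel M N}"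

definition pure_tensor :: "('k::comm_ring_1, 'm) module \<Rightarrow> ('k, 'n) module \<Rightarrow>
    'm \<Rightarrow> 'n \<Rightarrow> ('m \<times> 'n \<Rightarrow>\<^sub>0 'k) set" where
  "pure_tensor M N x y = tensor_cl M N (Poly_Mapping.single (x, y) 1)"

definition tensor_module :: "('k::comm_ring_1, 'm) module \<Rightarrow> ('k, 'n) module \<Rightarrow>
    ('k, ('m \<times> 'n \<Rightarrow>\<^sub>0 'k) set) module" where
  "tensor_module M N =
     \<lparr> carrier = tensor_cl M N ` tensor_free M N, monoid.mult = undefined, monoid.one = undefined,
       ring.zero = tensor_cl M N 0,
       ring.add = (\<lambda>P Q. \<Union>p\<in>P. \<Union>q\<in>Q. tensor_cl M N (p + q)),
       module.smult = (\<lambda>c P. \<Union>p\<in>P. tensor_cl M N (Poly_Mapping.map (\<lambda>a. c * a) p)) \<rparr>"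

text \<open>The tensor product of \<open>k\<close>-linear categories. The composition is the bilinear extension of
  \<open>(g \<otimes> g') (f \<otimes> f') = g f \<otimes> g' f'\<close>.\<close>

definition tensor_category :: "('o, 'm, 'k::comm_ring_1) lincat \<Rightarrow> ('p, 'n, 'k) lincat \<Rightarrow>
    ('o \<times> 'p, ('m \<times> 'n \<Rightarrow>\<^sub>0 'k) set, 'k) lincat" where
  "tensor_category C D =
     \<lparr> ob = ob C \<times> ob D,
       hom_mod = (\<lambda>(a, a') (b, b'). tensor_module (hom_mod C a b) (hom_mod D a' b')),
       cmp = (\<lambda>(a, a') (b, b') (c, c') P Q. \<Union>p\<in>P. \<Union>q\<in>Q.
         tensor_cl (hom_mod C a c) (hom_mod D a' c')
           (\<Sum>(g, g')\<in>Poly_Mapping.keys p. \<Sum>(f, f')\<in>Poly_Mapping.keys q.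
              Poly_Mapping.single (cmp C a b c g f, cmp D a' b' c' g' f')
                (Poly_Mapping.lookup p (g, g') * Poly_Mapping.lookup q (f, f')))),
       idt = (\<lambda>(a, a'). pure_tensor (hom_mod C a a) (hom_mod D a' a') (idt C a) (idt D a')) \<rparr>"


section \<open>The Clifford thickening\<close>

text \<open>An object \<open>((X, e), n)\<close> of the thickening: \<open>n\<close> is the common length of the lists of the
  homotopy classes by which the \<open>\<gamma>\<^sub>i\<close> and the \<open>\<gamma>\<^sub>i\<^sup>\<dagger>\<close> act.\<close>

datatype 'r cobj = CObj (c_mf: "'r mf") (c_idem: "'r mat set")
  (c_gam: "'r mat set list") (c_gamd: "'r mat set list")

definition clifford_action :: "'r::comm_ring_1 set \<Rightarrow> 'r mf \<Rightarrow> 'r mat set \<Rightarrow>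
    'r mat set list \<Rightarrow> 'r mat set list \<Rightarrow> bool" where
  "clifford_action R X e gs hs \<longleftrightarrow>
     length gs = length hs \<and>
     set gs \<subseteq> idem_hom R True X e X e \<and> set hs \<subseteq> idem_hom R True X e X e \<and>
     (\<forall>i<length gs. \<forall>j<length gs.
        hadd R False X X (hcomp R False X X (gs ! i) (gs ! j)) (hcomp R False X X (gs ! j) (gs ! i))
          = hzero R False X X \<and>
        hadd R False X X (hcomp R False X X (hs ! i) (hs ! j)) (hcomp R False X X (hs ! j) (hs ! i))
          = hzero R False X X \<and>
        hadd R False X X (hcomp R False X X (gs ! i) (hs ! j)) (hcomp R False X X (hs ! j) (gs ! i))
          = (if i = j then e else hzero R False X X))"

text \<open>The composite of a list of odd endomorphisms of \<open>(X, e)\<close>; the empty one is the identity \<open>e\<close>.\<close>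

fun odd_prod :: "'r::comm_ring_1 set \<Rightarrow> 'r mf \<Rightarrow> 'r mat set \<Rightarrow> 'r mat set list \<Rightarrow> 'r mat set" where
  "odd_prod R X e [] = e"
| "odd_prod R X e (g # gs) = hcomp R (odd (length (g # gs))) X X g (odd_prod R X e gs)"

text \<open>The action of \<open>e\<^sub>n = \<gamma>\<^sub>1 \<dots> \<gamma>\<^sub>n \<gamma>\<^sub>n\<^sup>\<dagger> \<dots> \<gamma>\<^sub>1\<^sup>\<dagger>\<close>.\<close>

definition clifford_idem :: "'r::comm_ring_1 set \<Rightarrow> 'r mf \<Rightarrow> 'r mat set \<Rightarrow>
    'r mat set list \<Rightarrow> 'r mat set list \<Rightarrow> 'r mat set" where
  "clifford_idem R X e gs hs = odd_prod R X e (gs @ rev hs)"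

definition thick_hom :: "('v, 'k::comm_ring_1) mpol set \<Rightarrow> ('v, 'k) mpol cobj \<Rightarrow> ('v, 'k) mpol cobj \<Rightarrow>
    ('k, ('v, 'k) mpol mat set) module" where
  "thick_hom R A B = (let X = c_mf A; Y = c_mf B in
     \<lparr> carrier = {F \<in> idem_hom R False X (c_idem A) Y (c_idem B).
         (\<forall>h\<in>set (c_gamd A). hcomp R True X Y F h = hzero R True X Y) \<and>
         (\<forall>g\<in>set (c_gam B). hcomp R True X Y g F = hzero R True X Y)},
       monoid.mult = undefined, monoid.one = undefined,
       ring.zero = hzero R False X Y, ring.add = hadd R False X Y,
       module.smult = (\<lambda>c. hscale R False X Y (pconst c)) \<rparr>)"

definition thickening :: "('v, 'k::comm_ring_1) mpol set \<Rightarrow> ('v, 'k) mpol \<Rightarrow>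
    (('v, 'k) mpol cobj, ('v, 'k) mpol mat set, 'k) lincat" where
  "thickening R W =
     \<lparr> ob = {A. idem_obj R W (c_mf A) (c_idem A) \<and>
                clifford_action R (c_mf A) (c_idem A) (c_gam A) (c_gamd A)},
       hom_mod = thick_hom R,
       cmp = (\<lambda>A B C G F. hcomp R False (c_mf A) (c_mf C) G F),
       idt = (\<lambda>A. clifford_idem R (c_mf A) (c_idem A) (c_gam A) (c_gamd A)) \<rparr>"

text \<open>\<open>\<C>(W, V)\<close> for \<open>W \<in> k[x]\<close> and \<open>V \<in> k[y]\<close>.\<close>

definition CC :: "'v list \<Rightarrow> ('v, 'k::comm_ring_1) mpol \<Rightarrow> 'v list \<Rightarrow> ('v, 'k) mpol \<Rightarrow>
    (('v, 'k) mpol cobj, ('v, 'k) mpol mat set, 'k) lincat" where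
  "CC xs W ys V = thickening (poly_in (set xs \<union> set ys)) (V - W)"


section \<open>The cut\<close>

text \<open>The matrix of \<open>f \<otimes> g\<close> with its Koszul sign, where \<open>p\<close> is the parity of \<open>g\<close> and \<open>par\<close> the list of
  parities of the source of \<open>f\<close>. The basis vector \<open>y\<^sub>a \<otimes> x\<^sub>b\<close> has index \<open>a \<cdot> n + b\<close>, where \<open>n\<close> is the
  rank of the right-hand factor.\<close>

definition tens_mat :: "bool \<Rightarrow> bool list \<Rightarrow> 'r::comm_ring_1 mat \<Rightarrow> 'r mat \<Rightarrow> 'r mat" where
  "tens_mat p par f g = mat (dim_row f * dim_row g) (dim_col f * dim_col g) (\<lambda>(P, Q).
     (if p \<and> par ! (Q div dim_col g) then - 1 else 1) *
     f $$ (P div dim_row g, Q div dim_col g) * g $$ (P mod dim_row g, Q mod dim_col g))"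

definition tens_d :: "'r::comm_ring_1 mf \<Rightarrow> 'r mf \<Rightarrow> 'r mat" where
  "tens_d Y X = tens_mat False (mf_par Y) (mf_d Y) (1\<^sub>m (mf_rank X)) +
                tens_mat True (mf_par Y) (1\<^sub>m (mf_rank Y)) (mf_d X)"

text \<open>Vectors \<open>v\<close> with entries in (polynomials over) the completion: \<open>v q n\<close> is the \<open>n\<close>-th member of
  the sequence representing the \<open>q\<close>-th entry.\<close>

definition mat_op :: "'r::comm_ring_1 mat \<Rightarrow> (nat \<Rightarrow> nat \<Rightarrow> 'r) \<Rightarrow> nat \<Rightarrow> nat \<Rightarrow> 'r" where
  "mat_op M v p n = (\<Sum>q<dim_col M. M $$ (p, q) * v q n)"

text \<open>In the following, \<open>R\<close> is the ring \<open>k[x,z]\<close>, \<open>bs\<close> is a \<open>k\<close>-basis of \<open>J\<^sub>V\<close> and \<open>\<sigma>\<close> a section.\<close>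

context
  fixes R :: "('v, 'k::comm_ring_1) mpol set"
    and ys :: "'v list"
    and V :: "('v, 'k) mpol"
    and bs :: "('v, 'k) mpol list"
    and \<sigma> :: "('v, 'k) mpol \<Rightarrow> nat \<Rightarrow> ('v, 'k) mpol"
begin

text \<open>The matrix of the map induced on \<open>Y \<otimes> J\<^sub>V \<otimes> X\<close> by an operator on the tensor product
  with the completion of \<open>k[y]\<close>, from rank \<open>N\<close> to rank \<open>N'\<close>: the basis vector \<open>y\<^sub>a \<otimes> b\<^sub>j \<otimes> x\<^sub>b\<close>, which has
  index \<open>(a \<cdot> n + b) \<cdot> \<mu> + j\<close> with \<open>\<mu> = length bs\<close>, is lifted, the operator is applied, and the result
  is reduced modulo \<open>t\<close>.\<close>

definition induced :: "nat \<Rightarrow> nat \<Rightarrow>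
    ((nat \<Rightarrow> nat \<Rightarrow> ('v, 'k) mpol) \<Rightarrow> nat \<Rightarrow> nat \<Rightarrow> ('v, 'k) mpol) \<Rightarrow> ('v, 'k) mpol mat" where
  "induced N' N T = mat (N' * length bs) (N * length bs) (\<lambda>(P, Q).
     jac_coord ys V bs
       (T (\<lambda>q n. if q = Q div length bs then bs ! (Q mod length bs) else 0) (P div length bs) 1)
       (P mod length bs))"

definition cut_mat :: "bool \<Rightarrow> bool list \<Rightarrow> ('v, 'k) mpol mat \<Rightarrow> ('v, 'k) mpol mat \<Rightarrow> ('v, 'k) mpol mat" where
  "cut_mat p par f g = induced (dim_row f * dim_row g) (dim_col f * dim_col g) (mat_op (tens_mat p par f g))"

definition cut_mf :: "('v, 'k) mpol mf \<Rightarrow> ('v, 'k) mpol mf \<Rightarrow> ('v, 'k) mpol mf" where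
  "cut_mf Y X = MF
     (map (\<lambda>P. mf_par Y ! (P div length bs div mf_rank X) \<noteq> mf_par X ! (P div length bs mod mf_rank X))
        [0..<mf_rank Y * mf_rank X * length bs])
     (induced (mf_rank Y * mf_rank X) (mf_rank Y * mf_rank X) (mat_op (tens_d Y X)))"

text \<open>\<open>At\<^sub>i\<close>, induced by \<open>[d, \<partial>/\<partial>t\<^sub>i] = d \<partial>/\<partial>t\<^sub>i - \<partial>/\<partial>t\<^sub>i d\<close>.\<close>

definition atiyah :: "('v, 'k) mpol mf \<Rightarrow> ('v, 'k) mpol mf \<Rightarrow> nat \<Rightarrow> ('v, 'k) mpol mat" where
  "atiyah Y X i = induced (mf_rank Y * mf_rank X) (mf_rank Y * mf_rank X)
     (\<lambda>v p n. mat_op (tens_d Y X) (\<lambda>q. pdt_ext ys V \<sigma> i (v q)) p n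
            - pdt_ext ys V \<sigma> i (mat_op (tens_d Y X) v p) n)"

text \<open>Multiplication by \<open>f\<close> on \<open>Y | X\<close>.\<close>

definition cut_scalar :: "('v, 'k) mpol mf \<Rightarrow> ('v, 'k) mpol mf \<Rightarrow> ('v, 'k) mpol \<Rightarrow> ('v, 'k) mpol mat" where
  "cut_scalar Y X f = induced (mf_rank Y * mf_rank X) (mf_rank Y * mf_rank X)
     (\<lambda>v p n. f * v p n)"

definition cut_gamd :: "('v, 'k) mpol mf \<Rightarrow> ('v, 'k) mpol mf \<Rightarrow> nat \<Rightarrow> ('v, 'k) mpol mat" where
  "cut_gamd Y X i =
     - cut_mat True (mf_par Y) (1\<^sub>m (mf_rank Y)) (map_mat (pdiff (ys ! i)) (mf_d X))
     - mat (mf_rank (cut_mf Y X)) (mf_rank (cut_mf Y X)) (\<lambda>(P, Q). pconst half *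
         (\<Sum>q<length ys.
            (cut_scalar Y X (pdiff (ys ! q) (pdiff (ys ! i) V)) * atiyah Y X q) $$ (P, Q)))"

text \<open>\<open>F | G\<close> for homotopy classes \<open>F : Y \<rightarrow> Y'\<close> and \<open>G : X \<rightarrow> X'\<close> of parities \<open>p\<close> and \<open>q\<close>.\<close>

definition cut_cl :: "bool \<Rightarrow> bool \<Rightarrow> ('v, 'k) mpol mf \<Rightarrow> ('v, 'k) mpol mf \<Rightarrow>
    ('v, 'k) mpol mf \<Rightarrow> ('v, 'k) mpol mf \<Rightarrow>
    ('v, 'k) mpol mat set \<Rightarrow> ('v, 'k) mpol mat set \<Rightarrow> ('v, 'k) mpol mat set" where
  "cut_cl p q Y Y' X X' F G =
     (\<Union>f\<in>F. \<Union>g\<in>G. hcl R (p \<noteq> q) (cut_mf Y X) (cut_mf Y' X') (cut_mat q (mf_par Y) f g))"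

definition cut_idem :: "('v, 'k) mpol cobj \<Rightarrow> ('v, 'k) mpol cobj \<Rightarrow> ('v, 'k) mpol mat set" where
  "cut_idem Y X = cut_cl False False (c_mf Y) (c_mf Y) (c_mf X) (c_mf X) (c_idem Y) (c_idem X)"

text \<open>An odd class on \<open>Y | X\<close>, cut down by the idempotent.\<close>

definition cut_down :: "('v, 'k) mpol cobj \<Rightarrow> ('v, 'k) mpol cobj \<Rightarrow>
    ('v, 'k) mpol mat set \<Rightarrow> ('v, 'k) mpol mat set" where
  "cut_down Y X F = (let M = cut_mf (c_mf Y) (c_mf X); E = cut_idem Y X in
     hcomp R True M M E (hcomp R True M M F E))"

definition cut_left :: "('v, 'k) mpol cobj \<Rightarrow> ('v, 'k) mpol cobj \<Rightarrow>
    ('v, 'k) mpol mat set \<Rightarrow> ('v, 'k) mpol mat set" where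
  "cut_left Y X F = cut_down Y X
     (cut_cl True False (c_mf Y) (c_mf Y) (c_mf X) (c_mf X) F {1\<^sub>m (mf_rank (c_mf X))})"

definition cut_right :: "('v, 'k) mpol cobj \<Rightarrow> ('v, 'k) mpol cobj \<Rightarrow>
    ('v, 'k) mpol mat set \<Rightarrow> ('v, 'k) mpol mat set" where
  "cut_right Y X G = cut_down Y X
     (cut_cl False True (c_mf Y) (c_mf Y) (c_mf X) (c_mf X) {1\<^sub>m (mf_rank (c_mf Y))} G)"

text \<open>The lists of the \<open>\<gamma>\<^sub>i\<close> and of the \<open>\<gamma>\<^sub>i\<^sup>\<dagger>\<close>, \<open>1 \<le> i \<le> m\<close>.\<close>

definition cut_gams :: "('v, 'k) mpol cobj \<Rightarrow> ('v, 'k) mpol cobj \<Rightarrow> ('v, 'k) mpol mat set list" where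
  "cut_gams Y X = (let M = cut_mf (c_mf Y) (c_mf X) in
     map (\<lambda>i. cut_down Y X (hcl R True M M (atiyah (c_mf Y) (c_mf X) i))) [0..<length ys])"

definition cut_gamds :: "('v, 'k) mpol cobj \<Rightarrow> ('v, 'k) mpol cobj \<Rightarrow> ('v, 'k) mpol mat set list" where
  "cut_gamds Y X = (let M = cut_mf (c_mf Y) (c_mf X) in
     map (\<lambda>i. cut_down Y X (hcl R True M M (cut_gamd (c_mf Y) (c_mf X) i))) [0..<length ys])"

definition cut_obj :: "('v, 'k) mpol cobj \<Rightarrow> ('v, 'k) mpol cobj \<Rightarrow> ('v, 'k) mpol cobj" where
  "cut_obj Y X = CObj (cut_mf (c_mf Y) (c_mf X)) (cut_idem Y X)
     (map (cut_left Y X) (c_gam Y) @ cut_gams Y X @ map (cut_right Y X) (c_gam X))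
     (map (cut_left Y X) (c_gamd Y) @ cut_gamds Y X @ map (cut_right Y X) (c_gamd X))"

text \<open>\<open>(\<psi> | \<phi>) e\<^sub>m\<close> for \<open>\<psi> : Y \<rightarrow> Y'\<close> and \<open>\<phi> : X \<rightarrow> X'\<close>.\<close>

definition cut_mor :: "('v, 'k) mpol cobj \<Rightarrow> ('v, 'k) mpol cobj \<Rightarrow>
    ('v, 'k) mpol cobj \<Rightarrow> ('v, 'k) mpol cobj \<Rightarrow>
    ('v, 'k) mpol mat set \<Rightarrow> ('v, 'k) mpol mat set \<Rightarrow> ('v, 'k) mpol mat set" where
  "cut_mor Y Y' X X' \<psi> \<phi> =
     hcomp R False (cut_mf (c_mf Y) (c_mf X)) (cut_mf (c_mf Y') (c_mf X'))
       (cut_cl False False (c_mf Y) (c_mf Y') (c_mf X) (c_mf X') \<psi> \<phi>)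
       (clifford_idem R (cut_mf (c_mf Y) (c_mf X)) (cut_idem Y X) (cut_gams Y X) (cut_gamds Y X))"

end

end

(* Homotopy classes of maps between matrix factorisations are embedded into a single ring: the
   cohomology of finitely supported matrices, indexed by all basis vectors of all factorisations, with
   respect to the inner differential. Identities between classes thus become identities in a ring. There
   the idempotent e_n of a Clifford action is determined by absorption: x e_n = x whenever x kills all
   gamma_i^dagger from the left, and e_n x = x whenever all gamma_i kill x.

   An operator F on the completed tensor product is expanded to second order in t: its matrices F_0, F_i
   and F_ij over k[x,z] are the reductions modulo t of F, of [d/dt_i, F] and of [d/dt_i, [d/dt_j, F]].
   They satisfy (F G)_i = F_i G_0 + F_0 G_i and
   (F G)_ij = F_ij G_0 + F_i G_j + F_j G_i + F_0 G_ij. Now At_i = -d_i, and applying the product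
   rules to d^2 = U - W and to d F = F d shows that the At_i anticommute and are natural up to homotopy,
   with homotopies d_ij and F_i. The partial derivative of d_X by y_l is a null homotopy lambda_l of t_l,
   which gives [At_i, lambda_l] = -delta_il; the anticommutators of the lambda_l are the second derivatives of
   V, and the last summand of gamma_i^dagger cancels them.

   By naturality e_m commutes with psi | phi, so that composition is preserved. For identities, both
   (e_r | e_s) e_m and the idempotent of the whole Clifford action absorb the other one, hence agree. *)
theory Submission
  imports Defs
begin

section \<open>The homotopy ring\<close>

text \<open>Morphisms of the thickening are classes of matrices whose operations take unions over
  representatives; arguing there would drag source, target, parity and coefficient ring through
  every step. The map \<open>eta\<close> into the ring \<open>hm\<close> avoids this: it is
  injective for fixed source, target and parity, and turns \<open>hcomp\<close>, \<open>hadd\<close>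
  and \<open>hscale\<close> into ring operations. Two points shape that ring. Its index set is
  infinite, so there is no unit; Clifford relations and products are therefore taken relative to an
  idempotent \<open>e\<close>, and halving is scalar multiplication by \<open>pconst half\<close>.
  And \<open>hm\<close> admits null homotopies over the whole polynomial type, whereas
  \<open>hcl\<close> prescribes the variables; setting the other variables to 0 repairs the
  difference.

  Absorption replaces the rearrangement of products because the idempotent of the cut involves the
  generators of three actions in one product, and sorting these into three idempotents would mean
  following signs. It rests on \<open>a * a = 0\<close>, which the relation
  \<open>[a, a] = 0\<close> gives only after division by 2.\<close>

typedef (overloaded) ('i, 'r::comm_ring_1) fmat =
  "{a :: 'i => 'i => 'r. finite {p. a (fst p) (snd p) \<noteq> 0}}"
  morphisms ent Fmat
  by (rule exI[of _ "\<lambda>_ _. 0"]) simp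

setup_lifting type_definition_fmat

lemma fin_sum_any: "finite S ==> (\<And>k. g k \<noteq> 0 ==> k \<in> S) ==> Sum_any g = sum g S"
  by (rule Sum_any.expand_superset) auto

instantiation fmat :: (type, comm_ring_1) ring
begin

lift_definition zero_fmat :: "('a, 'b) fmat" is "\<lambda>_ _. 0" by simp

lift_definition plus_fmat :: "('a, 'b) fmat => ('a, 'b) fmat => ('a, 'b) fmat"
  is "\<lambda>a b i j. a i j + b i j"
  subgoal for a b
    by (rule finite_subset[of _ "{p. a (fst p) (snd p) \<noteq> 0} \<union> {p. b (fst p) (snd p) \<noteq> 0}"]) auto
  done

lift_definition minus_fmat :: "('a, 'b) fmat => ('a, 'b) fmat => ('a, 'b) fmat"
  is "\<lambda>a b i j. a i j - b i j"
  subgoal for a b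
    by (rule finite_subset[of _ "{p. a (fst p) (snd p) \<noteq> 0} \<union> {p. b (fst p) (snd p) \<noteq> 0}"]) auto
  done

lift_definition uminus_fmat :: "('a, 'b) fmat => ('a, 'b) fmat"
  is "\<lambda>a i j. - a i j" by simp

lift_definition times_fmat :: "('a, 'b) fmat => ('a, 'b) fmat => ('a, 'b) fmat"
  is "\<lambda>a b i j. Sum_any (\<lambda>k. a i k * b k j)"
  subgoal for a b
    apply (rule finite_subset[of _ "fst ` {p. a (fst p) (snd p) \<noteq> 0} \<times> snd ` {p. b (fst p) (snd p) \<noteq> 0}"])
     apply clarsimp
    subgoal for i j
    proof -
      assume "Sum_any (\<lambda>k. a i k * b k j) \<noteq> 0"
      then obtain k where "a i k * b k j \<noteq> 0"
        by (rule Sum_any.not_neutral_obtains_not_neutral)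
      then have "(i, k) \<in> {p. a (fst p) (snd p) \<noteq> 0}" "(k, j) \<in> {p. b (fst p) (snd p) \<noteq> 0}"
        by auto
      then have "fst (i, k) \<in> fst ` {p. a (fst p) (snd p) \<noteq> 0}"
        and "snd (k, j) \<in> snd ` {p. b (fst p) (snd p) \<noteq> 0}"
        by (simp_all only: imageI)
      then show ?thesis by simp
    qed
    by simp
  done

lemma ent_support: "\<exists>S. finite S \<and> (\<forall>i j. ent a i j \<noteq> 0 \<longrightarrow> i \<in> S \<and> j \<in> S)"
proof -
  let ?P = "{p. ent a (fst p) (snd p) \<noteq> 0}"
  have "i \<in> fst ` ?P \<union> snd ` ?P \<and> j \<in> fst ` ?P \<union> snd ` ?P" if "ent a i j \<noteq> 0" for i j
    using imageI[of "(i, j)" ?P fst] imageI[of "(i, j)" ?P snd] that by simp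
  moreover have "finite (fst ` ?P \<union> snd ` ?P)" using ent[of a] by simp
  ultimately show ?thesis by blast
qed

lemma ent_times:
  assumes "finite S" "\<And>i j. ent a i j \<noteq> 0 ==> j \<in> S"
  shows "ent (a * b) i j = (\<Sum>k\<in>S. ent a i k * ent b k j)"
  unfolding times_fmat.rep_eq using assms by (intro fin_sum_any) (auto dest: mult_not_zero)

lemma ent_times':
  assumes "finite S" "\<And>i j. ent b i j \<noteq> 0 ==> i \<in> S"
  shows "ent (a * b) i j = (\<Sum>k\<in>S. ent a i k * ent b k j)"
  unfolding times_fmat.rep_eq using assms by (intro fin_sum_any) (auto dest: mult_not_zero)

lemma fmat_eqI: "(\<And>i j. ent a i j = ent b i j) ==> a = b"
  by (metis ent_inject ext)

instance
proof
  fix a b c :: "('a, 'b) fmat"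
  obtain S where S: "finite S" "\<And>i j. ent a i j \<noteq> 0 ==> i \<in> S \<and> j \<in> S" using ent_support[of a] by blast
  obtain T where T: "finite T" "\<And>i j. ent b i j \<noteq> 0 ==> i \<in> T \<and> j \<in> T" using ent_support[of b] by blast
  obtain U where U: "finite U" "\<And>i j. ent c i j \<noteq> 0 ==> i \<in> U \<and> j \<in> U" using ent_support[of c] by blast
  show "a * b * c = a * (b * c)"
  proof (rule fmat_eqI)
    fix i j
    have "ent (a * b * c) i j = (\<Sum>k\<in>U. (\<Sum>l\<in>S. ent a i l * ent b l k) * ent c k j)"
      using S U by (simp add: ent_times'[of U] ent_times[of S])
    also have "\<dots> = (\<Sum>l\<in>S. ent a i l * (\<Sum>k\<in>U. ent b l k * ent c k j))"
      by (simp add: sum_distrib_left sum_distrib_right mult.assoc) (rule sum.swap)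
    also have "\<dots> = ent (a * (b * c)) i j"
      using S U by (simp add: ent_times[of S] ent_times'[of U])
    finally show "ent (a * b * c) i j = ent (a * (b * c)) i j" .
  qed
  show "(a + b) * c = a * c + b * c"
    using U by (intro fmat_eqI) (simp add: ent_times'[of U] plus_fmat.rep_eq distrib_right sum.distrib)
  show "a * (b + c) = a * b + a * c"
    using S by (intro fmat_eqI) (simp add: ent_times[of S] plus_fmat.rep_eq distrib_left sum.distrib)
qed (transfer; simp add: fun_eq_iff algebra_simps)+

end

section \<open>The differential of all factorisations as a two-sided operator\<close>

definition nb :: "'r mf \<times> nat => ('r mf \<times> nat) set" where
  "nb i = {fst i} \<times> {..<mf_rank (fst i)}"

text \<open>The index type contains every value of \<open>mf\<close>, also those that are no
  factorisations. Dropping the entries between basis vectors of equal parity makes the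
  block-diagonal matrix D of all differentials odd without any hypothesis, so that
  \<open>dent_sg\<close>, \<open>sig_dl\<close> and \<open>sig_dr\<close> are unconditional.\<close>

definition dent :: "'r::comm_ring_1 mf \<times> nat => 'r mf \<times> nat => 'r" where
  "dent i j = (if fst i = fst j \<and> snd i < mf_rank (fst i) \<and> snd j < mf_rank (fst i) \<and>
     (mf_par (fst i) ! snd i \<noteq> mf_par (fst j) ! snd j)
     then mf_d (fst i) $$ (snd i, snd j) else 0)"

definition sg :: "'r mf \<times> nat => 'r::comm_ring_1" where
  "sg i = (if mf_par (fst i) ! snd i then - 1 else 1)"

lemma finite_nb [simp]: "finite (nb i)" by (simp add: nb_def)

lemma dent_nb: "dent i j \<noteq> 0 ==> i \<in> nb j \<and> j \<in> nb i"
  by (cases i; cases j) (auto simp: dent_def nb_def split: if_splits)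

lemma sg_sg [simp]: "sg i * sg i = 1" "sg i * (sg i * x) = x" by (auto simp: sg_def)

lemma dent_sg: "sg i * dent i j = - (dent i j * sg j)"
  by (auto simp: dent_def sg_def)

text \<open>The matrix D has infinite support and is no element of the ring. It still acts from the
  left (\<open>dl\<close>) and from the right (\<open>dr\<close>), because an index is linked only
  to the finitely many indices of its own factorisation.\<close>

lift_definition dl :: "('r::comm_ring_1 mf \<times> nat, 'r) fmat => ('r mf \<times> nat, 'r) fmat"
  is "\<lambda>a i j. \<Sum>k\<in>nb i. dent i k * a k j"
proof -
  fix a :: "'r mf \<times> nat => 'r mf \<times> nat => 'r"
  let ?P = "{p. a (fst p) (snd p) \<noteq> 0}"
  assume fin: "finite ?P"
  show "finite {p. (\<Sum>k\<in>nb (fst p). dent (fst p) k * a k (snd p)) \<noteq> 0}"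
  proof (rule finite_subset)
    show "finite (\<Union>p\<in>?P. nb (fst p) \<times> {snd p})" using fin by simp
    show "{p. (\<Sum>k\<in>nb (fst p). dent (fst p) k * a k (snd p)) \<noteq> 0} \<subseteq> (\<Union>p\<in>?P. nb (fst p) \<times> {snd p})"
    proof
      fix p assume "p \<in> {p. (\<Sum>k\<in>nb (fst p). dent (fst p) k * a k (snd p)) \<noteq> 0}"
      then obtain k where "dent (fst p) k * a k (snd p) \<noteq> 0"
        by (auto elim: sum.not_neutral_contains_not_neutral)
      then have "dent (fst p) k \<noteq> 0" "a k (snd p) \<noteq> 0" by auto
      then have "(k, snd p) \<in> ?P" "p \<in> nb (fst (k, snd p)) \<times> {snd (k, snd p)}"
        using dent_nb[of "fst p" k] by (auto simp: mem_Times_iff)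
      then show "p \<in> (\<Union>p\<in>?P. nb (fst p) \<times> {snd p})" by (rule UN_I)
    qed
  qed
qed

lift_definition dr :: "('r::comm_ring_1 mf \<times> nat, 'r) fmat => ('r mf \<times> nat, 'r) fmat"
  is "\<lambda>a i j. \<Sum>k\<in>nb j. a i k * dent k j"
proof -
  fix a :: "'r mf \<times> nat => 'r mf \<times> nat => 'r"
  let ?P = "{p. a (fst p) (snd p) \<noteq> 0}"
  assume fin: "finite ?P"
  show "finite {p. (\<Sum>k\<in>nb (snd p). a (fst p) k * dent k (snd p)) \<noteq> 0}"
  proof (rule finite_subset)
    show "finite (\<Union>p\<in>?P. {fst p} \<times> nb (snd p))" using fin by simp
    show "{p. (\<Sum>k\<in>nb (snd p). a (fst p) k * dent k (snd p)) \<noteq> 0} \<subseteq> (\<Union>p\<in>?P. {fst p} \<times> nb (snd p))"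
    proof
      fix p assume "p \<in> {p. (\<Sum>k\<in>nb (snd p). a (fst p) k * dent k (snd p)) \<noteq> 0}"
      then obtain k where "a (fst p) k * dent k (snd p) \<noteq> 0"
        by (auto elim: sum.not_neutral_contains_not_neutral)
      then have "a (fst p) k \<noteq> 0" "dent k (snd p) \<noteq> 0" by auto
      then have "(fst p, k) \<in> ?P" "p \<in> {fst (fst p, k)} \<times> nb (snd (fst p, k))"
        using dent_nb[of k "snd p"] by (auto simp: mem_Times_iff)
      then show "p \<in> (\<Union>p\<in>?P. {fst p} \<times> nb (snd p))" by (rule UN_I)
    qed
  qed
qed

text \<open>Conjugation by the grading operator: the identity on even matrices and minus the
  identity on odd ones. It carries the Koszul signs for elements that are not homogeneous.\<close>

lift_definition sig :: "('r::comm_ring_1 mf \<times> nat, 'r) fmat => ('r mf \<times> nat, 'r) fmat"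
  is "\<lambda>a i j. sg i * sg j * a i j"
  subgoal for a
    by (rule finite_subset[of _ "{p. a (fst p) (snd p) \<noteq> 0}"]) auto
  done

lift_definition fscl :: "'r::comm_ring_1 => ('i, 'r) fmat => ('i, 'r) fmat"
  is "\<lambda>c a i j. c * a i j"
  subgoal for c a
    by (rule finite_subset[of _ "{p. a (fst p) (snd p) \<noteq> 0}"]) auto
  done

lemma dl_add: "dl (a + b) = dl a + dl b" "dl (a - b) = dl a - dl b" "dl (fscl c a) = fscl c (dl a)"
  by (transfer; simp add: fun_eq_iff algebra_simps sum.distrib sum_subtractf sum_distrib_left)+
lemma dr_add: "dr (a + b) = dr a + dr b" "dr (a - b) = dr a - dr b" "dr (fscl c a) = fscl c (dr a)"
  by (transfer; simp add: fun_eq_iff algebra_simps sum.distrib sum_subtractf sum_distrib_left)+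
lemma sig_add: "sig (a + b) = sig a + sig b" "sig (a - b) = sig a - sig b" "sig (fscl c a) = fscl c (sig a)"
  by (transfer; simp add: fun_eq_iff algebra_simps)+
lemma sig_sig [simp]: "sig (sig a) = a"
  by (rule fmat_eqI) (auto simp: sig.rep_eq sg_def)
lemma fscl_props: "fscl c (a + b) = fscl c a + fscl c b" "fscl c (a - b) = fscl c a - fscl c b"
    "fscl (c + e) a = fscl c a + fscl e a" "fscl c (fscl e a) = fscl (c * e) a" "fscl 1 a = a"
  by (transfer; simp add: fun_eq_iff algebra_simps)+
lemma fscl_mult: "fscl c (a * b) = fscl c a * b" "fscl c (a * b) = a * fscl c b"
proof -
  obtain S where S: "finite S" "\<And>i j. ent a i j \<noteq> 0 ==> i \<in> S \<and> j \<in> S" using ent_support[of a] by blast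
  have 1: "ent (a * b) i j = (\<Sum>k\<in>S. ent a i k * ent b k j)" for b i j
    by (rule ent_times) (use S in auto)
  have 2: "ent (fscl c a * b) i j = (\<Sum>k\<in>S. ent (fscl c a) i k * ent b k j)" for i j
    by (rule ent_times) (use S in \<open>auto simp: fscl.rep_eq dest: mult_not_zero\<close>)
  show "fscl c (a * b) = fscl c a * b" "fscl c (a * b) = a * fscl c b"
    by (rule fmat_eqI, simp add: 1 2 fscl.rep_eq sum_distrib_left ac_simps)+
qed

lemma maps_0: "dl 0 = 0" "dr 0 = 0" "sig 0 = 0"
  by (transfer; simp)+

lemma sig_mult: "sig (a * b) = sig a * sig b"
proof -
  obtain S where S: "finite S" "\<And>i j. ent a i j \<noteq> 0 ==> i \<in> S \<and> j \<in> S" using ent_support[of a] by blast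
  have 1: "ent (a * b) i j = (\<Sum>k\<in>S. ent a i k * ent b k j)" for i j
    by (rule ent_times) (use S in auto)
  have 2: "ent (sig a * sig b) i j = (\<Sum>k\<in>S. ent (sig a) i k * ent (sig b) k j)" for i j
    by (rule ent_times) (use S in \<open>auto simp: sig.rep_eq simp del: split_paired_All dest: mult_not_zero\<close>)
  have 3: "sg i * sg j * (x * y) = sg i * sg k * x * (sg k * sg j * y)" for i j k :: "'a mf \<times> nat" and x y
    by (auto simp: sg_def)
  show ?thesis
    unfolding 1 2 sig.rep_eq sum_distrib_left by (intro fmat_eqI) (unfold 1 2 sig.rep_eq sum_distrib_left, intro sum.cong refl 3)
qed

lemma dl_mult: "dl (a * b) = dl a * b"
proof (rule fmat_eqI)
  fix i j
  obtain S where S: "finite S" "\<And>i j. ent b i j \<noteq> 0 ==> i \<in> S \<and> j \<in> S" using ent_support[of b] by blast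
  show "ent (dl (a * b)) i j = ent (dl a * b) i j"
    using S by (simp add: dl.rep_eq ent_times'[of S] sum_distrib_left sum_distrib_right mult.assoc)
      (rule sum.swap)
qed

lemma dr_mult: "dr (a * b) = a * dr b"
proof (rule fmat_eqI)
  fix i j
  obtain S where S: "finite S" "\<And>i j. ent a i j \<noteq> 0 ==> i \<in> S \<and> j \<in> S" using ent_support[of a] by blast
  show "ent (dr (a * b)) i j = ent (a * dr b) i j"
    using S by (simp add: dr.rep_eq ent_times[of S] sum_distrib_left sum_distrib_right mult.assoc)
      (rule sum.swap)
qed

text \<open>This is the associativity (a D) b = a (D b) for the infinite matrix D. Once the sums
  over a block are replaced by sums over the finite supports of \<open>a\<close> and
  \<open>b\<close>, the two summations can be exchanged.\<close>

lemma dr_dl: "dr a * b = a * dl b"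
proof (rule fmat_eqI)
  fix i j
  obtain S where S: "finite S" "\<And>i j. ent a i j \<noteq> 0 ==> i \<in> S \<and> j \<in> S" using ent_support[of a] by blast
  obtain T where T: "finite T" "\<And>i j. ent b i j \<noteq> 0 ==> i \<in> T \<and> j \<in> T" using ent_support[of b] by blast
  have SS: "(\<Sum>l\<in>nb k. ent a i l * dent l k) = (\<Sum>l\<in>S. ent a i l * dent l k)" for k
  proof (rule sum.mono_neutral_cong)
    fix l
    show "ent a i l * dent l k = 0" if "l \<in> S - nb k"
      using that dent_nb[of l k] by (cases "dent l k = 0") auto
    show "ent a i l * dent l k = 0" if "l \<in> nb k - S"
      using that S(2)[of i l] by (cases "ent a i l = 0") auto
  qed (use S in auto)
  have TT: "(\<Sum>k\<in>T. dent l k * ent b k j) = (\<Sum>k\<in>nb l. dent l k * ent b k j)" for l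
  proof (rule sum.mono_neutral_cong)
    fix k
    show "dent l k * ent b k j = 0" if "k \<in> T - nb l"
      using that dent_nb[of l k] by (cases "dent l k = 0") auto
    show "dent l k * ent b k j = 0" if "k \<in> nb l - T"
      using that T(2)[of k j] by (cases "ent b k j = 0") auto
  qed (use T in auto)
  have "ent (dr a * b) i j = (\<Sum>k\<in>T. (\<Sum>l\<in>nb k. ent a i l * dent l k) * ent b k j)"
    using T by (simp add: ent_times'[of T] dr.rep_eq)
  also have "\<dots> = (\<Sum>k\<in>T. (\<Sum>l\<in>S. ent a i l * dent l k) * ent b k j)"
    by (intro sum.cong refl arg_cong2[where f = "(*)"] SS)
  also have "\<dots> = (\<Sum>l\<in>S. ent a i l * (\<Sum>k\<in>T. dent l k * ent b k j))"
    by (simp add: sum_distrib_left sum_distrib_right mult.assoc) (rule sum.swap)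
  also have "\<dots> = (\<Sum>l\<in>S. ent a i l * (\<Sum>k\<in>nb l. dent l k * ent b k j))"
    by (intro sum.cong refl arg_cong2[where f = "(*)"] TT)
  also have "\<dots> = ent (a * dl b) i j"
    using S by (simp add: ent_times[of S] dl.rep_eq)
  finally show "ent (dr a * b) i j = ent (a * dl b) i j" .
qed

lemma sig_dl: "sig (dl a) = - dl (sig a)"
proof (rule fmat_eqI)
  fix i j
  show "ent (sig (dl a)) i j = ent (- dl (sig a)) i j"
    unfolding sig.rep_eq dl.rep_eq uminus_fmat.rep_eq sum_distrib_left sum_negf[symmetric]
  proof (rule sum.cong[OF refl])
    fix k
    have "sg i * sg j * (dent i k * ent a k j) = (sg i * dent i k) * (sg j * ent a k j)" by (simp add: ac_simps)
    then show "sg i * sg j * (dent i k * ent a k j) = - (dent i k * (sg k * sg j * ent a k j))"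
      by (simp add: dent_sg ac_simps)
  qed
qed

lemma sig_dr: "sig (dr a) = - dr (sig a)"
proof (rule fmat_eqI)
  fix i j
  show "ent (sig (dr a)) i j = ent (- dr (sig a)) i j"
    unfolding sig.rep_eq dr.rep_eq uminus_fmat.rep_eq sum_distrib_left sum_negf[symmetric]
  proof (rule sum.cong[OF refl])
    fix k
    have "sg i * sg k * ent a i k * dent k j = sg i * ent a i k * (sg k * dent k j)" by (simp add: ac_simps)
    then show "sg i * sg j * (ent a i k * dent k j) = - (sg i * sg k * ent a i k * dent k j)"
      by (simp add: dent_sg ac_simps)
  qed
qed

section \<open>Cycles modulo boundaries\<close>

definition cyc :: "('r::comm_ring_1 mf \<times> nat, 'r) fmat => bool" where
  "cyc a \<longleftrightarrow> dl a = dr (sig a)"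

text \<open>The graded commutator with D, whose kernel is \<open>cyc\<close>. It need not square to
  zero: \<open>bdy (bdy h)\<close> is D^2 h - h D^2, which can be nonzero between factorisations of
  different potentials.\<close>

definition bdy :: "('r::comm_ring_1 mf \<times> nat, 'r) fmat => ('r mf \<times> nat, 'r) fmat" where
  "bdy h = dl h - dr (sig h)"

lemma cyc_sig: "cyc a ==> dr a = dl (sig a)"
  unfolding cyc_def by (metis neg_equal_iff_equal sig_dl sig_dr sig_sig)

text \<open>With \<open>bdy_mult_left\<close> this is the Leibniz rule for one closed factor.
  Boundaries thus absorb cycles on both sides, and the product descends to classes.\<close>

lemma bdy_mult_right: "cyc f ==> bdy h * f = bdy (h * f)"
  by (simp add: bdy_def sig_mult left_diff_distrib dl_mult dr_mult dr_dl cyc_def)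

lemma bdy_mult_left: "cyc f ==> f * bdy h = bdy (sig f * h)"
  by (simp add: bdy_def sig_mult right_diff_distrib dl_mult dr_mult flip: dr_dl cyc_sig)

lemma bdy_add: "bdy (a + b) = bdy a + bdy b" "bdy (a - b) = bdy a - bdy b" "bdy (fscl c a) = fscl c (bdy a)"
  by (simp_all add: bdy_def dl_add dr_add sig_add fscl_props)

lemma cyc_ring: "cyc 0" "cyc a ==> cyc b ==> cyc (a + b)" "cyc a ==> cyc b ==> cyc (a - b)"
    "cyc a ==> cyc b ==> cyc (a * b)" "cyc a ==> cyc (fscl c a)"
proof -
  show "cyc 0" by (simp add: cyc_def maps_0)
qed (simp_all add: cyc_def dl_add dr_add sig_add sig_mult dl_mult dr_mult dr_dl)

definition hrel :: "('r::comm_ring_1 mf \<times> nat, 'r) fmat => ('r mf \<times> nat, 'r) fmat => bool" where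
  "hrel a b \<longleftrightarrow> cyc a \<and> cyc b \<and> (\<exists>h. a - b = bdy h)"

lemma bdy_0: "bdy 0 = 0"
  by (simp add: bdy_def maps_0)

\<comment> \<open>Boundaries need not be cycles, so the relation is only a partial equivalence: two
  cycles are identified if their difference happens to be a boundary.\<close>
quotient_type (overloaded) 'r hm = "('r::comm_ring_1 mf \<times> nat, 'r) fmat" / partial: hrel
proof (rule part_equivpI)
  show "\<exists>x. hrel x x" by (rule exI[of _ 0], auto simp: hrel_def cyc_ring bdy_0 intro!: exI[of _ 0])
  show "symp hrel"
  proof (rule sympI)
    fix a b :: "('a mf \<times> nat, 'a) fmat"
    assume "hrel a b"
    then obtain h where "cyc a" "cyc b" "a - b = bdy h" by (auto simp: hrel_def)
    then have "b - a = bdy (0 - h)" by (simp only: bdy_add(2) bdy_0) (simp add: algebra_simps)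
    then show "hrel b a" using \<open>cyc a\<close> \<open>cyc b\<close> by (auto simp: hrel_def)
  qed
  show "transp hrel"
  proof (rule transpI)
    fix a b c :: "('a mf \<times> nat, 'a) fmat"
    assume *: "hrel a b" "hrel b c"
    then obtain h k where "a - b = bdy h" "b - c = bdy k" by (auto simp: hrel_def)
    then have "a - c = bdy (h + k)" by (simp add: bdy_add) (simp add: algebra_simps)
    then show "hrel a c" using * by (auto simp: hrel_def)
  qed
qed

lemma hrelI: "cyc a ==> cyc b ==> a - b = bdy h ==> hrel a b"
  by (auto simp: hrel_def)

lemma hrelE:
  assumes "hrel a b"
  obtains h where "cyc a" "cyc b" "a = b + bdy h"
proof -
  from assms obtain h where *: "cyc a" "cyc b" "a - b = bdy h" by (auto simp: hrel_def)
  then have "a = b + bdy h" by (simp add: algebra_simps)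
  with * show ?thesis using that by blast
qed

instantiation hm :: (comm_ring_1) ring
begin
lift_definition zero_hm :: "'a hm" is 0
  by (auto simp: hrel_def cyc_ring bdy_0 intro!: exI[of _ 0])
lift_definition plus_hm :: "'a hm => 'a hm => 'a hm" is "(+)"
  by (elim hrelE, rule hrelI[of _ _ "_ + _"]) (auto intro!: cyc_ring simp: bdy_add)
lift_definition minus_hm :: "'a hm => 'a hm => 'a hm" is "(-)"
  by (elim hrelE, rule hrelI[of _ _ "_ - _"]) (auto intro!: cyc_ring simp: bdy_add)
lift_definition uminus_hm :: "'a hm => 'a hm" is uminus
proof (elim hrelE)
  fix a b h :: "('a mf \<times> nat, 'a) fmat"
  assume *: "cyc a" "cyc b" "a = b + bdy h"
  then have 1: "cyc (- a)" "cyc (- b)" using cyc_ring(1) cyc_ring(3)[of 0 a] cyc_ring(3)[of 0 b] by auto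
  show "hrel (- a) (- b)" by (rule hrelI[OF 1, of "0 - h"]) (simp add: bdy_add bdy_0 *(3) del: diff_0)
qed
lift_definition times_hm :: "'a hm => 'a hm => 'a hm" is "(*)"
proof -
  fix a b c e :: "('a mf \<times> nat, 'a) fmat"
  assume *: "hrel a b" "hrel c e"
  then obtain h k where hk: "a - b = bdy h" "c - e = bdy k" by (auto simp: hrel_def)
  have "a * c - b * e = (a - b) * c + b * (c - e)" by (simp add: algebra_simps)
  also have "\<dots> = bdy (h * c + sig b * k)"
    using * unfolding hk by (simp add: hrel_def bdy_mult_left bdy_mult_right bdy_add)
  finally show "hrel (a * c) (b * e)" using * by (auto simp: hrel_def cyc_ring)
qed
lemma hrel_refl [simp]: "cyc a ==> hrel a a" by (auto simp: hrel_def bdy_0 intro!: exI[of _ 0])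
lemma hrel_refl': "cyc a ==> a = b ==> hrel a b" by (auto simp: hrel_refl)
instance
proof
  fix a b c :: "'a hm"
  show "a * b * c = a * (b * c)" by transfer (rule hrel_refl', auto elim!: hrelE simp: mult.assoc intro!: cyc_ring)
  show "(a + b) * c = a * c + b * c" by transfer (rule hrel_refl', auto elim!: hrelE simp: algebra_simps intro!: cyc_ring)
  show "a * (b + c) = a * b + a * c" by transfer (rule hrel_refl', auto elim!: hrelE simp: algebra_simps intro!: cyc_ring)
  show "a + b + c = a + (b + c)" by transfer (rule hrel_refl', auto elim!: hrelE simp: algebra_simps intro!: cyc_ring)
  show "a + b = b + a" by transfer (rule hrel_refl', auto elim!: hrelE simp: algebra_simps intro!: cyc_ring)
  show "0 + a = a" by transfer (rule hrel_refl', auto elim!: hrelE intro!: cyc_ring)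
  show "- a + a = 0" by transfer (rule hrel_refl', auto elim!: hrelE intro!: cyc_ring)
  show "a - b = a + - b" by transfer (rule hrel_refl', auto elim!: hrelE intro!: cyc_ring)
qed
end

lift_definition scl :: "'r::comm_ring_1 => 'r hm => 'r hm" is fscl
proof -
  fix c :: 'r and a b :: "('r mf \<times> nat, 'r) fmat"
  assume "hrel a b"
  then obtain h where "cyc a" "cyc b" "a - b = bdy h" by (auto simp: hrel_def)
  then show "hrel (fscl c a) (fscl c b)"
    by (intro hrelI[of _ _ "fscl c h"]) (auto intro!: cyc_ring simp: bdy_add simp flip: fscl_props(2))
qed

lemma scl_props: "scl c (a + b) = scl c a + scl c b" "scl (c + e) a = scl c a + scl e a"
   "scl c (scl e a) = scl (c * e) a" "scl 1 a = a"
  "scl c (a * b) = scl c a * b" "scl c (a * b) = a * scl c b"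
proof -
  show "scl c (a + b) = scl c a + scl c b"
    by transfer (rule hrel_refl', auto elim!: hrelE simp: fscl_props intro!: cyc_ring)
  show "scl (c + e) a = scl c a + scl e a"
    by transfer (rule hrel_refl', auto elim!: hrelE simp: fscl_props intro!: cyc_ring)
  show "scl c (scl e a) = scl (c * e) a"
    by transfer (rule hrel_refl', auto elim!: hrelE simp: fscl_props intro!: cyc_ring)
  show "scl 1 a = a"
    by transfer (rule hrel_refl', auto elim!: hrelE simp: fscl_props intro!: cyc_ring)
  show "scl c (a * b) = scl c a * b"
    by transfer (rule hrel_refl', auto elim!: hrelE simp: fscl_mult(1) intro!: cyc_ring)
  show "scl c (a * b) = a * scl c b"
    by transfer (rule hrel_refl', auto elim!: hrelE simp: fscl_mult(2) intro!: cyc_ring)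
qed

section \<open>Maps of factorisations as blocks of the homotopy ring\<close>

lift_definition big :: "'r::comm_ring_1 mf => 'r mf => 'r mat => ('r mf \<times> nat, 'r) fmat"
  is "\<lambda>X Y f i j. if fst i = Y \<and> fst j = X \<and> snd i < mf_rank Y \<and> snd j < mf_rank X
        then f $$ (snd i, snd j) else 0"
  subgoal for X Y f
    by (rule finite_subset[of _ "nb (Y, 0) \<times> nb (X, 0)"]) (auto simp: nb_def split: if_splits)
  done

definition emb :: "'r::comm_ring_1 mf => 'r mf => 'r mat => 'r hm" where
  "emb X Y f = abs_hm (big X Y f)"

lemma sum_nb: "(\<Sum>k\<in>nb i. F k) = (\<Sum>l<mf_rank (fst i). F (fst i, l))"
proof -
  have "nb i = Pair (fst i) ` {..<mf_rank (fst i)}" by (auto simp: nb_def)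
  then show ?thesis by (simp add: sum.reindex inj_on_def)
qed

lemma index_mult: "i < nr ==> j < nc ==> g \<in> carrier_mat nr n ==> f \<in> carrier_mat n nc ==>
    (g * f) $$ (i, j) = (\<Sum>k<n. g $$ (i, k) * f $$ (k, j))"
  by (auto simp: scalar_prod_def atLeast0LessThan)

lemma big_times:
  assumes "f \<in> carrier_mat (mf_rank Y) (mf_rank X)" "g \<in> carrier_mat (mf_rank Z) (mf_rank Y)"
  shows "big Y Z g * big X Y f = big X Z (g * f)"
proof (rule fmat_eqI)
  fix i j
  have "ent (big Y Z g * big X Y f) i j = (\<Sum>k\<in>nb (Y, 0). ent (big Y Z g) i k * ent (big X Y f) k j)"
    by (rule ent_times) (auto simp: big.rep_eq nb_def split: if_splits)
  then show "ent (big Y Z g * big X Y f) i j = ent (big X Z (g * f)) i j"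
    using assms by (auto simp: sum_nb big.rep_eq index_mult[OF _ _ assms(2,1)] simp del: index_mult_mat(1))
qed

lemma big_add:
  assumes "f \<in> carrier_mat (mf_rank Y) (mf_rank X)" "g \<in> carrier_mat (mf_rank Y) (mf_rank X)"
  shows "big X Y (f + g) = big X Y f + big X Y g" "big X Y (f - g) = big X Y f - big X Y g"
    "big X Y (c \<cdot>\<^sub>m f) = fscl c (big X Y f)" "big X Y (- f) = - big X Y f"
  using assms by (auto intro!: fmat_eqI simp: big.rep_eq plus_fmat.rep_eq minus_fmat.rep_eq fscl.rep_eq uminus_fmat.rep_eq)

lemma big_0: "big X Y (0\<^sub>m (mf_rank Y) (mf_rank X)) = 0"
  by (auto intro!: fmat_eqI simp: big.rep_eq zero_fmat.rep_eq)

lemma hom_mapsD: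
  assumes "f \<in> hom_maps R p X Y"
  shows "f \<in> carrier_mat (mf_rank Y) (mf_rank X)"
    "i < mf_rank Y ==> j < mf_rank X ==> f $$ (i, j) \<in> R"
    "i < mf_rank Y ==> j < mf_rank X ==> f $$ (i, j) \<noteq> 0 ==> (mf_par Y ! i \<noteq> mf_par X ! j) = p"
  using assms elements_matI[of f "mf_rank Y" "mf_rank X" i j] by (auto simp: hom_maps_def)

lemma hom_mapsI:
  assumes "f \<in> carrier_mat (mf_rank Y) (mf_rank X)"
    "\<And>i j. i < mf_rank Y ==> j < mf_rank X ==> f $$ (i, j) \<in> R"
    "\<And>i j. i < mf_rank Y ==> j < mf_rank X ==> f $$ (i, j) \<noteq> 0 ==> (mf_par Y ! i \<noteq> mf_par X ! j) = p"
  shows "f \<in> hom_maps R p X Y"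
  using assms by (auto simp: hom_maps_def elements_mat_def)

lemma dcomm_carrier:
  assumes "mf_d X \<in> hom_maps R True X X" "mf_d Y \<in> hom_maps R True Y Y"
    "h \<in> carrier_mat (mf_rank Y) (mf_rank X)"
  shows "dcomm p X Y h \<in> carrier_mat (mf_rank Y) (mf_rank X)"
proof -
  have "mf_d X \<in> carrier_mat (mf_rank X) (mf_rank X)" "mf_d Y \<in> carrier_mat (mf_rank Y) (mf_rank Y)"
    using assms hom_mapsD(1) by blast+
  then have "mf_d Y * h \<in> carrier_mat (mf_rank Y) (mf_rank X)" "h * mf_d X \<in> carrier_mat (mf_rank Y) (mf_rank X)"
    using assms(3) by auto
  then show ?thesis by (auto simp: dcomm_def intro: minus_carrier_mat)
qed

lemma dcomm_index:
  assumes "mf_d X \<in> hom_maps R True X X" "mf_d Y \<in> hom_maps R True Y Y"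
    and h: "h \<in> carrier_mat (mf_rank Y) (mf_rank X)" and ij: "i < mf_rank Y" "j < mf_rank X"
  shows "dcomm p X Y h $$ (i, j) = (\<Sum>k<mf_rank Y. mf_d Y $$ (i, k) * h $$ (k, j))
    - (if p then - 1 else 1) * (\<Sum>k<mf_rank X. h $$ (i, k) * mf_d X $$ (k, j))"
proof -
  have d: "mf_d X \<in> carrier_mat (mf_rank X) (mf_rank X)" "mf_d Y \<in> carrier_mat (mf_rank Y) (mf_rank Y)"
    using assms hom_mapsD(1) by blast+
  then have "mf_d Y * h \<in> carrier_mat (mf_rank Y) (mf_rank X)" "h * mf_d X \<in> carrier_mat (mf_rank Y) (mf_rank X)"
    using h by auto
  from this[THEN carrier_matD(1)] this[THEN carrier_matD(2)] show ?thesis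
    using ij by (simp add: dcomm_def index_mult[OF ij d(2) h] index_mult[OF ij h d(1)] del: index_mult_mat(1))
qed

lemma dent_hom:
  assumes "mf_d X \<in> hom_maps R True X X" "i < mf_rank X" "j < mf_rank X"
  shows "dent (X, i) (X, j) = mf_d X $$ (i, j)"
  using hom_mapsD(3)[OF assms] assms by (auto simp: dent_def)

lemma ent_bdy: "ent (bdy a) i j =
   (\<Sum>k<mf_rank (fst i). dent i (fst i, k) * ent a (fst i, k) j)
   - (\<Sum>k<mf_rank (fst j). sg i * sg (fst j, k) * ent a i (fst j, k) * dent (fst j, k) j)"
  by (simp add: bdy_def minus_fmat.rep_eq dl.rep_eq dr.rep_eq sig.rep_eq sum_nb)

text \<open>For homogeneous \<open>h\<close> the product of the signs of row and column is the same
  at all nonzero entries, and it is the sign that occurs in \<open>dcomm\<close>. Outside the block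
  both sides vanish because D is block diagonal.\<close>

lemma bdy_big:
  assumes d: "mf_d X \<in> hom_maps R True X X" "mf_d Y \<in> hom_maps R True Y Y" and h: "h \<in> hom_maps S p X Y"
  shows "bdy (big X Y h) = big X Y (dcomm p X Y h)"
proof (rule fmat_eqI)
  fix i j :: "'a mf \<times> nat"
  note hc = hom_mapsD(1)[OF h]
  show "ent (bdy (big X Y h)) i j = ent (big X Y (dcomm p X Y h)) i j"
  proof (cases "fst i = Y \<and> fst j = X \<and> snd i < mf_rank Y \<and> snd j < mf_rank X")
    case True
    then obtain a b where ij: "i = (Y, a)" "j = (X, b)" and ab: "a < mf_rank Y" "b < mf_rank X"
      by (cases i, cases j) auto
    have 2: "sg (Y, a) * (sg (X, k) * (h $$ (a, k) * z)) = (if p then - 1 else 1) * (h $$ (a, k) * z)"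
      if "k < mf_rank X" for k z
      using hom_mapsD(3)[OF h ab(1) that] by (cases "h $$ (a, k) = 0") (auto simp: sg_def)
    show ?thesis unfolding ij
      using ab by (simp add: ent_bdy big.rep_eq dcomm_index[OF d hc] dent_hom[OF d(1)] dent_hom[OF d(2)] 2
        sum_distrib_left mult.assoc cong: sum.cong_simp)
  next
    case False
    have "dent i (fst i, k) * ent (big X Y h) (fst i, k) j = 0" for k
      using False by (auto simp: big.rep_eq dent_def)
    moreover have "ent (big X Y h) i (fst j, k) * dent (fst j, k) j = 0" for k
      using False by (auto simp: big.rep_eq dent_def)
    moreover have "ent (big X Y (dcomm p X Y h)) i j = 0" using False by (auto simp: big.rep_eq)
    ultimately show ?thesis by (simp add: ent_bdy mult.assoc)
  qed
qed

lemma cyc_iff: "cyc a \<longleftrightarrow> bdy a = 0" by (simp add: cyc_def bdy_def)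

lemma cyc_big:
  assumes d: "mf_d X \<in> hom_maps R True X X" "mf_d Y \<in> hom_maps R True Y Y" and f: "f \<in> closed_maps S p X Y"
  shows "cyc (big X Y f)"
  using bdy_big[OF d, of f S p] f by (simp add: closed_maps_def cyc_iff big_0)

lemma abs_hm_eq: "cyc a ==> cyc b ==> abs_hm a = abs_hm b \<longleftrightarrow> (\<exists>h. a - b = bdy h)"
  using Quotient_rel[OF Quotient_hm, of a b] by (auto simp: hrel_def bdy_0 intro: exI[of _ 0])

lemma big_inj:
  assumes "f \<in> carrier_mat (mf_rank Y) (mf_rank X)" "g \<in> carrier_mat (mf_rank Y) (mf_rank X)"
    "big X Y f = big X Y g"
  shows "f = g"
proof (rule eq_matI)
  fix i j assume "i < dim_row g" "j < dim_col g"
  then show "f $$ (i, j) = g $$ (i, j)"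
    using arg_cong[OF assms(3), of "\<lambda>a. ent a (Y, i) (X, j)"] assms(1,2) by (simp add: big.rep_eq)
qed (use assms in auto)

text \<open>A null homotopy in the ring may spread over other blocks and over both parities. Since D
  is block diagonal and odd, only its part from \<open>X\<close> to \<open>Y\<close> of parity
  \<open>\<not> p\<close> contributes to \<open>f - g\<close>; cutting out that part leaves a
  homotopy of matrices, with entries anywhere in the ambient ring.\<close>

lemma emb_eqD:
  assumes d: "mf_d X \<in> hom_maps R True X X" "mf_d Y \<in> hom_maps R True Y Y"
    and f: "f \<in> closed_maps S p X Y" and g: "g \<in> closed_maps S p X Y" and eq: "emb X Y f = emb X Y g"
  shows "\<exists>h\<in>hom_maps UNIV (\<not> p) X Y. f - g = dcomm (\<not> p) X Y h"
proof -
  have fc: "f \<in> hom_maps S p X Y" "g \<in> hom_maps S p X Y" using f g by (auto simp: closed_maps_def)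
  note fc' = hom_mapsD(1)[OF fc(1)] hom_mapsD(1)[OF fc(2)]
  obtain h where "big X Y f - big X Y g = bdy h"
    using eq abs_hm_eq[OF cyc_big[OF d f] cyc_big[OF d g]] by (auto simp: emb_def)
  then have h: "big X Y (f - g) = bdy h" by (simp add: big_add[OF fc'])
  define h' where "h' = mat (mf_rank Y) (mf_rank X)
    (\<lambda>(i, j). if (mf_par Y ! i \<noteq> mf_par X ! j) = (\<not> p) then ent h (Y, i) (X, j) else 0)"
  have h'c: "h' \<in> carrier_mat (mf_rank Y) (mf_rank X)" by (simp add: h'_def)
  have h'i: "h' $$ (i, j) = (if (mf_par Y ! i \<noteq> mf_par X ! j) = (\<not> p) then ent h (Y, i) (X, j) else 0)"
    if "i < mf_rank Y" "j < mf_rank X" for i j using that by (simp add: h'_def)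
  have "h' \<in> hom_maps UNIV (\<not> p) X Y"
    by (rule hom_mapsI) (use h'c h'i in \<open>auto split: if_splits\<close>)
  moreover have "f - g = dcomm (\<not> p) X Y h'"
  proof (rule eq_matI)
    fix i j assume "i < dim_row (dcomm (\<not> p) X Y h')" "j < dim_col (dcomm (\<not> p) X Y h')"
    then have ij: "i < mf_rank Y" "j < mf_rank X" using dcomm_carrier[OF d h'c, of "\<not> p"] by auto
    have e: "(f - g) $$ (i, j) = (\<Sum>k<mf_rank Y. mf_d Y $$ (i, k) * ent h (Y, k) (X, j))
       - (\<Sum>k<mf_rank X. sg (Y, i) * sg (X, k) * ent h (Y, i) (X, k) * mf_d X $$ (k, j))"
      using arg_cong[OF h, of "\<lambda>a. ent a (Y, i) (X, j)"] ij
      by (simp add: big.rep_eq ent_bdy dent_hom[OF d(1)] dent_hom[OF d(2)] cong: sum.cong_simp)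
    show "(f - g) $$ (i, j) = dcomm (\<not> p) X Y h' $$ (i, j)"
    proof (cases "(mf_par Y ! i \<noteq> mf_par X ! j) = p")
      case True
      have "mf_d Y $$ (i, k) * ent h (Y, k) (X, j) = mf_d Y $$ (i, k) * h' $$ (k, j)" if "k < mf_rank Y" for k
        using hom_mapsD(3)[OF d(2) ij(1) that] that ij True
        by (cases "mf_d Y $$ (i, k) = 0") (auto simp: h'i)
      moreover have "sg (Y, i) * sg (X, k) * ent h (Y, i) (X, k) * mf_d X $$ (k, j) =
          (if \<not> p then - 1 else 1) * (h' $$ (i, k) * mf_d X $$ (k, j))" if "k < mf_rank X" for k
        using hom_mapsD(3)[OF d(1) that ij(2)] that ij True
        by (cases "mf_d X $$ (k, j) = 0") (auto simp: h'i sg_def)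
      ultimately show ?thesis unfolding e dcomm_index[OF d h'c ij]
        by (simp add: sum_distrib_left cong: sum.cong_simp)
    next
      case False
      have "mf_d Y $$ (i, k) * h' $$ (k, j) = 0" if "k < mf_rank Y" for k
        using hom_mapsD(3)[OF d(2) ij(1) that] that ij False
        by (cases "mf_d Y $$ (i, k) = 0") (auto simp: h'i)
      moreover have "h' $$ (i, k) * mf_d X $$ (k, j) = 0" if "k < mf_rank X" for k
        using hom_mapsD(3)[OF d(1) that ij(2)] that ij False
        by (cases "mf_d X $$ (k, j) = 0") (auto simp: h'i)
      moreover have "f $$ (i, j) = 0" "g $$ (i, j) = 0"
        using hom_mapsD(3)[OF fc(1) ij] hom_mapsD(3)[OF fc(2) ij] False by auto
      ultimately show ?thesis unfolding dcomm_index[OF d h'c ij] using ij fc' by simp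
    qed
  qed (use fc' dcomm_carrier[OF d h'c, of "\<not> p"] in auto)
  ultimately show ?thesis by blast
qed

lemma emb_eqI:
  assumes d: "mf_d X \<in> hom_maps R True X X" "mf_d Y \<in> hom_maps R True Y Y"
    and f: "f \<in> closed_maps S p X Y" and g: "g \<in> closed_maps S p X Y"
    and h: "h \<in> hom_maps S' (\<not> p) X Y" "f - g = dcomm (\<not> p) X Y h"
  shows "emb X Y f = emb X Y g"
proof -
  have "f \<in> carrier_mat (mf_rank Y) (mf_rank X)" "g \<in> carrier_mat (mf_rank Y) (mf_rank X)"
    using f g hom_mapsD(1) unfolding closed_maps_def by blast+
  then have "big X Y f - big X Y g = bdy (big X Y h)"
    using bdy_big[OF d h(1)] h(2) big_add(2) by metis
  then show ?thesis unfolding emb_def using abs_hm_eq[OF cyc_big[OF d f] cyc_big[OF d g]] by blast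
qed

lemma emb_mult:
  assumes "mf_d X \<in> hom_maps R True X X" "mf_d Y \<in> hom_maps R True Y Y" "mf_d Z \<in> hom_maps R True Z Z"
    and f: "f \<in> closed_maps S p X Y" and g: "g \<in> closed_maps S q Y Z"
  shows "emb X Z (g * f) = emb Y Z g * emb X Y f"
proof -
  have "f \<in> carrier_mat (mf_rank Y) (mf_rank X)" "g \<in> carrier_mat (mf_rank Z) (mf_rank Y)"
    using f g hom_mapsD(1) unfolding closed_maps_def by blast+
  then have "big X Z (g * f) = big Y Z g * big X Y f" by (simp add: big_times)
  then show ?thesis unfolding emb_def using times_hm.abs_eq[OF hrel_refl hrel_refl]
      cyc_big[OF assms(1,2) f] cyc_big[OF assms(2,3) g] by metis
qed

lemma emb_add:
  assumes "mf_d X \<in> hom_maps R True X X" "mf_d Y \<in> hom_maps R True Y Y"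
    and f: "f \<in> closed_maps S p X Y" and g: "g \<in> closed_maps S q X Y"
  shows "emb X Y (f + g) = emb X Y f + emb X Y g" "emb X Y (c \<cdot>\<^sub>m f) = scl c (emb X Y f)"
    "emb X Y (- f) = - emb X Y f"
proof -
  have *: "f \<in> carrier_mat (mf_rank Y) (mf_rank X)" "g \<in> carrier_mat (mf_rank Y) (mf_rank X)"
    using f g hom_mapsD(1) unfolding closed_maps_def by blast+
  note big_add[OF *] 
  then show "emb X Y (f + g) = emb X Y f + emb X Y g" "emb X Y (c \<cdot>\<^sub>m f) = scl c (emb X Y f)"
      "emb X Y (- f) = - emb X Y f"
    unfolding emb_def using plus_hm.abs_eq[OF hrel_refl hrel_refl] scl.abs_eq[OF hrel_refl] uminus_hm.abs_eq[OF hrel_refl]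
      cyc_big[OF assms(1,2) f] cyc_big[OF assms(1,2) g] by metis+
qed

lemma emb_0: "emb X Y (0\<^sub>m (mf_rank Y) (mf_rank X)) = 0"
  by (simp add: emb_def big_0 zero_hm.abs_eq)

text \<open>A retraction onto the coefficient ring \<open>R\<close> makes null homotopies over the ambient ring type
  available over \<open>R\<close>.\<close>

definition mfR :: "'r::comm_ring_1 set => 'r mf => bool" where
  "mfR R X \<longleftrightarrow> mf_d X \<in> hom_maps R True X X"

definition Hm :: "'r::comm_ring_1 set => bool => 'r mf => 'r mf => 'r mat set set" where
  "Hm R p X Y = hcl R p X Y ` closed_maps R p X Y"

text \<open>The choice does not matter: by \<open>Hm_memb\<close> all members of a class have the
  same image under \<open>emb\<close>.\<close>

definition eta :: "'r::comm_ring_1 mf => 'r mf => 'r mat set => 'r hm" where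
  "eta X Y F = emb X Y (SOME f. f \<in> F)"

locale coeff_ring =
  fixes R :: "'r::comm_ring_1 set" and \<rho> :: "'r => 'r"
  assumes R_0 [simp, intro]: "0 \<in> R" and R_1 [simp, intro]: "1 \<in> R"
    and R_add [intro]: "x \<in> R ==> y \<in> R ==> x + y \<in> R"
    and R_minus [intro]: "x \<in> R ==> - x \<in> R"
    and R_mult [intro]: "x \<in> R ==> y \<in> R ==> x * y \<in> R"
    and retr_R: "\<rho> x \<in> R" and retr_id: "x \<in> R ==> \<rho> x = x"
    and retr_add: "\<rho> (x + y) = \<rho> x + \<rho> y" and retr_mult: "\<rho> (x * y) = \<rho> x * \<rho> y"
begin

lemma R_sum: "(\<And>x. x \<in> A ==> g x \<in> R) ==> sum g A \<in> R"
  by (induction A rule: infinite_finite_induct) auto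

lemma R_diff: "x \<in> R ==> y \<in> R ==> x - y \<in> R"
  using R_add[of x "- y"] R_minus by auto

lemma retr_0 [simp]: "\<rho> 0 = 0" by (simp add: retr_id)
lemma retr_neg: "\<rho> (- x) = - \<rho> x" using retr_add[of x "- x"] by (simp add: add_eq_0_iff)
lemma retr_diff: "\<rho> (x - y) = \<rho> x - \<rho> y" using retr_add[of x "- y"] by (simp add: retr_neg)
lemma retr_sum: "\<rho> (sum g A) = (\<Sum>x\<in>A. \<rho> (g x))"
  by (induction A rule: infinite_finite_induct) (auto simp: retr_add)

lemma hom_maps_add:
  assumes "f \<in> hom_maps R p X Y" "g \<in> hom_maps R p X Y"
  shows "f + g \<in> hom_maps R p X Y" "f - g \<in> hom_maps R p X Y" "- f \<in> hom_maps R p X Y"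
    "c \<in> R ==> c \<cdot>\<^sub>m f \<in> hom_maps R p X Y"
proof -
  note c = hom_mapsD(1)[OF assms(1)] hom_mapsD(1)[OF assms(2)]
  note R = hom_mapsD(2)[OF assms(1)] hom_mapsD(2)[OF assms(2)]
  have p: "(mf_par Y ! i \<noteq> mf_par X ! j) = p" if "i < mf_rank Y" "j < mf_rank X"
    "f $$ (i, j) \<noteq> 0 \<or> g $$ (i, j) \<noteq> 0" for i j
    using hom_mapsD(3)[OF assms(1) that(1,2)] hom_mapsD(3)[OF assms(2) that(1,2)] that(3) by blast
  have *: "u \<in> hom_maps R p X Y" if "u \<in> carrier_mat (mf_rank Y) (mf_rank X)"
    "\<And>i j. i < mf_rank Y ==> j < mf_rank X ==> u $$ (i, j) \<in> R \<and>
      (u $$ (i, j) \<noteq> 0 \<longrightarrow> f $$ (i, j) \<noteq> 0 \<or> g $$ (i, j) \<noteq> 0)" for u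
    by (rule hom_mapsI) (use that p in blast)+
  show "f + g \<in> hom_maps R p X Y" by (rule *) (use c R in auto)
  show "f - g \<in> hom_maps R p X Y" by (rule *) (use c R R_diff in \<open>auto intro: minus_carrier_mat\<close>)
  show "- f \<in> hom_maps R p X Y" by (rule *) (use c R in auto)
  show "c \<cdot>\<^sub>m f \<in> hom_maps R p X Y" if "c \<in> R" by (rule *) (use c R that in auto)
qed

lemma hom_maps_0: "0\<^sub>m (mf_rank Y) (mf_rank X) \<in> hom_maps R p X Y"
  by (rule hom_mapsI) auto

lemma hom_maps_1: "1\<^sub>m (mf_rank X) \<in> hom_maps R False X X"
  by (rule hom_mapsI) (auto split: if_splits)

lemma hom_maps_mult:
  assumes "f \<in> hom_maps R p X Y" "g \<in> hom_maps R q Y Z"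
  shows "g * f \<in> hom_maps R (q \<noteq> p) X Z"
proof (rule hom_mapsI)
  note c = hom_mapsD(1)[OF assms(1)] hom_mapsD(1)[OF assms(2)]
  show "g * f \<in> carrier_mat (mf_rank Z) (mf_rank X)" using c by auto
  fix i j assume ij: "i < mf_rank Z" "j < mf_rank X"
  note e = index_mult[OF ij c(2,1)]
  show "(g * f) $$ (i, j) \<in> R"
    unfolding e using ij hom_mapsD(2)[OF assms(1)] hom_mapsD(2)[OF assms(2)] by (auto intro!: R_sum)
  assume "(g * f) $$ (i, j) \<noteq> 0"
  then obtain k where k: "k < mf_rank Y" "g $$ (i, k) * f $$ (k, j) \<noteq> 0"
    unfolding e by (auto elim: sum.not_neutral_contains_not_neutral)
  then have "g $$ (i, k) \<noteq> 0" "f $$ (k, j) \<noteq> 0" by auto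
  then show "(mf_par Z ! i \<noteq> mf_par X ! j) = (q \<noteq> p)"
    using hom_mapsD(3)[OF assms(1) k(1) ij(2)] hom_mapsD(3)[OF assms(2) ij(1) k(1)] by auto
qed

lemma closed_carrier: "f \<in> closed_maps S p X Y ==> f \<in> carrier_mat (mf_rank Y) (mf_rank X)"
  using hom_mapsD(1) by (auto simp: closed_maps_def)

lemma closed_maps_cyc:
  assumes "mfR R X" "mfR R Y"
  shows "f \<in> closed_maps R p X Y \<longleftrightarrow> f \<in> hom_maps R p X Y \<and> cyc (big X Y f)"
proof
  assume "f \<in> closed_maps R p X Y"
  then show "f \<in> hom_maps R p X Y \<and> cyc (big X Y f)"
    using cyc_big[of X R Y f R p] assms by (auto simp: closed_maps_def mfR_def)
next
  assume *: "f \<in> hom_maps R p X Y \<and> cyc (big X Y f)"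
  then have "big X Y (dcomm p X Y f) = big X Y (0\<^sub>m (mf_rank Y) (mf_rank X))"
    using bdy_big[of X R Y f R p] assms by (simp add: mfR_def cyc_iff big_0)
  then show "f \<in> closed_maps R p X Y"
    using * assms dcomm_carrier[of X R Y f p] hom_mapsD(1)[of f R p X Y]
    by (auto simp: closed_maps_def mfR_def intro!: big_inj)
qed

lemma closed_maps_ops:
  assumes X: "mfR R X" and Y: "mfR R Y"
  shows "f \<in> closed_maps R p X Y ==> g \<in> closed_maps R p X Y ==> f + g \<in> closed_maps R p X Y"
    and "f \<in> closed_maps R p X Y ==> g \<in> closed_maps R p X Y ==> f - g \<in> closed_maps R p X Y"
    and "f \<in> closed_maps R p X Y ==> - f \<in> closed_maps R p X Y"
    and "f \<in> closed_maps R p X Y ==> c \<in> R ==> c \<cdot>\<^sub>m f \<in> closed_maps R p X Y"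
    and "0\<^sub>m (mf_rank Y) (mf_rank X) \<in> closed_maps R p X Y"
    and "1\<^sub>m (mf_rank X) \<in> closed_maps R False X X"
proof -
  show "0\<^sub>m (mf_rank Y) (mf_rank X) \<in> closed_maps R p X Y"
    using X Y by (simp add: closed_maps_cyc hom_maps_0 big_0 cyc_ring)
  have "mf_d X \<in> carrier_mat (mf_rank X) (mf_rank X)" using X hom_mapsD(1) by (auto simp: mfR_def)
  then show "1\<^sub>m (mf_rank X) \<in> closed_maps R False X X"
    by (auto simp: closed_maps_def hom_maps_1 dcomm_def)
  assume f: "f \<in> closed_maps R p X Y"
  note fc = closed_carrier[OF f]
  show "- f \<in> closed_maps R p X Y"
    using f X Y cyc_ring(3)[of 0 "big X Y f"] by (simp add: closed_maps_cyc hom_maps_add(3)[of f p X Y f] cyc_ring big_add(4)[OF fc fc])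
  show "c \<in> R ==> c \<cdot>\<^sub>m f \<in> closed_maps R p X Y"
    using f X Y by (simp add: closed_maps_cyc hom_maps_add(4)[of f p X Y f] cyc_ring big_add(3)[OF fc fc])
  assume g: "g \<in> closed_maps R p X Y"
  note gc = closed_carrier[OF g]
  show "f + g \<in> closed_maps R p X Y" "f - g \<in> closed_maps R p X Y"
    using f g X Y by (simp_all add: closed_maps_cyc hom_maps_add cyc_ring big_add(1,2)[OF fc gc])
qed

lemma closed_maps_mult:
  assumes X: "mfR R X" and Y: "mfR R Y" and Z: "mfR R Z"
    and f: "f \<in> closed_maps R p X Y" and g: "g \<in> closed_maps R q Y Z"
  shows "g * f \<in> closed_maps R (q \<noteq> p) X Z"
  using f g hom_maps_mult[of f p X Y g q Z]
  by (auto simp: closed_maps_cyc[OF X Y] closed_maps_cyc[OF Y Z] closed_maps_cyc[OF X Z]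
     cyc_ring simp flip: big_times[OF closed_carrier[OF f] closed_carrier[OF g]])

lemma hcl_iff:
  assumes X: "mfR R X" and Y: "mfR R Y" and f: "f \<in> closed_maps R p X Y"
  shows "g \<in> hcl R p X Y f \<longleftrightarrow> g \<in> closed_maps R p X Y \<and> emb X Y g = emb X Y f"
proof
  assume "g \<in> hcl R p X Y f"
  then obtain h where gh: "g \<in> closed_maps R p X Y" "h \<in> hom_maps R (\<not> p) X Y" "g - f = dcomm (\<not> p) X Y h"
    by (auto simp: hcl_def)
  then show "g \<in> closed_maps R p X Y \<and> emb X Y g = emb X Y f"
    using emb_eqI[OF X[unfolded mfR_def] Y[unfolded mfR_def] gh(1) f gh(2,3)] by simp
next
  assume *: "g \<in> closed_maps R p X Y \<and> emb X Y g = emb X Y f"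
  note X' = X[unfolded mfR_def] and Y' = Y[unfolded mfR_def]
  obtain h where h: "h \<in> hom_maps UNIV (\<not> p) X Y" "g - f = dcomm (\<not> p) X Y h"
    using emb_eqD[OF X' Y' _ f] * by blast
  \<comment> \<open>The homotopy found so far has entries outside \<open>R\<close>. The
    differentials and \<open>g - f\<close> have entries in \<open>R\<close>, which \<rho> fixes, and
    \<rho> respects sums and products, so the entrywise image of \<open>h\<close> is a homotopy over
    \<open>R\<close> for the same difference.\<close>
  define h' where "h' = map_mat \<rho> h"
  note hc = hom_mapsD(1)[OF h(1)]
  then have h'c: "h' \<in> carrier_mat (mf_rank Y) (mf_rank X)" by (simp add: h'_def)
  have h': "h' \<in> hom_maps R (\<not> p) X Y"
  proof (rule hom_mapsI[OF h'c])
    fix i j assume ij: "i < mf_rank Y" "j < mf_rank X"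
    then show "h' $$ (i, j) \<in> R" using hc by (simp add: h'_def retr_R)
    show "(mf_par Y ! i \<noteq> mf_par X ! j) = (\<not> p)" if "h' $$ (i, j) \<noteq> 0"
      using that ij hc hom_mapsD(3)[OF h(1) ij] by (cases "h $$ (i, j) = 0") (auto simp: h'_def)
  qed
  have h'i: "h' $$ (i, j) = \<rho> (h $$ (i, j))" if "i < mf_rank Y" "j < mf_rank X" for i j
    using that hc by (simp add: h'_def)
  have fg: "g - f \<in> hom_maps R p X Y"
    using * f X Y by (simp add: closed_maps_cyc hom_maps_add)
  have "g - f = dcomm (\<not> p) X Y h'"
  proof (rule eq_matI)
    fix i j assume "i < dim_row (dcomm (\<not> p) X Y h')" "j < dim_col (dcomm (\<not> p) X Y h')"
    then have ij: "i < mf_rank Y" "j < mf_rank X" using dcomm_carrier[OF X' Y' h'c, of "\<not> p"] by auto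
    have "(g - f) $$ (i, j) = \<rho> ((g - f) $$ (i, j))"
      using hom_mapsD(2)[OF fg ij] by (simp add: retr_id)
    also have "\<dots> = \<rho> (dcomm (\<not> p) X Y h $$ (i, j))" by (simp add: h(2))
    also have "\<dots> = dcomm (\<not> p) X Y h' $$ (i, j)"
      using ij hc hom_mapsD(2)[OF X'] hom_mapsD(2)[OF Y']
      by (cases p) (simp_all add: retr_diff dcomm_index[OF X' Y' hc ij] dcomm_index[OF X' Y' h'c ij] retr_add retr_neg retr_mult retr_sum
          retr_id h'i cong: sum.cong_simp)
    finally show "(g - f) $$ (i, j) = dcomm (\<not> p) X Y h' $$ (i, j)" .
  qed (use dcomm_carrier[OF X' Y' h'c, of "\<not> p"] hom_mapsD(1)[OF fg] in auto)
  with * h' show "g \<in> hcl R p X Y f" by (auto simp: hcl_def)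
qed

lemma hcl_self: "mfR R X ==> mfR R Y ==> f \<in> closed_maps R p X Y ==> f \<in> hcl R p X Y f"
  by (simp add: hcl_iff)

lemma hcl_cong:
  assumes "mfR R X" "mfR R Y" "f \<in> closed_maps R p X Y" "g \<in> closed_maps R p X Y" "emb X Y f = emb X Y g"
  shows "hcl R p X Y f = hcl R p X Y g"
  using assms by (auto simp: hcl_iff)

lemma eta_hcl:
  assumes "mfR R X" "mfR R Y" "f \<in> closed_maps R p X Y"
  shows "eta X Y (hcl R p X Y f) = emb X Y f"
  unfolding eta_def using someI[of "\<lambda>g. g \<in> hcl R p X Y f", OF hcl_self[OF assms]] by (simp add: hcl_iff[OF assms])

section \<open>Operations on classes computed in the ring\<close>

lemma Hm_memb:
  assumes "mfR R X" "mfR R Y" "F \<in> Hm R p X Y" "f \<in> F"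
  shows "f \<in> closed_maps R p X Y" "emb X Y f = eta X Y F" "F = hcl R p X Y f"
  using assms by (auto simp: Hm_def eta_hcl hcl_iff intro!: hcl_cong)

lemma Hm_ex: "mfR R X ==> mfR R Y ==> F \<in> Hm R p X Y ==> \<exists>f. f \<in> F"
  unfolding Hm_def using hcl_self by blast

lemma HmI: "f \<in> closed_maps R p X Y ==> hcl R p X Y f \<in> Hm R p X Y"
  by (simp add: Hm_def)

text \<open>The bridge back: an equation in \<open>hm\<close> becomes an equation of homotopy
  classes once source, target and parity are known to agree. Equations of morphisms are later
  established through it.\<close>

lemma eta_inj:
  assumes "mfR R X" "mfR R Y" "F \<in> Hm R p X Y" "G \<in> Hm R p X Y"
  shows "F = G \<longleftrightarrow> eta X Y F = eta X Y G"
proof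
  assume *: "eta X Y F = eta X Y G"
  obtain f g where "f \<in> F" "g \<in> G" using Hm_ex[OF assms(1,2,3)] Hm_ex[OF assms(1,2,4)] by blast
  then show "F = G" using * Hm_memb[OF assms(1,2,3)] Hm_memb[OF assms(1,2,4)] hcl_cong[OF assms(1,2)] by metis
qed simp

lemma UN_eqI: "F \<noteq> {} ==> (\<And>f. f \<in> F ==> A f = C) ==> (\<Union>f\<in>F. A f) = C"
  by auto

text \<open>The unions in \<open>hcomp\<close> run over all representatives; each of them
  contributes the same class, so the union is that class. \<open>Hm_hadd\<close> and
  \<open>Hm_hscale\<close> follow the same pattern.\<close>

lemma Hm_hcomp:
  assumes X: "mfR R X" and Y: "mfR R Y" and Z: "mfR R Z" and F: "F \<in> Hm R p X Y" and G: "G \<in> Hm R q Y Z" and r: "r = (q \<noteq> p)"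
  shows "hcomp R r X Z G F \<in> Hm R r X Z" "eta X Z (hcomp R r X Z G F) = eta Y Z G * eta X Y F"
proof -
  obtain f g where f: "f \<in> F" and g: "g \<in> G" using Hm_ex[OF X Y F] Hm_ex[OF Y Z G] by blast
  have m: "g' * f' \<in> closed_maps R r X Z" "emb X Z (g' * f') = eta Y Z G * eta X Y F" if "f' \<in> F" "g' \<in> G" for f' g'
    using Hm_memb[OF X Y F that(1)] Hm_memb[OF Y Z G that(2)] closed_maps_mult[OF X Y Z] r
      emb_mult[of X R Y Z f' R p g' q] X Y Z unfolding mfR_def by auto
  have "hcomp R r X Z G F = hcl R r X Z (g * f)"
    unfolding hcomp_def using f g m by (intro UN_eqI hcl_cong[OF X Z]) auto
  then show "hcomp R r X Z G F \<in> Hm R r X Z" "eta X Z (hcomp R r X Z G F) = eta Y Z G * eta X Y F"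
    using m[OF f g] by (auto simp: Hm_def eta_hcl[OF X Z])
qed

lemma Hm_hadd:
  assumes X: "mfR R X" and Y: "mfR R Y" and F: "F \<in> Hm R p X Y" and G: "G \<in> Hm R p X Y"
  shows "hadd R p X Y F G \<in> Hm R p X Y" "eta X Y (hadd R p X Y F G) = eta X Y F + eta X Y G"
proof -
  obtain f g where f: "f \<in> F" and g: "g \<in> G" using Hm_ex[OF X Y F] Hm_ex[OF X Y G] by blast
  have m: "f' + g' \<in> closed_maps R p X Y" "emb X Y (f' + g') = eta X Y F + eta X Y G" if "f' \<in> F" "g' \<in> G" for f' g'
    using Hm_memb[OF X Y F that(1)] Hm_memb[OF X Y G that(2)] closed_maps_ops(1)[OF X Y]
      emb_add(1)[of X R Y f' R p g' p] X Y unfolding mfR_def by auto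
  have "hadd R p X Y F G = hcl R p X Y (f + g)"
    unfolding hadd_def using f g m by (intro UN_eqI hcl_cong[OF X Y]) auto
  then show "hadd R p X Y F G \<in> Hm R p X Y" "eta X Y (hadd R p X Y F G) = eta X Y F + eta X Y G"
    using m[OF f g] by (auto simp: Hm_def eta_hcl[OF X Y])
qed

lemma Hm_hscale:
  assumes X: "mfR R X" and Y: "mfR R Y" and F: "F \<in> Hm R p X Y" and c: "c \<in> R"
  shows "hscale R p X Y c F \<in> Hm R p X Y" "eta X Y (hscale R p X Y c F) = scl c (eta X Y F)"
proof -
  obtain f where f: "f \<in> F" using Hm_ex[OF X Y F] by blast
  have m: "c \<cdot>\<^sub>m f' \<in> closed_maps R p X Y" "emb X Y (c \<cdot>\<^sub>m f') = scl c (eta X Y F)" if "f' \<in> F" for f'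
    using Hm_memb[OF X Y F that(1)] closed_maps_ops(4)[OF X Y]
      emb_add(2)[of X R Y f' R p f' p] X Y c unfolding mfR_def by auto
  have "hscale R p X Y c F = hcl R p X Y (c \<cdot>\<^sub>m f)"
    unfolding hscale_def using f m by (intro UN_eqI hcl_cong[OF X Y]) auto
  then show "hscale R p X Y c F \<in> Hm R p X Y" "eta X Y (hscale R p X Y c F) = scl c (eta X Y F)"
    using m[OF f] by (auto simp: Hm_def eta_hcl[OF X Y])
qed

lemma Hm_hzero:
  assumes X: "mfR R X" and Y: "mfR R Y"
  shows "hzero R p X Y \<in> Hm R p X Y" "eta X Y (hzero R p X Y) = 0"
  using assms by (auto simp: hzero_def Hm_def eta_hcl closed_maps_ops emb_0)

end

section \<open>Clifford algebras acting in a ring\<close>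

text \<open>In a ring without unit the empty product has to be supplied; it will be the idempotent
  of the object.\<close>

fun rprod :: "'a::ring => 'a list => 'a" where
  "rprod e [] = e"
| "rprod e (g # gs) = g * rprod e gs"

text \<open>A representation of the Clifford algebra in the corner \<open>e A e\<close>, with
  \<open>e\<close> as unit. Squares are restricted only by \<open>a * a + a * a = 0\<close>, in
  accordance with \<open>clifford_action\<close>.\<close>

definition cliff :: "'a::ring => 'a list => 'a list => bool" where
  "cliff e as bs \<longleftrightarrow> length as = length bs \<and> e * e = e \<and> (\<forall>x\<in>set as \<union> set bs. e * x = x \<and> x * e = x) \<and>
     (\<forall>i<length as. \<forall>j<length as. as ! i * as ! j + as ! j * as ! i = 0 \<and>
        bs ! i * bs ! j + bs ! j * bs ! i = 0 \<and> as ! i * bs ! j + bs ! j * as ! i = (if i = j then e else 0))"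

definition cliff_idem :: "'a::ring => 'a list => 'a list => 'a" where
  "cliff_idem e as bs = rprod e (as @ rev bs)"

lemma rprod_snoc:
  "e * e = e ==> e * b = b ==> b * e = b ==> rprod e (L @ [b]) = rprod e L * b"
  by (induction L) (auto simp: mult.assoc)

lemma rprod_anticommute:
  assumes "y * e = e * y" "\<And>x. x \<in> set L ==> y * x + x * y = 0"
  shows "y * rprod e L = (if even (length L) then rprod e L * y else - (rprod e L * y))"
  using assms(2)
proof (induction L)
  case (Cons x L)
  have 1: "y * x = - (x * y)" using Cons.prems[of x] by (simp add: add_eq_0_iff2)
  have "y * rprod e (x # L) = - (x * (y * rprod e L))" by (simp flip: mult.assoc add: 1)
  then show ?case using Cons by (simp add: mult.assoc)
qed (use assms in simp)

lemma rprod_unit: "e * e = e ==> (\<And>x. x \<in> set L ==> e * x = x \<and> x * e = x) ==> e * rprod e L = rprod e L \<and> rprod e L * e = rprod e L"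
  by (induction L) (simp_all add: mult.assoc, simp flip: mult.assoc)

lemma cliff_Cons:
  assumes "cliff e (a # as) (b # bs)"
  shows "cliff e as bs" "a * b + b * a = e" "a * a + a * a = 0" "b * b + b * b = 0"
    "\<And>x. x \<in> set as \<union> set bs ==> a * x + x * a = 0 \<and> b * x + x * b = 0"
    "e * a = a" "a * e = a" "e * b = b" "b * e = b"
proof -
  note * = assms[unfolded cliff_def]
  have "\<forall>i<length (a # as). \<forall>j<length (a # as). (a # as) ! i * (a # as) ! j + (a # as) ! j * (a # as) ! i = 0 \<and>
      (b # bs) ! i * (b # bs) ! j + (b # bs) ! j * (b # bs) ! i = 0 \<and>
      (a # as) ! i * (b # bs) ! j + (b # bs) ! j * (a # as) ! i = (if i = j then e else 0)"
    using * by blast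
  then have rel: "(a # as) ! i * (a # as) ! j + (a # as) ! j * (a # as) ! i = 0"
      "(b # bs) ! i * (b # bs) ! j + (b # bs) ! j * (b # bs) ! i = 0"
      "(a # as) ! i * (b # bs) ! j + (b # bs) ! j * (a # as) ! i = (if i = j then e else 0)"
    if "i < Suc (length as)" "j < Suc (length as)" for i j using that by (simp_all only: length_Cons)
  have len: "length as = length bs" using * by simp
  have "as ! i * as ! j + as ! j * as ! i = 0 \<and> bs ! i * bs ! j + bs ! j * bs ! i = 0 \<and>
      as ! i * bs ! j + bs ! j * as ! i = (if i = j then e else 0)" if "i < length as" "j < length as" for i j
    using rel(1)[of "Suc i" "Suc j"] rel(2)[of "Suc i" "Suc j"] rel(3)[of "Suc i" "Suc j"] that by simp
  then show "cliff e as bs" unfolding cliff_def using * by simp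
  show "a * b + b * a = e" "a * a + a * a = 0" "b * b + b * b = 0"
    using rel[of 0 0] by auto
  show "e * a = a" "a * e = a" "e * b = b" "b * e = b" using * by auto
  fix x assume "x \<in> set as \<union> set bs"
  then show "a * x + x * a = 0 \<and> b * x + x * b = 0"
  proof
    assume "x \<in> set as"
    then obtain i where "i < length as" "x = as ! i" by (metis in_set_conv_nth)
    then show ?thesis using rel(1)[of 0 "Suc i"] rel(3)[of "Suc i" 0] by (simp add: add.commute)
  next
    assume "x \<in> set bs"
    then obtain i where "i < length bs" "x = bs ! i" by (metis in_set_conv_nth)
    then show ?thesis using len rel(2)[of 0 "Suc i"] rel(3)[of 0 "Suc i"] by (simp add: add.commute)
  qed
qed

text \<open>Moving \<open>y\<close> past a generator costs a sign, and the product has an even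
  number of factors.\<close>

lemma cliff_idem_commute:
  assumes "cliff e as bs" "y * e = e * y" "\<And>x. x \<in> set as \<union> set bs ==> y * x + x * y = 0"
  shows "y * cliff_idem e as bs = cliff_idem e as bs * y"
  using rprod_anticommute[of y e "as @ rev bs"] assms by (auto simp: cliff_idem_def cliff_def)

lemma cliff_idem_Cons:
  assumes "cliff e (a # as) (b # bs)"
  shows "cliff_idem e (a # as) (b # bs) = a * cliff_idem e as bs * b"
  using rprod_snoc[of e b "as @ rev bs"] cliff_Cons[OF assms] assms
  by (simp add: cliff_idem_def mult.assoc cliff_def)

text \<open>Induction on the outermost pair of generators \<open>a\<close>, \<open>b\<close>: both
  commute with the idempotent \<open>?E\<close> of the inner pairs, so the whole idempotent is
  \<open>?E\<close> times \<open>a * b\<close> in either order. The first two clauses are the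
  absorption properties; the last two say that the idempotent itself satisfies their
  hypotheses.\<close>

lemma cliff_idem_props:
  fixes e :: "'a::ring"
  assumes two: "\<And>x::'a. x + x = 0 ==> x = 0" and "cliff e as bs"
  shows "(\<forall>x. x * e = x \<longrightarrow> (\<forall>b\<in>set bs. x * b = 0) \<longrightarrow> x * cliff_idem e as bs = x) \<and>
    (\<forall>x. e * x = x \<longrightarrow> (\<forall>a\<in>set as. a * x = 0) \<longrightarrow> cliff_idem e as bs * x = x) \<and>
    (\<forall>b\<in>set bs. cliff_idem e as bs * b = 0) \<and> (\<forall>a\<in>set as. a * cliff_idem e as bs = 0)"
  using assms(2)
proof (induction as arbitrary: bs)
  case Nil
  then show ?case by (auto simp: cliff_def cliff_idem_def)
next
  case (Cons a as)
  then obtain b bs' where bs: "bs = b # bs'" by (cases bs) (auto simp: cliff_def)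
  note c = cliff_Cons[OF Cons.prems[unfolded bs]]
  let ?E = "cliff_idem e as bs'"
  note IH = Cons.IH[OF c(1)]
  have E: "cliff_idem e (a # as) bs = a * ?E * b" unfolding bs by (rule cliff_idem_Cons[OF Cons.prems[unfolded bs]])
  have aE: "a * ?E = ?E * a" and bE: "b * ?E = ?E * b"
    by (rule cliff_idem_commute[OF c(1)]; use c in simp)+
  \<comment> \<open>In this form \<open>a * b\<close> visibly acts as the identity on everything
    that \<open>b\<close> kills from the right or that \<open>a\<close> kills from the left.\<close>
  have ab: "a * b = e - b * a" using c(2) by (simp add: algebra_simps)
  \<comment> \<open>The only use of \<open>two\<close>: the Clifford relations give twice the
    square.\<close>
  have aa: "a * a = 0" "b * b = 0" by (rule two[OF c(3)], rule two[OF c(4)])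
  have ee: "e * e = e" using Cons.prems by (simp add: cliff_def)
  have E1: "cliff_idem e (a # as) bs = ?E * (a * b)" "cliff_idem e (a # as) bs = (a * b) * ?E"
    unfolding E aE by (rule mult.assoc) (simp only: aE[symmetric] mult.assoc bE)
  have Ee: "e * ?E = ?E" "?E * e = ?E"
    using rprod_unit[of e "as @ rev bs'"] c(1) by (auto simp: cliff_def cliff_idem_def)
  show ?case unfolding bs
  proof (intro conjI allI impI ballI, unfold bs[symmetric])
    fix x assume x: "x * e = x" "\<forall>b\<in>set bs. x * b = 0"
    have "x * (a * b) = x" using x by (simp add: ab right_diff_distrib bs flip: mult.assoc)
    then show "x * cliff_idem e (a # as) bs = x" unfolding E1(2) using IH x bs by (simp flip: mult.assoc)
  next
    fix x assume x: "e * x = x" "\<forall>a\<in>set (a # as). a * x = 0"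
    have "a * b * x = x" using x by (simp add: ab left_diff_distrib mult.assoc)
    then show "cliff_idem e (a # as) bs * x = x" unfolding E1(1) using IH x by (simp add: mult.assoc)
  next
    fix y assume "y \<in> set bs"
    then consider "y = b" | "y \<in> set bs'" using bs by auto
    then show "cliff_idem e (a # as) bs * y = 0"
    proof cases
      case 1
      then show ?thesis unfolding E1(1) by (simp add: mult.assoc aa)
    next
      case 2
      have "b * y = - (y * b)" using c(5)[of y] 2 by (simp add: add_eq_0_iff2)
      then have "a * ?E * b * y = - (a * (?E * y) * b)" by (simp add: mult.assoc)
      then show ?thesis unfolding E using IH 2 by simp
    qed
  next
    fix y assume "y \<in> set (a # as)"
    then consider "y = a" | "y \<in> set as" by auto
    then show "y * cliff_idem e (a # as) bs = 0"
    proof cases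
      case 1
      then show ?thesis unfolding E1(2) by (simp add: aa flip: mult.assoc)
    next
      case 2
      have "y * a = - (a * y)" using c(5)[of y] 2 by (simp add: add_eq_0_iff2 add.commute)
      then have "y * (a * ?E * b) = - (a * (y * ?E) * b)" by (simp flip: mult.assoc)
      then show ?thesis unfolding E using IH 2 by simp
    qed
  qed
qed

lemma cliff_idem_unit:
  assumes "cliff e as bs"
  shows "e * cliff_idem e as bs = cliff_idem e as bs" "cliff_idem e as bs * e = cliff_idem e as bs"
  using rprod_unit[of e "as @ rev bs"] assms by (auto simp: cliff_def cliff_idem_def)

section \<open>Polynomials with separated variables\<close>

abbreviation "single \<equiv> Poly_Mapping.single"
abbreviation "lookup \<equiv> Poly_Mapping.lookup"
abbreviation "keys \<equiv> Poly_Mapping.keys"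

lemma pm_sum_singles: "p = (\<Sum>a\<in>keys p. single a (lookup p a))"
  by (rule poly_mapping_eqI) (auto simp: lookup_sum lookup_single when_def in_keys_iff)

lemma pm_induct [consumes 0, case_names zero single add]:
  assumes "P 0" "\<And>a k. a \<in> keys p ==> P (single a k)"
    "\<And>f g. P f ==> P g ==> P (f + g)"
  shows "P (p :: 'a \<Rightarrow>\<^sub>0 'b::comm_monoid_add)"
proof -
  have "P (\<Sum>a\<in>S. single a (lookup p a))" if "finite S" "S \<subseteq> keys p" for S
    using that by (induction S) (auto intro: assms)
  from this[of "keys p"] show ?thesis by (simp flip: pm_sum_singles)
qed

lemma poly_in_iff: "p \<in> poly_in A \<longleftrightarrow> (\<forall>a. lookup p a \<noteq> 0 \<longrightarrow> keys a \<subseteq> A)"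
  by (auto simp: poly_in_def in_keys_iff)

lemma poly_in_0 [simp, intro]: "0 \<in> poly_in A" by (simp add: poly_in_iff)
lemma poly_in_single: "keys a \<subseteq> A ==> single a k \<in> poly_in A"
  by (auto simp: poly_in_iff lookup_single when_def)
lemma poly_in_1 [simp, intro]: "1 \<in> poly_in A"
  using poly_in_single[of 0 A 1] by simp
lemma poly_in_pconst [simp, intro]: "pconst c \<in> poly_in A"
  by (simp add: pconst_def poly_in_single)
lemma poly_in_add [intro]: "p \<in> poly_in A ==> q \<in> poly_in A ==> p + q \<in> poly_in A"
  unfolding poly_in_iff lookup_add by (metis add.right_neutral)
lemma poly_in_uminus [intro]: "p \<in> poly_in A ==> - p \<in> poly_in A"
  by (simp add: poly_in_iff)
lemma poly_in_diff [intro]: "p \<in> poly_in A ==> q \<in> poly_in A ==> p - q \<in> poly_in A"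
  using poly_in_add[of p A "- q"] by auto
lemma poly_in_sum [intro]: "(\<And>x. x \<in> S ==> g x \<in> poly_in A) ==> sum g S \<in> poly_in A"
  by (induction S rule: infinite_finite_induct) auto
lemma poly_in_mult [intro]:
  assumes "p \<in> poly_in A" "q \<in> poly_in A" shows "p * q \<in> poly_in A"
proof -
  have "keys c \<subseteq> A" if "c \<in> keys (p * q)" for c
  proof -
    obtain a b where "a \<in> keys p" "b \<in> keys q" "c = a + b"
      using keys_mult[of p q] \<open>c \<in> _\<close> by auto
    then show ?thesis using keys_add[of a b] assms by (auto simp: poly_in_def)
  qed
  then show ?thesis by (auto simp: poly_in_def)
qed
lemma poly_in_mono: "p \<in> poly_in A ==> A \<subseteq> B ==> p \<in> poly_in B" by (auto simp: poly_in_def)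

lemma pconst_add: "pconst (a + b) = pconst a + pconst b" by (simp add: pconst_def single_add)
lemma pconst_mult: "pconst (a * b) = pconst a * pconst b" by (simp add: pconst_def mult_single)
lemma pconst_1 [simp]: "pconst 1 = 1" by (simp add: pconst_def)
lemma pconst_0 [simp]: "pconst 0 = 0" by (simp add: pconst_def)

section \<open>Inner and outer parts of a monomial\<close>

definition restr :: "'v set => ('v \<Rightarrow>\<^sub>0 nat) => 'v \<Rightarrow>\<^sub>0 nat" where
  "restr A a = (\<Sum>v\<in>keys a \<inter> A. single v (lookup a v))"

lemma lookup_restr: "lookup (restr A a) v = (if v \<in> A then lookup a v else 0)"
  by (auto simp: restr_def lookup_sum lookup_single when_def in_keys_iff)

lemma keys_restr: "keys (restr A a) = keys a \<inter> A"
  by (auto simp: in_keys_iff lookup_restr split: if_splits)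

lemma restr_sum: "a = restr (- A) a + restr A a"
  by (rule poly_mapping_eqI) (simp add: lookup_add lookup_restr)

lemma restr_add: "restr A (a + b) = restr A a + restr A b"
  by (rule poly_mapping_eqI) (simp add: lookup_add lookup_restr)

lemma restr_id: "keys a \<subseteq> A ==> restr A a = a"
  by (rule poly_mapping_eqI) (auto simp: lookup_restr in_keys_iff)

lemma restr_0: "keys a \<inter> A = {} ==> restr A a = 0"
  by (rule poly_mapping_eqI) (auto simp: lookup_restr in_keys_iff)

lemma restr_out: "keys a \<inter> A = {} ==> restr (- A) a = a"
  by (rule restr_id) auto

text \<open>All rules for \<open>outer_coeff\<close> are derived from this pointwise form, which no
  longer mentions the support of \<open>p\<close> and is therefore visibly additive.\<close>

lemma lookup_outer_coeff: "lookup (outer_coeff A b p) c =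
   (if keys c \<subseteq> A then lookup p (b + c) else 0)"
proof -
  let ?S = "{a \<in> keys p. \<exists>c. keys c \<subseteq> A \<and> a = b + c}"
  have fin: "finite ?S" by simp
  have "lookup (outer_coeff A b p) c = (\<Sum>a\<in>?S. lookup p a when a - b = c)"
    by (simp add: outer_coeff_def lookup_sum lookup_single)
  also have "\<dots> = (\<Sum>a\<in>?S. if a = b + c then lookup p (b + c) else 0)"
    by (rule sum.cong) (auto simp: when_def)
  also have "\<dots> = (if b + c \<in> ?S then lookup p (b + c) else 0)"
    using fin by (simp add: sum.delta)
  finally show ?thesis by (auto simp: in_keys_iff)
qed

lemma outer_coeff_add: "outer_coeff A b (p + q) = outer_coeff A b p + outer_coeff A b q"
  by (rule poly_mapping_eqI) (simp add: lookup_outer_coeff lookup_add)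
lemma outer_coeff_diff: "outer_coeff A b (p - q) = outer_coeff A b p - outer_coeff A b q"
  by (rule poly_mapping_eqI) (simp add: lookup_outer_coeff lookup_minus)
lemma outer_coeff_0 [simp]: "outer_coeff A b 0 = 0"
  by (rule poly_mapping_eqI) (simp add: lookup_outer_coeff)
lemma outer_coeff_uminus: "outer_coeff A b (- p) = - outer_coeff A b p"
  using outer_coeff_diff[of A b 0 p] by simp
lemma outer_coeff_sum: "outer_coeff A b (sum g S) = (\<Sum>x\<in>S. outer_coeff A b (g x))"
  by (induction S rule: infinite_finite_induct) (auto simp: outer_coeff_add)

lemma outer_coeff_in [simp, intro]: "outer_coeff A b p \<in> poly_in A"
  by (auto simp: poly_in_iff lookup_outer_coeff split: if_splits)

lemma outer_coeff_single:
  assumes "keys b \<inter> A = {}"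
  shows "outer_coeff A b (single a k) = (if restr (- A) a = b then single (restr A a) k else 0)"
proof (rule poly_mapping_eqI)
  fix c
  have "a = b + c \<longleftrightarrow> restr (- A) a = b \<and> restr A a = c" if "keys c \<subseteq> A"
  proof
    assume "a = b + c"
    moreover have "restr (- A) c = 0" by (rule restr_0) (use that in auto)
    ultimately show "restr (- A) a = b \<and> restr A a = c"
      using assms that by (simp add: restr_add restr_0 restr_out restr_id)
  qed (use restr_sum[of a A] in auto)
  moreover have "keys (restr A a) \<subseteq> A" by (simp add: keys_restr)
  ultimately show "lookup (outer_coeff A b (single a k)) c =
      lookup (if restr (- A) a = b then single (restr A a) k else 0) c"
    by (auto simp: lookup_outer_coeff lookup_single when_def)
qed

lemma outer_coeff_mult_in:
  assumes b: "keys b \<inter> A = {}" and "p \<in> poly_in A"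
  shows "outer_coeff A b (p * f) = p * outer_coeff A b f"
proof (induction p rule: pm_induct)
  case (single a k)
  then have a: "keys a \<subseteq> A" using assms by (auto simp: poly_in_def)
  have "restr (- A) a = 0" by (rule restr_0) (use a in auto)
  then show ?case
    by (induction f rule: pm_induct)
      (simp_all add: mult_single outer_coeff_single[OF b] restr_add restr_id[OF a] distrib_left outer_coeff_add)
qed (simp_all add: distrib_right outer_coeff_add)

lemma outer_coeff_mult_out:
  assumes b: "keys b \<inter> A = {}" and c: "keys c \<inter> A = {}"
  shows "outer_coeff A (c + b) (single c k * f) = pconst k * outer_coeff A b f"
proof -
  have cb: "keys (c + b) \<inter> A = {}" using keys_add[of c b] b c by auto
  show ?thesis
    by (induction f rule: pm_induct)
      (simp_all add: mult_single outer_coeff_single[OF b] outer_coeff_single[OF cb] restr_add restr_0[OF c] restr_out[OF c]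
        distrib_left outer_coeff_add pconst_def)
qed

text \<open>Together with \<open>outer_coeff_mult_out\<close> this describes multiplication by an
  outer monomial as a shift of the coefficients; here the requested coefficient is not reached by
  the shift.\<close>

lemma outer_coeff_mult_out':
  assumes b: "keys b \<inter> A = {}" and c: "keys c \<inter> A = {}" and "\<And>d. keys d \<inter> A = {} ==> b \<noteq> c + d"
  shows "outer_coeff A b (single c k * f) = 0"
proof (induction f rule: pm_induct)
  case (single a l)
  have "keys (restr (- A) a) \<inter> A = {}" by (auto simp: keys_restr)
  then show ?case using assms(3)[of "restr (- A) a"] by (auto simp: mult_single outer_coeff_single[OF b] restr_add restr_out[OF c])
qed (simp_all add: distrib_left outer_coeff_add)

lemma outer_coeff_eqI:
  assumes "\<And>b. keys b \<inter> A = {} ==> outer_coeff A b f = outer_coeff A b g"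
  shows "f = g"
proof (rule poly_mapping_eqI)
  fix a
  have "keys (restr (- A) a) \<inter> A = {}" by (auto simp: keys_restr)
  from assms[OF this] have "lookup (outer_coeff A (restr (- A) a) f) (restr A a) = lookup (outer_coeff A (restr (- A) a) g) (restr A a)" by simp
  then show "lookup f a = lookup g a"
    by (simp add: lookup_outer_coeff keys_restr flip: restr_sum)
qed

lemma finite_outer_monos [simp]: "finite (outer_monos A f)"
proof (rule finite_subset)
  show "outer_monos A f \<subseteq> restr (- A) ` keys f"
  proof
    fix b assume "b \<in> outer_monos A f"
    then have b: "keys b \<inter> A = {}" "outer_coeff A b f \<noteq> 0" by (auto simp: outer_monos_def)
    then obtain c where "lookup (outer_coeff A b f) c \<noteq> 0" by (metis poly_mapping_eqI lookup_zero)
    then have c: "keys c \<subseteq> A" "lookup f (b + c) \<noteq> 0" by (auto simp: lookup_outer_coeff split: if_splits)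
    have "restr (- A) c = 0" by (rule restr_0) (use c in auto)
    then have "restr (- A) (b + c) = b" using b by (simp add: restr_add restr_out)
    then show "b \<in> restr (- A) ` keys f" using c(2) by (metis image_eqI in_keys_iff)
  qed
qed simp

lemma outer_coeff_mono_mult:
  assumes b: "keys b \<inter> A = {}" and b': "keys b' \<inter> A = {}" and "p \<in> poly_in A"
  shows "outer_coeff A b (single b' 1 * p) = (if b' = b then p else 0)"
  using outer_coeff_mult_in[OF b assms(3), of "single b' 1"]
  by (simp add: mult.commute outer_coeff_single[OF b] restr_0[OF b'] restr_0[OF b] restr_out[OF b'])

text \<open>Coefficientwise application of a map on \<open>k[A]\<close> that is only meaningful up to an ideal:
  vanishing coefficients are left alone.\<close>

lemma outer_coeff_ext:
  assumes b: "keys b \<inter> A = {}" and "\<And>b. \<phi> b \<in> poly_in A"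
  shows "outer_coeff A b (\<Sum>b\<in>outer_monos A f. single b 1 * \<phi> b) = (if b \<in> outer_monos A f then \<phi> b else 0)"
proof -
  have "outer_coeff A b (\<Sum>b\<in>outer_monos A f. single b 1 * \<phi> b) = (\<Sum>b'\<in>outer_monos A f. if b' = b then \<phi> b' else 0)"
    unfolding outer_coeff_sum using assms
    by (intro sum.cong refl outer_coeff_mono_mult) (auto simp: outer_monos_def)
  then show ?thesis by simp
qed

lemma outer_decomp:
  fixes f :: "('v, 'k::comm_ring_1) mpol"
  shows "f = (\<Sum>b\<in>outer_monos A f. single b 1 * outer_coeff A b f)"
proof (rule outer_coeff_eqI[of A])
  fix b :: "'v \<Rightarrow>\<^sub>0 nat" assume "keys b \<inter> A = {}"
  then show "outer_coeff A b f = outer_coeff A b (\<Sum>b\<in>outer_monos A f. single b 1 * outer_coeff A b f)"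
    by (subst outer_coeff_ext) (auto simp: outer_monos_def)
qed

text \<open>Taking the coefficient of the outer monomial 1 means substituting 0 for all variables
  outside \<open>A\<close>. It is multiplicative because exponents are natural numbers: a product of
  two monomials is free of outer variables only if both are. This is the retraction that
  \<open>coeff_ring\<close> asks for.\<close>

lemma outer_coeff_retr_mult: "outer_coeff A 0 (f * g) = outer_coeff A 0 f * outer_coeff A 0 g"
proof (induction f rule: pm_induct)
  case (single a k)
  show ?case
  proof (induction g rule: pm_induct)
    case (single b l)
    have "restr (- A) a + restr (- A) b = 0 \<longleftrightarrow> restr (- A) a = 0 \<and> restr (- A) b = 0"
      by (auto simp: poly_mapping_eq_iff fun_eq_iff lookup_add)
    then show ?case by (auto simp: mult_single outer_coeff_single restr_add)
  qed (simp_all add: distrib_left outer_coeff_add)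
qed (simp_all add: distrib_right outer_coeff_add)

lemma outer_coeff_id: "f \<in> poly_in A ==> outer_coeff A 0 f = f"
  by (rule poly_mapping_eqI) (auto simp: lookup_outer_coeff poly_in_iff)

lemma outer_monos_vars:
  assumes "f \<in> poly_in B" "b \<in> outer_monos A f"
  shows "keys b \<subseteq> B - A"
proof -
  from assms obtain c where "lookup (outer_coeff A b f) c \<noteq> 0"
    by (metis (mono_tags, lifting) mem_Collect_eq outer_monos_def poly_mapping_eqI lookup_zero)
  then have "lookup f (b + c) \<noteq> 0" by (auto simp: lookup_outer_coeff split: if_splits)
  then have "keys (b + c) \<subseteq> B" using assms by (auto simp: poly_in_iff)
  moreover have "keys b \<subseteq> keys (b + c)" by (auto simp: in_keys_iff lookup_add)
  ultimately show ?thesis using assms by (auto simp: outer_monos_def)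
qed

interpretation pr: coeff_ring "poly_in S" "outer_coeff S 0" for S :: "'v set"
  by unfold_locales (auto simp: outer_coeff_id outer_coeff_add outer_coeff_retr_mult)

section \<open>Powers of the ideal\<close>

lemma finite_exps [simp]: "finite (exps m n)"
proof (rule finite_subset)
  show "exps m n \<subseteq> {u. set u \<subseteq> {..n} \<and> length u = m}" by (auto simp: exps_def member_le_sum_list)
  show "finite {u. set u \<subseteq> {..n} \<and> length u = m}" by (rule finite_lists_length_eq) simp
qed

lemma sum_list_inc: "j < length u ==> sum_list (u[j := Suc (u ! j)]) = Suc (sum_list u)"
  by (induction u arbitrary: j) (auto split: nat.splits)

lemma sum_list_dec: "j < length u ==> u ! j > 0 ==> Suc (sum_list (u[j := u ! j - 1])) = sum_list u"
  using sum_list_inc[of j "u[j := u ! j - 1]"] by simp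

lemma tmon_update:
  "j < length ts ==> length u = length ts ==> tmon ts (u[j := Suc (u ! j)]) = ts ! j * tmon ts u"
  unfolding tmon_def by (subst (1 2) prod.remove[of _ j]) (auto simp: mult.assoc intro!: prod.cong)

lemma tmon_dec:
  assumes "j < length ts" "length u = length ts" "u ! j > 0"
  shows "tmon ts u = ts ! j * tmon ts (u[j := u ! j - 1])"
  using tmon_update[of j ts "u[j := u ! j - 1]"] assms by simp

locale regular_ideal =
  fixes P :: "'r::comm_ring_1 set" and ts :: "'r list"
  assumes P_0 [simp, intro]: "0 \<in> P" and P_1 [simp, intro]: "1 \<in> P"
    and P_add [intro]: "x \<in> P ==> y \<in> P ==> x + y \<in> P"
    and P_minus [intro]: "x \<in> P ==> - x \<in> P"
    and P_mult [intro]: "x \<in> P ==> y \<in> P ==> x * y \<in> P"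
    and ts_P: "set ts \<subseteq> P"
begin

abbreviation "m \<equiv> length ts"
abbreviation "I \<equiv> ideal_pow P ts"

lemma P_diff: "x \<in> P ==> y \<in> P ==> x - y \<in> P" using P_add[of x "- y"] by auto
lemma P_sum: "(\<And>x. x \<in> A ==> g x \<in> P) ==> sum g A \<in> P"
  by (induction A rule: infinite_finite_induct) auto
lemma P_power: "x \<in> P ==> x ^ n \<in> P" by (induction n) auto
lemma P_of_nat [intro]: "of_nat n \<in> P" by (induction n) auto
lemma P_prod: "(\<And>x. x \<in> A ==> g x \<in> P) ==> prod g A \<in> P"
  by (induction A rule: infinite_finite_induct) auto
lemma t_P [intro]: "j < m ==> ts ! j \<in> P" using ts_P by auto
lemma tmon_P [intro]: "tmon ts u \<in> P" unfolding tmon_def by (intro P_prod P_power) auto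

lemma I_sub: "x \<in> I n ==> x \<in> P"
  by (auto simp: ideal_pow_def intro!: P_sum)

lemma I_add [intro]: assumes "x \<in> I n" "y \<in> I n" shows "x + y \<in> I n"
proof -
  obtain c d where "\<forall>u\<in>exps m n. c u \<in> P" "x = (\<Sum>u\<in>exps m n. c u * tmon ts u)"
    "\<forall>u\<in>exps m n. d u \<in> P" "y = (\<Sum>u\<in>exps m n. d u * tmon ts u)"
    using assms by (auto simp: ideal_pow_def)
  then show ?thesis unfolding ideal_pow_def
    by (auto intro!: exI[of _ "\<lambda>u. c u + d u"] simp: distrib_right sum.distrib)
qed

lemma I_smult [intro]: assumes "p \<in> P" "x \<in> I n" shows "p * x \<in> I n"
proof -
  obtain c where "\<forall>u\<in>exps m n. c u \<in> P" "x = (\<Sum>u\<in>exps m n. c u * tmon ts u)"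
    using assms by (auto simp: ideal_pow_def)
  then show ?thesis unfolding ideal_pow_def using assms
    by (auto intro!: exI[of _ "\<lambda>u. p * c u"] simp: sum_distrib_left mult.assoc)
qed

lemma I_0 [simp, intro]: "0 \<in> I n"
  unfolding ideal_pow_def by (auto intro!: exI[of _ "\<lambda>_. 0"])

lemma I_uminus [intro]: "x \<in> I n ==> - x \<in> I n"
  using I_smult[of "- 1" x n] by auto

lemma I_diff [intro]: "x \<in> I n ==> y \<in> I n ==> x - y \<in> I n"
  using I_add[of x n "- y"] by auto

lemma I_sum: "(\<And>x. x \<in> A ==> g x \<in> I n) ==> sum g A \<in> I n"
  by (induction A rule: infinite_finite_induct) auto

lemma tmon_I: assumes "length u = m" "p \<in> P" shows "p * tmon ts u \<in> I (sum_list u)"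
proof -
  let ?E = "exps m (sum_list u)"
  have u: "u \<in> ?E" using assms by (simp add: exps_def)
  have "(\<Sum>v\<in>?E. (if v = u then p else 0) * tmon ts v) = (\<Sum>v\<in>?E. if v = u then p * tmon ts u else 0)"
    by (rule sum.cong) auto
  also have "\<dots> = p * tmon ts u" using u by (simp add: sum.delta)
  finally show ?thesis unfolding ideal_pow_def using assms
    by (auto intro!: exI[of _ "\<lambda>v. if v = u then p else 0"])
qed

lemma I_Zero: "x \<in> P ==> x \<in> I 0"
  using tmon_I[of "replicate m 0" x] by (simp add: tmon_def sum_list_replicate)

lemma I_t: assumes "j < m" "x \<in> I n" shows "ts ! j * x \<in> I (Suc n)"
proof -
  obtain c where c: "\<forall>u\<in>exps m n. c u \<in> P" "x = (\<Sum>u\<in>exps m n. c u * tmon ts u)"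
    using assms by (auto simp: ideal_pow_def)
  have "ts ! j * x = (\<Sum>u\<in>exps m n. c u * tmon ts (u[j := Suc (u ! j)]))"
    unfolding c(2) sum_distrib_left using assms(1) by (intro sum.cong) (auto simp: exps_def tmon_update ac_simps)
  also have "\<dots> \<in> I (Suc n)"
  proof (rule I_sum)
    fix u assume u: "u \<in> exps m n"
    then show "c u * tmon ts (u[j := Suc (u ! j)]) \<in> I (Suc n)"
      using tmon_I[of "u[j := Suc (u ! j)]" "c u"] c(1) assms(1) by (auto simp: exps_def sum_list_inc)
  qed
  finally show ?thesis .
qed

text \<open>A monomial of degree \<open>Suc n\<close> has some positive exponent, so one
  \<open>t_j\<close> can be pulled out and the power \<open>Suc n\<close> is generated by the
  products of a \<open>t_j\<close> with elements of the power \<open>n\<close>. Later arguments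
  thereby never touch coefficient families.\<close>

lemma I_Suc_induct [consumes 1, case_names zero add t]:
  assumes "x \<in> I (Suc n)" and "Q 0" "\<And>x y. Q x ==> Q y ==> Q (x + y)"
    "\<And>j y. j < m ==> y \<in> I n ==> Q (ts ! j * y)"
  shows "Q x"
proof -
  obtain c where c: "\<forall>u\<in>exps m (Suc n). c u \<in> P" "x = (\<Sum>u\<in>exps m (Suc n). c u * tmon ts u)"
    using assms by (auto simp: ideal_pow_def)
  have *: "Q (c u * tmon ts u)" if u: "u \<in> exps m (Suc n)" for u
  proof -
    have "sum_list u \<noteq> 0" using u by (auto simp: exps_def)
    then obtain j where j: "j < length u" "u ! j > 0"
      by (metis gr0I in_set_conv_nth sum_list_eq_0_iff)
    then have "c u * tmon ts u = ts ! j * (c u * tmon ts (u[j := u ! j - 1]))"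
      using u tmon_dec[of j ts u] by (simp add: exps_def ac_simps)
    moreover have "c u * tmon ts (u[j := u ! j - 1]) \<in> I n"
      using tmon_I[of "u[j := u ! j - 1]" "c u"] u j c(1) sum_list_dec[OF j] by (auto simp: exps_def)
    ultimately show ?thesis using assms(4)[of j] j u by (auto simp: exps_def)
  qed
  have "Q (\<Sum>u\<in>S. c u * tmon ts u)" if "finite S" "S \<subseteq> exps m (Suc n)" for S
    using that by (induction S rule: finite_induct) (auto intro: assms *)
  then show ?thesis unfolding c(2) by simp
qed

lemma I_Suc_sub: "x \<in> I (Suc n) ==> x \<in> I n"
  by (induction x rule: I_Suc_induct) auto

lemma I_mono: "x \<in> I n ==> k \<le> n ==> x \<in> I k"
  by (induction n) (auto simp: le_Suc_eq dest: I_Suc_sub)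

lemma I_mult: "x \<in> I a ==> y \<in> I b ==> x * y \<in> I (a + b)"
proof (induction a arbitrary: x)
  case 0
  then show ?case using I_sub by auto
next
  case (Suc a)
  from Suc.prems(1) show ?case
    by (induction rule: I_Suc_induct) (use Suc in \<open>auto simp: distrib_right mult.assoc intro!: I_t\<close>)
qed

lemma I_diff_trans: "x - y \<in> I n ==> y - z \<in> I n ==> x - z \<in> I n"
  using I_add[of "x - y" n "y - z"] by simp

lemma I_diff_sym: "x - y \<in> I n ==> y - x \<in> I n"
  using I_uminus[of "x - y" n] by simp

lemma I_diff_mult: "p \<in> P ==> x - y \<in> I n ==> p * x - p * y \<in> I n"
  using I_smult[of p "x - y" n] by (simp add: right_diff_distrib)

lemma I_diff_sum: "(\<And>u. u \<in> S ==> g u - h u \<in> I n) ==> sum g S - sum h S \<in> I n"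
  using I_sum[of S "\<lambda>u. g u - h u" n] by (simp add: sum_subtractf)

text \<open>Multi-indices of degree below \<open>n\<close>: the terms of a power series in
  \<open>t\<close> that matter modulo the \<open>n\<close>-th power of the ideal.\<close>

definition U :: "nat => nat list set" where "U n = {u. length u = m \<and> sum_list u < n}"

lemma U_eq: "U n = (\<Union>l<n. exps m l)" by (auto simp: U_def exps_def)
lemma finite_U [simp]: "finite (U n)" by (simp add: U_eq)
lemma sum_U: "(\<Sum>l<n. \<Sum>u\<in>exps m l. g u) = sum g (U n)"
proof -
  have "exps m i \<inter> exps m j = {}" if "i \<noteq> j" for i j using that by (auto simp: exps_def)
  then show ?thesis unfolding U_eq by (subst sum.UNION_disjoint) auto
qed

lemma U_shift: assumes "j < m"
  shows "{u \<in> U (Suc n). u ! j > 0} = (\<lambda>u. u[j := Suc (u ! j)]) ` U n" "inj_on (\<lambda>u. u[j := Suc (u ! j)]) (U n)"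
proof -
  show "{u \<in> U (Suc n). u ! j > 0} = (\<lambda>u. u[j := Suc (u ! j)]) ` U n"
  proof (intro equalityI subsetI)
    fix u assume u: "u \<in> {u \<in> U (Suc n). u ! j > 0}"
    then have "u = (u[j := u ! j - 1])[j := Suc (u[j := u ! j - 1] ! j)]" using assms by (auto simp: U_def)
    moreover have "u[j := u ! j - 1] \<in> U n" using u sum_list_dec[of j u] assms by (auto simp: U_def)
    ultimately show "u \<in> (\<lambda>u. u[j := Suc (u ! j)]) ` U n" by blast
  qed (use assms in \<open>auto simp: U_def sum_list_inc\<close>)
  show "inj_on (\<lambda>u. u[j := Suc (u ! j)]) (U n)"
  proof (rule inj_onI)
    fix u v assume *: "u \<in> U n" "v \<in> U n" and eq: "u[j := Suc (u ! j)] = v[j := Suc (v ! j)]"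
    have "u ! i = v ! i" if "i < m" for i
      using arg_cong[OF eq, of "\<lambda>w. w ! i"] * that by (cases "i = j") (auto simp: U_def)
    then show "u = v" using * by (auto simp: U_def intro: nth_equalityI)
  qed
qed

text \<open>The indices with positive \<open>j\<close>-th exponent are the shifts of the indices of
  lower degree. This splitting computes the expansion of \<open>ts ! j * h\<close> from that of
  \<open>h\<close>.\<close>

lemma sum_U_shift:
  assumes "j < m"
  shows "sum g (U (Suc n)) = (\<Sum>u\<in>U n. g (u[j := Suc (u ! j)])) + sum g {u \<in> U (Suc n). u ! j = 0}"
proof -
  have "sum g (U (Suc n)) = sum g ({u \<in> U (Suc n). u ! j > 0} \<union> {u \<in> U (Suc n). u ! j = 0})"
    by (rule sum.cong) auto
  also have "\<dots> = sum g {u \<in> U (Suc n). u ! j > 0} + sum g {u \<in> U (Suc n). u ! j = 0}"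
    by (rule sum.union_disjoint) auto
  finally have "sum g (U (Suc n)) = sum g {u \<in> U (Suc n). u ! j > 0} + sum g {u \<in> U (Suc n). u ! j = 0}" .
  then show ?thesis unfolding U_shift(1)[OF assms] using sum.reindex[OF U_shift(2)[OF assms], of g] by simp
qed

end

lemma regular_ideal_partials:
  assumes "V \<in> poly_in (set ys)"
  shows "regular_ideal (poly_in (set ys)) (partials ys V)"
proof
  have "pdiff v V \<in> poly_in (set ys)" for v
    unfolding pdiff_def
  proof (intro poly_in_sum poly_in_single)
    fix a assume "a \<in> keys V"
    then have "keys a \<subseteq> set ys" using assms by (auto simp: poly_in_def)
    moreover have "keys (a - single v 1) \<subseteq> keys a"
      by (auto simp: in_keys_iff lookup_minus)
    ultimately show "keys (a - single v 1) \<subseteq> set ys" by blast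
  qed
  then show "set (partials ys V) \<subseteq> poly_in (set ys)" by (auto simp: partials_def)
qed (rule poly_in_0 poly_in_1 poly_in_add poly_in_uminus poly_in_mult; assumption?)+

section \<open>Expansions along the ideal\<close>

text \<open>The value \<open>\<sigma> r\<close> is a sequence that represents an element of the
  completion, so its \<open>n\<close>-th member carries information only modulo \<open>I n\<close>;
  hence the linearity of the section in this form. \<open>K\<close> stands for the
  constants.\<close>

locale regular_section = regular_ideal +
  fixes K :: "'a set" and \<sigma> :: "'a => nat => 'a"
  assumes qr: "quasi_regular P ts" and K_P: "K \<subseteq> P"
    and s_P [intro]: "r \<in> P ==> \<sigma> r n \<in> P"
    and s_add: "r \<in> P ==> r' \<in> P ==> \<sigma> (r + r') n - (\<sigma> r n + \<sigma> r' n) \<in> I n"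
    and s_K: "c \<in> K ==> r \<in> P ==> \<sigma> (c * r) n - c * \<sigma> r n \<in> I n"
    and s_I: "r \<in> I 1 ==> \<sigma> r n \<in> I n"
    and s_1: "r \<in> P ==> \<sigma> r 1 - r \<in> I 1"
    and s_Suc: "r \<in> P ==> \<sigma> r (Suc n) - \<sigma> r n \<in> I n"
begin

lemma s_diff_1: assumes "r \<in> P" "n \<ge> 1" shows "\<sigma> r n - r \<in> I 1"
  using assms(2)
proof (induction n rule: nat_induct_at_least)
  case (Suc n)
  then have "\<sigma> r (Suc n) - \<sigma> r n \<in> I 1" using s_Suc[OF assms(1)] I_mono by blast
  with Suc show ?case using I_diff_trans by blast
qed (use s_1 assms in auto)

lemma s_cong: assumes "r \<in> P" "r' \<in> P" "r - r' \<in> I 1" shows "\<sigma> r n - \<sigma> r' n \<in> I n"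
proof -
  have "\<sigma> ((r - r') + r') n - (\<sigma> (r - r') n + \<sigma> r' n) \<in> I n"
    using assms by (intro s_add P_diff) auto
  from I_add[OF this s_I[OF assms(3), of n]] show ?thesis by (simp add: algebra_simps)
qed

section \<open>Uniqueness and existence of expansions\<close>

definition fam :: "(nat list => 'a) => bool" where "fam a \<longleftrightarrow> (\<forall>u. length u = m \<longrightarrow> a u \<in> P)"

definition S :: "nat => (nat list => 'a) => 'a" where "S n a = (\<Sum>u\<in>U n. \<sigma> (a u) n * tmon ts u)"

definition is_exp :: "'a => (nat list => 'a) => bool" where
  "is_exp f a \<longleftrightarrow> fam a \<and> (\<forall>n. f - S n a \<in> I n)"

lemma famD: "fam a ==> u \<in> U n ==> a u \<in> P" by (simp add: fam_def U_def)

lemma tmon_I': "length u = m ==> p \<in> I k ==> p * tmon ts u \<in> I (k + sum_list u)"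
  using I_mult[of p k "tmon ts u" "sum_list u"] tmon_I[of u 1] by auto

lemma S_P: "fam a ==> S n a \<in> P"
  unfolding S_def by (intro P_sum P_mult s_P tmon_P) (rule famD)

lemma U_Suc: "U (Suc n) = U n \<union> exps m n" "U n \<inter> exps m n = {}"
  by (auto simp: U_def exps_def)

lemma S_Suc:
  assumes "fam a"
  shows "S (Suc n) a - (S n a + (\<Sum>u\<in>exps m n. \<sigma> (a u) (Suc n) * tmon ts u)) \<in> I n"
proof -
  have "(\<Sum>u\<in>U n. \<sigma> (a u) (Suc n) * tmon ts u) - (\<Sum>u\<in>U n. \<sigma> (a u) n * tmon ts u) \<in> I n"
    by (rule I_diff_sum) (use s_Suc[OF famD[OF assms]] in \<open>auto simp: mult.commute[of _ "tmon ts _"] intro!: I_diff_mult\<close>)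
  then show ?thesis unfolding S_def U_Suc(1) using U_Suc(2) by (simp add: sum.union_disjoint)
qed

text \<open>Induction on the degree \<open>l\<close>. If the coefficients of degree below
  \<open>l\<close> lie in the ideal, their terms lie in \<open>I n\<close> by \<open>s_I\<close>;
  the terms of degree above \<open>l\<close> lie in \<open>I (Suc l)\<close> anyway. Hence the
  homogeneous part of degree \<open>l\<close> lies in \<open>I (Suc l)\<close>, and quasi-regularity
  puts its coefficients into the ideal.\<close>

lemma S_unique_aux:
  assumes "fam a" "S n a \<in> I n" "l \<le> n" "u \<in> U l"
  shows "a u \<in> I 1"
  using assms(3,4)
proof (induction l arbitrary: u)
  case (Suc l)
  have IH: "a v \<in> I 1" if "v \<in> U l" for v using Suc that by auto
  let ?g = "\<lambda>v. \<sigma> (a v) n * tmon ts v"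
  have Un: "U n = U l \<union> (exps m l \<union> (U n - U (Suc l)))" using Suc.prems(1)
    by (auto simp: U_def exps_def)
  have "S n a = sum ?g (U l) + sum ?g (exps m l) + sum ?g (U n - U (Suc l))"
  proof -
    have d: "U l \<inter> (exps m l \<union> (U n - U (Suc l))) = {}" "exps m l \<inter> (U n - U (Suc l)) = {}"
      by (auto simp: U_def exps_def)
    show ?thesis unfolding S_def by (subst Un) (simp add: sum.union_disjoint d add.assoc)
  qed
  then have "sum ?g (exps m l) = S n a - sum ?g (U l) - sum ?g (U n - U (Suc l))" by simp
  also have "\<dots> \<in> I (Suc l)"
  proof (intro I_diff)
    show "S n a \<in> I (Suc l)" using assms(2) Suc.prems(1) I_mono by blast
    show "sum ?g (U l) \<in> I (Suc l)"
    proof (rule I_sum)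
      fix v assume "v \<in> U l"
      then have "\<sigma> (a v) n \<in> I n" by (intro s_I IH)
      then have "tmon ts v * \<sigma> (a v) n \<in> I n" by auto
      then show "?g v \<in> I (Suc l)" using I_mono Suc.prems(1) by (simp add: mult.commute)
    qed
    show "sum ?g (U n - U (Suc l)) \<in> I (Suc l)"
    proof (rule I_sum)
      fix v assume v: "v \<in> U n - U (Suc l)"
      then have "?g v \<in> I (sum_list v)" using famD[OF assms(1)] by (intro tmon_I) (auto simp: U_def)
      then show "?g v \<in> I (Suc l)" using v I_mono by (auto simp: U_def)
    qed
  qed
  finally have *: "(\<Sum>v\<in>exps m l. \<sigma> (a v) n * tmon ts v) \<in> I (Suc l)" .
  have aP: "a v \<in> P" if "v \<in> exps m l" for v using assms(1) that by (simp add: fam_def exps_def)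
  show ?case
  proof (cases "u \<in> U l")
    case False
    then have u: "u \<in> exps m l" using Suc.prems(2) by (auto simp: U_def exps_def)
    have "\<forall>v\<in>exps m l. \<sigma> (a v) n \<in> I 1"
      using qr[unfolded quasi_regular_def, rule_format, of l "\<lambda>v. \<sigma> (a v) n"] * aP by auto
    then have "\<sigma> (a u) n \<in> I 1" using u by blast
    moreover have "\<sigma> (a u) n - a u \<in> I 1" using aP[OF u] Suc.prems(1) by (intro s_diff_1) auto
    ultimately show ?thesis using I_diff[of "\<sigma> (a u) n" 1 "\<sigma> (a u) n - a u"] by simp
  qed (rule IH)
qed (auto simp: U_def)

lemma S_unique: "fam a ==> S n a \<in> I n ==> u \<in> U n ==> a u \<in> I 1"
  using S_unique_aux by blast

lemma S_add:
  assumes "fam a" "fam b" shows "S n (\<lambda>u. a u + b u) - (S n a + S n b) \<in> I n"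
proof -
  have "(\<Sum>u\<in>U n. \<sigma> (a u + b u) n * tmon ts u) - (\<Sum>u\<in>U n. (\<sigma> (a u) n + \<sigma> (b u) n) * tmon ts u) \<in> I n"
    by (rule I_diff_sum) (use s_add[OF famD[OF assms(1)] famD[OF assms(2)]] in
      \<open>auto simp: mult.commute[of _ "tmon ts _"] intro!: I_diff_mult\<close>)
  then show ?thesis by (simp add: S_def distrib_right sum.distrib)
qed

lemma S_K:
  assumes "fam a" "c \<in> K" shows "S n (\<lambda>u. c * a u) - c * S n a \<in> I n"
proof -
  have "(\<Sum>u\<in>U n. \<sigma> (c * a u) n * tmon ts u) - (\<Sum>u\<in>U n. (c * \<sigma> (a u) n) * tmon ts u) \<in> I n"
    by (rule I_diff_sum) (use s_K[OF assms(2) famD[OF assms(1)]] in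
      \<open>auto simp: mult.commute[of _ "tmon ts _"] simp del: mult.assoc intro!: I_diff_mult\<close>)
  then show ?thesis by (simp add: S_def sum_distrib_left mult.assoc)
qed

lemma S_eq_imp:
  assumes a: "fam a" and b: "fam b" and "S n a - S n b \<in> I n" "u \<in> U n"
  shows "a u - b u \<in> I 1"
proof -
  have d: "fam (\<lambda>u. a u - b u)" using a b P_diff by (simp add: fam_def)
  have "S n (\<lambda>u. (a u - b u) + b u) - (S n (\<lambda>u. a u - b u) + S n b) \<in> I n" by (rule S_add[OF d b])
  then have "S n a - (S n (\<lambda>u. a u - b u) + S n b) \<in> I n" by simp
  from I_diff[OF assms(3) this] have "S n (\<lambda>u. a u - b u) \<in> I n" by (simp add: algebra_simps)
  from S_unique[OF d this assms(4)] show ?thesis .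
qed

lemma S_cong: "(\<And>u. u \<in> U n ==> a u = b u) ==> S n a = S n b"
  unfolding S_def by (auto intro: sum.cong)

text \<open>Successive approximation: a family that is correct modulo \<open>I n\<close> is
  corrected in degree \<open>n\<close> by writing the remainder, an element of \<open>I n\<close>,
  as a form of degree \<open>n\<close> in the \<open>t_j\<close>. The lower coefficients stay fixed,
  so the approximations stabilise at each index.\<close>

lemma is_exp_ex:
  assumes "f \<in> P" shows "\<exists>a. is_exp f a"
proof -
  let ?Q = "\<lambda>n a. fam a \<and> f - S n a \<in> I n" and ?St = "\<lambda>n a b. \<forall>u\<in>U n. a u = b u"
  have "\<exists>F. \<forall>n. ?Q n (F n) \<and> ?St n (F n) (F (Suc n))"
  proof (rule dependent_nat_choice)
    show "\<exists>a. ?Q 0 a"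
      using assms S_P[of "\<lambda>_. 0" 0] by (intro exI[of _ "\<lambda>_. 0"]) (auto simp: fam_def intro!: I_Zero P_diff)
  next
    fix a n assume a: "?Q n a"
    \<comment> \<open>The entries from degree \<open>n\<close> on are reset to 0, so that the new
      coefficients of degree \<open>n\<close> can replace them instead of being added to them under
      \<sigma>.\<close>
    define b where "b u = (if u \<in> U n then a u else 0)" for u
    have b: "fam b" using a by (auto simp: fam_def b_def)
    have Sb: "S n b = S n a" by (rule S_cong) (simp add: b_def)
    have "S (Suc n) b - (S n b + (\<Sum>u\<in>exps m n. \<sigma> (b u) (Suc n) * tmon ts u)) \<in> I n" by (rule S_Suc[OF b])
    moreover have "(\<Sum>u\<in>exps m n. \<sigma> (b u) (Suc n) * tmon ts u) \<in> I n"
    proof (rule I_sum)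
      fix u assume "u \<in> exps m n"
      then show "\<sigma> (b u) (Suc n) * tmon ts u \<in> I n"
        using tmon_I[of u "\<sigma> (b u) (Suc n)"] b by (auto simp: exps_def fam_def)
    qed
    ultimately have "S (Suc n) b - S n a \<in> I n" using I_add by (fastforce simp: Sb algebra_simps)
    then have "f - S (Suc n) b \<in> I n" using a I_diff_trans I_diff_sym by blast
    then obtain c where c: "\<forall>u\<in>exps m n. c u \<in> P" "f - S (Suc n) b = (\<Sum>u\<in>exps m n. c u * tmon ts u)"
      by (auto simp: ideal_pow_def)
    define b' where "b' u = (if u \<in> exps m n then c u else b u)" for u
    have b': "fam b'" using b c(1) by (auto simp: fam_def b'_def)
    have out: "b u = 0" if "u \<in> exps m n" for u using that U_Suc(2)[of n] by (auto simp: b_def)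
    have "S (Suc n) b' - (S (Suc n) b + (\<Sum>u\<in>exps m n. \<sigma> (c u) (Suc n) * tmon ts u)) \<in> I (Suc n)"
    proof -
      have "S (Suc n) b' = (\<Sum>u\<in>U n. \<sigma> (b u) (Suc n) * tmon ts u) + (\<Sum>u\<in>exps m n. \<sigma> (c u) (Suc n) * tmon ts u)"
        unfolding S_def U_Suc(1) using U_Suc(2)[of n]
        by (subst sum.union_disjoint) (auto simp: b'_def intro!: sum.cong arg_cong2[where f = "(+)"])
      moreover have "S (Suc n) b = (\<Sum>u\<in>U n. \<sigma> (b u) (Suc n) * tmon ts u) + (\<Sum>u\<in>exps m n. \<sigma> 0 (Suc n) * tmon ts u)"
        unfolding S_def U_Suc(1) using U_Suc(2)[of n]
        by (subst sum.union_disjoint) (auto simp: out intro!: sum.cong arg_cong2[where f = "(+)"])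
      moreover have "(\<Sum>u\<in>exps m n. \<sigma> 0 (Suc n) * tmon ts u) \<in> I (Suc n)"
        by (rule I_sum) (use s_I[of 0 "Suc n"] in \<open>auto simp: mult.commute[of _ "tmon ts _"]\<close>)
      ultimately show ?thesis using I_uminus by fastforce
    qed
    moreover have "(\<Sum>u\<in>exps m n. \<sigma> (c u) (Suc n) * tmon ts u) - (\<Sum>u\<in>exps m n. c u * tmon ts u) \<in> I (Suc n)"
    proof (rule I_diff_sum)
      fix u assume u: "u \<in> exps m n"
      then have "(\<sigma> (c u) (Suc n) - c u) * tmon ts u \<in> I (1 + sum_list u)"
        using c(1) by (intro tmon_I' s_diff_1) (auto simp: exps_def)
      then show "\<sigma> (c u) (Suc n) * tmon ts u - c u * tmon ts u \<in> I (Suc n)"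
        using u by (simp add: left_diff_distrib exps_def)
    qed
    ultimately have "S (Suc n) b' - f \<in> I (Suc n)"
      unfolding c(2)[symmetric] using I_add by (fastforce simp: algebra_simps)
    then have "f - S (Suc n) b' \<in> I (Suc n)" by (rule I_diff_sym)
    moreover have "\<forall>u\<in>U n. a u = b' u" using U_Suc(2)[of n] by (auto simp: b'_def b_def)
    ultimately show "\<exists>b. ?Q (Suc n) b \<and> ?St n a b" using b' by blast
  qed
  then obtain F where F: "\<And>n. fam (F n)" "\<And>n. f - S n (F n) \<in> I n" "\<And>n u. u \<in> U n ==> F n u = F (Suc n) u" by blast
  have mono: "F (n + k) u = F n u" if "u \<in> U n" for n k u
  proof (induction k)
    case (Suc k)
    have "u \<in> U (n + k)" using that by (auto simp: U_def)
    then show ?case using F(3) Suc by simp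
  qed simp
  \<comment> \<open>The index \<open>u\<close> belongs to \<open>U n\<close> as soon as
    \<open>n\<close> exceeds its degree; from \<open>Suc (sum_list u)\<close> on the value
    \<open>F n u\<close> is constant.\<close>
  define a where "a u = F (Suc (sum_list u)) u" for u
  have "S n a = S n (F n)" for n
  proof (rule S_cong)
    fix u assume u: "u \<in> U n"
    then show "a u = F n u" using mono[of u "Suc (sum_list u)" "n - Suc (sum_list u)"] by (auto simp: U_def a_def)
  qed
  then have "is_exp f a" using F by (auto simp: is_exp_def fam_def a_def)
  then show ?thesis by blast
qed

text \<open>The coefficient \<open>u\<^sub>i\<close> vanishes when \<open>u ! i - 1\<close> is truncated.\<close>

definition D :: "nat => nat => (nat list => 'a) => 'a" where
  "D i n a = (\<Sum>u\<in>U (Suc n). of_nat (u ! i) * \<sigma> (a u) n * tmon ts (u[i := u ! i - 1]))"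

lemma D_P: "fam a ==> D i n a \<in> P"
  unfolding D_def by (intro P_sum P_mult P_of_nat s_P tmon_P) (rule famD)

text \<open>Differentiation loses one order: \<open>D\<close> at level \<open>n\<close> reads the
  coefficients up to degree \<open>n\<close>, and these are determined modulo the ideal by the value
  modulo \<open>I (Suc n)\<close>.\<close>

lemma D_cong:
  assumes a: "fam a" and b: "fam b" and "S (Suc n) a - S (Suc n) b \<in> I (Suc n)"
  shows "D i n a - D i n b \<in> I n"
  unfolding D_def
proof (rule I_diff_sum)
  fix u assume u: "u \<in> U (Suc n)"
  have "\<sigma> (a u) n - \<sigma> (b u) n \<in> I n"
    using famD[OF a u] famD[OF b u] S_eq_imp[OF assms u] by (intro s_cong)
  then have "(of_nat (u ! i) * tmon ts (u[i := u ! i - 1])) * (\<sigma> (a u) n - \<sigma> (b u) n) \<in> I n" by auto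
  then show "of_nat (u ! i) * \<sigma> (a u) n * tmon ts (u[i := u ! i - 1]) -
     of_nat (u ! i) * \<sigma> (b u) n * tmon ts (u[i := u ! i - 1]) \<in> I n" by (simp add: algebra_simps)
qed

lemma is_exp_S: "is_exp f a ==> f - S n b \<in> I n ==> S n a - S n b \<in> I n"
  using I_diff_trans I_diff_sym unfolding is_exp_def by blast

lemma D_add:
  assumes "is_exp f a" "is_exp g b" "is_exp (f + g) c"
  shows "D i n c - (D i n a + D i n b) \<in> I n"
proof -
  have ab: "fam a" "fam b" "fam c" using assms by (auto simp: is_exp_def)
  have f: "fam (\<lambda>u. a u + b u)" using ab by (auto simp: fam_def)
  have "f + g - (S (Suc n) a + S (Suc n) b) \<in> I (Suc n)"
    using I_add[of "f - S (Suc n) a" "Suc n" "g - S (Suc n) b"] assms by (simp add: is_exp_def algebra_simps)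
  then have "f + g - S (Suc n) (\<lambda>u. a u + b u) \<in> I (Suc n)"
    using S_add[OF ab(1,2)] I_diff_sym I_diff_trans by blast
  then have 1: "D i n c - D i n (\<lambda>u. a u + b u) \<in> I n"
    by (intro D_cong[OF ab(3) f] is_exp_S[OF assms(3)])
  have "D i n (\<lambda>u. a u + b u) - (\<Sum>u\<in>U (Suc n). of_nat (u ! i) * (\<sigma> (a u) n + \<sigma> (b u) n) * tmon ts (u[i := u ! i - 1])) \<in> I n"
    unfolding D_def
  proof (rule I_diff_sum)
    fix u assume u: "u \<in> U (Suc n)"
    have "(of_nat (u ! i) * tmon ts (u[i := u ! i - 1])) * (\<sigma> (a u + b u) n - (\<sigma> (a u) n + \<sigma> (b u) n)) \<in> I n"
      using s_add[OF famD[OF ab(1) u] famD[OF ab(2) u]] by auto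
    then show "of_nat (u ! i) * \<sigma> (a u + b u) n * tmon ts (u[i := u ! i - 1]) -
       of_nat (u ! i) * (\<sigma> (a u) n + \<sigma> (b u) n) * tmon ts (u[i := u ! i - 1]) \<in> I n" by (simp add: algebra_simps)
  qed
  then have "D i n (\<lambda>u. a u + b u) - (D i n a + D i n b) \<in> I n"
    by (simp add: D_def algebra_simps sum.distrib)
  with 1 show ?thesis using I_diff_trans by blast
qed

lemma D_K:
  assumes "is_exp f a" "c \<in> K" "is_exp (c * f) b"
  shows "D i n b - c * D i n a \<in> I n"
proof -
  have ab: "fam a" "fam b" using assms by (auto simp: is_exp_def)
  have c: "c \<in> P" using assms K_P by auto
  have f: "fam (\<lambda>u. c * a u)" using ab c by (auto simp: fam_def)
  have "c * f - c * S (Suc n) a \<in> I (Suc n)"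
    using assms c by (intro I_diff_mult) (auto simp: is_exp_def)
  then have "c * f - S (Suc n) (\<lambda>u. c * a u) \<in> I (Suc n)"
    using S_K[OF ab(1) assms(2)] I_diff_sym I_diff_trans by blast
  then have 1: "D i n b - D i n (\<lambda>u. c * a u) \<in> I n"
    by (intro D_cong[OF ab(2) f] is_exp_S[OF assms(3)])
  have "D i n (\<lambda>u. c * a u) - (\<Sum>u\<in>U (Suc n). of_nat (u ! i) * (c * \<sigma> (a u) n) * tmon ts (u[i := u ! i - 1])) \<in> I n"
    unfolding D_def
  proof (rule I_diff_sum)
    fix u assume u: "u \<in> U (Suc n)"
    have "(of_nat (u ! i) * tmon ts (u[i := u ! i - 1])) * (\<sigma> (c * a u) n - c * \<sigma> (a u) n) \<in> I n"
      using s_K[OF assms(2) famD[OF ab(1) u]] by auto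
    then show "of_nat (u ! i) * \<sigma> (c * a u) n * tmon ts (u[i := u ! i - 1]) -
       of_nat (u ! i) * (c * \<sigma> (a u) n) * tmon ts (u[i := u ! i - 1]) \<in> I n" by (simp add: algebra_simps)
  qed
  then have "D i n (\<lambda>u. c * a u) - c * D i n a \<in> I n"
    by (simp add: D_def sum_distrib_left mult.assoc mult.left_commute)
  with 1 show ?thesis using I_diff_trans by blast
qed

text \<open>Multiplication by \<open>t_j\<close> shifts the family of coefficients by one in
  direction \<open>j\<close>. The exponent in direction \<open>i\<close> thereby grows by 1 exactly
  if \<open>i = j\<close>, which is the Leibniz rule with the term \<delta>_ij h.\<close>

lemma D_t:
  assumes "is_exp h a" "j < m" "i < m" "is_exp (ts ! j * h) b"
  shows "D i n b - ((if i = j then h else 0) + ts ! j * D i n a) \<in> I n"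
proof -
  have ab: "fam a" "fam b" using assms by (auto simp: is_exp_def)
  \<comment> \<open>The expected coefficients of \<open>ts ! j * h\<close>: those of
    \<open>h\<close>, shifted, and 0 where the exponent of \<open>t_j\<close> is 0.\<close>
  define s where "s u = (if u ! j > 0 then a (u[j := u ! j - 1]) else 0)" for u
  have s: "fam s" using ab by (auto simp: fam_def s_def)
  let ?inc = "\<lambda>u. u[j := Suc (u ! j)]" and ?dec = "\<lambda>u. u[i := u ! i - 1]"
  have inc: "?inc u ! j = Suc (u ! j)" "s (?inc u) = a u" if "u \<in> U k" for u k
    using that assms(2) by (auto simp: U_def s_def)
  have 1: "S (Suc n) s - ts ! j * S n a \<in> I (Suc n)"
  proof -
    have "(\<Sum>u\<in>{u \<in> U (Suc n). u ! j = 0}. \<sigma> (s u) (Suc n) * tmon ts u) \<in> I (Suc n)"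
      by (rule I_sum) (use s_I[of 0 "Suc n"] in \<open>auto simp: s_def mult.commute[of _ "tmon ts _"]\<close>)
    moreover have "(\<Sum>u\<in>U n. \<sigma> (s (?inc u)) (Suc n) * tmon ts (?inc u)) - (\<Sum>u\<in>U n. ts ! j * (\<sigma> (a u) n * tmon ts u)) \<in> I (Suc n)"
    proof (rule I_diff_sum)
      fix u assume u: "u \<in> U n"
      have "ts ! j * (tmon ts u * (\<sigma> (a u) (Suc n) - \<sigma> (a u) n)) \<in> I (Suc n)"
        using s_Suc[OF famD[OF ab(1) u]] by (intro I_t[OF assms(2)]) auto
      moreover have "tmon ts (?inc u) = ts ! j * tmon ts u" using u assms(2) by (intro tmon_update) (auto simp: U_def)
      ultimately show "\<sigma> (s (?inc u)) (Suc n) * tmon ts (?inc u) - ts ! j * (\<sigma> (a u) n * tmon ts u) \<in> I (Suc n)"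
        using inc(2)[OF u] by (simp add: algebra_simps)
    qed
    ultimately show ?thesis unfolding S_def sum_U_shift[OF assms(2)] sum_distrib_left
      using I_add by (fastforce simp: algebra_simps)
  qed
  moreover have "ts ! j * h - ts ! j * S n a \<in> I (Suc n)"
    using I_t[OF assms(2), of "h - S n a" n] assms(1) by (simp add: is_exp_def right_diff_distrib)
  ultimately have "ts ! j * h - S (Suc n) s \<in> I (Suc n)" using I_diff_sym I_diff_trans by blast
  then have 2: "D i n b - D i n s \<in> I n"
    by (intro D_cong[OF ab(2) s] is_exp_S[OF assms(4)])
  let ?T = "\<Sum>u\<in>U n. of_nat (?inc u ! i) * \<sigma> (a u) n * tmon ts (?dec (?inc u))"
  have "(\<Sum>u\<in>{u \<in> U (Suc n). u ! j = 0}. of_nat (u ! i) * \<sigma> (s u) n * tmon ts (?dec u)) \<in> I n"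
  proof (rule I_sum)
    fix u assume "u \<in> {u \<in> U (Suc n). u ! j = 0}"
    then have "of_nat (u ! i) * tmon ts (?dec u) * \<sigma> (s u) n \<in> I n"
      using s_I[of 0 n] by (auto simp: s_def)
    then show "of_nat (u ! i) * \<sigma> (s u) n * tmon ts (?dec u) \<in> I n" by (simp add: ac_simps)
  qed
  moreover have "(\<Sum>u\<in>U n. of_nat (?inc u ! i) * \<sigma> (s (?inc u)) n * tmon ts (?dec (?inc u))) = ?T"
    by (rule sum.cong) (use inc(2) in auto)
  ultimately have 3: "D i n s - ?T \<in> I n"
    unfolding D_def sum_U_shift[OF assms(2)] by simp
  \<comment> \<open>The weight of the shifted index is \<open>u ! i\<close> plus the Kronecker
    delta. The delta reproduces the partial sum for \<open>h\<close>, the rest is \<open>t_j\<close>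
    times the derivative.\<close>
  have tm: "of_nat (?inc u ! i) * tmon ts (?dec (?inc u)) =
      (if i = j then tmon ts u else 0) + of_nat (u ! i) * (ts ! j * tmon ts (?dec u))" if u: "u \<in> U n" for u
  proof (cases "i = j")
    case True
    have l: "length u = m" using u by (simp add: U_def)
    have "?dec (?inc u) = u" using True l assms(2) by simp
    moreover have "of_nat (u ! i) * tmon ts u = of_nat (u ! i) * (ts ! j * tmon ts (?dec u))"
      using tmon_dec[OF assms(2) l] True by (cases "u ! i = 0") auto
    ultimately show ?thesis using True l assms(2) by (simp add: distrib_right)
  next
    case False
    have l: "length u = m" using u by (simp add: U_def)
    have "?dec (?inc u) = (?dec u)[j := Suc (?dec u ! j)]" using False by (simp add: list_update_swap)
    then have "tmon ts (?dec (?inc u)) = ts ! j * tmon ts (?dec u)"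
      using tmon_update[OF assms(2), of "?dec u"] l by simp
    then show ?thesis using False by simp
  qed
  have "?T = (\<Sum>u\<in>U n. \<sigma> (a u) n * (of_nat (?inc u ! i) * tmon ts (?dec (?inc u))))"
    by (simp add: ac_simps)
  also have "\<dots> = (\<Sum>u\<in>U n. \<sigma> (a u) n * ((if i = j then tmon ts u else 0) + of_nat (u ! i) * (ts ! j * tmon ts (?dec u))))"
    by (intro sum.cong refl) (simp only: tm)
  also have "\<dots> = (if i = j then S n a else 0) + ts ! j * (\<Sum>u\<in>U n. of_nat (u ! i) * \<sigma> (a u) n * tmon ts (?dec u))"
    by (auto simp: S_def distrib_left sum.distrib sum_distrib_left ac_simps)
  finally have 4: "?T = (if i = j then S n a else 0) + ts ! j * (\<Sum>u\<in>U n. of_nat (u ! i) * \<sigma> (a u) n * tmon ts (?dec u))" .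
  \<comment> \<open>\<open>D i n a\<close> includes degree \<open>n\<close>, whereas the shifted sum
    stops one degree earlier. A surplus term has degree \<open>n - 1\<close> after differentiation
    and is returned to \<open>I n\<close> by the factor \<open>t_j\<close>.\<close>
  have top: "ts ! j * (\<Sum>u\<in>exps m n. of_nat (u ! i) * \<sigma> (a u) n * tmon ts (?dec u)) \<in> I n"
    unfolding sum_distrib_left
  proof (rule I_sum)
    fix u assume u: "u \<in> exps m n"
    then have aP: "a u \<in> P" using ab by (simp add: fam_def exps_def)
    show "ts ! j * (of_nat (u ! i) * \<sigma> (a u) n * tmon ts (?dec u)) \<in> I n"
    proof (cases "u ! i = 0")
      case False
      have "of_nat (u ! i) * \<sigma> (a u) n * tmon ts (?dec u) \<in> I (sum_list (?dec u))"
        using u aP by (intro tmon_I) (auto simp: exps_def)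
      from I_t[OF assms(2) this] show ?thesis using sum_list_dec[of i u] False u assms(3) by (simp add: exps_def)
    qed simp
  qed
  have "D i n a = (\<Sum>u\<in>U n. of_nat (u ! i) * \<sigma> (a u) n * tmon ts (?dec u)) + (\<Sum>u\<in>exps m n. of_nat (u ! i) * \<sigma> (a u) n * tmon ts (?dec u))"
    unfolding D_def U_Suc(1) using U_Suc(2)[of n] by (subst sum.union_disjoint) auto
  then have 5: "?T - ((if i = j then S n a else 0) + ts ! j * D i n a) \<in> I n"
    unfolding 4 using I_uminus[OF top] by (simp add: distrib_left)
  have 6: "((if i = j then S n a else 0) + ts ! j * D i n a) - ((if i = j then h else 0) + ts ! j * D i n a) \<in> I n"
    using assms(1) I_diff_sym by (auto simp: is_exp_def)
  show ?thesis using 2 3 5 6 I_diff_trans by blast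
qed

text \<open>The values of \<open>D\<close> form a sequence that represents an element of the
  completion; this is what permits the comparison of its members 1 and 2 below.\<close>

lemma D_Suc: assumes "fam a" "i < m" shows "D i (Suc n) a - D i n a \<in> I n"
proof -
  let ?dec = "\<lambda>u. u[i := u ! i - 1]"
  have "(\<Sum>u\<in>U (Suc n). of_nat (u ! i) * \<sigma> (a u) (Suc n) * tmon ts (?dec u)) - D i n a \<in> I n"
    unfolding D_def
  proof (rule I_diff_sum)
    fix u assume u: "u \<in> U (Suc n)"
    have "(of_nat (u ! i) * tmon ts (?dec u)) * (\<sigma> (a u) (Suc n) - \<sigma> (a u) n) \<in> I n"
      using s_Suc[OF famD[OF assms(1) u]] by auto
    then show "of_nat (u ! i) * \<sigma> (a u) (Suc n) * tmon ts (?dec u) - of_nat (u ! i) * \<sigma> (a u) n * tmon ts (?dec u) \<in> I n"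
      by (simp add: algebra_simps)
  qed
  moreover have "(\<Sum>u\<in>exps m (Suc n). of_nat (u ! i) * \<sigma> (a u) (Suc n) * tmon ts (?dec u)) \<in> I n"
  proof (rule I_sum)
    fix u assume u: "u \<in> exps m (Suc n)"
    then have aP: "a u \<in> P" using assms by (simp add: fam_def exps_def)
    show "of_nat (u ! i) * \<sigma> (a u) (Suc n) * tmon ts (?dec u) \<in> I n"
    proof (cases "u ! i = 0")
      case False
      have "of_nat (u ! i) * \<sigma> (a u) (Suc n) * tmon ts (?dec u) \<in> I (sum_list (?dec u))"
        using u aP by (intro tmon_I) (auto simp: exps_def)
      then show ?thesis using sum_list_dec[of i u] False u assms(2) by (simp add: exps_def)
    qed simp
  qed
  moreover have "D i (Suc n) a = (\<Sum>u\<in>U (Suc n). of_nat (u ! i) * \<sigma> (a u) (Suc n) * tmon ts (?dec u)) + (\<Sum>u\<in>exps m (Suc n). of_nat (u ! i) * \<sigma> (a u) (Suc n) * tmon ts (?dec u))"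
    unfolding D_def U_Suc(1)[of "Suc n"] using U_Suc(2)[of "Suc n"] by (subst sum.union_disjoint) auto
  ultimately show ?thesis using I_add by (fastforce simp: algebra_simps)
qed

end

section \<open>Differential operators on the ambient polynomial ring\<close>

lemma lookup_single_mult:
  fixes p :: "('v, 'k::comm_ring_1) mpol"
  shows "lookup (single c k * p) (c + a) = k * lookup p a"
  by (induction p rule: pm_induct) (simp_all add: mult_single lookup_single when_def distrib_left lookup_add)

lemma lookup_single_mult':
  fixes p :: "('v, 'k::comm_ring_1) mpol"
  assumes "\<And>a. b \<noteq> c + a"
  shows "lookup (single c k * p) b = 0"
  by (induction p rule: pm_induct) (use assms in \<open>auto simp: mult_single lookup_single when_def distrib_left lookup_add\<close>)

lemma out_addD:
  "keys (c + d :: 'v \<Rightarrow>\<^sub>0 nat) \<inter> A = {} \<longleftrightarrow> keys c \<inter> A = {} \<and> keys d \<inter> A = {}"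
  by (auto simp: in_keys_iff lookup_add disjoint_iff)

locale cut_data =
  fixes ys :: "'v list" and V :: "('v, 'k::comm_ring_1) mpol" and bs :: "('v, 'k) mpol list"
    and \<sigma> :: "('v, 'k) mpol => nat => ('v, 'k) mpol"
  assumes dist: "distinct ys" and pot: "potential ys V" and basis: "jac_basis ys V bs" and sect: "jac_section ys V \<sigma>"

sublocale cut_data \<subseteq> regular_section "poly_in (set ys)" "partials ys V" "range pconst" \<sigma>
proof -
  interpret regular_ideal "poly_in (set ys)" "partials ys V"
    using regular_ideal_partials pot by (auto simp: potential_def)
  show "regular_section (poly_in (set ys)) (partials ys V) (range pconst) \<sigma>"
  proof
    show "quasi_regular (poly_in (set ys)) (partials ys V)" using pot by (simp add: potential_def)
  qed (use sect in \<open>auto simp: jac_section_def adic_eq_def adic_elem_def adic_ideal_def\<close>)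
qed

context cut_data
begin

abbreviation "A \<equiv> set ys"
abbreviation "R' \<equiv> poly_in (- set ys)"
abbreviation oc where "oc \<equiv> outer_coeff (set ys)"
abbreviation t where "t j \<equiv> partials ys V ! j"
abbreviation "out b \<equiv> keys b \<inter> set ys = {}"

lemma len_m [simp]: "m = length ys" by (simp add: partials_def)

text \<open>The ideal generated by the \<open>n\<close>-th power of \<open>I\<close> in the
  polynomial ring in all variables, described through coefficients with respect to the outer
  monomials.\<close>

definition IA :: "nat => ('v, 'k) mpol set" where "IA n = {f. \<forall>b. out b \<longrightarrow> oc b f \<in> I n}"

lemma IA_0 [simp, intro]: "0 \<in> IA n" by (simp add: IA_def)
lemma IA_add [intro]: "f \<in> IA n ==> g \<in> IA n ==> f + g \<in> IA n" by (simp add: IA_def outer_coeff_add I_add)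
lemma IA_uminus [intro]: "f \<in> IA n ==> - f \<in> IA n" by (simp add: IA_def outer_coeff_uminus I_uminus)
lemma IA_diff [intro]: "f \<in> IA n ==> g \<in> IA n ==> f - g \<in> IA n" by (simp add: IA_def outer_coeff_diff I_diff)
lemma IA_mono: "f \<in> IA n ==> k \<le> n ==> f \<in> IA k" unfolding IA_def using I_mono by blast

text \<open>A monomial factor splits into an inner part, which multiplies every coefficient by an
  element of \<open>poly_in A\<close>, and an outer part, which only moves the coefficients to other
  monomials.\<close>

lemma IA_mult [intro]: assumes "f \<in> IA n" shows "g * f \<in> IA n"
proof (induction g rule: pm_induct)
  case (single a k)
  have *: "single a k = single (restr A a) k * single (restr (- A) a) 1"
    by (subst restr_sum[of a A]) (simp add: mult_single add.commute)
  have o: "out (restr (- A) a)" by (auto simp: keys_restr)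
  have "single (restr (- A) a) 1 * f \<in> IA n" unfolding IA_def
  proof (intro CollectI allI impI)
    fix b :: "'v \<Rightarrow>\<^sub>0 nat" assume b: "out b"
    show "oc b (single (restr (- A) a) 1 * f) \<in> I n"
    proof (cases "\<exists>d. b = restr (- A) a + d \<and> out d")
      case True
      then obtain d where d: "b = restr (- A) a + d" "out d" by blast
      show ?thesis using assms outer_coeff_mult_out[OF d(2) o, of 1 f] d by (simp add: IA_def)
    next
      case False
      have "oc b (single (restr (- A) a) 1 * f) = 0"
        by (rule outer_coeff_mult_out'[OF b o]) (use False in auto)
      then show ?thesis by simp
    qed
  qed
  moreover have "single (restr A a) k \<in> poly_in A" by (intro poly_in_single) (simp add: keys_restr)
  ultimately show ?case unfolding * mult.assoc by (auto simp: IA_def outer_coeff_mult_in)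
qed (auto simp: distrib_right)

lemma IA_mult' [intro]: "f \<in> IA n ==> f * g \<in> IA n" using IA_mult[of f n g] by (simp add: mult.commute)

lemma t_P' [intro]: "j < length ys ==> t j \<in> poly_in A" using t_P[of j] by simp

lemma IA_t: "j < length ys ==> f \<in> IA n ==> t j * f \<in> IA (Suc n)"
  using I_t[of j _ n] t_P' by (auto simp: IA_def outer_coeff_mult_in)

lemma IA_Suc0: "f \<in> IA 0" using I_Zero by (auto simp: IA_def)

lemma IA_t1: "j < length ys ==> t j * f \<in> IA 1" using IA_t[of j f 0] IA_Suc0 by auto

lemma IA_1_induct [consumes 1, case_names zero add t]:
  assumes "f \<in> IA 1" "Q 0" "\<And>x y. Q x ==> Q y ==> Q (x + y)" "\<And>j y. j < length ys ==> Q (t j * y)"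
  shows "Q f"
proof -
  have sums: "Q (\<Sum>b\<in>B. g b)" if "\<And>b. b \<in> B ==> Q (g b)" for B :: "('v \<Rightarrow>\<^sub>0 nat) set" and g
    using that by (induction B rule: infinite_finite_induct) (auto intro: assms)
  have "Q (single b 1 * x)" if "x \<in> I (Suc 0)" for b x
    using that
  proof (induction x rule: I_Suc_induct)
    case (t j y)
    then show ?case using assms(4)[of j "single b 1 * y"] by (simp add: ac_simps)
  qed (auto simp: assms distrib_left)
  then have "Q (\<Sum>b\<in>outer_monos A f. single b 1 * oc b f)"
    using assms(1) by (intro sums) (auto simp: IA_def outer_monos_def)
  then show ?thesis by (simp flip: outer_decomp)
qed

lemma IA_eqI: "(\<And>b. out b ==> oc b f - oc b g \<in> I n) ==> f - g \<in> IA n"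
  by (auto simp: IA_def outer_coeff_diff)

lemma IA_diff_trans: "x - y \<in> IA n ==> y - z \<in> IA n ==> x - z \<in> IA n"
  using IA_add[of "x - y" n "y - z"] by simp
definition ex :: "('v, 'k) mpol => nat list => ('v, 'k) mpol" where "ex f = expansion ys V \<sigma> (\<lambda>_. f)"

lemma is_exp_ex': assumes "f \<in> poly_in A" shows "is_exp f (ex f)"
proof -
  have *: "is_exp f r \<longleftrightarrow> (\<forall>u. length u = length ys \<longrightarrow> r u \<in> poly_in (set ys)) \<and>
     (\<forall>n. f - (\<Sum>l<n. \<Sum>u\<in>exps (length ys) l. \<sigma> (r u) n * tmon (partials ys V) u) \<in> adic_ideal ys V n)" for r
    by (simp add: is_exp_def fam_def S_def adic_ideal_def flip: sum_U)
  show ?thesis unfolding ex_def expansion_def *[symmetric] by (rule someI_ex[OF is_exp_ex[OF assms]])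
qed

lemma pdt_D: "pdt ys V \<sigma> i (\<lambda>_. f) n = D i n (ex f)"
  unfolding pdt_def D_def ex_def by (simp only: lessThan_Suc_atMost[symmetric] sum_U[symmetric] len_m)

lemma I_21: "x \<in> I 2 ==> x \<in> I 1" using I_mono[of x 2 1] by simp

text \<open>Why member 2: \<open>dd i f\<close> is meaningful modulo \<open>IA 2\<close>, and a
  second derivative then still has a meaning modulo \<open>IA 1\<close>, which is what survives in
  J_V. At most two derivatives are ever taken.\<close>

definition dd :: "nat => ('v, 'k) mpol => ('v, 'k) mpol" where "dd i f = pdt_ext ys V \<sigma> i (\<lambda>_. f) 2"

lemma pdt_ext_eq: "pdt_ext ys V \<sigma> i (\<lambda>_. f) n = (\<Sum>b\<in>outer_monos A f. single b 1 * D i n (ex (oc b f)))"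
  by (simp add: pdt_ext_def pdt_D)

lemma ex_fam: "f \<in> poly_in A ==> fam (ex f)" using is_exp_ex' by (auto simp: is_exp_def)

lemma D_ex_0: "D i n (ex 0) \<in> I n"
  using I_uminus[OF D_add[OF is_exp_ex' is_exp_ex', of 0 0 "ex 0" i n]] is_exp_ex'[of 0] by simp

lemma oc_pdt_ext: assumes "out b" shows "oc b (pdt_ext ys V \<sigma> i (\<lambda>_. f) n) - D i n (ex (oc b f)) \<in> I n"
proof -
  have "oc b (pdt_ext ys V \<sigma> i (\<lambda>_. f) n) = (if b \<in> outer_monos A f then D i n (ex (oc b f)) else 0)"
    unfolding pdt_ext_eq by (rule outer_coeff_ext[OF assms]) (intro D_P ex_fam outer_coeff_in)
  then show ?thesis using assms D_ex_0[of i n] by (auto simp: outer_monos_def)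
qed

text \<open>\<open>induced\<close> evaluates an operator at member 1 of the sequence. After
  reduction to J_V this gives the same result as the more precise member 2 used in
  \<open>dd\<close>.\<close>

lemma pdt_ext_1: assumes "i < length ys" shows "pdt_ext ys V \<sigma> i (\<lambda>_. f) 1 - dd i f \<in> IA 1"
proof (rule IA_eqI)
  fix b :: "'v \<Rightarrow>\<^sub>0 nat" assume b: "out b"
  have "oc b (dd i f) - D i 2 (ex (oc b f)) \<in> I 1"
    using oc_pdt_ext[OF b, of i f 2] I_mono[of _ 2 1] by (simp add: dd_def)
  moreover have "D i 2 (ex (oc b f)) - D i 1 (ex (oc b f)) \<in> I 1"
    using D_Suc[of "ex (oc b f)" i 1] ex_fam assms by (simp add: numeral_2_eq_2)
  ultimately show "oc b (pdt_ext ys V \<sigma> i (\<lambda>_. f) 1) - oc b (dd i f) \<in> I 1"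
    using oc_pdt_ext[OF b, of i f 1] I_diff_sym I_diff_trans by blast
qed

lemma oc_dd: "out b ==> oc b (dd i f) - D i 2 (ex (oc b f)) \<in> I 2"
  unfolding dd_def by (rule oc_pdt_ext)

lemma dd_add: "dd i (f + g) - (dd i f + dd i g) \<in> IA 2"
proof (rule IA_eqI)
  fix b :: "'v \<Rightarrow>\<^sub>0 nat" assume b: "out b"
  have "D i 2 (ex (oc b f + oc b g)) - (D i 2 (ex (oc b f)) + D i 2 (ex (oc b g))) \<in> I 2"
    by (rule D_add[OF is_exp_ex' is_exp_ex' is_exp_ex']) auto
  moreover have "(D i 2 (ex (oc b f)) + D i 2 (ex (oc b g))) - oc b (dd i f + dd i g) \<in> I 2"
    using I_add[OF I_diff_sym[OF oc_dd[OF b, of i f]] I_diff_sym[OF oc_dd[OF b, of i g]]]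
    by (simp add: outer_coeff_add algebra_simps)
  ultimately show "oc b (dd i (f + g)) - oc b (dd i f + dd i g) \<in> I 2"
    using oc_dd[OF b, of i "f + g"] I_diff_trans unfolding outer_coeff_add by blast
qed

text \<open>For an outer monomial both sides are shifted by the same amount, and a coefficient
  outside the range of the shift vanishes on both sides; the constants in front are handled by
  \<open>D_K\<close>.\<close>

lemma dd_R: assumes "r \<in> R'" shows "dd i (r * f) - r * dd i f \<in> IA 2"
proof (induction r rule: pm_induct)
  case zero
  show ?case using IA_uminus[OF dd_add[of i 0 0]] by simp
next
  case (single c k)
  then have c: "out c" using assms by (auto simp: poly_in_def)
  show ?case
  proof (rule IA_eqI)
    fix b :: "'v \<Rightarrow>\<^sub>0 nat" assume b: "out b"
    show "oc b (dd i (single c k * f)) - oc b (single c k * dd i f) \<in> I 2"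
    proof (cases "\<exists>d. b = c + d \<and> out d")
      case True
      then obtain d where d: "b = c + d" "out d" by blast
      have "D i 2 (ex (pconst k * oc d f)) - pconst k * D i 2 (ex (oc d f)) \<in> I 2"
        by (intro D_K[of "oc d f"] is_exp_ex') auto
      moreover have "pconst k * D i 2 (ex (oc d f)) - pconst k * oc d (dd i f) \<in> I 2"
        using I_diff_sym[OF oc_dd[OF d(2), of i f]] by (intro I_diff_mult) auto
      moreover have "oc b (single c k * g) = pconst k * oc d g" for g
        unfolding d(1) by (rule outer_coeff_mult_out[OF d(2) c])
      ultimately show ?thesis using oc_dd[OF b, of i "single c k * f"] I_diff_trans by metis
    next
      case False
      then have "oc b (single c k * g) = 0" for g
        using outer_coeff_mult_out'[OF b c] by blast
      then show ?thesis
        using I_add[OF oc_dd[OF b, of i "single c k * f"] D_ex_0[of i 2]] by simp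
    qed
  qed
next
  case (add r s)
  have "dd i (r * f + s * f) - (dd i (r * f) + dd i (s * f)) \<in> IA 2" by (rule dd_add)
  from IA_add[OF this IA_add[OF add.IH]] show ?case by (simp add: algebra_simps)
qed

lemma dd_t: assumes "i < length ys" "j < length ys"
  shows "dd i (t j * h) - ((if i = j then h else 0) + t j * dd i h) \<in> IA 2"
proof (rule IA_eqI)
  fix b :: "'v \<Rightarrow>\<^sub>0 nat" assume b: "out b"
  have e: "oc b (t j * g) = t j * oc b g" for g using b t_P'[OF assms(2)] by (rule outer_coeff_mult_in)
  have 1: "D i 2 (ex (t j * oc b h)) - ((if i = j then oc b h else 0) + t j * D i 2 (ex (oc b h))) \<in> I 2"
    by (rule D_t[OF is_exp_ex' _ _ is_exp_ex']) (use assms t_P' in \<open>auto intro: poly_in_mult\<close>)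
  have 2: "t j * D i 2 (ex (oc b h)) - t j * oc b (dd i h) \<in> I 2"
    using I_diff_sym[OF oc_dd[OF b, of i h]] t_P'[OF assms(2)] by (intro I_diff_mult)
  have "D i 2 (ex (oc b (t j * h))) - oc b ((if i = j then h else 0) + t j * dd i h) \<in> I 2"
    using I_add[OF 1 2] unfolding e outer_coeff_add by (cases "i = j") (simp_all add: algebra_simps)
  then show "oc b (dd i (t j * h)) - oc b ((if i = j then h else 0) + t j * dd i h) \<in> I 2"
    using oc_dd[OF b, of i "t j * h"] I_diff_trans by blast
qed

lemma D_ex_I2: assumes "i < length ys" "x \<in> I 2" shows "D i 2 (ex x) \<in> I 1"
proof -
  have "x \<in> poly_in A \<and> D i 2 (ex x) \<in> I 1"
    using assms(2) unfolding numeral_2_eq_2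
  proof (induction x rule: I_Suc_induct)
    case zero
    show ?case using I_21[OF D_ex_0[of i 2]] by (simp add: numeral_2_eq_2)
  next
    case (add x y)
    have "D i 2 (ex (x + y)) - (D i 2 (ex x) + D i 2 (ex y)) \<in> I 2"
      by (rule D_add[OF is_exp_ex' is_exp_ex' is_exp_ex']) (use add in auto)
    then have "D i 2 (ex (x + y)) - (D i 2 (ex x) + D i 2 (ex y)) \<in> I 1" by (rule I_21)
    from I_add[OF this, of "D i 2 (ex x) + D i 2 (ex y)"] show ?case using add by (auto simp: numeral_2_eq_2)
  next
    case (t j y)
    then have y: "y \<in> poly_in A" "j < length ys" by (auto dest: I_sub)
    have "D i 2 (ex (t j * y)) - ((if i = j then y else 0) + t j * D i 2 (ex y)) \<in> I 2"
      by (rule D_t[OF is_exp_ex' _ _ is_exp_ex']) (use assms t_P' y in \<open>auto intro: poly_in_mult\<close>)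
    then have *: "D i 2 (ex (t j * y)) - ((if i = j then y else 0) + t j * D i 2 (ex y)) \<in> I 1" by (rule I_21)
    have "t j * D i 2 (ex y) \<in> I 1" using I_t[of j "D i 2 (ex y)" 0] y I_Zero D_P[OF ex_fam[OF y(1)]] by simp
    then have "(if i = j then y else 0) + t j * D i 2 (ex y) \<in> I 1" using t by auto
    from I_add[OF * this] show ?case using y t_P' by (auto simp: numeral_2_eq_2 intro: poly_in_mult)
  qed
  then show ?thesis ..
qed

lemma dd_IA2: assumes "i < length ys" "f \<in> IA 2" shows "dd i f \<in> IA 1"
  unfolding IA_def
proof (intro CollectI allI impI)
  fix b :: "'v \<Rightarrow>\<^sub>0 nat" assume b: "out b"
  have "D i 2 (ex (oc b f)) \<in> I 1" using assms b by (intro D_ex_I2) (auto simp: IA_def)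
  moreover have "oc b (dd i f) - D i 2 (ex (oc b f)) \<in> I 1" by (intro I_21 oc_dd b)
  ultimately show "oc b (dd i f) \<in> I 1"
    using I_add[of "oc b (dd i f) - D i 2 (ex (oc b f))" 1 "D i 2 (ex (oc b f))"] by simp
qed

lemma IA_21: "f \<in> IA 2 ==> f \<in> IA 1" using IA_mono[of f 2 1] by simp

text \<open>\<open>Lop j f\<close> is the commutator \<open>[dd j, f]\<close> and \<open>Kop i j f\<close> is \<open>[dd i, [dd j, f]]\<close>.\<close>

definition Lop :: "nat => ('v, 'k) mpol => ('v, 'k) mpol => ('v, 'k) mpol" where
  "Lop j f h = dd j (f * h) - f * dd j h"

definition Kop :: "nat => nat => ('v, 'k) mpol => ('v, 'k) mpol => ('v, 'k) mpol" where
  "Kop i j f h = dd i (Lop j f h) - Lop j f (dd i h)"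

section \<open>First and second commutators with multiplication operators\<close>

lemma Lop_add_right: "Lop j f (g + h) - (Lop j f g + Lop j f h) \<in> IA 2"
proof -
  have "dd j (f * g + f * h) - (dd j (f * g) + dd j (f * h)) - f * (dd j (g + h) - (dd j g + dd j h)) \<in> IA 2"
    by (intro IA_diff dd_add IA_mult)
  then show ?thesis by (simp add: Lop_def algebra_simps)
qed

lemma Lop_add_left: "Lop j (f + g) h - (Lop j f h + Lop j g h) \<in> IA 2"
proof -
  have "dd j (f * h + g * h) - (dd j (f * h) + dd j (g * h)) \<in> IA 2" by (rule dd_add)
  then show ?thesis by (simp add: Lop_def algebra_simps)
qed

lemma Lop_R: assumes "r \<in> R'" shows "Lop j f (r * h) - r * Lop j f h \<in> IA 2"
proof -
  have "dd j (r * (f * h)) - r * dd j (f * h) - f * (dd j (r * h) - r * dd j h) \<in> IA 2"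
    by (intro IA_diff dd_R IA_mult assms)
  then show ?thesis by (simp add: Lop_def algebra_simps)
qed

text \<open>The derivative \<open>dd j\<close> is not linear over the \<open>t_l\<close>, but the
  terms \<delta>_jl f h produced by the two halves of the commutator cancel. Therefore the
  commutator descends to J_V, and the Atiyah operator becomes a matrix over the outer
  variables.\<close>

lemma Lop_t: assumes "j < length ys" "l < length ys" shows "Lop j f (t l * h) - t l * Lop j f h \<in> IA 2"
proof -
  have "dd j (t l * (f * h)) - ((if j = l then f * h else 0) + t l * dd j (f * h))
     - f * (dd j (t l * h) - ((if j = l then h else 0) + t l * dd j h)) \<in> IA 2"
    by (intro IA_diff dd_t IA_mult assms)
  then show ?thesis by (cases "j = l") (simp_all add: Lop_def algebra_simps)
qed

lemma Lop_prod: "Lop j (f * g) h = Lop j f (g * h) + f * Lop j g h"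
  by (simp add: Lop_def algebra_simps)

lemma Lop_of_R: "r \<in> R' ==> Lop j r h \<in> IA 2"
  using dd_R by (simp add: Lop_def)

lemma Lop_of_t: "i < length ys ==> j < length ys ==> Lop i (t j) h - (if i = j then h else 0) \<in> IA 2"
  using dd_t[of i j h] by (simp add: Lop_def algebra_simps)

lemma Lop_0: "Lop j f 0 \<in> IA 2"
  using Lop_R[of 0 j f 0] by simp

lemma Lop_I1: assumes "j < length ys" "h \<in> IA 1" shows "Lop j f h \<in> IA 1"
  using assms(2)
proof (induction h rule: IA_1_induct)
  case (add x y)
  then have "Lop j f x + Lop j f y \<in> IA 1" by auto
  from IA_add[OF IA_21[OF Lop_add_right[of j f x y]] this] show ?case by simp
next
  case (t l y)
  from IA_add[OF IA_21[OF Lop_t[OF assms(1) t, of f y]] IA_t1[OF t, of "Lop j f y"]] show ?case by simp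
qed (use Lop_0 IA_21 in auto)

lemma Lop_cong1: assumes "j < length ys" "g - h \<in> IA 1" shows "Lop j f g - Lop j f h \<in> IA 1"
  using IA_add[OF IA_21[OF Lop_add_right[of j f "g - h" h]] Lop_I1[OF assms, of f]] by simp

lemma dd_cong: assumes "i < length ys" "g - h \<in> IA 2" shows "dd i g - dd i h \<in> IA 1"
  using IA_add[OF IA_21[OF dd_add[of i "g - h" h]] dd_IA2[OF assms]] by simp

lemma Kop_add_right: assumes "i < length ys" "j < length ys"
  shows "Kop i j f (g + h) - (Kop i j f g + Kop i j f h) \<in> IA 1"
proof -
  have 1: "dd i (Lop j f (g + h)) - dd i (Lop j f g + Lop j f h) \<in> IA 1"
    by (intro dd_cong Lop_add_right assms)
  have 2: "dd i (Lop j f g + Lop j f h) - (dd i (Lop j f g) + dd i (Lop j f h)) \<in> IA 1"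
    by (intro IA_21 dd_add)
  have 3: "Lop j f (dd i (g + h)) - Lop j f (dd i g + dd i h) \<in> IA 1"
    by (intro Lop_cong1 assms IA_21 dd_add)
  have 4: "Lop j f (dd i g + dd i h) - (Lop j f (dd i g) + Lop j f (dd i h)) \<in> IA 1"
    by (intro IA_21 Lop_add_right)
  have "(dd i (Lop j f (g + h)) - (dd i (Lop j f g) + dd i (Lop j f h)))
     - (Lop j f (dd i (g + h)) - (Lop j f (dd i g) + Lop j f (dd i h))) \<in> IA 1"
    by (rule IA_diff[OF IA_diff_trans[OF 1 2] IA_diff_trans[OF 3 4]])
  then show ?thesis by (simp add: Kop_def algebra_simps)
qed

lemma Kop_add_left: assumes "i < length ys" "j < length ys"
  shows "Kop i j (f + g) h - (Kop i j f h + Kop i j g h) \<in> IA 1"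
proof -
  have 1: "dd i (Lop j (f + g) h) - dd i (Lop j f h + Lop j g h) \<in> IA 1"
    by (intro dd_cong Lop_add_left assms)
  have 2: "dd i (Lop j f h + Lop j g h) - (dd i (Lop j f h) + dd i (Lop j g h)) \<in> IA 1"
    by (intro IA_21 dd_add)
  have 3: "Lop j (f + g) (dd i h) - (Lop j f (dd i h) + Lop j g (dd i h)) \<in> IA 1"
    by (intro IA_21 Lop_add_left)
  have "(dd i (Lop j (f + g) h) - (dd i (Lop j f h) + dd i (Lop j g h)))
     - (Lop j (f + g) (dd i h) - (Lop j f (dd i h) + Lop j g (dd i h))) \<in> IA 1"
    by (rule IA_diff[OF IA_diff_trans[OF 1 2] 3])
  then show ?thesis by (simp add: Kop_def algebra_simps)
qed

lemma Kop_R: assumes "i < length ys" "j < length ys" "r \<in> R'"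
  shows "Kop i j f (r * h) - r * Kop i j f h \<in> IA 1"
proof -
  have 1: "dd i (Lop j f (r * h)) - dd i (r * Lop j f h) \<in> IA 1"
    by (intro dd_cong Lop_R assms)
  have 2: "dd i (r * Lop j f h) - r * dd i (Lop j f h) \<in> IA 1"
    by (intro IA_21 dd_R assms)
  have 3: "Lop j f (dd i (r * h)) - Lop j f (r * dd i h) \<in> IA 1"
    by (intro Lop_cong1 assms IA_21 dd_R)
  have 4: "Lop j f (r * dd i h) - r * Lop j f (dd i h) \<in> IA 1"
    by (intro IA_21 Lop_R assms)
  have "(dd i (Lop j f (r * h)) - r * dd i (Lop j f h)) - (Lop j f (dd i (r * h)) - r * Lop j f (dd i h)) \<in> IA 1"
    by (rule IA_diff[OF IA_diff_trans[OF 1 2] IA_diff_trans[OF 3 4]])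
  then show ?thesis by (simp add: Kop_def algebra_simps)
qed

lemma Kop_of_R: assumes "i < length ys" "j < length ys" "r \<in> R'" shows "Kop i j r h \<in> IA 1"
  unfolding Kop_def by (intro IA_diff dd_IA2 Lop_of_R IA_21 assms)

text \<open>The second commutator kills multiples of \<open>t_l\<close> modulo \<open>IA 1\<close>
  by the same cancellation, now with \<open>Lop j f h\<close> in place of \<open>f * h\<close>. One
  order of precision is used up by the outer derivative.\<close>

lemma Kop_t: assumes "i < length ys" "j < length ys" "l < length ys"
  shows "Kop i j f (t l * h) \<in> IA 1"
proof -
  let ?d = "if i = l then Lop j f h else 0" and ?e = "if i = l then h else 0"
  have 1: "dd i (Lop j f (t l * h)) - dd i (t l * Lop j f h) \<in> IA 1"
    by (intro dd_cong Lop_t assms)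
  have 2: "dd i (t l * Lop j f h) - (?d + t l * dd i (Lop j f h)) \<in> IA 1"
    by (intro IA_21 dd_t assms)
  have 3: "(?d + t l * dd i (Lop j f h)) - ?d \<in> IA 1" using IA_t1 assms by simp
  have 4: "Lop j f (dd i (t l * h)) - Lop j f (?e + t l * dd i h) \<in> IA 1"
    by (intro Lop_cong1 assms IA_21 dd_t)
  have 5: "Lop j f (?e + t l * dd i h) - (Lop j f ?e + Lop j f (t l * dd i h)) \<in> IA 1"
    by (intro IA_21 Lop_add_right)
  have 6: "(Lop j f ?e + Lop j f (t l * dd i h)) - Lop j f ?e \<in> IA 1"
    using Lop_I1[OF assms(2) IA_t1[OF assms(3)]] by simp
  have 7: "Lop j f ?e - ?d \<in> IA 1" using Lop_0 IA_21 by auto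
  from IA_diff[OF IA_diff_trans[OF IA_diff_trans[OF 1 2] 3]
      IA_diff_trans[OF IA_diff_trans[OF IA_diff_trans[OF 4 5] 6] 7]]
  show ?thesis by (simp add: Kop_def)
qed

lemma Kop_I1: assumes "i < length ys" "j < length ys" "h \<in> IA 1" shows "Kop i j f h \<in> IA 1"
  using assms(3)
proof (induction h rule: IA_1_induct)
  case zero
  then show ?case using Kop_R[OF assms(1,2), of 0 f 0] by simp
next
  case (add x y)
  then have "Kop i j f x + Kop i j f y \<in> IA 1" by auto
  from IA_add[OF Kop_add_right[OF assms(1,2), of f x y] this] show ?case by simp
qed (rule Kop_t[OF assms(1,2)])

text \<open>The second-order Leibniz rule: the mixed terms come from letting one of the two
  derivations act on each factor.\<close>

lemma Kop_prod: assumes "i < length ys" "j < length ys"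
  shows "Kop i j (f * g) h - (Kop i j f (g * h) + Lop j f (Lop i g h) + Lop i f (Lop j g h) + f * Kop i j g h) \<in> IA 1"
proof -
  have 1: "dd i (Lop j f (g * h) + f * Lop j g h) - (dd i (Lop j f (g * h)) + dd i (f * Lop j g h)) \<in> IA 1"
    by (intro IA_21 dd_add)
  have 2: "Lop j f (Lop i g h + g * dd i h) - (Lop j f (Lop i g h) + Lop j f (g * dd i h)) \<in> IA 1"
    by (intro IA_21 Lop_add_right)
  \<comment> \<open>It merges the two summands produced by the mixed term into one derivative of
    \<open>g * h\<close>, the argument that \<open>Kop i j f (g * h)\<close> requires.\<close>
  have 3: "Lop i g h + g * dd i h = dd i (g * h)" by (simp add: Lop_def)
  show ?thesis
    using IA_add[OF 1 2[unfolded 3]] unfolding Kop_def Lop_prod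
    by (simp add: algebra_simps Lop_def[of i f])
qed

end

section \<open>Matrices over the Jacobi ring\<close>

lemma mat_eqI:
  assumes "A \<in> carrier_mat n m" "B \<in> carrier_mat n m" "\<And>i j. i < n ==> j < m ==> A $$ (i, j) = B $$ (i, j)"
  shows "A = B"
  using assms by (intro eq_matI) auto

lemma index_add: "i < n ==> j < m ==> A \<in> carrier_mat n m ==> B \<in> carrier_mat n m ==> (A + B) $$ (i, j) = A $$ (i, j) + B $$ (i, j)"
  by auto

lemma sum_blocks: "(\<Sum>s<n * k. h s) = (\<Sum>r<n. \<Sum>l<k. h (r * k + l))" for h :: "nat => 'c::comm_monoid_add"
proof -
  have "(\<Sum>s<n * k. h s) = (\<Sum>r<n. sum h {r * k..<r * k + k})" by (rule sum.nat_group[symmetric])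
  also have "\<dots> = (\<Sum>r<n. \<Sum>l<k. h (r * k + l))"
    by (rule sum.cong[OF refl]) (simp add: sum.shift_bounds_nat_ivl[of h 0 _ k, simplified] atLeast0LessThan add.commute
      sum.atLeastLessThan_shift_0)
  finally show ?thesis .
qed

context cut_data
begin

abbreviation "\<mu> \<equiv> length bs"

section \<open>Coordinates in J_V with outer variables as scalars\<close>

definition co :: "('v, 'k) mpol => 'k list" where "co g = (THE c. jac_coords ys V bs g c)"

lemma bs_P [intro]: "j < \<mu> ==> bs ! j \<in> poly_in A"
  using basis by (auto simp: jac_basis_def)

lemma jac_coords_co: "g \<in> poly_in A ==> jac_coords ys V bs g (co g)"
  unfolding co_def using basis theI'[of "\<lambda>c. jac_coords ys V bs g c"] by (auto simp: jac_basis_def)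

lemma co_eqI:
  assumes "g \<in> poly_in A" "g - (\<Sum>j<\<mu>. pconst (c j) * bs ! j) \<in> I 1" "j < \<mu>"
  shows "co g ! j = c j"
proof -
  have "jac_coords ys V bs g (map c [0..<\<mu>])"
    using assms by (simp add: jac_coords_def adic_ideal_def)
  then have "co g = map c [0..<\<mu>]"
    using jac_coords_co[OF assms(1)] basis assms(1) unfolding jac_basis_def by blast
  then show ?thesis using assms(3) by simp
qed

lemma co_spec: "g \<in> poly_in A ==> g - (\<Sum>j<\<mu>. pconst (co g ! j) * bs ! j) \<in> I 1"
  using jac_coords_co by (auto simp: jac_coords_def adic_ideal_def)

lemma co_add: "g \<in> poly_in A ==> h \<in> poly_in A ==> j < \<mu> ==> co (g + h) ! j = co g ! j + co h ! j"
  using I_add[OF co_spec[of g] co_spec[of h]]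
  by (intro co_eqI) (auto simp: pconst_add distrib_right sum.distrib algebra_simps)

lemma co_scale: "g \<in> poly_in A ==> j < \<mu> ==> co (pconst k * g) ! j = k * co g ! j"
  using I_smult[of "pconst k", OF _ co_spec[of g]]
  by (intro co_eqI) (auto simp: pconst_mult right_diff_distrib sum_distrib_left mult.assoc)

lemma co_I: "g \<in> I 1 ==> j < \<mu> ==> co g ! j = 0"
  using I_sub by (intro co_eqI) auto

lemma co_bs: "i < \<mu> ==> j < \<mu> ==> co (bs ! i) ! j = (if i = j then 1 else 0)"
  by (intro co_eqI) (auto simp: if_distrib[where f = pconst] if_distrib[where f = "\<lambda>x. x * _"] cong: if_cong)

abbreviation "jc \<equiv> jac_coord ys V bs"

lemma lookup_jc:
  assumes "j < \<mu>"
  shows "lookup (jc f j) b = (if out b then co (oc b f) ! j else 0)"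
proof -
  have "lookup (jc f j) b = (\<Sum>b'\<in>outer_monos A f. if b' = b then co (oc b f) ! j else 0)"
    unfolding jac_coord_def lookup_sum co_def[symmetric] by (rule sum.cong) (auto simp: lookup_single when_def)
  also have "\<dots> = (if b \<in> outer_monos A f then co (oc b f) ! j else 0)" by simp
  finally show ?thesis using co_I[OF I_0 assms] by (auto simp: outer_monos_def)
qed

lemma jc_R [intro]: "jc f j \<in> R'"
  unfolding jac_coord_def by (intro poly_in_sum poly_in_single) (auto simp: outer_monos_def)

lemma jc_vars: "f \<in> poly_in B ==> jc f j \<in> poly_in (B - A)"
  unfolding jac_coord_def by (intro poly_in_sum poly_in_single outer_monos_vars)

lemma jc_add: "j < \<mu> ==> jc (f + g) j = jc f j + jc g j"
  by (rule poly_mapping_eqI) (simp add: lookup_jc lookup_add outer_coeff_add co_add)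

lemma jc_IA: "f \<in> IA 1 ==> j < \<mu> ==> jc f j = 0"
  by (rule poly_mapping_eqI) (simp add: lookup_jc IA_def co_I)

lemma jc_0: "j < \<mu> ==> jc 0 j = 0" by (simp add: jc_IA)

lemma jc_uminus: "j < \<mu> ==> jc (- f) j = - jc f j"
  using jc_add[of j f "- f"] by (simp add: jc_0 add_eq_0_iff)

lemma jc_diff: "j < \<mu> ==> jc (f - g) j = jc f j - jc g j"
  using jc_add[of j f "- g"] by (simp add: jc_uminus)

lemma jc_cong: "f - g \<in> IA 1 ==> j < \<mu> ==> jc f j = jc g j"
  using jc_IA[of "f - g" j] by (simp add: jc_diff)

lemma jc_scale:
  assumes "r \<in> R'" "j < \<mu>" shows "jc (r * f) j = r * jc f j"
proof (induction r rule: pm_induct)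
  case (single c k)
  then have c: "out c" using assms(1) by (auto simp: poly_in_def)
  show ?case
  proof (rule poly_mapping_eqI)
    fix b
    show "lookup (jc (single c k * f) j) b = lookup (single c k * jc f j) b"
    proof (cases "\<exists>d. b = c + d")
      case True
      then obtain d where d: "b = c + d" by blast
      have "out b \<longleftrightarrow> out d" using c by (simp add: d out_addD)
      then show ?thesis using assms(2) outer_coeff_mult_out[of d A c k f] c
        by (auto simp: d lookup_jc lookup_single_mult co_scale)
    next
      case False
      then have "out b ==> oc b (single c k * f) = 0"
        using outer_coeff_mult_out'[OF _ c] by blast
      then show ?thesis using False assms(2) lookup_single_mult'[of b c k "jc f j"]
        by (auto simp: lookup_jc co_I)
    qed
  qed
qed (simp_all add: distrib_right jc_add jc_0 assms)

lemma oc_R: assumes "r \<in> R'" "out b" shows "oc b r = pconst (lookup r b)"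
proof (rule poly_mapping_eqI)
  fix c
  show "lookup (oc b r) c = lookup (pconst (lookup r b)) c"
  proof (cases "c = 0")
    case False
    then obtain v where v: "v \<in> keys c" by (metis keys_eq_empty ex_in_conv)
    have "lookup r (b + c) = 0" if "keys c \<subseteq> A"
    proof (rule ccontr)
      assume "lookup r (b + c) \<noteq> 0"
      then have "keys (b + c) \<subseteq> - A" using assms by (auto simp: poly_in_iff)
      moreover have "v \<in> keys (b + c)" using v by (simp add: in_keys_iff lookup_add)
      ultimately show False using v that by blast
    qed
    then show ?thesis using False by (auto simp: lookup_outer_coeff pconst_def lookup_single when_def)
  qed (simp add: lookup_outer_coeff pconst_def lookup_single)
qed

lemma jc_bs: "i < \<mu> ==> j < \<mu> ==> jc (bs ! i) j = (if i = j then 1 else 0)"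
proof (rule poly_mapping_eqI)
  fix b assume ij: "i < \<mu>" "j < \<mu>"
  have "oc b (bs ! i) = (if b = 0 then bs ! i else 0)" if "out b"
    using outer_coeff_mono_mult[OF that, of 0 "bs ! i"] bs_P[OF ij(1)] by (auto simp: single_one)
  then show "lookup (jc (bs ! i) j) b = lookup (if i = j then 1 else 0) b"
    using ij co_I[OF I_0] by (auto simp: lookup_jc co_bs lookup_one when_def)
qed

text \<open>The inner coefficient at each outer monomial is expanded in the basis separately; the
  scalars collected over all monomials are the \<open>jc f j\<close>.\<close>

lemma jc_spec: "f - (\<Sum>j<\<mu>. jc f j * bs ! j) \<in> IA 1"
proof (rule IA_eqI)
  fix b :: "'v \<Rightarrow>\<^sub>0 nat" assume b: "out b"
  have "oc b (jc f j * bs ! j) = pconst (co (oc b f) ! j) * bs ! j" if "j < \<mu>" for j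
    using outer_coeff_mult_in[OF b bs_P[OF that], of "jc f j"] oc_R[OF jc_R b, of f j] b that
    by (simp add: lookup_jc mult.commute)
  then have "oc b (\<Sum>j<\<mu>. jc f j * bs ! j) = (\<Sum>j<\<mu>. pconst (co (oc b f) ! j) * bs ! j)"
    by (simp add: outer_coeff_sum)
  then show "oc b f - oc b (\<Sum>j<\<mu>. jc f j * bs ! j) \<in> I 1" using co_spec[OF outer_coeff_in] by simp
qed

text \<open>The operators on the ambient polynomial ring that induce an \<open>R'\<close>-linear map
  modulo \<open>IA 1\<close>, that is, an endomorphism of J_V with scalars extended to the outer
  variables.\<close>

definition lop :: "(('v, 'k) mpol => ('v, 'k) mpol) => bool" where
  "lop T \<longleftrightarrow> (\<forall>f g. T (f + g) - (T f + T g) \<in> IA 1) \<and> (\<forall>r\<in>R'. \<forall>f. T (r * f) - r * T f \<in> IA 1) \<and>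
     (\<forall>f\<in>IA 1. T f \<in> IA 1)"

lemma lop_cong: assumes "lop T" "f - g \<in> IA 1" shows "T f - T g \<in> IA 1"
proof -
  have "T ((f - g) + g) - (T (f - g) + T g) \<in> IA 1" "T (f - g) \<in> IA 1" using assms unfolding lop_def by blast+
  from IA_add[OF this] show ?thesis by simp
qed

text \<open>Modulo \<open>IA 1\<close> the argument may be replaced by its expansion in the basis,
  since \<open>T\<close> preserves \<open>IA 1\<close> and is \<open>R'\<close>-linear there. When
  \<open>g\<close> is the value of another such operator, this turns composition into a matrix
  product.\<close>

lemma jc_lop:
  assumes T: "lop T" and a: "a < \<mu>"
  shows "jc (T g) a = (\<Sum>l<\<mu>. jc (T (bs ! l)) a * jc g l)"
proof -
  have T0: "T 0 \<in> IA 1" using T by (auto simp: lop_def)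
  have sums: "jc (T (sum h B)) a = (\<Sum>x\<in>B. jc (T (h x)) a)" if "finite B" for h and B :: "nat set"
    using that
  proof (induction B rule: finite_induct)
    case (insert x B)
    have "T (h x + sum h B) - (T (h x) + T (sum h B)) \<in> IA 1" using T unfolding lop_def by blast
    from jc_cong[OF this a] insert show ?case by (simp add: jc_add[OF a])
  qed (simp add: jc_IA[OF T0 a])
  have sc: "jc (T (jc g l * bs ! l)) a = jc (T (bs ! l)) a * jc g l" for l
  proof -
    have "T (jc g l * bs ! l) - jc g l * T (bs ! l) \<in> IA 1" using T jc_R unfolding lop_def by blast
    from jc_cong[OF this a] show ?thesis using jc_scale[OF jc_R a] by (simp add: mult.commute)
  qed
  have "jc (T g) a = jc (T (\<Sum>l<\<mu>. jc g l * bs ! l)) a"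
    by (intro jc_cong lop_cong[OF T] jc_spec a)
  then show ?thesis by (simp add: sums sc)
qed

lemma lop_mult: "lop ((*) f)"
  by (auto simp: lop_def algebra_simps)

lemma lop_Lop: "j < length ys ==> lop (Lop j f)"
  using IA_21[OF Lop_add_right] IA_21[OF Lop_R] Lop_I1 by (simp add: lop_def)

lemma lop_Kop: "i < length ys ==> j < length ys ==> lop (Kop i j f)"
  using Kop_add_right Kop_R Kop_I1 by (simp add: lop_def)

text \<open>With rows \<open>a\<close> and columns \<open>b\<close> these are the matrices over
  \<open>R'\<close> of multiplication by \<open>f\<close> and of its first and second commutators
  with the derivations. They are the entries of F_0, F_i and F_ij, and the rules
  \<open>phi0_mult\<close>, \<open>phi1_mult\<close>, \<open>phi2_mult\<close> are Leibniz rules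
  read in coordinates.\<close>

definition phi0 :: "('v, 'k) mpol => nat => nat => ('v, 'k) mpol" where "phi0 f a b = jc (f * bs ! b) a"
definition phi1 :: "nat => ('v, 'k) mpol => nat => nat => ('v, 'k) mpol" where "phi1 j f a b = jc (Lop j f (bs ! b)) a"
definition phi2 :: "nat => nat => ('v, 'k) mpol => nat => nat => ('v, 'k) mpol" where
  "phi2 i j f a b = jc (Kop i j f (bs ! b)) a"

lemma phi0_mult: "a < \<mu> ==> phi0 (f * g) a b = (\<Sum>l<\<mu>. phi0 f a l * phi0 g l b)"
  using jc_lop[OF lop_mult, of a f "g * bs ! b"] by (simp add: phi0_def mult.assoc)

lemma phi1_mult: "a < \<mu> ==> j < length ys ==>
    phi1 j (f * g) a b = (\<Sum>l<\<mu>. phi1 j f a l * phi0 g l b) + (\<Sum>l<\<mu>. phi0 f a l * phi1 j g l b)"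
  using jc_lop[OF lop_mult, of a f "Lop j g (bs ! b)"] jc_lop[OF lop_Lop, of j a f "g * bs ! b"]
  by (simp add: phi0_def phi1_def Lop_prod jc_add)

lemma phi2_mult: "a < \<mu> ==> i < length ys ==> j < length ys ==>
    phi2 i j (f * g) a b = (\<Sum>l<\<mu>. phi2 i j f a l * phi0 g l b) + (\<Sum>l<\<mu>. phi1 j f a l * phi1 i g l b)
      + (\<Sum>l<\<mu>. phi1 i f a l * phi1 j g l b) + (\<Sum>l<\<mu>. phi0 f a l * phi2 i j g l b)"
  using jc_lop[OF lop_mult, of a f "Kop i j g (bs ! b)"] jc_lop[OF lop_Lop, of j a f "Lop i g (bs ! b)"]
    jc_lop[OF lop_Lop, of i a f "Lop j g (bs ! b)"] jc_lop[OF lop_Kop, of i j a f "g * bs ! b"]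
    jc_cong[OF Kop_prod, of i j a f g "bs ! b"]
  by (simp add: phi0_def phi1_def phi2_def jc_add)

lemma phi0_add: "a < \<mu> ==> phi0 (f + g) a b = phi0 f a b + phi0 g a b"
  by (simp add: phi0_def distrib_right jc_add)
lemma phi1_add: "a < \<mu> ==> phi1 j (f + g) a b = phi1 j f a b + phi1 j g a b"
  using jc_cong[OF IA_21[OF Lop_add_left], of a j f g "bs ! b"] by (simp add: phi1_def jc_add)
lemma phi2_add: "a < \<mu> ==> i < length ys ==> j < length ys ==> phi2 i j (f + g) a b = phi2 i j f a b + phi2 i j g a b"
  using jc_cong[OF Kop_add_left, of i j a f g "bs ! b"] by (simp add: phi2_def jc_add)

lemma phi0_R: "a < \<mu> ==> b < \<mu> ==> r \<in> R' ==> phi0 r a b = (if a = b then r else 0)"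
  by (auto simp: phi0_def jc_scale jc_bs)
lemma phi1_R: "a < \<mu> ==> r \<in> R' ==> phi1 j r a b = 0"
  unfolding phi1_def by (rule jc_IA[OF IA_21[OF Lop_of_R]])
lemma phi2_R: "a < \<mu> ==> i < length ys ==> j < length ys ==> r \<in> R' ==> phi2 i j r a b = 0"
  unfolding phi2_def by (rule jc_IA[OF Kop_of_R])

lemma phi0_t: "a < \<mu> ==> l < length ys ==> phi0 (t l) a b = 0"
  unfolding phi0_def by (rule jc_IA[OF IA_t1])
text \<open>Multiplication by \<open>t_l\<close> vanishes on J_V, but its derivative in direction
  \<open>l\<close> is 1. The Clifford relation between \<open>\<gamma>_i\<close> and its partner has
  its unit from here.\<close>

lemma phi1_t: "a < \<mu> ==> b < \<mu> ==> i < length ys ==> l < length ys ==> phi1 i (t l) a b = (if i = l \<and> a = b then 1 else 0)"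
  using jc_cong[OF IA_21[OF Lop_of_t], of i l a "bs ! b"] by (auto simp: phi1_def jc_bs jc_0)

text \<open>The index convention is that of \<open>induced\<close>: the position in the matrix is
  the quotient by \<open>\<mu>\<close> and the basis element of J_V the remainder.\<close>

definition blk :: "(('v, 'k) mpol => nat => nat => ('v, 'k) mpol) => ('v, 'k) mpol mat => ('v, 'k) mpol mat" where
  "blk \<phi> F = mat (dim_row F * \<mu>) (dim_col F * \<mu>) (\<lambda>(P, Q). \<phi> (F $$ (P div \<mu>, Q div \<mu>)) (P mod \<mu>) (Q mod \<mu>))"

lemma blk_carrier [simp]: "F \<in> carrier_mat n m' ==> blk \<phi> F \<in> carrier_mat (n * \<mu>) (m' * \<mu>)"
  by (auto simp: blk_def)

lemma blk_index:
  assumes "F \<in> carrier_mat n m'" "P < n * \<mu>" "Q < m' * \<mu>"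
  shows "blk \<phi> F $$ (P, Q) = \<phi> (F $$ (P div \<mu>, Q div \<mu>)) (P mod \<mu>) (Q mod \<mu>)"
    "P div \<mu> < n" "Q div \<mu> < m'" "P mod \<mu> < \<mu>" "Q mod \<mu> < \<mu>"
proof -
  have "\<mu> > 0" using assms by (cases \<mu>) auto
  then show "blk \<phi> F $$ (P, Q) = \<phi> (F $$ (P div \<mu>, Q div \<mu>)) (P mod \<mu>) (Q mod \<mu>)"
    "P div \<mu> < n" "Q div \<mu> < m'" "P mod \<mu> < \<mu>" "Q mod \<mu> < \<mu>"
    using assms by (auto simp: blk_def less_mult_imp_div_less)
qed

lemma blk_mult_index:
  assumes F: "F \<in> carrier_mat n k" and G: "G \<in> carrier_mat k m'" and PQ: "P < n * \<mu>" "Q < m' * \<mu>"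
  shows "(blk \<alpha> F * blk \<beta> G) $$ (P, Q) =
    (\<Sum>r<k. \<Sum>l<\<mu>. \<alpha> (F $$ (P div \<mu>, r)) (P mod \<mu>) l * \<beta> (G $$ (r, Q div \<mu>)) l (Q mod \<mu>))"
proof -
  have "(blk \<alpha> F * blk \<beta> G) $$ (P, Q) = (\<Sum>s<k * \<mu>. blk \<alpha> F $$ (P, s) * blk \<beta> G $$ (s, Q))"
    by (rule index_mult[OF PQ blk_carrier[OF F] blk_carrier[OF G]])
  also have "\<dots> = (\<Sum>r<k. \<Sum>l<\<mu>. blk \<alpha> F $$ (P, r * \<mu> + l) * blk \<beta> G $$ (r * \<mu> + l, Q))" by (rule sum_blocks)
  also have "\<dots> = (\<Sum>r<k. \<Sum>l<\<mu>. \<alpha> (F $$ (P div \<mu>, r)) (P mod \<mu>) l * \<beta> (G $$ (r, Q div \<mu>)) l (Q mod \<mu>))"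
  proof (intro sum.cong refl)
    fix r l assume "r \<in> {..<k}" "l \<in> {..<\<mu>}"
    then have rl: "r < k" "l < \<mu>" by auto
    then have "r * \<mu> + l < k * \<mu>" using mult_le_mono1[of "Suc r" k \<mu>] by simp
    moreover have "(r * \<mu> + l) div \<mu> = r" by (rule div_nat_eqI) (use rl(2) in \<open>auto simp: algebra_simps\<close>)
    moreover have "(r * \<mu> + l) mod \<mu> = l" using rl(2) by simp
    ultimately show "blk \<alpha> F $$ (P, r * \<mu> + l) * blk \<beta> G $$ (r * \<mu> + l, Q) = \<alpha> (F $$ (P div \<mu>, r)) (P mod \<mu>) l * \<beta> (G $$ (r, Q div \<mu>)) l (Q mod \<mu>)"
      using rl by (simp add: blk_index(1)[OF F PQ(1)] blk_index(1)[OF G _ PQ(2)])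
  qed
  finally show ?thesis .
qed

lemma phi_0: "a < \<mu> ==> phi0 0 a b = 0" "a < \<mu> ==> phi1 j 0 a b = 0"
    "a < \<mu> ==> i < length ys ==> j < length ys ==> phi2 i j 0 a b = 0"
  using jc_0 phi1_R[OF _ poly_in_0] phi2_R[OF _ _ _ poly_in_0] by (simp_all add: phi0_def)

lemma phi_sum:
  assumes "a < \<mu>" shows "phi0 (sum g B) a b = (\<Sum>x\<in>B. phi0 (g x) a b)"
    "phi1 j (sum g B) a b = (\<Sum>x\<in>B. phi1 j (g x) a b)"
    "i < length ys ==> j < length ys ==> phi2 i j (sum g B) a b = (\<Sum>x\<in>B. phi2 i j (g x) a b)"
  using assms by (induction B rule: infinite_finite_induct; simp add: phi0_add phi1_add phi2_add phi_0)+

text \<open>The product rules for the entries, summed over the inner index. No Koszul signs occur,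
  because the derivations and the entries are even; signs enter only through the matrices
  themselves.\<close>

lemma blk_mult:
  assumes F: "F \<in> carrier_mat n k" and G: "G \<in> carrier_mat k m'"
  shows "blk phi0 (F * G) = blk phi0 F * blk phi0 G"
    and "j < length ys ==> blk (phi1 j) (F * G) = blk (phi1 j) F * blk phi0 G + blk phi0 F * blk (phi1 j) G"
    and "i < length ys ==> j < length ys ==> blk (phi2 i j) (F * G) =
      blk (phi2 i j) F * blk phi0 G + blk (phi1 j) F * blk (phi1 i) G + blk (phi1 i) F * blk (phi1 j) G + blk phi0 F * blk (phi2 i j) G"
proof -
  have FG: "F * G \<in> carrier_mat n m'" using F G by auto
  have c: "blk \<alpha> F * blk \<beta> G \<in> carrier_mat (n * \<mu>) (m' * \<mu>)" for \<alpha> \<beta>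
    by (rule mult_carrier_mat[OF blk_carrier[OF F] blk_carrier[OF G]])
  have e: "(F * G) $$ (P div \<mu>, Q div \<mu>) = (\<Sum>r<k. F $$ (P div \<mu>, r) * G $$ (r, Q div \<mu>))"
    if "P < n * \<mu>" "Q < m' * \<mu>" for P Q
    by (rule index_mult[OF blk_index(2,3)[OF FG that] F G])
  note b = blk_index(1)[OF FG] blk_mult_index[OF F G] e
  note C = blk_carrier[OF FG] c add_carrier_mat
  show "blk phi0 (F * G) = blk phi0 F * blk phi0 G"
  proof (rule mat_eqI[of _ "n * \<mu>" "m' * \<mu>"])
    fix P Q assume PQ: "P < n * \<mu>" "Q < m' * \<mu>"
    note a = blk_index(4)[OF FG PQ]
    show "blk phi0 (F * G) $$ (P, Q) = (blk phi0 F * blk phi0 G) $$ (P, Q)"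
      by (simp only: b[OF PQ] phi_sum[OF a] phi0_mult[OF a])
  qed (intro C)+
  show "blk (phi1 j) (F * G) = blk (phi1 j) F * blk phi0 G + blk phi0 F * blk (phi1 j) G" if j: "j < length ys"
  proof (rule mat_eqI[of _ "n * \<mu>" "m' * \<mu>"])
    fix P Q assume PQ: "P < n * \<mu>" "Q < m' * \<mu>"
    note a = blk_index(4)[OF FG PQ]
    show "blk (phi1 j) (F * G) $$ (P, Q) = (blk (phi1 j) F * blk phi0 G + blk phi0 F * blk (phi1 j) G) $$ (P, Q)"
      by (simp only: b[OF PQ] phi_sum[OF a] phi1_mult[OF a j] index_add[OF PQ c c] sum.distrib)
  qed (intro C)+
  show "blk (phi2 i j) (F * G) =
      blk (phi2 i j) F * blk phi0 G + blk (phi1 j) F * blk (phi1 i) G + blk (phi1 i) F * blk (phi1 j) G + blk phi0 F * blk (phi2 i j) G"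
    if ij: "i < length ys" "j < length ys"
  proof (rule mat_eqI[of _ "n * \<mu>" "m' * \<mu>"])
    fix P Q assume PQ: "P < n * \<mu>" "Q < m' * \<mu>"
    note a = blk_index(4)[OF FG PQ]
    show "blk (phi2 i j) (F * G) $$ (P, Q) = (blk (phi2 i j) F * blk phi0 G + blk (phi1 j) F * blk (phi1 i) G
        + blk (phi1 i) F * blk (phi1 j) G + blk phi0 F * blk (phi2 i j) G) $$ (P, Q)"
      by (simp only: b[OF PQ] phi_sum[OF a] phi_sum(3)[OF a ij] phi2_mult[OF a ij] index_add[OF PQ _ c] c C sum.distrib)
  qed (intro C)+
qed

lemma blk_add:
  assumes "F \<in> carrier_mat n k" "G \<in> carrier_mat n k"
  shows "blk phi0 (F + G) = blk phi0 F + blk phi0 G" "blk (phi1 j) (F + G) = blk (phi1 j) F + blk (phi1 j) G"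
    "i < length ys ==> j < length ys ==> blk (phi2 i j) (F + G) = blk (phi2 i j) F + blk (phi2 i j) G"
proof -
  have FG: "F + G \<in> carrier_mat n k" using assms by auto
  have *: "blk \<phi> (F + G) = blk \<phi> F + blk \<phi> G"
    if "\<And>f g a b. a < \<mu> ==> \<phi> (f + g) a b = \<phi> f a b + \<phi> g a b" for \<phi>
  proof (rule mat_eqI[of _ "n * \<mu>" "k * \<mu>"])
    fix P Q assume PQ: "P < n * \<mu>" "Q < k * \<mu>"
    show "blk \<phi> (F + G) $$ (P, Q) = (blk \<phi> F + blk \<phi> G) $$ (P, Q)"
      unfolding index_add[OF PQ blk_carrier[OF assms(1)] blk_carrier[OF assms(2)]] blk_index(1)[OF FG PQ]
        blk_index(1)[OF assms(1) PQ] blk_index(1)[OF assms(2) PQ] index_add[OF blk_index(2,3)[OF FG PQ] assms]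
      by (rule that[OF blk_index(4)[OF FG PQ]])
  qed (use FG assms in auto)
  show "blk phi0 (F + G) = blk phi0 F + blk phi0 G" "blk (phi1 j) (F + G) = blk (phi1 j) F + blk (phi1 j) G"
    "i < length ys ==> j < length ys ==> blk (phi2 i j) (F + G) = blk (phi2 i j) F + blk (phi2 i j) G"
    by (intro * phi0_add phi1_add phi2_add; assumption)+
qed

end

section \<open>Partial derivatives\<close>

text \<open>Every rule below reduces to this coefficient formula; in the definition the subtraction
  of exponents is truncated, but then the exponent in front is 0.\<close>

lemma lookup_pdiff: "lookup (pdiff v p) a =
    of_nat (Suc (lookup a v)) * lookup p (a + single v 1)"
proof -
  let ?e = "single v (1::nat)"
  have "lookup (pdiff v p) a = (\<Sum>b\<in>keys p.
      if b = a + ?e then of_nat (Suc (lookup a v)) * lookup p (a + ?e) else 0)"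
    unfolding pdiff_def lookup_sum
  proof (rule sum.cong[OF refl])
    fix b assume "b \<in> keys p"
    show "lookup (single (b - ?e) (of_nat (lookup b v) * lookup p b)) a
      = (if b = a + ?e then of_nat (Suc (lookup a v)) * lookup p (a + ?e) else 0)"
    proof (cases "lookup b v = 0")
      case True
      then show ?thesis by (auto simp: lookup_single lookup_add)
    next
      case False
      have "b - ?e = a \<longleftrightarrow> b = a + ?e"
      proof
        assume *: "b - ?e = a"
        show "b = a + ?e"
          by (rule poly_mapping_eqI) (use False in \<open>auto simp: *[symmetric] lookup_add lookup_minus lookup_single when_def\<close>)
      qed simp
      then show ?thesis by (auto simp: lookup_single lookup_add when_def)
    qed
  qed
  also have "\<dots> = of_nat (Suc (lookup a v)) * lookup p (a + ?e)"
    by (simp add: in_keys_iff)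
  finally show ?thesis .
qed

lemma pdiff_add: "pdiff v (p + q) = pdiff v p + pdiff v q"
  by (rule poly_mapping_eqI) (simp add: lookup_pdiff lookup_add algebra_simps)

lemma pdiff_0 [simp]: "pdiff v 0 = 0"
  by (rule poly_mapping_eqI) (simp add: lookup_pdiff)

lemma pdiff_diff: "pdiff v (p - q) = pdiff v p - pdiff v q"
  by (rule poly_mapping_eqI) (simp add: lookup_pdiff lookup_minus algebra_simps)

lemma pdiff_sum: "pdiff v (sum g B) = (\<Sum>x\<in>B. pdiff v (g x))"
  by (induction B rule: infinite_finite_induct) (auto simp: pdiff_add)

lemma pdiff_commute: "pdiff v (pdiff w p) = pdiff w (pdiff v p)"
  by (cases "v = w") (auto intro!: poly_mapping_eqI simp: lookup_pdiff lookup_add lookup_single ac_simps)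

lemma pdiff_single: "pdiff v (single a k) =
    single (a - single v 1) (of_nat (lookup a v) * k)"
  by (cases "k = 0") (simp_all add: pdiff_def)

lemma pdiff_mult: "pdiff v (p * q) = pdiff v p * q + p * pdiff v q"
proof (induction p rule: pm_induct)
  case (single a k)
  show ?case
  proof (induction q rule: pm_induct)
    case (single b l)
    let ?e = "single v (1::nat)"
    \<comment> \<open>Truncated subtraction of exponents is compatible with addition only if
      \<open>v\<close> occurs in the monomial; otherwise the corresponding summand of the product
      rule has coefficient 0.\<close>
    have 1: "(a - ?e) + b = a + b - ?e" if "lookup a v \<noteq> 0"
      by (rule poly_mapping_eqI) (use that in \<open>auto simp: lookup_add lookup_minus lookup_single when_def\<close>)
    have 2: "a + (b - ?e) = a + b - ?e" if "lookup b v \<noteq> 0"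
      by (rule poly_mapping_eqI) (use that in \<open>auto simp: lookup_add lookup_minus lookup_single when_def\<close>)
    show ?case
      using 1 2 by (cases "lookup a v = 0"; cases "lookup b v = 0")
        (simp_all add: mult_single pdiff_single lookup_add algebra_simps single_add)
  qed (simp_all add: distrib_left pdiff_add)
qed (simp_all add: distrib_right pdiff_add)

lemma pdiff_outside: "p \<in> poly_in B ==> v \<notin> B ==> pdiff v p = 0"
proof (rule poly_mapping_eqI)
  fix a :: "'a \<Rightarrow>\<^sub>0 nat" assume p: "p \<in> poly_in B" "v \<notin> B"
  have "v \<in> keys (a + single v 1)" by (simp add: in_keys_iff lookup_add)
  then have "lookup p (a + single v 1) = 0" using p by (auto simp: poly_in_iff)
  then show "lookup (pdiff v p) a = lookup 0 a" by (simp add: lookup_pdiff)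
qed

lemma pdiff_in: assumes "p \<in> poly_in B" shows "pdiff v p \<in> poly_in B"
  unfolding poly_in_iff
proof (intro allI impI)
  fix a assume "lookup (pdiff v p) a \<noteq> 0"
  then have "lookup p (a + single v 1) \<noteq> 0" by (auto simp: lookup_pdiff)
  then have "keys (a + single v 1) \<subseteq> B" using assms by (auto simp: poly_in_iff)
  then show "keys a \<subseteq> B" by (auto simp: in_keys_iff lookup_add)
qed

lemma pdiff_1 [simp]: "pdiff v 1 = 0" using pdiff_outside[of 1 "{}" v] by simp

lemma map_pdiff_mult:
  assumes "F \<in> carrier_mat n k" "G \<in> carrier_mat k m"
  shows "map_mat (pdiff v) (F * G) = map_mat (pdiff v) F * G + F * map_mat (pdiff v) G"
proof (rule mat_eqI[of _ n m])
  fix i j assume ij: "i < n" "j < m"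
  have c: "map_mat (pdiff v) F * G \<in> carrier_mat n m" "F * map_mat (pdiff v) G \<in> carrier_mat n m"
    "map_mat (pdiff v) F \<in> carrier_mat n k" "map_mat (pdiff v) G \<in> carrier_mat k m" using assms by auto
  have "map_mat (pdiff v) (F * G) $$ (i, j) = pdiff v ((F * G) $$ (i, j))" using assms ij by simp
  then show "map_mat (pdiff v) (F * G) $$ (i, j) = (map_mat (pdiff v) F * G + F * map_mat (pdiff v) G) $$ (i, j)"
    unfolding index_add[OF ij c(1,2)] index_mult[OF ij assms] index_mult[OF ij c(3) assms(2)] index_mult[OF ij assms(1) c(4)]
    using assms ij by (simp add: pdiff_sum pdiff_mult sum.distrib)
qed (use assms in auto)

section \<open>Tensor products of matrices\<close>

lemma tens_carrier: "f \<in> carrier_mat a b ==> g \<in> carrier_mat c e ==> tens_mat q par f g \<in> carrier_mat (a * c) (b * e)"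
  by (auto simp: tens_mat_def)

lemma tens_index:
  assumes "f \<in> carrier_mat a b" "g \<in> carrier_mat c e" "P < a * c" "Q < b * e"
  shows "tens_mat q par f g $$ (P, Q) = (if q \<and> par ! (Q div e) then - 1 else 1) * f $$ (P div c, Q div e) * g $$ (P mod c, Q mod e)"
    "P div c < a" "P mod c < c" "Q div e < b" "Q mod e < e"
proof -
  have "c > 0" using assms(3) by (cases c) auto
  moreover have "e > 0" using assms(4) by (cases e) auto
  ultimately show "tens_mat q par f g $$ (P, Q) = (if q \<and> par ! (Q div e) then - 1 else 1) * f $$ (P div c, Q div e) * g $$ (P mod c, Q mod e)"
    "P div c < a" "P mod c < c" "Q div e < b" "Q mod e < e"
    using assms by (auto simp: tens_mat_def less_mult_imp_div_less)
qed

lemma tens_eqI: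
  assumes "F \<in> carrier_mat (a * c) (b * e)" "f \<in> carrier_mat a b" "g \<in> carrier_mat c e"
    "\<And>P Q. P < a * c ==> Q < b * e ==> F $$ (P, Q) = (if q \<and> par ! (Q div e) then - 1 else 1) * f $$ (P div c, Q div e) * g $$ (P mod c, Q mod e)"
  shows "F = tens_mat q par f g"
  by (rule mat_eqI[OF assms(1) tens_carrier[OF assms(2,3)]]) (simp add: assms(4) tens_index[OF assms(2,3)])

text \<open>The sign is the Koszul sign for moving \<open>g'\<close> past \<open>f\<close>. In
  coordinates the sign of \<open>g'\<close> depends on the parity of the intermediate basis vector,
  which differs from that of the source vector by \<open>pf\<close> wherever the entry of
  \<open>f\<close> is nonzero.\<close>

lemma tens_mult:
  fixes f :: "'r::comm_ring_1 mat"
  assumes f: "f \<in> hom_maps UNIV pf Y Y'" and g: "g \<in> carrier_mat x' x"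
    and f': "f' \<in> carrier_mat y'' (mf_rank Y')" and g': "g' \<in> carrier_mat x'' x'"
  shows "tens_mat q' (mf_par Y') f' g' * tens_mat q (mf_par Y) f g =
    (if q' \<and> pf then - 1 else 1) \<cdot>\<^sub>m tens_mat (q' \<noteq> q) (mf_par Y) (f' * f) (g' * g)"
proof (rule mat_eqI[of _ "y'' * x''" "mf_rank Y * x"])
  note fc = hom_mapsD(1)[OF f]
  have ff: "f' * f \<in> carrier_mat y'' (mf_rank Y)" "g' * g \<in> carrier_mat x'' x" using fc g f' g' by auto
  note T = tens_carrier[OF f' g', of q' "mf_par Y'"] and T' = tens_carrier[OF fc g, of q "mf_par Y"]
    and T'' = tens_carrier[OF ff, of "q' \<noteq> q" "mf_par Y"]
  show "tens_mat q' (mf_par Y') f' g' * tens_mat q (mf_par Y) f g \<in> carrier_mat (y'' * x'') (mf_rank Y * x)"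
    by (rule mult_carrier_mat[OF T T'])
  show "(if q' \<and> pf then - 1 else 1) \<cdot>\<^sub>m tens_mat (q' \<noteq> q) (mf_par Y) (f' * f) (g' * g) \<in> carrier_mat (y'' * x'') (mf_rank Y * x)"
    using T'' by simp
  fix P Q assume P: "P < y'' * x''" and Q: "Q < mf_rank Y * x"
  note i = tens_index(2-5)[OF ff P Q]
  let ?s = "\<lambda>b. if b then - 1 else (1::'r)"
  have "(tens_mat q' (mf_par Y') f' g' * tens_mat q (mf_par Y) f g) $$ (P, Q) =
     (\<Sum>s<mf_rank Y' * x'. tens_mat q' (mf_par Y') f' g' $$ (P, s) * tens_mat q (mf_par Y) f g $$ (s, Q))"
    by (rule index_mult[OF P Q T T'])
  also have "\<dots> = (\<Sum>a<mf_rank Y'. \<Sum>b<x'. tens_mat q' (mf_par Y') f' g' $$ (P, a * x' + b) * tens_mat q (mf_par Y) f g $$ (a * x' + b, Q))"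
    by (rule sum_blocks)
  also have "\<dots> = (\<Sum>a<mf_rank Y'. \<Sum>b<x'. ?s (q' \<and> pf) * ?s ((q' \<noteq> q) \<and> mf_par Y ! (Q div x)) *
      (f' $$ (P div x'', a) * f $$ (a, Q div x)) * (g' $$ (P mod x'', b) * g $$ (b, Q mod x)))"
  proof (intro sum.cong refl)
    fix a b assume "a \<in> {..<mf_rank Y'}" "b \<in> {..<x'}"
    then have ab: "a < mf_rank Y'" "b < x'" by auto
    have s: "a * x' + b < mf_rank Y' * x'" using ab mult_le_mono1[of "Suc a" "mf_rank Y'" x'] by simp
    have d: "(a * x' + b) div x' = a" "(a * x' + b) mod x' = b"
      by (rule div_nat_eqI) (use ab in \<open>auto simp: algebra_simps\<close>)
    show "tens_mat q' (mf_par Y') f' g' $$ (P, a * x' + b) * tens_mat q (mf_par Y) f g $$ (a * x' + b, Q) =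
      ?s (q' \<and> pf) * ?s ((q' \<noteq> q) \<and> mf_par Y ! (Q div x)) *
      (f' $$ (P div x'', a) * f $$ (a, Q div x)) * (g' $$ (P mod x'', b) * g $$ (b, Q mod x))"
      unfolding tens_index(1)[OF f' g' P s] tens_index(1)[OF fc g s Q] d
      using hom_mapsD(3)[OF f ab(1) i(3)] by (cases "f $$ (a, Q div x) = 0") auto
  qed
  also have "\<dots> = ?s (q' \<and> pf) * ?s ((q' \<noteq> q) \<and> mf_par Y ! (Q div x)) *
      ((\<Sum>a<mf_rank Y'. f' $$ (P div x'', a) * f $$ (a, Q div x)) * (\<Sum>b<x'. g' $$ (P mod x'', b) * g $$ (b, Q mod x)))"
    unfolding sum_product by (simp only: sum_distrib_left mult.assoc)
  also have "\<dots> = ?s (q' \<and> pf) * tens_mat (q' \<noteq> q) (mf_par Y) (f' * f) (g' * g) $$ (P, Q)"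
    unfolding tens_index(1)[OF ff P Q] index_mult[OF i(1,3) f' fc] index_mult[OF i(2,4) g' g] by (simp only: mult.assoc)
  finally show "(tens_mat q' (mf_par Y') f' g' * tens_mat q (mf_par Y) f g) $$ (P, Q) =
      (?s (q' \<and> pf) \<cdot>\<^sub>m tens_mat (q' \<noteq> q) (mf_par Y) (f' * f) (g' * g)) $$ (P, Q)"
    using P Q T'' by simp
qed

lemma tens_lin:
  assumes "f \<in> carrier_mat a b" "f' \<in> carrier_mat a b" "g \<in> carrier_mat c e" "g' \<in> carrier_mat c e"
  shows "tens_mat q par (f + f') g = tens_mat q par f g + tens_mat q par f' g"
    "tens_mat q par (f - f') g = tens_mat q par f g - tens_mat q par f' g"
    "tens_mat q par f (g + g') = tens_mat q par f g + tens_mat q par f g'"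
    "tens_mat q par f (g - g') = tens_mat q par f g - tens_mat q par f g'"
    "tens_mat q par (k \<cdot>\<^sub>m f) g = k \<cdot>\<^sub>m tens_mat q par f g"
    "tens_mat q par f (k \<cdot>\<^sub>m g) = k \<cdot>\<^sub>m tens_mat q par f g"
    "tens_mat q par (- f) g = - tens_mat q par f g"
    "tens_mat q par f (- g) = - tens_mat q par f g"
proof -
  note T = tens_carrier[OF assms(1,3), of q par] tens_carrier[OF assms(1,4), of q par] tens_carrier[OF assms(2,3), of q par]
  have mc: "f - f' \<in> carrier_mat a b" "g - g' \<in> carrier_mat c e" using assms by (auto intro: minus_carrier_mat)
  note i = tens_index[OF assms(1,3)] tens_index[OF assms(1,4)] tens_index[OF assms(2,3)]
  show "tens_mat q par (f + f') g = tens_mat q par f g + tens_mat q par f' g"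
    "tens_mat q par (f - f') g = tens_mat q par f g - tens_mat q par f' g"
    "tens_mat q par f (g + g') = tens_mat q par f g + tens_mat q par f g'"
    "tens_mat q par f (g - g') = tens_mat q par f g - tens_mat q par f g'"
    "tens_mat q par (k \<cdot>\<^sub>m f) g = k \<cdot>\<^sub>m tens_mat q par f g"
    "tens_mat q par f (k \<cdot>\<^sub>m g) = k \<cdot>\<^sub>m tens_mat q par f g"
    "tens_mat q par (- f) g = - tens_mat q par f g"
    "tens_mat q par f (- g) = - tens_mat q par f g"
    by (rule tens_eqI[where a = a and b = b and c = c and e = e, symmetric];
       insert T assms mc i(2-5); auto simp: i(1) tens_index(1)[OF assms(1,4)] tens_index(1)[OF assms(2,3)] algebra_simps intro: minus_carrier_mat)+
qed

section \<open>The tensor product of matrix factorisations\<close>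

text \<open>The tensor product over \<open>k[x,y,z]\<close> before it is restricted to J_V.
  Homotopies are constructed here and then reduced.\<close>

definition tmf :: "'r::comm_ring_1 mf => 'r mf => 'r mf" where
  "tmf Y X = MF (map (\<lambda>P. mf_par Y ! (P div mf_rank X) \<noteq> mf_par X ! (P mod mf_rank X)) [0..<mf_rank Y * mf_rank X])
     (tens_d Y X)"

lemma tmf_simps [simp]: "mf_rank (tmf Y X) = mf_rank Y * mf_rank X" "mf_d (tmf Y X) = tens_d Y X"
    "P < mf_rank Y * mf_rank X ==> mf_par (tmf Y X) ! P = (mf_par Y ! (P div mf_rank X) \<noteq> mf_par X ! (P mod mf_rank X))"
  by (simp_all add: tmf_def mf_rank_def)

lemma hom_maps_mono: "f \<in> hom_maps B p X Y ==> B \<subseteq> C ==> f \<in> hom_maps C p X Y"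
  by (auto simp: hom_maps_def)

abbreviation sgn_of :: "bool => 'r::comm_ring_1" where "sgn_of b \<equiv> (if b then - 1 else 1)"

lemma tens_hom:
  fixes f :: "('v, 'k::comm_ring_1) mpol mat"
  assumes f: "f \<in> hom_maps (poly_in E) p Y Y'" and g: "g \<in> hom_maps (poly_in E) q X X'"
  shows "tens_mat q (mf_par Y) f g \<in> hom_maps (poly_in E) (p \<noteq> q) (tmf Y X) (tmf Y' X')"
proof (rule hom_mapsI)
  note c = hom_mapsD(1)[OF f] hom_mapsD(1)[OF g]
  show "tens_mat q (mf_par Y) f g \<in> carrier_mat (mf_rank (tmf Y' X')) (mf_rank (tmf Y X))"
    using tens_carrier[OF c] by simp
  fix P Q assume "P < mf_rank (tmf Y' X')" "Q < mf_rank (tmf Y X)"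
  then have PQ: "P < mf_rank Y' * mf_rank X'" "Q < mf_rank Y * mf_rank X" by simp_all
  note i = tens_index[OF c PQ]
  have "f $$ (P div mf_rank X', Q div mf_rank X) \<in> poly_in E" "g $$ (P mod mf_rank X', Q mod mf_rank X) \<in> poly_in E"
    using hom_mapsD(2)[OF f i(2,4)] hom_mapsD(2)[OF g i(3,5)] by auto
  then show "tens_mat q (mf_par Y) f g $$ (P, Q) \<in> poly_in E"
    unfolding i(1) by (intro poly_in_mult) auto
  assume "tens_mat q (mf_par Y) f g $$ (P, Q) \<noteq> 0"
  then have "f $$ (P div mf_rank X', Q div mf_rank X) \<noteq> 0" "g $$ (P mod mf_rank X', Q mod mf_rank X) \<noteq> 0"
    unfolding i(1) by auto
  then show "(mf_par (tmf Y' X') ! P \<noteq> mf_par (tmf Y X) ! Q) = (p \<noteq> q)"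
    using hom_mapsD(3)[OF f i(2,4)] hom_mapsD(3)[OF g i(3,5)] PQ by auto
qed

lemma tens_d_hom:
  assumes "mfR (poly_in E) Y" "mfR (poly_in E) X"
  shows "mfR (poly_in E) (tmf Y X)"
proof -
  have "tens_mat False (mf_par Y) (mf_d Y) (1\<^sub>m (mf_rank X)) \<in> hom_maps (poly_in E) True (tmf Y X) (tmf Y X)"
    using tens_hom[OF assms(1)[unfolded mfR_def] pr.hom_maps_1[of X E]] by simp
  moreover have "tens_mat True (mf_par Y) (1\<^sub>m (mf_rank Y)) (mf_d X) \<in> hom_maps (poly_in E) True (tmf Y X) (tmf Y X)"
    using tens_hom[OF pr.hom_maps_1[of Y E] assms(2)[unfolded mfR_def]] by simp
  ultimately show ?thesis unfolding mfR_def tens_d_def tmf_simps by (rule pr.hom_maps_add(1))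
qed

lemma dcomm_alt:
  assumes "mf_d X \<in> carrier_mat (mf_rank X) (mf_rank X)" "mf_d Y \<in> carrier_mat (mf_rank Y) (mf_rank Y)"
    "f \<in> carrier_mat (mf_rank Y) (mf_rank X)"
  shows "dcomm p X Y f = mf_d Y * f - sgn_of p \<cdot>\<^sub>m (f * mf_d X)"
  using assms by (auto simp: dcomm_def intro!: eq_matI)

lemma one_smult [simp]: "1 \<cdot>\<^sub>m A = (A :: 'r::comm_ring_1 mat)" "- 1 \<cdot>\<^sub>m A = - A"
  by auto

text \<open>The graded Leibniz rule for the tensor differential. Both products with the differential
  are computed by \<open>tens_mult\<close>; the signs found there are those needed to collect the
  four terms into two commutators.\<close>

lemma dcomm_tens:
  fixes f :: "('v, 'k::comm_ring_1) mpol mat"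
  assumes Y: "mfR (poly_in E) Y" "mfR (poly_in E) Y'" and X: "mfR (poly_in E) X" "mfR (poly_in E) X'"
    and f: "f \<in> hom_maps (poly_in E) pf Y Y'" and g: "g \<in> hom_maps (poly_in E) q X X'"
  shows "dcomm (pf \<noteq> q) (tmf Y X) (tmf Y' X') (tens_mat q (mf_par Y) f g) =
     tens_mat q (mf_par Y) (dcomm pf Y Y' f) g + sgn_of pf \<cdot>\<^sub>m tens_mat (\<not> q) (mf_par Y) f (dcomm q X X' g)"
proof -
  have U: "h \<in> hom_maps (poly_in E) p A B ==> h \<in> hom_maps UNIV p A B" for h p A B
    by (rule hom_maps_mono) auto
  have d: "mf_d Y \<in> hom_maps (poly_in E) True Y Y" "mf_d Y' \<in> hom_maps (poly_in E) True Y' Y'"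
     "mf_d X \<in> hom_maps (poly_in E) True X X" "mf_d X' \<in> hom_maps (poly_in E) True X' X'" using Y X by (auto simp: mfR_def)
  note dc = d[THEN hom_mapsD(1)]
  note c = hom_mapsD(1)[OF f] hom_mapsD(1)[OF g]
  have pc: "mf_d Y' * f \<in> carrier_mat (mf_rank Y') (mf_rank Y)" "f * mf_d Y \<in> carrier_mat (mf_rank Y') (mf_rank Y)"
      "mf_d X' * g \<in> carrier_mat (mf_rank X') (mf_rank X)" "g * mf_d X \<in> carrier_mat (mf_rank X') (mf_rank X)"
    using dc c by auto
  let ?N = "mf_rank Y * mf_rank X" and ?N' = "mf_rank Y' * mf_rank X'"
  let ?T1 = "tens_mat q (mf_par Y) (mf_d Y' * f) g" and ?T2 = "tens_mat (\<not> q) (mf_par Y) f (mf_d X' * g)"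
    and ?T3 = "tens_mat q (mf_par Y) (f * mf_d Y) g" and ?T4 = "tens_mat (\<not> q) (mf_par Y) f (g * mf_d X)"
  let ?F = "tens_mat q (mf_par Y) f g"
  have one: "1\<^sub>m (mf_rank X') \<in> carrier_mat (mf_rank X') (mf_rank X')" "1\<^sub>m (mf_rank Y') \<in> carrier_mat (mf_rank Y') (mf_rank Y')"
    "1\<^sub>m (mf_rank X) \<in> carrier_mat (mf_rank X) (mf_rank X)" by auto
  have T: "?T1 \<in> carrier_mat ?N' ?N" "?T2 \<in> carrier_mat ?N' ?N" "?T3 \<in> carrier_mat ?N' ?N" "?T4 \<in> carrier_mat ?N' ?N" "?F \<in> carrier_mat ?N' ?N"
    by (intro tens_carrier pc c)+
  have L: "tens_d Y' X' * ?F = ?T1 + sgn_of pf \<cdot>\<^sub>m ?T2"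
    unfolding tens_d_def
    using tens_mult[OF U[OF f] c(2) dc(2) one(1), of False q] tens_mult[OF U[OF f] c(2) one(2) dc(4), of True q]
    by (subst add_mult_distrib_mat[of _ ?N' ?N']) (use c T tens_carrier[OF dc(2) one(1)] tens_carrier[OF one(2) dc(4)] in auto)
  have R: "?F * tens_d Y X = sgn_of q \<cdot>\<^sub>m ?T3 + ?T4"
    unfolding tens_d_def
    using tens_mult[OF U[OF d(1)] one(3) c, of q False] tens_mult[OF U[OF pr.hom_maps_1] dc(3) c, of q True]
    by (subst mult_add_distrib_mat[of _ ?N' ?N]) (use c T tens_carrier[OF dc(1) one(3)] tens_carrier[OF _ dc(3)] in auto)
  have D: "tens_d Y X \<in> carrier_mat ?N ?N" "tens_d Y' X' \<in> carrier_mat ?N' ?N'"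
    using tens_d_hom[OF Y(1) X(1)] tens_d_hom[OF Y(2) X(2)] hom_mapsD(1)[of "tens_d Y X" "poly_in E" True "tmf Y X" "tmf Y X"]
     hom_mapsD(1)[of "tens_d Y' X'" "poly_in E" True "tmf Y' X'" "tmf Y' X'"] by (auto simp: mfR_def)
  have "dcomm (pf \<noteq> q) (tmf Y X) (tmf Y' X') ?F = (?T1 + sgn_of pf \<cdot>\<^sub>m ?T2) - sgn_of (pf \<noteq> q) \<cdot>\<^sub>m (sgn_of q \<cdot>\<^sub>m ?T3 + ?T4)"
    using D T by (subst dcomm_alt) (auto simp: L R)
  moreover have "tens_mat q (mf_par Y) (dcomm pf Y Y' f) g = ?T1 - sgn_of pf \<cdot>\<^sub>m ?T3"
    unfolding dcomm_alt[OF dc(1,2) c(1)] using pc c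
    by (simp add: tens_lin(2)[of _ "mf_rank Y'" "mf_rank Y" _ g "mf_rank X'" "mf_rank X" g]
       tens_lin(5)[of _ "mf_rank Y'" "mf_rank Y" _ g "mf_rank X'" "mf_rank X" g] tens_lin(7)[of _ "mf_rank Y'" "mf_rank Y" _ g "mf_rank X'" "mf_rank X" g])
  moreover have "tens_mat (\<not> q) (mf_par Y) f (dcomm q X X' g) = ?T2 - sgn_of q \<cdot>\<^sub>m ?T4"
    unfolding dcomm_alt[OF dc(3,4) c(2)] using pc c
    by (simp add: tens_lin(4)[of f "mf_rank Y'" "mf_rank Y" f _ "mf_rank X'" "mf_rank X"]
       tens_lin(6)[of f "mf_rank Y'" "mf_rank Y" f _ "mf_rank X'" "mf_rank X" _] tens_lin(8)[of f "mf_rank Y'" "mf_rank Y" f _ "mf_rank X'" "mf_rank X" _])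
  ultimately show ?thesis
    using T by (intro mat_eqI[of _ ?N' ?N]) (auto intro: minus_carrier_mat split: if_splits simp: algebra_simps)
qed

lemma tens_one: "tens_mat False par (1\<^sub>m a) (1\<^sub>m b) = (1\<^sub>m (a * b) :: 'r::comm_ring_1 mat)"
proof (rule tens_eqI[where a = a and b = a and c = b and e = b, symmetric])
  fix P Q assume PQ: "P < a * b" "Q < a * b"
  note i = tens_index(2-5)[OF one_carrier_mat one_carrier_mat PQ]
  have "P = Q \<longleftrightarrow> P div b = Q div b \<and> P mod b = Q mod b" by (metis div_mult_mod_eq)
  then show "(1\<^sub>m (a * b) :: 'r mat) $$ (P, Q) = (if False \<and> par ! (Q div b) then - 1 else 1) * 1\<^sub>m a $$ (P div b, Q div b) * 1\<^sub>m b $$ (P mod b, Q mod b)"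
    using PQ i by auto
qed auto

text \<open>The two cross terms cancel, because moving the odd \<open>d_X\<close> past the odd
  \<open>d_Y\<close> costs a sign.\<close>

lemma tens_d_square:
  fixes Y :: "('v, 'k::comm_ring_1) mpol mf"
  assumes Y: "mfR (poly_in E) Y" and X: "mfR (poly_in E) X"
    and "mf_d Y * mf_d Y = u \<cdot>\<^sub>m 1\<^sub>m (mf_rank Y)" "mf_d X * mf_d X = v \<cdot>\<^sub>m 1\<^sub>m (mf_rank X)"
  shows "tens_d Y X * tens_d Y X = (u + v) \<cdot>\<^sub>m 1\<^sub>m (mf_rank Y * mf_rank X)"
proof -
  let ?N = "mf_rank Y * mf_rank X"
  have U: "h \<in> hom_maps (poly_in E) p A B ==> h \<in> hom_maps UNIV p A B" for h p A B
    by (rule hom_maps_mono) auto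
  have d: "mf_d Y \<in> hom_maps (poly_in E) True Y Y" "mf_d X \<in> hom_maps (poly_in E) True X X" using Y X by (auto simp: mfR_def)
  note dc = d[THEN hom_mapsD(1)]
  let ?A = "tens_mat False (mf_par Y) (mf_d Y) (1\<^sub>m (mf_rank X))" and ?B = "tens_mat True (mf_par Y) (1\<^sub>m (mf_rank Y)) (mf_d X)"
  have c: "?A \<in> carrier_mat ?N ?N" "?B \<in> carrier_mat ?N ?N" by (intro tens_carrier dc one_carrier_mat)+
  have cc: "?A * ?A \<in> carrier_mat ?N ?N" "?A * ?B \<in> carrier_mat ?N ?N" "?B * ?A \<in> carrier_mat ?N ?N" "?B * ?B \<in> carrier_mat ?N ?N" using c by auto
  note o1 = one_carrier_mat[of "mf_rank X"] and o2 = one_carrier_mat[of "mf_rank Y"]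
  have AA: "?A * ?A = u \<cdot>\<^sub>m 1\<^sub>m ?N"
    using tens_mult[OF U[OF d(1)] o1 dc(1) o1, of False False] assms(3)
    by (simp add: tens_lin(5)[OF o2 o2 o1 o1] tens_one)
  have BB: "?B * ?B = v \<cdot>\<^sub>m 1\<^sub>m ?N"
    using tens_mult[OF U[OF pr.hom_maps_1] dc(2) o2 dc(2), of True True] assms(4)
    by (simp add: tens_lin(6)[OF o2 o2 o1 o1] tens_one)
  have AB: "?A * ?B = tens_mat True (mf_par Y) (mf_d Y) (mf_d X)"
    using tens_mult[OF U[OF pr.hom_maps_1] dc(2) dc(1) o1, of False True] dc by simp
  have BA: "?B * ?A = - tens_mat True (mf_par Y) (mf_d Y) (mf_d X)"
    using tens_mult[OF U[OF d(1)] o1 o2 dc(2), of True False] dc by simp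
  have "tens_d Y X * tens_d Y X = (?A * ?A + ?A * ?B) + (?B * ?A + ?B * ?B)"
    unfolding tens_d_def add_mult_distrib_mat[OF c(1,2) add_carrier_mat[OF c(2)]]
      mult_add_distrib_mat[OF c(1) c] mult_add_distrib_mat[OF c(2) c] ..
  also have "\<dots> = (u + v) \<cdot>\<^sub>m 1\<^sub>m ?N"
    unfolding AA BB AB BA using tens_carrier[OF dc, of True "mf_par Y"]
    by (intro mat_eqI[of _ ?N ?N]) (auto simp: algebra_simps)
  finally show ?thesis .
qed

section \<open>Block matrices of the cut\<close>

context cut_data
begin

abbreviation "mc \<equiv> cut_mf ys V bs"
abbreviation "C0 \<equiv> blk phi0"
abbreviation "C1 i \<equiv> blk (phi1 i)"
abbreviation "C2 i j \<equiv> blk (phi2 i j)"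

lemma mat_op_basis:
  "M \<in> carrier_mat n' n ==> q < n ==> mat_op M (\<lambda>q' l. if q' = q then x else 0) p l = M $$ (p, q) * x"
  by (simp add: mat_op_def if_distrib[where f = "\<lambda>y. _ * y"] cong: if_cong)

lemma div_mod_less: "P < n * k ==> P div k < n" "P < n * k ==> P mod k < k" for P n k :: nat
proof -
  assume P: "P < n * k"
  then have "k > 0" by (cases k) auto
  then show "P div k < n" "P mod k < k" using P by (simp_all add: less_mult_imp_div_less)
qed

lemma induced_mat: "M \<in> carrier_mat n' n ==> induced ys V bs n' n (mat_op M) = C0 M"
  by (rule mat_eqI[of _ "n' * \<mu>" "n * \<mu>"])
    (auto simp: induced_def blk_index(1) mat_op_basis div_mod_less phi0_def intro!: carrier_matI)

lemma cut_mat_C0: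
  "f \<in> carrier_mat a b ==> g \<in> carrier_mat c e ==> cut_mat ys V bs p par f g = C0 (tens_mat p par f g)"
  using tens_carrier[of f a b g c e p par] by (auto simp: cut_mat_def induced_mat[of _ "a * c" "b * e"])

lemma cut_scalar_C0: "cut_scalar ys V bs Y X f = C0 (f \<cdot>\<^sub>m 1\<^sub>m (mf_rank Y * mf_rank X))"
proof (rule mat_eqI[of _ "mf_rank Y * mf_rank X * \<mu>" "mf_rank Y * mf_rank X * \<mu>"])
  let ?N = "mf_rank Y * mf_rank X"
  fix P Q assume PQ: "P < ?N * \<mu>" "Q < ?N * \<mu>"
  have c: "f \<cdot>\<^sub>m 1\<^sub>m ?N \<in> carrier_mat ?N ?N" by simp
  note b = blk_index[OF c PQ]
  have "(f \<cdot>\<^sub>m 1\<^sub>m ?N) $$ (P div \<mu>, Q div \<mu>) = (if P div \<mu> = Q div \<mu> then f else 0)" using b(2,3) by simp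
  then show "cut_scalar ys V bs Y X f $$ (P, Q) = C0 (f \<cdot>\<^sub>m 1\<^sub>m ?N) $$ (P, Q)"
    unfolding b(1) using PQ b by (simp add: cut_scalar_def induced_def phi0_def)
qed (auto simp: cut_scalar_def induced_def)

lemma tens_d_carrier:
  assumes "mfR B Y" "mfR B X" shows "tens_d Y X \<in> carrier_mat (mf_rank Y * mf_rank X) (mf_rank Y * mf_rank X)"
proof -
  have "mf_d Y \<in> carrier_mat (mf_rank Y) (mf_rank Y)" "mf_d X \<in> carrier_mat (mf_rank X) (mf_rank X)"
    using assms hom_mapsD(1) by (auto simp: mfR_def)
  then show ?thesis unfolding tens_d_def by (intro add_carrier_mat tens_carrier) auto
qed

text \<open>The minus sign turns the commutator of d with the derivation into that of the derivation
  with d. The difference between the members of the sequences used on both sides lies in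
  \<open>IA 1\<close> by \<open>pdt_ext_1\<close>.\<close>

lemma atiyah_C1:
  assumes "mfR B Y" "mfR B X" "i < length ys"
  shows "atiyah ys V bs \<sigma> Y X i = - C1 i (tens_d Y X)"
proof (rule mat_eqI[of _ "mf_rank Y * mf_rank X * \<mu>" "mf_rank Y * mf_rank X * \<mu>"])
  let ?N = "mf_rank Y * mf_rank X" and ?d = "tens_d Y X"
  fix P Q assume PQ: "P < ?N * \<mu>" "Q < ?N * \<mu>"
  note dc = tens_d_carrier[OF assms(1,2)]
  note b = blk_index[OF dc PQ]
  let ?x = "bs ! (Q mod \<mu>)" and ?e = "?d $$ (P div \<mu>, Q div \<mu>)"
  let ?v = "\<lambda>q n::nat. if q = Q div \<mu> then ?x else 0"
  \<comment> \<open>Away from the chosen basis vector the entries are zero sequences; no outer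
    monomial occurs in them, so their derivative is literally 0 and not just 0 modulo the
    ideal.\<close>
  have pdt0: "pdt_ext ys V \<sigma> i (\<lambda>n. 0) 1 = 0" unfolding pdt_ext_eq by (simp add: outer_monos_def)
  have "mat_op ?d (\<lambda>q. pdt_ext ys V \<sigma> i (?v q)) (P div \<mu>) 1
      = (\<Sum>q<?N. ?d $$ (P div \<mu>, q) * (if q = Q div \<mu> then pdt_ext ys V \<sigma> i (\<lambda>_. ?x) 1 else 0))"
    unfolding mat_op_def using dc pdt0 by (auto intro!: sum.cong)
  also have "\<dots> = ?e * pdt_ext ys V \<sigma> i (\<lambda>_. ?x) 1"
    using b(3) by (simp add: if_distrib[where f = "\<lambda>y. _ * y"] cong: if_cong)
  finally have 1: "mat_op ?d (\<lambda>q. pdt_ext ys V \<sigma> i (?v q)) (P div \<mu>) 1 = ?e * pdt_ext ys V \<sigma> i (\<lambda>_. ?x) 1" .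
  have 2: "mat_op ?d ?v (P div \<mu>) = (\<lambda>_. ?e * ?x)"
    by (rule ext) (rule mat_op_basis[OF dc b(3)])
  have "(?e * pdt_ext ys V \<sigma> i (\<lambda>_. ?x) 1 - pdt_ext ys V \<sigma> i (\<lambda>_. ?e * ?x) 1) - (- Lop i ?e ?x)
     = ?e * (pdt_ext ys V \<sigma> i (\<lambda>_. ?x) 1 - dd i ?x) - (pdt_ext ys V \<sigma> i (\<lambda>_. ?e * ?x) 1 - dd i (?e * ?x))"
    by (simp add: Lop_def algebra_simps)
  also have "\<dots> \<in> IA 1" by (intro IA_diff IA_mult pdt_ext_1 assms)
  finally have 3: "(?e * pdt_ext ys V \<sigma> i (\<lambda>_. ?x) 1 - pdt_ext ys V \<sigma> i (\<lambda>_. ?e * ?x) 1) - (- Lop i ?e ?x) \<in> IA 1" .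
  have "jc (?e * pdt_ext ys V \<sigma> i (\<lambda>_. ?x) 1 - pdt_ext ys V \<sigma> i (\<lambda>_. ?e * ?x) 1) (P mod \<mu>) = - phi1 i ?e (P mod \<mu>) (Q mod \<mu>)"
    unfolding jc_cong[OF 3 b(4)] phi1_def by (rule jc_uminus[OF b(4)])
  moreover have "atiyah ys V bs \<sigma> Y X i $$ (P, Q) =
      jc (?e * pdt_ext ys V \<sigma> i (\<lambda>_. ?x) 1 - pdt_ext ys V \<sigma> i (\<lambda>_. ?e * ?x) 1) (P mod \<mu>)"
    using PQ by (simp only: atiyah_def induced_def index_mat(1) prod.case 1 2)
  moreover have "(- C1 i ?d) $$ (P, Q) = - phi1 i ?e (P mod \<mu>) (Q mod \<mu>)"
    using PQ b(1) blk_carrier[OF dc, of "phi1 i"] by simp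
  ultimately show "atiyah ys V bs \<sigma> Y X i $$ (P, Q) = (- C1 i ?d) $$ (P, Q)" by simp
qed (use tens_d_carrier[OF assms(1,2)] in \<open>auto simp: atiyah_def induced_def\<close>)

lemma mc_simps:
  assumes "mfR B Y" "mfR B X"
  shows "mf_rank (mc Y X) = mf_rank Y * mf_rank X * \<mu>" "mf_d (mc Y X) = C0 (tens_d Y X)"
    "P < mf_rank Y * mf_rank X * \<mu> ==> mf_par (mc Y X) ! P = mf_par (tmf Y X) ! (P div \<mu>)"
  using induced_mat[OF tens_d_carrier[OF assms]]
  by (simp_all add: cut_mf_def mf_rank_def[of "MF _ _"] div_mod_less del: mf_rank_def) 

lemma D_vars: "A \<subseteq> E ==> f \<in> poly_in E ==> dd i f \<in> poly_in E"
  unfolding dd_def pdt_ext_eq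
proof (intro poly_in_sum poly_in_mult poly_in_single)
  fix b assume "A \<subseteq> E" "f \<in> poly_in E" "b \<in> outer_monos A f"
  then show "keys b \<subseteq> E" using outer_monos_vars by blast
  show "D i 2 (ex (oc b f)) \<in> poly_in E"
    using poly_in_mono[OF D_P[OF ex_fam[OF outer_coeff_in]] \<open>A \<subseteq> E\<close>] .
qed

lemma Lop_vars: "A \<subseteq> E ==> f \<in> poly_in E ==> h \<in> poly_in E ==> Lop i f h \<in> poly_in E"
  unfolding Lop_def by (intro poly_in_diff poly_in_mult D_vars)

text \<open>\<open>hom_maps\<close> prescribes the variables of the entries. Taking a commutator
  introduces no outer variable that was not present in \<open>f\<close>, and the passage to
  coordinates removes the \<open>ys\<close>.\<close>

lemma phi_vars:
  assumes "A \<subseteq> E" "f \<in> poly_in E" "b < \<mu>"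
  shows "phi0 f a b \<in> poly_in (E - A)" "phi1 i f a b \<in> poly_in (E - A)" "phi2 i j f a b \<in> poly_in (E - A)"
proof -
  have b: "bs ! b \<in> poly_in E" using bs_P[OF assms(3)] assms(1) by (rule poly_in_mono)
  show "phi0 f a b \<in> poly_in (E - A)"
    unfolding phi0_def by (intro jc_vars poly_in_mult assms b)
  show "phi1 i f a b \<in> poly_in (E - A)"
    unfolding phi1_def by (intro jc_vars Lop_vars assms b)
  show "phi2 i j f a b \<in> poly_in (E - A)"
    unfolding phi2_def Kop_def by (intro jc_vars poly_in_diff Lop_vars D_vars assms b)
qed

lemma blk_hom:
  assumes E: "A \<subseteq> E" and mf: "mfR (poly_in E) Y" "mfR (poly_in E) X" "mfR (poly_in E) Y'" "mfR (poly_in E) X'"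
    and F: "F \<in> hom_maps (poly_in E) p (tmf Y X) (tmf Y' X')"
    and \<phi>: "\<And>f a b. f \<in> poly_in E ==> b < \<mu> ==> \<phi> f a b \<in> poly_in (E - A)" "\<And>a b. a < \<mu> ==> \<phi> 0 a b = 0"
  shows "blk \<phi> F \<in> hom_maps (poly_in (E - A)) p (mc Y X) (mc Y' X')"
proof (rule hom_mapsI)
  note r = mc_simps(1)[OF mf(1,2)] mc_simps(1)[OF mf(3,4)]
  have Fc: "F \<in> carrier_mat (mf_rank Y' * mf_rank X') (mf_rank Y * mf_rank X)" using hom_mapsD(1)[OF F] by simp
  show "blk \<phi> F \<in> carrier_mat (mf_rank (mc Y' X')) (mf_rank (mc Y X))" unfolding r by (rule blk_carrier[OF Fc])
  fix P Q assume "P < mf_rank (mc Y' X')" "Q < mf_rank (mc Y X)"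
  then have PQ: "P < mf_rank Y' * mf_rank X' * \<mu>" "Q < mf_rank Y * mf_rank X * \<mu>" by (simp_all add: r)
  note b = blk_index[OF Fc PQ]
  note h = hom_mapsD(2,3)[OF F, unfolded tmf_simps(1), OF b(2,3)]
  show "blk \<phi> F $$ (P, Q) \<in> poly_in (E - A)" unfolding b(1) by (rule \<phi>(1)[OF h(1) b(5)])
  assume "blk \<phi> F $$ (P, Q) \<noteq> 0"
  then have "F $$ (P div \<mu>, Q div \<mu>) \<noteq> 0" unfolding b(1) using \<phi>(2)[OF b(4)] by metis
  then show "(mf_par (mc Y' X') ! P \<noteq> mf_par (mc Y X) ! Q) = p"
    using h(2) PQ by (simp add: mc_simps(3)[OF mf(1,2)] mc_simps(3)[OF mf(3,4)])
qed

text \<open>Stated for an arbitrary additive entry map so that it serves both \<open>phi0\<close>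
  and \<open>phi1\<close>.\<close>

lemma blk_diff:
  assumes "F \<in> carrier_mat n k" "G \<in> carrier_mat n k"
    and add: "\<And>f g a b. a < \<mu> ==> \<phi> (f + g) a b = \<phi> f a b + \<phi> g a b"
  shows "blk \<phi> (F - G) = blk \<phi> F - blk \<phi> G"
proof (rule mat_eqI[of _ "n * \<mu>" "k * \<mu>"])
  have FG: "F - G \<in> carrier_mat n k" using assms by (auto intro: minus_carrier_mat)
  then show "blk \<phi> (F - G) \<in> carrier_mat (n * \<mu>) (k * \<mu>)" by simp
  show "blk \<phi> F - blk \<phi> G \<in> carrier_mat (n * \<mu>) (k * \<mu>)" using assms(1,2) by (auto intro: minus_carrier_mat)
  fix P Q assume PQ: "P < n * \<mu>" "Q < k * \<mu>"
  note b = blk_index[OF FG PQ]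
  have "\<phi> (f - g) a b = \<phi> f a b - \<phi> g a b" if "a < \<mu>" for f g a b
    using add[OF that, of "f - g" g b] by simp
  from this[OF b(4)] have "blk \<phi> (F - G) $$ (P, Q) = blk \<phi> F $$ (P, Q) - blk \<phi> G $$ (P, Q)"
    unfolding b(1) blk_index(1)[OF assms(1) PQ] blk_index(1)[OF assms(2) PQ] using b(2,3) assms(2) by simp
  then show "blk \<phi> (F - G) $$ (P, Q) = (blk \<phi> F - blk \<phi> G) $$ (P, Q)"
    using PQ blk_carrier[OF assms(2), of \<phi>] by simp
qed

text \<open>These values are inserted for two right-hand sides: for the square of the differential,
  a scalar free of the \<open>ys\<close>, all derivatives vanish; for \<open>t l\<close>, the
  derivative in direction \<open>l\<close> is the identity.\<close>

lemma blk_scalar: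
  "r \<in> R' ==> C0 (r \<cdot>\<^sub>m 1\<^sub>m N) = r \<cdot>\<^sub>m 1\<^sub>m (N * \<mu>)"
  "r \<in> R' ==> C1 i (r \<cdot>\<^sub>m 1\<^sub>m N) = 0\<^sub>m (N * \<mu>) (N * \<mu>)"
  "i < length ys ==> j < length ys ==> r \<in> R' ==> C2 i j (r \<cdot>\<^sub>m 1\<^sub>m N) = 0\<^sub>m (N * \<mu>) (N * \<mu>)"
  "l < length ys ==> C0 (t l \<cdot>\<^sub>m 1\<^sub>m N) = 0\<^sub>m (N * \<mu>) (N * \<mu>)"
  "l < length ys ==> i < length ys ==> C1 i (t l \<cdot>\<^sub>m 1\<^sub>m N) = (if i = l then 1\<^sub>m (N * \<mu>) else 0\<^sub>m (N * \<mu>) (N * \<mu>))"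
proof -
  have c: "(k \<cdot>\<^sub>m 1\<^sub>m N :: ('v, 'k) mpol mat) \<in> carrier_mat N N" for k by simp
  have *: "blk \<phi> (k \<cdot>\<^sub>m 1\<^sub>m N) = M" if M: "M \<in> carrier_mat (N * \<mu>) (N * \<mu>)"
    "\<And>P Q. P < N * \<mu> ==> Q < N * \<mu> ==> P mod \<mu> < \<mu> ==> Q mod \<mu> < \<mu> ==>
        (P = Q) = (P div \<mu> = Q div \<mu> \<and> P mod \<mu> = Q mod \<mu>) ==>
        \<phi> (if P div \<mu> = Q div \<mu> then k else 0) (P mod \<mu>) (Q mod \<mu>) = M $$ (P, Q)" for \<phi> k M
  proof (rule mat_eqI[OF blk_carrier[OF c] M(1)])
    fix P Q assume PQ: "P < N * \<mu>" "Q < N * \<mu>"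
    note b = blk_index[OF c[of k] PQ]
    have eq: "(P = Q) = (P div \<mu> = Q div \<mu> \<and> P mod \<mu> = Q mod \<mu>)" by (metis div_mult_mod_eq)
    have "(k \<cdot>\<^sub>m 1\<^sub>m N) $$ (P div \<mu>, Q div \<mu>) = (if P div \<mu> = Q div \<mu> then k else 0)" using b(2,3) by simp
    then show "blk \<phi> (k \<cdot>\<^sub>m 1\<^sub>m N) $$ (P, Q) = M $$ (P, Q)" unfolding b(1) using M(2)[OF PQ b(4,5) eq] by simp
  qed
  show "r \<in> R' ==> C0 (r \<cdot>\<^sub>m 1\<^sub>m N) = r \<cdot>\<^sub>m 1\<^sub>m (N * \<mu>)"
    by (rule *) (auto simp: phi0_R phi_0)
  show "r \<in> R' ==> C1 i (r \<cdot>\<^sub>m 1\<^sub>m N) = 0\<^sub>m (N * \<mu>) (N * \<mu>)"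
    by (rule *) (auto simp: phi1_R phi_0)
  show "i < length ys ==> j < length ys ==> r \<in> R' ==> C2 i j (r \<cdot>\<^sub>m 1\<^sub>m N) = 0\<^sub>m (N * \<mu>) (N * \<mu>)"
    by (rule *) (auto simp: phi2_R phi_0)
  show "l < length ys ==> C0 (t l \<cdot>\<^sub>m 1\<^sub>m N) = 0\<^sub>m (N * \<mu>) (N * \<mu>)"
    by (rule *) (auto simp: phi0_t phi_0)
  show "l < length ys ==> i < length ys ==> C1 i (t l \<cdot>\<^sub>m 1\<^sub>m N) = (if i = l then 1\<^sub>m (N * \<mu>) else 0\<^sub>m (N * \<mu>) (N * \<mu>))"
    by (rule *) (auto simp: phi1_t phi_0)
qed

end

section \<open>Atiyah classes up to homotopy\<close>

text \<open>Matrices of all sizes together form no group, so the few transpositions and signs that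
  occur in this section are verified entrywise once.\<close>

lemma mat_rearrange:
  fixes a :: "'r::comm_ring_1 mat"
  assumes "a \<in> carrier_mat n m" "b \<in> carrier_mat n m" "c \<in> carrier_mat n m" "e \<in> carrier_mat n m"
  shows "(a + b) + (c + e) = (b + c) + (a + e)" "(a + b) - (c + e) = (b - c) + (a - e)"
    "a + b + c + e = 0\<^sub>m n m ==> (b + c) - 0\<^sub>m n m = - e + - a"
    "(a + b) + (c + e) = z ==> (c + e) - z = - a + - b"
    "(a + b) + (c + e) = 0\<^sub>m n m ==> c - (- e) = - a + - b"
    "(a - b) + (c - e) = 0\<^sub>m n m ==> c - e = - a - - b"
proof -
  note d = assms[THEN carrier_matD(1)] assms[THEN carrier_matD(2)]
  show "(a + b) + (c + e) = (b + c) + (a + e)" "(a + b) - (c + e) = (b - c) + (a - e)"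
    by (rule eq_matI; simp add: d algebra_simps)+
  show "(a + b) + (c + e) = z ==> (c + e) - z = - a + - b"
    by (rule eq_matI) (auto simp: d algebra_simps)
  show "a + b + c + e = 0\<^sub>m n m ==> (b + c) - 0\<^sub>m n m = - e + - a"
  proof (rule eq_matI)
    assume z: "a + b + c + e = 0\<^sub>m n m"
    fix i j assume "i < dim_row (- e + - a)" "j < dim_col (- e + - a)"
    then have ij: "i < n" "j < m" by (simp_all add: d)
    then have "(b + c) $$ (i, j) + (e + a) $$ (i, j) = 0" using arg_cong[OF z, of "\<lambda>x. x $$ (i, j)"] by (simp add: d algebra_simps)
    then have "(b + c) $$ (i, j) = - (e + a) $$ (i, j)" by (simp only: eq_neg_iff_add_eq_0)
    then show "(b + c - 0\<^sub>m n m) $$ (i, j) = (- e + - a) $$ (i, j)" using ij by (simp add: d)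
  qed (simp_all add: d)
  show "(a + b) + (c + e) = 0\<^sub>m n m ==> c - (- e) = - a + - b"
  proof (rule eq_matI)
    assume z: "(a + b) + (c + e) = 0\<^sub>m n m"
    fix i j assume "i < dim_row (- a + - b)" "j < dim_col (- a + - b)"
    then have ij: "i < n" "j < m" by (simp_all add: d)
    then have "(c + e) $$ (i, j) + (a + b) $$ (i, j) = 0" using arg_cong[OF z, of "\<lambda>x. x $$ (i, j)"] by (simp add: d algebra_simps)
    then have "(c + e) $$ (i, j) = - (a + b) $$ (i, j)" by (simp only: eq_neg_iff_add_eq_0)
    then show "(c - (- e)) $$ (i, j) = (- a + - b) $$ (i, j)" using ij by (simp add: d)
  qed (simp_all add: d)
  show "(a - b) + (c - e) = 0\<^sub>m n m ==> c - e = - a - - b"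
  proof (rule eq_matI)
    assume z: "(a - b) + (c - e) = 0\<^sub>m n m"
    fix i j assume "i < dim_row (- a - - b)" "j < dim_col (- a - - b)"
    then have ij: "i < n" "j < m" by (simp_all add: d)
    then have "(c - e) $$ (i, j) + (a - b) $$ (i, j) = 0" using arg_cong[OF z, of "\<lambda>x. x $$ (i, j)"] by (simp add: d algebra_simps)
    then have "(c - e) $$ (i, j) = - (a - b) $$ (i, j)" by (simp only: eq_neg_iff_add_eq_0)
    then show "(c - e) $$ (i, j) = (- a - - b) $$ (i, j)" using ij by (simp add: d)
  qed (simp_all add: d)
qed

lemma mult_uminus_mat:
  fixes f :: "'r::comm_ring_1 mat"
  assumes "f \<in> carrier_mat n k" "g \<in> carrier_mat k m"
  shows "f * (- g) = - (f * g)" "(- f) * g = - (f * g)"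
  using assms by auto

lemma emb_mult_R:
  assumes "mfR R X" "mfR R Y" "mfR R Z" "f \<in> closed_maps R p X Y" "g \<in> closed_maps R q Y Z"
  shows "emb X Z (g * f) = emb Y Z g * emb X Y f"
  using emb_mult assms unfolding mfR_def by blast

lemma emb_add_R:
  assumes "mfR R X" "mfR R Y" "f \<in> closed_maps R p X Y" "g \<in> closed_maps R q X Y"
  shows "emb X Y (f + g) = emb X Y f + emb X Y g"
  using emb_add(1) assms unfolding mfR_def by blast

lemma emb_smult_R:
  assumes "mfR R X" "mfR R Y" "f \<in> closed_maps R p X Y"
  shows "emb X Y (c \<cdot>\<^sub>m f) = scl c (emb X Y f)" "emb X Y (- f) = - emb X Y f"
  using emb_add(2,3)[of X R Y f R p f p] assms unfolding mfR_def by blast+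

lemma emb_eqI_R:
  assumes "mfR R X" "mfR R Y" "f \<in> closed_maps R p X Y" "g \<in> closed_maps R p X Y"
    "h \<in> hom_maps R' (\<not> p) X Y" "f - g = dcomm (\<not> p) X Y h"
  shows "emb X Y f = emb X Y g"
  using emb_eqI[OF assms(1,2)[unfolded mfR_def] assms(3-6)] .

context cut_data
begin

lemma blk_mult_carrier:
  "F \<in> carrier_mat n k ==> G \<in> carrier_mat k m' ==> blk \<alpha> F * blk \<beta> G \<in> carrier_mat (n * \<mu>) (m' * \<mu>)"
  by (rule mult_carrier_mat[OF blk_carrier blk_carrier])

context
  fixes E :: "'v set"
  assumes AE: "A \<subseteq> E"
begin

abbreviation "mE \<equiv> mfR (poly_in E)"
abbreviation "PS \<equiv> poly_in (E - A)"

lemma C0_hom: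
  "mE Y ==> mE X ==> mE Y' ==> mE X' ==> F \<in> hom_maps (poly_in E) p (tmf Y X) (tmf Y' X') ==>
    C0 F \<in> hom_maps PS p (mc Y X) (mc Y' X')"
  by (rule blk_hom[OF AE]) (use phi_vars[OF AE] phi_0 in auto)

lemma C1_hom:
  "mE Y ==> mE X ==> mE Y' ==> mE X' ==> F \<in> hom_maps (poly_in E) p (tmf Y X) (tmf Y' X') ==>
    C1 i F \<in> hom_maps PS p (mc Y X) (mc Y' X')"
  by (rule blk_hom[OF AE]) (use phi_vars[OF AE] phi_0 in auto)

lemma C2_hom:
  "mE Y ==> mE X ==> mE Y' ==> mE X' ==> F \<in> hom_maps (poly_in E) p (tmf Y X) (tmf Y' X') ==>
    i < length ys ==> j < length ys ==> C2 i j F \<in> hom_maps PS p (mc Y X) (mc Y' X')"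
  by (rule blk_hom[OF AE]) (use phi_vars[OF AE] phi_0 in auto)

lemma tens_d_hom': "mE Y ==> mE X ==> tens_d Y X \<in> hom_maps (poly_in E) True (tmf Y X) (tmf Y X)"
  using tens_d_hom[of E Y X] by (simp add: mfR_def)

lemma mc_mfR: "mE Y ==> mE X ==> mfR PS (mc Y X)"
  unfolding mfR_def[of PS] using C0_hom[OF _ _ _ _ tens_d_hom'] by (simp add: mc_simps(2))

lemma hom_tmf_carrier: "F \<in> hom_maps B p (tmf Y X) (tmf Y' X') ==> F \<in> carrier_mat (mf_rank Y' * mf_rank X') (mf_rank Y * mf_rank X)"
  using hom_mapsD(1) by fastforce

text \<open>The second part is the product rule, sorted into the commutator of the reduced
  differential with \<open>C1 i F\<close> and the commutator of \<open>C1 i d\<close> with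
  \<open>C0 F\<close>. When \<open>[d, F]\<close> is known, it exhibits \<open>- C1 i F\<close> as a
  homotopy for the latter.\<close>

lemma dcomm_blocks:
  assumes mf: "mE Y" "mE X" "mE Y'" "mE X'" and F: "F \<in> hom_maps (poly_in E) q (tmf Y X) (tmf Y' X')"
  shows "C0 (dcomm p (tmf Y X) (tmf Y' X') F) = dcomm p (mc Y X) (mc Y' X') (C0 F)"
    and "i < length ys ==> C1 i (dcomm p (tmf Y X) (tmf Y' X') F) = dcomm p (mc Y X) (mc Y' X') (C1 i F) +
     (if p then C1 i (tens_d Y' X') * C0 F + C0 F * C1 i (tens_d Y X) else C1 i (tens_d Y' X') * C0 F - C0 F * C1 i (tens_d Y X))"
proof -
  let ?N = "mf_rank Y * mf_rank X" and ?N' = "mf_rank Y' * mf_rank X'"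
  note Fc = hom_tmf_carrier[OF F]
  note d = tens_d_carrier[OF mf(1,2)] tens_d_carrier[OF mf(3,4)]
  have dF: "tens_d Y' X' * F \<in> carrier_mat ?N' ?N" "F * tens_d Y X \<in> carrier_mat ?N' ?N" using Fc d by auto
  note a = blk_add[OF dF] blk_diff[OF dF, of phi0] blk_diff[OF dF, of "phi1 i"] phi0_add phi1_add
  note m = blk_mult[OF d(2) Fc] blk_mult[OF Fc d(1)]
  show "C0 (dcomm p (tmf Y X) (tmf Y' X') F) = dcomm p (mc Y X) (mc Y' X') (C0 F)"
    unfolding dcomm_def by (simp add: a m mc_simps(2)[OF mf(1,2)] mc_simps(2)[OF mf(3,4)])
  assume i: "i < length ys"
  have c: "C1 i (tens_d Y' X') * C0 F \<in> carrier_mat (?N' * \<mu>) (?N * \<mu>)" "C0 (tens_d Y' X') * C1 i F \<in> carrier_mat (?N' * \<mu>) (?N * \<mu>)"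
    "C1 i F * C0 (tens_d Y X) \<in> carrier_mat (?N' * \<mu>) (?N * \<mu>)" "C0 F * C1 i (tens_d Y X) \<in> carrier_mat (?N' * \<mu>) (?N * \<mu>)"
    by (rule blk_mult_carrier[OF d(2) Fc] blk_mult_carrier[OF Fc d(1)])+
  show "C1 i (dcomm p (tmf Y X) (tmf Y' X') F) = dcomm p (mc Y X) (mc Y' X') (C1 i F) +
     (if p then C1 i (tens_d Y' X') * C0 F + C0 F * C1 i (tens_d Y X) else C1 i (tens_d Y' X') * C0 F - C0 F * C1 i (tens_d Y X))"
  proof (cases p)
    case True
    have "C1 i (dcomm p (tmf Y X) (tmf Y' X') F) = (C1 i (tens_d Y' X') * C0 F + C0 (tens_d Y' X') * C1 i F)
       + (C1 i F * C0 (tens_d Y X) + C0 F * C1 i (tens_d Y X))"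
      using True i by (simp add: dcomm_def a m)
    also have "\<dots> = (C0 (tens_d Y' X') * C1 i F + C1 i F * C0 (tens_d Y X)) + (C1 i (tens_d Y' X') * C0 F + C0 F * C1 i (tens_d Y X))"
      by (rule mat_rearrange(1)[OF c])
    finally show ?thesis using True by (simp add: dcomm_def mc_simps(2)[OF mf(1,2)] mc_simps(2)[OF mf(3,4)])
  next
    case False
    have "C1 i (dcomm p (tmf Y X) (tmf Y' X') F) = (C1 i (tens_d Y' X') * C0 F + C0 (tens_d Y' X') * C1 i F)
       - (C1 i F * C0 (tens_d Y X) + C0 F * C1 i (tens_d Y X))"
      using False i by (simp add: dcomm_def a m)
    also have "\<dots> = (C0 (tens_d Y' X') * C1 i F - C1 i F * C0 (tens_d Y X)) + (C1 i (tens_d Y' X') * C0 F - C0 F * C1 i (tens_d Y X))"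
      by (rule mat_rearrange(2)[OF c])
    finally show ?thesis using False by (simp add: dcomm_def mc_simps(2)[OF mf(1,2)] mc_simps(2)[OF mf(3,4)])
  qed
qed

lemma blk_zero: "C0 (0\<^sub>m n k) = 0\<^sub>m (n * \<mu>) (k * \<mu>)" "C1 i (0\<^sub>m n k) = 0\<^sub>m (n * \<mu>) (k * \<mu>)"
proof -
  have z: "(0\<^sub>m n k :: ('v, 'k) mpol mat) \<in> carrier_mat n k" by simp
  show "C0 (0\<^sub>m n k) = 0\<^sub>m (n * \<mu>) (k * \<mu>)" "C1 i (0\<^sub>m n k) = 0\<^sub>m (n * \<mu>) (k * \<mu>)"
    by (rule mat_eqI[OF blk_carrier[OF z]], simp, use blk_index[OF z] phi_0 in force)+
qed

lemma C0_closed: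
  assumes mf: "mE Y" "mE X" "mE Y'" "mE X'" and F: "F \<in> closed_maps (poly_in E) p (tmf Y X) (tmf Y' X')"
  shows "C0 F \<in> closed_maps PS p (mc Y X) (mc Y' X')"
proof -
  have F': "F \<in> hom_maps (poly_in E) p (tmf Y X) (tmf Y' X')" using F by (simp add: closed_maps_def)
  have "dcomm p (mc Y X) (mc Y' X') (C0 F) = C0 (dcomm p (tmf Y X) (tmf Y' X') F)"
    using dcomm_blocks(1)[OF mf F'] by simp
  also have "\<dots> = 0\<^sub>m (mf_rank (mc Y' X')) (mf_rank (mc Y X))"
    using F by (simp add: closed_maps_def blk_zero mc_simps(1)[OF mf(1,2)] mc_simps(1)[OF mf(3,4)])
  finally show ?thesis using C0_hom[OF mf F'] by (simp add: closed_maps_def)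
qed

text \<open>Only the reductions have to be closed, not \<open>F\<close> and \<open>G\<close>
  themselves. This is essential for products of the \<open>\<lambda>_l\<close>, which are closed
  only modulo \<open>t\<close>.\<close>

lemma C0_null:
  assumes mf: "mE Y" "mE X" "mE Y'" "mE X'"
    and F: "C0 F \<in> closed_maps PS p (mc Y X) (mc Y' X')" "F \<in> hom_maps (poly_in E) p (tmf Y X) (tmf Y' X')"
    and G: "C0 G \<in> closed_maps PS p (mc Y X) (mc Y' X')" "G \<in> hom_maps (poly_in E) p (tmf Y X) (tmf Y' X')"
    and H: "H \<in> hom_maps (poly_in E) (\<not> p) (tmf Y X) (tmf Y' X')" "F - G = dcomm (\<not> p) (tmf Y X) (tmf Y' X') H"
  shows "emb (mc Y X) (mc Y' X') (C0 F) = emb (mc Y X) (mc Y' X') (C0 G)"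
proof (rule emb_eqI_R[OF mc_mfR[OF mf(1,2)] mc_mfR[OF mf(3,4)] F(1) G(1) C0_hom[OF mf H(1)]])
  show "C0 F - C0 G = dcomm (\<not> p) (mc Y X) (mc Y' X') (C0 H)"
    using blk_diff[OF hom_tmf_carrier[OF F(2)] hom_tmf_carrier[OF G(2)], of phi0] phi0_add dcomm_blocks(1)[OF mf H(1), of "\<not> p"] H(2) by simp
qed

context
  fixes Y X :: "('v, 'k) mpol mf" and w :: "('v, 'k) mpol"
  assumes mY: "mE Y" and mX: "mE X" and w: "w \<in> R'"
    and sq: "tens_d Y X * tens_d Y X = w \<cdot>\<^sub>m 1\<^sub>m (mf_rank Y * mf_rank X)"
begin

abbreviation "M \<equiv> mc Y X"
abbreviation "ee F \<equiv> emb (mc Y X) (mc Y X) F"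
abbreviation "dT \<equiv> tens_d Y X"

lemma mM: "mfR PS M" by (rule mc_mfR[OF mY mX])
lemmas dT_hom = tens_d_hom'[OF mY mX]
lemmas dTc = tens_d_carrier[OF mY mX]

text \<open>Differentiating d^2 = w once: the right-hand side is free of the \<open>ys\<close>, so
  its derivative is 0.\<close>

lemma C1d_closed: assumes "i < length ys" shows "C1 i dT \<in> closed_maps PS True M M"
proof -
  have "C1 i dT * C0 dT + C0 dT * C1 i dT = C1 i (dT * dT)" by (simp add: blk_mult(2)[OF dTc dTc assms])
  also have "\<dots> = 0\<^sub>m (mf_rank M) (mf_rank M)" unfolding sq using w by (simp add: blk_scalar mc_simps(1)[OF mY mX])
  finally have "C1 i dT * C0 dT + C0 dT * C1 i dT = 0\<^sub>m (mf_rank M) (mf_rank M)" .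
  moreover have "C0 dT * C1 i dT + C1 i dT * C0 dT = C1 i dT * C0 dT + C0 dT * C1 i dT"
    by (rule comm_add_mat[OF blk_mult_carrier[OF dTc dTc] blk_mult_carrier[OF dTc dTc]])
  ultimately show ?thesis using C1_hom[OF mY mX mY mX dT_hom]
    by (simp add: closed_maps_def dcomm_def mc_simps(2)[OF mY mX])
qed

text \<open>Differentiating d^2 = w twice: the two middle terms of the second-order product rule
  form the anticommutator, and the two outer terms are the boundary of
  \<open>C2 i j dT\<close>.\<close>

lemma At_anticommute:
  assumes ij: "i < length ys" "j < length ys"
  shows "ee (C1 i dT) * ee (C1 j dT) + ee (C1 j dT) * ee (C1 i dT) = 0"
proof -
  let ?D = "C1 i dT" and ?D' = "C1 j dT" and ?n = "mf_rank Y * mf_rank X * \<mu>"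
  note cl = C1d_closed[OF ij(1)] C1d_closed[OF ij(2)]
  have p: "?D * ?D' \<in> closed_maps PS False M M" "?D' * ?D \<in> closed_maps PS False M M"
    using pr.closed_maps_mult[OF mM mM mM cl(2,1)] pr.closed_maps_mult[OF mM mM mM cl(1,2)] by simp_all
  have s: "?D' * ?D + ?D * ?D' \<in> closed_maps PS False M M" by (rule pr.closed_maps_ops(1)[OF mM mM p(2,1)])
  have z: "0\<^sub>m (mf_rank M) (mf_rank M) \<in> closed_maps PS False M M" by (rule pr.closed_maps_ops(5)[OF mM mM])
  have h: "- C2 i j dT \<in> hom_maps PS (\<not> False) M M"
    using pr.hom_maps_add(3)[OF C2_hom[OF mY mX mY mX dT_hom ij] C2_hom[OF mY mX mY mX dT_hom ij]] by simp
  have c: "C2 i j dT * C0 dT \<in> carrier_mat ?n ?n" "?D' * ?D \<in> carrier_mat ?n ?n" "?D * ?D' \<in> carrier_mat ?n ?n" "C0 dT * C2 i j dT \<in> carrier_mat ?n ?n"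
    by (rule blk_mult_carrier[OF dTc dTc])+
  have "C2 i j dT * C0 dT + ?D' * ?D + ?D * ?D' + C0 dT * C2 i j dT = C2 i j (dT * dT)"
    by (simp add: blk_mult(3)[OF dTc dTc ij])
  also have "\<dots> = 0\<^sub>m ?n ?n" unfolding sq using w ij by (simp add: blk_scalar)
  finally have e: "C2 i j dT * C0 dT + ?D' * ?D + ?D * ?D' + C0 dT * C2 i j dT = 0\<^sub>m ?n ?n" .
  have "(?D' * ?D + ?D * ?D') - 0\<^sub>m (mf_rank M) (mf_rank M) = dcomm (\<not> False) M M (- C2 i j dT)"
    using mat_rearrange(3)[OF c e] mult_uminus_mat[OF blk_carrier[OF dTc] blk_carrier[OF dTc]]
    by (simp add: dcomm_def mc_simps[OF mY mX])
  from emb_eqI_R[OF mM mM s z h this] have "ee (?D' * ?D + ?D * ?D') = 0" by (simp add: emb_0)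
  then show ?thesis
    using emb_add_R[OF mM mM p(2,1)] emb_mult_R[OF mM mM mM cl] emb_mult_R[OF mM mM mM cl(2,1)] by (simp add: add.commute)
qed

text \<open>Applies to \<open>F = 1 \<otimes> \<partial>d\<^sub>X\<close>, which is a null homotopy for multiplication by \<open>t\<^sub>l\<close>.\<close>

lemma t_homotopy_closed:
  assumes F: "F \<in> hom_maps (poly_in E) True (tmf Y X) (tmf Y X)" and l: "l < length ys"
    and dF: "dcomm True (tmf Y X) (tmf Y X) F = t l \<cdot>\<^sub>m 1\<^sub>m (mf_rank Y * mf_rank X)"
  shows "C0 F \<in> closed_maps PS True M M"
  using dcomm_blocks(1)[OF mY mX mY mX F, of True] C0_hom[OF mY mX mY mX F] l
  by (simp add: dF blk_scalar closed_maps_def mc_simps(1)[OF mY mX])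

text \<open>Differentiate \<open>[d, F] = t_l\<close> in direction \<open>i\<close>. The right-hand
  side becomes \<delta>_il, and the part of the left-hand side in which F is differentiated is the
  boundary of \<open>C1 i F\<close>.\<close>

lemma At_t_homotopy:
  assumes F: "F \<in> hom_maps (poly_in E) True (tmf Y X) (tmf Y X)" and l: "l < length ys" and i: "i < length ys"
    and dF: "dcomm True (tmf Y X) (tmf Y X) F = t l \<cdot>\<^sub>m 1\<^sub>m (mf_rank Y * mf_rank X)"
  shows "ee (C1 i dT) * ee (C0 F) + ee (C0 F) * ee (C1 i dT) = (if i = l then ee (1\<^sub>m (mf_rank M)) else 0)"
proof -
  let ?D = "C1 i dT" and ?n = "mf_rank Y * mf_rank X * \<mu>"
  note cl = C1d_closed[OF i] t_homotopy_closed[OF F l dF]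
  note Fc = hom_tmf_carrier[OF F]
  have p: "?D * C0 F \<in> closed_maps PS False M M" "C0 F * ?D \<in> closed_maps PS False M M"
    using pr.closed_maps_mult[OF mM mM mM cl(2,1)] pr.closed_maps_mult[OF mM mM mM cl(1,2)] by simp_all
  have s: "?D * C0 F + C0 F * ?D \<in> closed_maps PS False M M" by (rule pr.closed_maps_ops(1)[OF mM mM p])
  let ?z = "if i = l then 1\<^sub>m (mf_rank M) else 0\<^sub>m (mf_rank M) (mf_rank M)"
  have z: "?z \<in> closed_maps PS False M M" using pr.closed_maps_ops(5,6)[OF mM mM] by simp
  have h: "- C1 i F \<in> hom_maps PS (\<not> False) M M"
    using pr.hom_maps_add(3)[OF C1_hom[OF mY mX mY mX F] C1_hom[OF mY mX mY mX F]] by simp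
  have c: "?D * C0 F \<in> carrier_mat ?n ?n" "C0 F * ?D \<in> carrier_mat ?n ?n" "C0 dT * C1 i F \<in> carrier_mat ?n ?n" "C1 i F * C0 dT \<in> carrier_mat ?n ?n"
    by (rule blk_mult_carrier[OF dTc Fc] blk_mult_carrier[OF Fc dTc])+
  have e: "(C0 dT * C1 i F + C1 i F * C0 dT) + (?D * C0 F + C0 F * ?D) = ?z"
    using dcomm_blocks(2)[OF mY mX mY mX F i, of True, unfolded dF] l i
    by (cases "i = l") (simp_all add: blk_scalar dcomm_def mc_simps[OF mY mX])
  have "(?D * C0 F + C0 F * ?D) - ?z = dcomm (\<not> False) M M (- C1 i F)"
    using mat_rearrange(4)[OF c(3,4,1,2) e] mult_uminus_mat[OF blk_carrier[OF dTc] blk_carrier[OF Fc]]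
      mult_uminus_mat[OF blk_carrier[OF Fc] blk_carrier[OF dTc]]
    by (simp add: dcomm_def mc_simps[OF mY mX])
  from emb_eqI_R[OF mM mM s z h this] have "ee (?D * C0 F + C0 F * ?D) = (if i = l then ee (1\<^sub>m (mf_rank M)) else 0)" by (auto simp: emb_0)
  then show ?thesis
    using emb_add_R[OF mM mM p] emb_mult_R[OF mM mM mM cl] emb_mult_R[OF mM mM mM cl(2,1)] by simp
qed

end

text \<open>Differentiate \<open>[d, F] = 0\<close>; \<open>- C1 i F\<close> is the homotopy, and
  the parity of \<open>F\<close> decides between commuting and anticommuting.\<close>

lemma At_natural:
  assumes mf: "mE Y" "mE X" "mE Y'" "mE X'" and w: "w \<in> R'" "w' \<in> R'"
    and sq: "tens_d Y X * tens_d Y X = w \<cdot>\<^sub>m 1\<^sub>m (mf_rank Y * mf_rank X)" "tens_d Y' X' * tens_d Y' X' = w' \<cdot>\<^sub>m 1\<^sub>m (mf_rank Y' * mf_rank X')"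
    and F: "F \<in> closed_maps (poly_in E) p (tmf Y X) (tmf Y' X')" and i: "i < length ys"
  shows "emb (mc Y' X') (mc Y' X') (C1 i (tens_d Y' X')) * emb (mc Y X) (mc Y' X') (C0 F) =
    (if p then - (emb (mc Y X) (mc Y' X') (C0 F) * emb (mc Y X) (mc Y X) (C1 i (tens_d Y X)))
      else emb (mc Y X) (mc Y' X') (C0 F) * emb (mc Y X) (mc Y X) (C1 i (tens_d Y X)))"
proof -
  let ?M = "mc Y X" and ?M' = "mc Y' X'" and ?D = "C1 i (tens_d Y X)" and ?D' = "C1 i (tens_d Y' X')"
  let ?n = "mf_rank Y * mf_rank X * \<mu>" and ?n' = "mf_rank Y' * mf_rank X' * \<mu>"
  note m = mc_mfR[OF mf(1,2)] mc_mfR[OF mf(3,4)]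
  note D = C1d_closed[OF mf(1,2) w(1) sq(1) i] C1d_closed[OF mf(3,4) w(2) sq(2) i]
  note F0 = C0_closed[OF mf F]
  have F': "F \<in> hom_maps (poly_in E) p (tmf Y X) (tmf Y' X')" using F by (simp add: closed_maps_def)
  note Fc = hom_tmf_carrier[OF F']
  note d = tens_d_carrier[OF mf(1,2)] tens_d_carrier[OF mf(3,4)]
  let ?G = "if p then - (C0 F * ?D) else C0 F * ?D"
  have p1: "?D' * C0 F \<in> closed_maps PS (\<not> p) ?M ?M'" "C0 F * ?D \<in> closed_maps PS (\<not> p) ?M ?M'"
    using pr.closed_maps_mult[OF m(1,2,2) F0 D(2)] pr.closed_maps_mult[OF m(1,1,2) D(1) F0] by (cases p; simp)+
  have G: "?G \<in> closed_maps PS (\<not> p) ?M ?M'" using p1(2) pr.closed_maps_ops(3)[OF m p1(2)] by (cases p) simp_all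
  have h: "- C1 i F \<in> hom_maps PS (\<not> \<not> p) ?M ?M'"
    using pr.hom_maps_add(3)[OF C1_hom[OF mf F'] C1_hom[OF mf F']] by simp
  have c: "?D' * C0 F \<in> carrier_mat ?n' ?n" "C0 F * ?D \<in> carrier_mat ?n' ?n" "C0 (tens_d Y' X') * C1 i F \<in> carrier_mat ?n' ?n" "C1 i F * C0 (tens_d Y X) \<in> carrier_mat ?n' ?n"
    by (rule blk_mult_carrier[OF d(2) Fc] blk_mult_carrier[OF Fc d(1)])+
  have e: "dcomm p ?M ?M' (C1 i F) + (if p then ?D' * C0 F + C0 F * ?D else ?D' * C0 F - C0 F * ?D) = 0\<^sub>m ?n' ?n"
    using dcomm_blocks(2)[OF mf F' i, of p] F by (simp add: closed_maps_def blk_zero)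
  have n: "C0 (tens_d Y' X') * (- C1 i F) = - (C0 (tens_d Y' X') * C1 i F)" "(- C1 i F) * C0 (tens_d Y X) = - (C1 i F * C0 (tens_d Y X))"
    by (rule mult_uminus_mat[OF blk_carrier[OF d(2)] blk_carrier[OF Fc]] mult_uminus_mat[OF blk_carrier[OF Fc] blk_carrier[OF d(1)]])+
  have "?D' * C0 F - ?G = dcomm (\<not> \<not> p) ?M ?M' (- C1 i F)"
    using mat_rearrange(5,6)[OF c(3,4,1,2)] e
    by (cases p) (simp_all add: dcomm_def mc_simps[OF mf(1,2)] mc_simps[OF mf(3,4)] n)
  from emb_eqI_R[OF m p1(1) G h this] have "emb ?M ?M' (?D' * C0 F) = emb ?M ?M' ?G" .
  then show ?thesis
    using emb_mult_R[OF m(1,2,2) F0 D(2)] emb_mult_R[OF m(1,1,2) D(1) F0] emb_smult_R(2)[OF m p1(2)] by simp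
qed

end

end

section \<open>The Clifford action on the cut\<close>

lemma anticommutator_sum:
  fixes x :: "'a::ring"
  assumes "\<And>q. q \<in> Q ==> x * s q = s q * x" "\<And>q. q \<in> Q ==> x * a q + a q * x = c q"
  shows "x * (\<Sum>q\<in>Q. s q * a q) + (\<Sum>q\<in>Q. s q * a q) * x = (\<Sum>q\<in>Q. s q * c q)"
proof -
  have "x * (s q * a q) + s q * a q * x = s q * c q" if "q \<in> Q" for q
    using assms[OF that] by (simp add: distrib_left mult.assoc flip: assms(2)[OF that] mult.assoc[of x])
  then show ?thesis by (simp add: sum_distrib_left sum_distrib_right flip: sum.distrib)
qed

text \<open>Pure algebra, with \<open>h\<close> standing for halving. For \<open>T_j\<close>, the
  sum of \<open>S_qj At_q\<close>, one has \<open>[Lam_i, T_j] = - S_ij\<close>. The two cross terms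
  of \<open>[Gd_i, Gd_j]\<close> contribute \<open>S_ij\<close> and \<open>S_ji\<close>, halved and
  with a minus sign; by the symmetry of \<open>S\<close> they add up to the full correction, whence
  the factor one half in \<open>cut_gamd\<close>.\<close>

lemma clifford_from_atiyah:
  fixes At Lam :: "nat => 'a::ring" and S :: "nat => nat => 'a" and one :: 'a and h :: "'a => 'a"
  assumes At: "\<And>i j. i < m ==> j < m ==> At i * At j + At j * At i = 0"
    and AL: "\<And>i j. i < m ==> j < m ==> At i * Lam j + Lam j * At i = (if i = j then - one else 0)"
    and LL: "\<And>i j. i < m ==> j < m ==> Lam i * Lam j + Lam j * Lam i = S i j"
    and S: "\<And>i j q. i < m ==> j < m ==> q < m ==> At q * S i j = S i j * At q"
      "\<And>i j q. i < m ==> j < m ==> q < m ==> Lam q * S i j = S i j * Lam q"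
      "\<And>i j k l. i < m ==> j < m ==> k < m ==> l < m ==> S k l * S i j = S i j * S k l"
      "\<And>i j. i < m ==> j < m ==> S i j = S j i" "\<And>i j. i < m ==> j < m ==> S i j * one = S i j"
    and h: "\<And>x y. h (x + y) = h x + h y" "\<And>x y. h (x * y) = h x * y" "\<And>x y. h (x * y) = x * h y" "\<And>x. h x + h x = x"
    and Gd: "\<And>i. i < m ==> Gd i = - Lam i - h (\<Sum>q<m. S q i * At q)"
    and ij: "i < m" "j < m"
  shows "At i * Gd j + Gd j * At i = (if i = j then one else 0)" "Gd i * Gd j + Gd j * Gd i = 0"
proof -
  define T where "T i = (\<Sum>q<m. S q i * At q)" for i
  have h0: "h 0 = 0" using h(1)[of 0 0] by simp
  have hneg: "h (- x) = - h x" for x using h(1)[of x "- x"] h0 by (simp add: add_eq_0_iff)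
  have AT: "At i * T j + T j * At i = 0" if "i < m" "j < m" for i j
    unfolding T_def by (subst anticommutator_sum[where c = "\<lambda>_. 0"]) (use that At S in auto)
  \<comment> \<open>Only the summand \<open>q = i\<close> survives, since \<open>Lam_i\<close>
    anticommutes with all other \<open>At_q\<close>.\<close>
  have LT: "Lam i * T j + T j * Lam i = - S i j" if "i < m" "j < m" for i j
  proof -
    have "Lam i * T j + T j * Lam i = (\<Sum>q<m. S q j * (if q = i then - one else 0))"
      unfolding T_def by (rule anticommutator_sum) (use that AL[of _ i] S in \<open>auto simp: add.commute\<close>)
    also have "\<dots> = (\<Sum>q<m. if q = i then - S i j else 0)"
      by (rule sum.cong) (use that S in auto)
    finally show ?thesis using that by simp
  qed
  have ST: "S k l * T i = T i * S k l" if "k < m" "l < m" "i < m" for k l i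
    unfolding T_def sum_distrib_left sum_distrib_right
  proof (rule sum.cong[OF refl])
    fix q assume "q \<in> {..<m}"
    then have q: "q < m" by simp
    have "S k l * (S q i * At q) = S q i * (S k l * At q)" using S(3)[OF q that(3,1,2)] by (simp flip: mult.assoc)
    then show "S k l * (S q i * At q) = S q i * At q * S k l" using S(1)[OF that(1,2) q] by (simp add: mult.assoc)
  qed
  have TT: "T i * T j + T j * T i = 0" if "i < m" "j < m" for i j
  proof -
    have "T i * T j + T j * T i = (\<Sum>q<m. S q j * 0)"
      unfolding T_def[of j]
      by (rule anticommutator_sum) (use that ST AT[of _ i] in \<open>auto simp: add.commute\<close>)
    then show ?thesis by simp
  qed
  have G: "Gd i = - Lam i - h (T i)" if "i < m" for i using Gd[OF that] by (simp add: T_def)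
  have hh: "x * h y + h y * x = h (x * y + y * x)" for x y by (simp only: h(1) h(2)[of y x] h(3)[of x y])
  have hh2: "h x * h y + h y * h x = h (h (x * y + y * x))" for x y
  proof -
    have "h x * h y + h y * h x = h (h x * y + y * h x)" by (simp only: h(1) h(2)[of y "h x"] h(3)[of "h x" y])
    then show ?thesis by (simp only: h(1) h(2)[of x y] h(3)[of y x])
  qed
  have "At i * Gd j + Gd j * At i = - (At i * Lam j + Lam j * At i) - (At i * h (T j) + h (T j) * At i)"
    unfolding G[OF ij(2)] by (simp add: algebra_simps)
  then show "At i * Gd j + Gd j * At i = (if i = j then one else 0)"
    unfolding hh AT[OF ij] AL[OF ij] h0 by simp
  have "Gd i * Gd j + Gd j * Gd i = (Lam i * Lam j + Lam j * Lam i) + (Lam i * h (T j) + h (T j) * Lam i)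
     + (Lam j * h (T i) + h (T i) * Lam j) + (h (T i) * h (T j) + h (T j) * h (T i))"
    unfolding G[OF ij(1)] G[OF ij(2)] by (simp add: algebra_simps)
  also have "\<dots> = S i j - h (S i j) - h (S j i)"
    unfolding hh[of "Lam i"] hh[of "Lam j"] hh2[of "T i"] LT[OF ij] LT[OF ij(2,1)] TT[OF ij] LL[OF ij] h0 by (simp add: hneg)
  also have "\<dots> = 0" using h(4)[of "S i j"] S(4)[OF ij] by (simp add: algebra_simps)
  finally show "Gd i * Gd j + Gd j * Gd i = 0" .
qed

lemma closed_maps_mono: "f \<in> closed_maps B p X Y ==> B \<subseteq> C ==> f \<in> closed_maps C p X Y"
  by (auto simp: closed_maps_def hom_maps_def)

lemma poly_in_subset: "B \<subseteq> C ==> poly_in B \<subseteq> poly_in C"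
  using poly_in_mono by blast

text \<open>\<open>half\<close> is a definite description, so uniqueness is needed as well: the
  image of 1/2 inverts 2, and hence every solution of \<open>c + c = 1\<close> equals it.\<close>

lemma half_half:
  assumes "rat_algebra TYPE('k::comm_ring_1)" shows "half + half = (1 :: 'k)"
proof -
  obtain h :: "rat => 'k" where h: "h 1 = 1" "\<And>a b. h (a + b) = h a + h b" using assms by (auto simp: rat_algebra_def)
  have e: "h (1/2) + h (1/2) = 1" using h(2)[of "1/2" "1/2"] h(1) by simp
  have "c = h (1/2)" if "c + c = 1" for c
  proof -
    have "c = c * (h (1/2) + h (1/2))" by (simp add: e)
    also have "\<dots> = (c + c) * h (1/2)" by (simp add: algebra_simps)
    finally show ?thesis by (simp add: that)
  qed
  then have "\<exists>!c::'k. c + c = 1" using e by blast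
  then show ?thesis unfolding half_def by (rule theI')
qed

locale cut_full = cut_data ys V bs \<sigma>
  for ys :: "'v list" and V :: "('v, 'k::comm_ring_1) mpol" and bs \<sigma> +
  fixes xs zs :: "'v list" and W U :: "('v, 'k) mpol"
  assumes dist3: "distinct (xs @ ys @ zs)" and WP: "W \<in> poly_in (set xs)" and UP: "U \<in> poly_in (set zs)"
    and rat: "rat_algebra TYPE('k)"
begin

abbreviation "E \<equiv> set xs \<union> set ys \<union> set zs"
abbreviation "R \<equiv> poly_in (set xs \<union> set zs)"
abbreviation "R1 \<equiv> poly_in (set ys \<union> set zs)"
abbreviation "R2 \<equiv> poly_in (set xs \<union> set ys)"
abbreviation "Yok Y \<equiv> matrix_factorisation R1 (U - V) Y"
abbreviation "Xok X \<equiv> matrix_factorisation R2 (V - W) X"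

lemma E_A: "E - set ys = set xs \<union> set zs" using dist3 by auto
lemma AE: "set ys \<subseteq> E" by auto
lemma R1E: "R1 \<subseteq> poly_in E" by (rule poly_in_subset) auto
lemma R2E: "R2 \<subseteq> poly_in E" by (rule poly_in_subset) auto

lemma Yok_mf: assumes "Yok Y" shows "mfR R1 Y" "mE E Y"
  using assms hom_maps_mono[OF _ R1E] by (auto simp: matrix_factorisation_def mfR_def)
lemma Xok_mf: assumes "Xok X" shows "mfR R2 X" "mE E X"
  using assms hom_maps_mono[OF _ R2E] by (auto simp: matrix_factorisation_def mfR_def)

text \<open>The scalar is kept in the shape in which \<open>tens_d_square\<close> delivers it; the
  two occurrences of \<open>V\<close> cancel.\<close>

lemma w_R': "U - V + (V - W) \<in> R'"
proof -
  have "U \<in> R'" "W \<in> R'" using dist3 WP UP by (auto elim!: poly_in_mono)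
  then show ?thesis by (simp add: poly_in_diff)
qed

lemma sq: assumes "Yok Y" "Xok X"
  shows "tens_d Y X * tens_d Y X = (U - V + (V - W)) \<cdot>\<^sub>m 1\<^sub>m (mf_rank Y * mf_rank X)"
  using assms by (intro tens_d_square[OF Yok_mf(2)[OF assms(1)] Xok_mf(2)[OF assms(2)]]) (auto simp: matrix_factorisation_def)

lemma mcR: "Yok Y ==> Xok X ==> mfR R (mc Y X)"
  using mc_mfR[OF AE Yok_mf(2) Xok_mf(2)] by (simp add: E_A)

lemma mc_factorisation: assumes "Yok Y" "Xok X" shows "matrix_factorisation R (U - W) (mc Y X)"
proof -
  note mf = Yok_mf(2)[OF assms(1)] Xok_mf(2)[OF assms(2)]
  note d = tens_d_carrier[OF mf]
  have "C0 (tens_d Y X) * C0 (tens_d Y X) = C0 (tens_d Y X * tens_d Y X)" by (simp add: blk_mult(1)[OF d d])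
  also have "\<dots> = (U - V + (V - W)) \<cdot>\<^sub>m 1\<^sub>m (mf_rank Y * mf_rank X * \<mu>)"
    unfolding sq[OF assms] by (rule blk_scalar(1)[OF w_R'])
  finally show ?thesis using mcR[OF assms] by (simp add: matrix_factorisation_def mfR_def mc_simps[OF mf])
qed

text \<open>Up to sign the first summand of \<open>cut_gamd\<close>, taken before reduction to
  J_V.\<close>

definition lam :: "('v, 'k) mpol mf => ('v, 'k) mpol mf => nat => ('v, 'k) mpol mat" where
  "lam Y X l = tens_mat True (mf_par Y) (1\<^sub>m (mf_rank Y)) (map_mat (pdiff (ys ! l)) (mf_d X))"

abbreviation "Vd i j \<equiv> pdiff (ys ! i) (pdiff (ys ! j) V)"

lemma pdiff_hom: "f \<in> hom_maps (poly_in B) p X X' ==> map_mat (pdiff v) f \<in> hom_maps (poly_in B) p X X'"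
proof (rule hom_mapsI)
  assume f: "f \<in> hom_maps (poly_in B) p X X'"
  note c = hom_mapsD(1)[OF f]
  show "map_mat (pdiff v) f \<in> carrier_mat (mf_rank X') (mf_rank X)" using c by simp
  fix i j assume ij: "i < mf_rank X'" "j < mf_rank X"
  show "map_mat (pdiff v) f $$ (i, j) \<in> poly_in B" using hom_mapsD(2)[OF f ij] c ij by (simp add: pdiff_in)
  show "(mf_par X' ! i \<noteq> mf_par X ! j) = p" if "map_mat (pdiff v) f $$ (i, j) \<noteq> 0"
    using that hom_mapsD(3)[OF f ij] c ij by (cases "f $$ (i, j) = 0") auto
qed

lemma map_pdiff_lin:
  assumes "f \<in> carrier_mat n k" "g \<in> carrier_mat n k"
  shows "map_mat (pdiff v) (f + g) = map_mat (pdiff v) f + map_mat (pdiff v) g"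
    "map_mat (pdiff v) (f - g) = map_mat (pdiff v) f - map_mat (pdiff v) g"
    "map_mat (pdiff v) (c \<cdot>\<^sub>m 1\<^sub>m n) = pdiff v c \<cdot>\<^sub>m 1\<^sub>m n"
    "map_mat (pdiff v) (0\<^sub>m n k) = 0\<^sub>m n k"
  using assms by (auto intro!: eq_matI simp: pdiff_add pdiff_diff)

text \<open>Differentiating \<open>[d, f] = 0\<close> entrywise: the derivative of \<open>f\<close>
  is a homotopy, up to sign, for the commutator of \<open>f\<close> with the derivatives of the
  differentials. It is the source of the naturality of the \<open>\<lambda>_l\<close>.\<close>

lemma dcomm_pdiff:
  assumes X: "mfR B X" "mfR B X'" and f: "f \<in> hom_maps B p X X'" and p: "dcomm p X X' f = 0\<^sub>m (mf_rank X') (mf_rank X)"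
  shows "dcomm p X X' (map_mat (pdiff v) f) =
    (if p then - (map_mat (pdiff v) (mf_d X') * f + f * map_mat (pdiff v) (mf_d X))
     else f * map_mat (pdiff v) (mf_d X) - map_mat (pdiff v) (mf_d X') * f)"
proof -
  let ?n = "mf_rank X" and ?n' = "mf_rank X'" and ?\<delta> = "map_mat (pdiff v)"
  have c: "mf_d X \<in> carrier_mat ?n ?n" "mf_d X' \<in> carrier_mat ?n' ?n'" "f \<in> carrier_mat ?n' ?n"
    using X f hom_mapsD(1) by (auto simp: mfR_def)
  have \<delta>c: "?\<delta> (mf_d X) \<in> carrier_mat ?n ?n" "?\<delta> (mf_d X') \<in> carrier_mat ?n' ?n'" "?\<delta> f \<in> carrier_mat ?n' ?n" using c by auto
  have pc: "mf_d X' * f \<in> carrier_mat ?n' ?n" "f * mf_d X \<in> carrier_mat ?n' ?n" "?\<delta> (mf_d X') * f \<in> carrier_mat ?n' ?n"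
    "mf_d X' * ?\<delta> f \<in> carrier_mat ?n' ?n" "f * ?\<delta> (mf_d X) \<in> carrier_mat ?n' ?n" "?\<delta> f * mf_d X \<in> carrier_mat ?n' ?n"
    using c \<delta>c by auto
  have "?\<delta> (dcomm p X X' f) = 0\<^sub>m ?n' ?n" unfolding p by (rule map_pdiff_lin(4)[OF c(3,3)])
  then have e: "(if p then (?\<delta> (mf_d X') * f + mf_d X' * ?\<delta> f) + (?\<delta> f * mf_d X + f * ?\<delta> (mf_d X))
     else (?\<delta> (mf_d X') * f + mf_d X' * ?\<delta> f) - (?\<delta> f * mf_d X + f * ?\<delta> (mf_d X))) = 0\<^sub>m ?n' ?n"
    unfolding dcomm_def using map_pdiff_lin(1,2)[OF pc(1,2)] map_pdiff_mult[OF c(2,3)] map_pdiff_mult[OF c(3,1)] by (simp split: if_splits)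
  show ?thesis
  proof (rule mat_eqI[of _ ?n' ?n])
    fix a b assume ab: "a < ?n'" "b < ?n"
    note dims = pc[THEN carrier_matD(1)] pc[THEN carrier_matD(2)]
    show "dcomm p X X' (?\<delta> f) $$ (a, b) = (if p then - (?\<delta> (mf_d X') * f + f * ?\<delta> (mf_d X)) else f * ?\<delta> (mf_d X) - ?\<delta> (mf_d X') * f) $$ (a, b)"
    proof (cases p)
      case True
      have "((mf_d X' * ?\<delta> f) $$ (a, b) + (?\<delta> f * mf_d X) $$ (a, b)) + ((?\<delta> (mf_d X') * f) $$ (a, b) + (f * ?\<delta> (mf_d X)) $$ (a, b)) = 0"
        using arg_cong[OF e, of "\<lambda>x. x $$ (a, b)"] ab dims True by (simp add: algebra_simps del: index_mult_mat(1))
      then have "(mf_d X' * ?\<delta> f) $$ (a, b) + (?\<delta> f * mf_d X) $$ (a, b) = - ((?\<delta> (mf_d X') * f) $$ (a, b) + (f * ?\<delta> (mf_d X)) $$ (a, b))"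
        by (simp only: eq_neg_iff_add_eq_0)
      then show ?thesis using ab dims True by (simp add: dcomm_def del: index_mult_mat(1))
    next
      case False
      have "((mf_d X' * ?\<delta> f) $$ (a, b) - (?\<delta> f * mf_d X) $$ (a, b)) - ((f * ?\<delta> (mf_d X)) $$ (a, b) - (?\<delta> (mf_d X') * f) $$ (a, b)) = 0"
        using arg_cong[OF e, of "\<lambda>x. x $$ (a, b)"] ab dims False by (simp add: algebra_simps del: index_mult_mat(1))
      then show ?thesis using ab dims False by (simp add: dcomm_def del: index_mult_mat(1))
    qed
  qed (use pc in \<open>auto simp: dcomm_def intro: minus_carrier_mat\<close>)
qed

lemma mat_add_cancel:
  assumes "P \<in> carrier_mat n k" "Q \<in> carrier_mat n k" "Q' \<in> carrier_mat n k" "P' \<in> carrier_mat n k"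
  shows "P + P' = (P + Q) + (Q' + P') - (Q + (Q' :: 'a::ab_group_add mat))"
  using assms by (intro eq_matI) auto

lemma mat_neg_add:
  assumes "P \<in> carrier_mat n k" "Q \<in> carrier_mat n k"
  shows "- P + - Q = - (P + (Q :: 'a::ab_group_add mat))"
  using assms by (intro eq_matI) auto

lemma mat_diff_diff:
  assumes "P \<in> carrier_mat n k" "Q \<in> carrier_mat n k"
  shows "P - Q - P = - (Q :: 'a::ab_group_add mat)"
  using assms by (intro eq_matI) auto

text \<open>The first and second entrywise derivatives of d_X^2 = V - W. The first makes the
  derivative of d_X a null homotopy; the second shows that two such derivatives anticommute up to a
  second derivative of the potential and a boundary.\<close>

lemma pdiff_square: assumes "Xok X"
  shows "mf_d X * map_mat (pdiff (ys ! l)) (mf_d X) + map_mat (pdiff (ys ! l)) (mf_d X) * mf_d X = pdiff (ys ! l) (V - W) \<cdot>\<^sub>m 1\<^sub>m (mf_rank X)"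
    "map_mat (pdiff v) (mf_d X) * map_mat (pdiff (ys ! l)) (mf_d X) + map_mat (pdiff (ys ! l)) (mf_d X) * map_mat (pdiff v) (mf_d X)
      = pdiff v (pdiff (ys ! l) (V - W)) \<cdot>\<^sub>m 1\<^sub>m (mf_rank X)
       - (mf_d X * map_mat (pdiff v) (map_mat (pdiff (ys ! l)) (mf_d X)) + map_mat (pdiff v) (map_mat (pdiff (ys ! l)) (mf_d X)) * mf_d X)"
proof -
  let ?n = "mf_rank X" and ?\<delta> = "map_mat (pdiff (ys ! l))" and ?\<epsilon> = "map_mat (pdiff v)" and ?d = "mf_d X"
  have c: "?d \<in> carrier_mat ?n ?n" using assms hom_mapsD(1) by (auto simp: matrix_factorisation_def)
  have \<delta>: "?\<delta> ?d \<in> carrier_mat ?n ?n" "?\<epsilon> ?d \<in> carrier_mat ?n ?n" "?\<epsilon> (?\<delta> ?d) \<in> carrier_mat ?n ?n" using c by auto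
  have pc: "?d * ?\<delta> ?d \<in> carrier_mat ?n ?n" "?\<delta> ?d * ?d \<in> carrier_mat ?n ?n"
     "?\<epsilon> ?d * ?\<delta> ?d \<in> carrier_mat ?n ?n" "?\<delta> ?d * ?\<epsilon> ?d \<in> carrier_mat ?n ?n"
     "?d * ?\<epsilon> (?\<delta> ?d) \<in> carrier_mat ?n ?n" "?\<epsilon> (?\<delta> ?d) * ?d \<in> carrier_mat ?n ?n" using c \<delta> by auto
  have "?\<delta> (?d * ?d) = pdiff (ys ! l) (V - W) \<cdot>\<^sub>m 1\<^sub>m ?n"
    using assms by (simp add: matrix_factorisation_def map_pdiff_lin(3)[OF c c])
  then show 1: "?d * ?\<delta> ?d + ?\<delta> ?d * ?d = pdiff (ys ! l) (V - W) \<cdot>\<^sub>m 1\<^sub>m ?n"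
    using map_pdiff_mult[OF c c] comm_add_mat[OF pc(1,2)] by metis
  have "?\<epsilon> (?d * ?\<delta> ?d + ?\<delta> ?d * ?d) = pdiff v (pdiff (ys ! l) (V - W)) \<cdot>\<^sub>m 1\<^sub>m ?n"
    unfolding 1 by (rule map_pdiff_lin(3)[OF c c])
  then have e: "(?\<epsilon> ?d * ?\<delta> ?d + ?d * ?\<epsilon> (?\<delta> ?d)) + (?\<epsilon> (?\<delta> ?d) * ?d + ?\<delta> ?d * ?\<epsilon> ?d) = pdiff v (pdiff (ys ! l) (V - W)) \<cdot>\<^sub>m 1\<^sub>m ?n"
    unfolding map_pdiff_lin(1)[OF pc(1,2)] map_pdiff_mult[OF c \<delta>(1)] map_pdiff_mult[OF \<delta>(1) c] .
  show "?\<epsilon> ?d * ?\<delta> ?d + ?\<delta> ?d * ?\<epsilon> ?d = pdiff v (pdiff (ys ! l) (V - W)) \<cdot>\<^sub>m 1\<^sub>m ?n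
      - (?d * ?\<epsilon> (?\<delta> ?d) + ?\<epsilon> (?\<delta> ?d) * ?d)"
    unfolding e[symmetric] by (rule mat_add_cancel[OF pc(3,5,6,4)])
qed

lemma pdiff_VW: "l < length ys ==> pdiff (ys ! l) (V - W) = t l" "l < length ys ==> pdiff v (pdiff (ys ! l) (V - W)) = pdiff v (t l)"
proof -
  assume l: "l < length ys"
  have "pdiff (ys ! l) W = 0" by (rule pdiff_outside[OF WP]) (use l dist3 in \<open>auto simp: disjoint_iff\<close>)
  then show "pdiff (ys ! l) (V - W) = t l" using l by (simp add: pdiff_diff partials_def)
  then show "pdiff v (pdiff (ys ! l) (V - W)) = pdiff v (t l)" by simp
qed

end

section \<open>Relations among the operators on one cut\<close>

context cut_full
begin

lemma tens_zero:
  "tens_mat q par (0\<^sub>m a b) (g :: ('v, 'k) mpol mat) = 0\<^sub>m (a * dim_row g) (b * dim_col g)"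
  "tens_mat q par (f :: ('v, 'k) mpol mat) (0\<^sub>m a b) = 0\<^sub>m (dim_row f * a) (dim_col f * b)"
  using div_mod_less by (auto intro!: eq_matI simp: tens_mat_def)

context
  fixes Y X :: "('v, 'k) mpol mf"
  assumes Yk: "Yok Y" and Xk: "Xok X"
begin

abbreviation "MM \<equiv> mc Y X"
abbreviation "em F \<equiv> emb (mc Y X) (mc Y X) F"
abbreviation "NN \<equiv> mf_rank Y * mf_rank X"

lemmas mY' = Yok_mf(2)[OF Yk] and mX' = Xok_mf(2)[OF Xk]
lemmas sq' = sq[OF Yk Xk]
lemmas mM' = mcR[OF Yk Xk]

lemma rank_MM: "mf_rank MM = NN * \<mu>" by (rule mc_simps(1)[OF mY' mX'])

lemma dX_hom: "mf_d X \<in> hom_maps (poly_in E) True X X" using mX' by (simp add: mfR_def)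

lemma one_hom: "1\<^sub>m (mf_rank Y) \<in> hom_maps (poly_in E) False Y Y" by (rule pr.hom_maps_1)

lemma tens_one_left_hom: "g \<in> hom_maps (poly_in E) q X X ==> tens_mat q (mf_par Y) (1\<^sub>m (mf_rank Y)) g \<in> hom_maps (poly_in E) q (tmf Y X) (tmf Y X)"
  using tens_hom[OF one_hom, of g q X X] by simp

lemma dcomm_one: "dcomm False Y Y (1\<^sub>m (mf_rank Y)) = 0\<^sub>m (mf_rank Y) (mf_rank Y)"
proof -
  have "mf_d Y \<in> carrier_mat (mf_rank Y) (mf_rank Y)" using mY' hom_mapsD(1) by (auto simp: mfR_def)
  then show ?thesis by (simp add: dcomm_def)
qed

lemma dcomm_tens_one_left:
  assumes g: "g \<in> hom_maps (poly_in E) q X X"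
  shows "dcomm q (tmf Y X) (tmf Y X) (tens_mat q (mf_par Y) (1\<^sub>m (mf_rank Y)) g) = tens_mat (\<not> q) (mf_par Y) (1\<^sub>m (mf_rank Y)) (dcomm q X X g)"
proof -
  have c: "tens_mat (\<not> q) (mf_par Y) (1\<^sub>m (mf_rank Y)) (dcomm q X X g) \<in> carrier_mat NN NN"
    using mX' hom_mapsD(1)[OF g] by (intro tens_carrier dcomm_carrier[of X "poly_in E" X]) (auto simp: mfR_def)
  show ?thesis using dcomm_tens[OF mY' mY' mX' mX' one_hom g] hom_mapsD(1)[OF g] c by (simp add: dcomm_one tens_zero)
qed

lemma lam_hom: "lam Y X l \<in> hom_maps (poly_in E) True (tmf Y X) (tmf Y X)"
  unfolding lam_def by (rule tens_one_left_hom[OF pdiff_hom[OF dX_hom]])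

lemma tens_scalar: "tens_mat False par (1\<^sub>m a) (c \<cdot>\<^sub>m 1\<^sub>m b) = (c \<cdot>\<^sub>m 1\<^sub>m (a * b) :: ('v, 'k) mpol mat)"
  using tens_lin(6)[of "1\<^sub>m a" a a "1\<^sub>m a" "1\<^sub>m b" b b "1\<^sub>m b" False par c] by (simp add: tens_one)

lemma dcomm_lam: assumes l: "l < length ys"
  shows "dcomm True (tmf Y X) (tmf Y X) (lam Y X l) = t l \<cdot>\<^sub>m 1\<^sub>m NN"
proof -
  have "dcomm True X X (map_mat (pdiff (ys ! l)) (mf_d X)) = t l \<cdot>\<^sub>m 1\<^sub>m (mf_rank X)"
    using pdiff_square(1)[OF Xk, of l] pdiff_VW(1)[OF l] by (simp add: dcomm_def)
  then show ?thesis unfolding lam_def dcomm_tens_one_left[OF pdiff_hom[OF dX_hom]] by (simp add: tens_scalar)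
qed

abbreviation "At i \<equiv> em (atiyah ys V bs \<sigma> Y X i)"
abbreviation "Lam l \<equiv> em (C0 (lam Y X l))"
abbreviation "Sc i j \<equiv> em (C0 (Vd i j \<cdot>\<^sub>m 1\<^sub>m NN))"
abbreviation "on \<equiv> em (1\<^sub>m (mf_rank MM))"

lemma at_closed0: "i < length ys ==> C1 i (tens_d Y X) \<in> closed_maps R True MM MM"
  using C1d_closed[OF AE mY' mX' w_R' sq'] by (simp add: E_A)

lemma at_closed: "i < length ys ==> atiyah ys V bs \<sigma> Y X i \<in> closed_maps R True MM MM"
  using pr.closed_maps_ops(3)[OF mM' mM' at_closed0] by (simp add: atiyah_C1[OF mY' mX'])

lemma At_eq: "i < length ys ==> At i = - em (C1 i (tens_d Y X))"
  using emb_smult_R(2)[OF mM' mM' at_closed0] by (simp add: atiyah_C1[OF mY' mX'])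

lemma lam_closed: "l < length ys ==> C0 (lam Y X l) \<in> closed_maps R True MM MM"
  using t_homotopy_closed[OF AE mY' mX' w_R' sq' lam_hom _ dcomm_lam] by (simp add: E_A)

lemma scalar_closed: assumes "c \<in> poly_in E" shows "c \<cdot>\<^sub>m 1\<^sub>m NN \<in> closed_maps (poly_in E) False (tmf Y X) (tmf Y X)"
proof -
  have d: "tens_d Y X \<in> carrier_mat NN NN" by (rule tens_d_carrier[OF mY' mX'])
  have "c \<cdot>\<^sub>m 1\<^sub>m (mf_rank (tmf Y X)) \<in> hom_maps (poly_in E) False (tmf Y X) (tmf Y X)"
    by (rule pr.hom_maps_add(4)[OF pr.hom_maps_1 pr.hom_maps_1 assms])
  moreover have "tens_d Y X * (c \<cdot>\<^sub>m 1\<^sub>m NN) - c \<cdot>\<^sub>m 1\<^sub>m NN * tens_d Y X = 0\<^sub>m NN NN"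
    using d by (simp add: mult_smult_distrib[of _ NN NN _ NN] mult_smult_assoc_mat[of _ NN NN _ NN])
  ultimately show ?thesis by (simp add: closed_maps_def dcomm_def)
qed

lemma Vd_E: "Vd i j \<in> poly_in E"
proof -
  have "V \<in> poly_in E" using pot poly_in_mono[of V "set ys" E] by (auto simp: potential_def)
  then show ?thesis by (intro pdiff_in)
qed

lemma Sc_closed: "c \<in> poly_in E ==> C0 (c \<cdot>\<^sub>m 1\<^sub>m NN) \<in> closed_maps R False MM MM"
  using C0_closed[OF AE mY' mX' mY' mX' scalar_closed] by (simp add: E_A)

text \<open>Before reduction these are scalar matrices, and \<open>C0\<close> is
  multiplicative.\<close>

lemma C0_scalar_commute:
  assumes "F \<in> carrier_mat NN NN" shows "C0 (c \<cdot>\<^sub>m 1\<^sub>m NN) * C0 F = C0 F * C0 (c \<cdot>\<^sub>m 1\<^sub>m NN)"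
proof -
  have s: "c \<cdot>\<^sub>m 1\<^sub>m NN \<in> carrier_mat NN NN" by simp
  have "c \<cdot>\<^sub>m 1\<^sub>m NN * F = F * (c \<cdot>\<^sub>m 1\<^sub>m NN)"
    using assms by (simp add: mult_smult_distrib[of _ NN NN _ NN] mult_smult_assoc_mat[of _ NN NN _ NN])
  then show ?thesis by (simp flip: blk_mult(1)[OF s assms] blk_mult(1)[OF assms s])
qed

lemma lam_carrier: "lam Y X l \<in> carrier_mat NN NN" by (rule hom_tmf_carrier[OF AE lam_hom])

lemma AtAt: "i < length ys ==> j < length ys ==> At i * At j + At j * At i = 0"
  using At_anticommute[OF AE mY' mX' w_R' sq'] by (simp add: At_eq)

lemma AtLam: assumes "i < length ys" "j < length ys" shows "At i * Lam j + Lam j * At i = (if i = j then - on else 0)"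
proof -
  let ?D = "em (C1 i (tens_d Y X))"
  have "?D * Lam j + Lam j * ?D = (if i = j then on else 0)"
    by (rule At_t_homotopy[OF AE mY' mX' w_R' sq' lam_hom assms(2,1) dcomm_lam[OF assms(2)]])
  moreover have "At i * Lam j + Lam j * At i = - (?D * Lam j + Lam j * ?D)"
    unfolding At_eq[OF assms(1)] by simp
  ultimately show ?thesis by simp
qed

text \<open>Multiplication by a polynomial in the \<open>ys\<close> is an even closed map before
  reduction, so naturality applies to it, although its derivative in direction \<open>i\<close> need
  not vanish.\<close>

lemma AtSc: assumes "i < length ys" "c \<in> poly_in E" shows "At i * em (C0 (c \<cdot>\<^sub>m 1\<^sub>m NN)) = em (C0 (c \<cdot>\<^sub>m 1\<^sub>m NN)) * At i"
  using At_natural[OF AE mY' mX' mY' mX' w_R' w_R' sq' sq' scalar_closed[OF assms(2)] assms(1)] assms(1) by (simp add: At_eq)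

lemma LamSc: assumes "l < length ys" "c \<in> poly_in E" shows "Lam l * em (C0 (c \<cdot>\<^sub>m 1\<^sub>m NN)) = em (C0 (c \<cdot>\<^sub>m 1\<^sub>m NN)) * Lam l"
  using emb_mult_R[OF mM' mM' mM' lam_closed[OF assms(1)] Sc_closed[OF assms(2)]]
    emb_mult_R[OF mM' mM' mM' Sc_closed[OF assms(2)] lam_closed[OF assms(1)]] C0_scalar_commute[OF lam_carrier] by simp

lemma ScSc: assumes "c \<in> poly_in E" "e \<in> poly_in E"
  shows "em (C0 (c \<cdot>\<^sub>m 1\<^sub>m NN)) * em (C0 (e \<cdot>\<^sub>m 1\<^sub>m NN)) = em (C0 (e \<cdot>\<^sub>m 1\<^sub>m NN)) * em (C0 (c \<cdot>\<^sub>m 1\<^sub>m NN))"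
  using emb_mult_R[OF mM' mM' mM' Sc_closed[OF assms(1)] Sc_closed[OF assms(2)]]
    emb_mult_R[OF mM' mM' mM' Sc_closed[OF assms(2)] Sc_closed[OF assms(1)]] C0_scalar_commute[of "e \<cdot>\<^sub>m 1\<^sub>m NN" c] by simp

lemma on_unit: assumes "f \<in> closed_maps R p MM MM" shows "em f * on = em f" "on * em f = em f"
proof -
  have f: "f \<in> carrier_mat (mf_rank MM) (mf_rank MM)" by (rule pr.closed_carrier[OF assms])
  have o: "1\<^sub>m (mf_rank MM) \<in> closed_maps R False MM MM" by (rule pr.closed_maps_ops(6)[OF mM' mM'])
  show "em f * on = em f" "on * em f = em f"
    using emb_mult_R[OF mM' mM' mM' o assms] emb_mult_R[OF mM' mM' mM' assms o] f by simp_all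
qed

text \<open>Second derivative of the potential equation for \<open>X\<close>, tensored with the
  identity of \<open>Y\<close> (which is even, so no signs arise) and reduced to J_V. The homotopy
  is minus the second derivative of d_X.\<close>

lemma LamLam: assumes ij: "i < length ys" "j < length ys" shows "Lam i * Lam j + Lam j * Lam i = Sc i j"
proof -
  let ?\<delta> = "\<lambda>l. map_mat (pdiff (ys ! l)) (mf_d X)" and ?I = "1\<^sub>m (mf_rank Y) :: ('v, 'k) mpol mat"
  let ?n = "mf_rank X"
  have h: "?\<delta> l \<in> hom_maps (poly_in E) True X X" for l by (rule pdiff_hom[OF dX_hom])
  have c: "?\<delta> l \<in> carrier_mat ?n ?n" for l using hom_mapsD(1)[OF h] .
  have I: "?I \<in> carrier_mat (mf_rank Y) (mf_rank Y)" by simp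
  have U: "?I \<in> hom_maps UNIV False Y Y" by (rule hom_maps_mono[OF one_hom]) simp
  have L: "lam Y X a * lam Y X b = tens_mat False (mf_par Y) ?I (?\<delta> a * ?\<delta> b)" for a b
    unfolding lam_def using tens_mult[OF U c I c, where q'=True and q=True] by simp
  let ?H = "map_mat (pdiff (ys ! i)) (?\<delta> j)"
  have H: "?H \<in> hom_maps (poly_in E) True X X" by (rule pdiff_hom[OF h])
  have pc: "?\<delta> i * ?\<delta> j \<in> carrier_mat ?n ?n" "?\<delta> j * ?\<delta> i \<in> carrier_mat ?n ?n" using c by auto
  have F: "lam Y X i * lam Y X j + lam Y X j * lam Y X i \<in> hom_maps (poly_in E) False (tmf Y X) (tmf Y X)"
    using pr.hom_maps_add(1)[OF pr.hom_maps_mult[OF lam_hom lam_hom] pr.hom_maps_mult[OF lam_hom lam_hom]] by simp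
  have G: "Vd i j \<cdot>\<^sub>m 1\<^sub>m NN \<in> hom_maps (poly_in E) False (tmf Y X) (tmf Y X)" using scalar_closed[OF Vd_E] by (simp add: closed_maps_def)
  have lc: "C0 (lam Y X a * lam Y X b) \<in> closed_maps R False MM MM" "em (C0 (lam Y X a * lam Y X b)) = Lam a * Lam b"
    if "a < length ys" "b < length ys" for a b
    using pr.closed_maps_mult[OF mM' mM' mM' lam_closed[OF that(2)] lam_closed[OF that(1)]]
      emb_mult_R[OF mM' mM' mM' lam_closed[OF that(2)] lam_closed[OF that(1)]] blk_mult(1)[OF lam_carrier lam_carrier] by simp_all
  have lsum: "C0 (lam Y X i * lam Y X j + lam Y X j * lam Y X i) = C0 (lam Y X i * lam Y X j) + C0 (lam Y X j * lam Y X i)"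
    by (rule blk_add(1)[OF mult_carrier_mat[OF lam_carrier lam_carrier] mult_carrier_mat[OF lam_carrier lam_carrier]])
  have F0: "C0 (lam Y X i * lam Y X j + lam Y X j * lam Y X i) \<in> closed_maps R False MM MM"
    unfolding lsum by (rule pr.closed_maps_ops(1)[OF mM' mM' lc(1)[OF ij] lc(1)[OF ij(2,1)]])
  have nH: "- tens_mat True (mf_par Y) ?I ?H \<in> hom_maps (poly_in E) (\<not> False) (tmf Y X) (tmf Y X)"
    using pr.hom_maps_add(3)[OF tens_one_left_hom[OF H] tens_one_left_hom[OF H]] by simp
  let ?dH = "mf_d X * ?H + ?H * mf_d X"
  have dXc: "mf_d X \<in> carrier_mat ?n ?n" by (rule hom_mapsD(1)[OF dX_hom])
  have dHc: "?dH \<in> carrier_mat ?n ?n" using dXc hom_mapsD(1)[OF H] by auto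
  have "dcomm True X X ?H = ?dH" by (simp add: dcomm_def)
  then have dT: "dcomm True (tmf Y X) (tmf Y X) (tens_mat True (mf_par Y) ?I ?H) = tens_mat False (mf_par Y) ?I ?dH"
    using dcomm_tens_one_left[OF H] by simp
  have d: "tens_d Y X \<in> carrier_mat NN NN" by (rule tens_d_carrier[OF mY' mX'])
  have Tc: "tens_mat True (mf_par Y) ?I ?H \<in> carrier_mat NN NN" by (rule hom_tmf_carrier[OF AE tens_one_left_hom[OF H]])
  have dn: "dcomm True (tmf Y X) (tmf Y X) (- tens_mat True (mf_par Y) ?I ?H) = - tens_mat False (mf_par Y) ?I ?dH"
  proof -
    have p: "tens_d Y X * tens_mat True (mf_par Y) ?I ?H \<in> carrier_mat NN NN" "tens_mat True (mf_par Y) ?I ?H * tens_d Y X \<in> carrier_mat NN NN" using d Tc by auto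
    have "dcomm True (tmf Y X) (tmf Y X) (- tens_mat True (mf_par Y) ?I ?H) = - dcomm True (tmf Y X) (tmf Y X) (tens_mat True (mf_par Y) ?I ?H)"
      unfolding dcomm_def if_True tmf_simps mult_uminus_mat(1)[OF d Tc] mult_uminus_mat(2)[OF Tc d] by (rule mat_neg_add[OF p])
    then show ?thesis by (simp only: dT)
  qed
  \<comment> \<open>Everything is brought under one tensor product, so that the difference can be
    formed in the right-hand factor.\<close>
  have sc: "Vd i j \<cdot>\<^sub>m 1\<^sub>m NN = tens_mat False (mf_par Y) ?I (Vd i j \<cdot>\<^sub>m 1\<^sub>m ?n)" by (rule tens_scalar[symmetric])
  have sum: "lam Y X i * lam Y X j + lam Y X j * lam Y X i = tens_mat False (mf_par Y) ?I (Vd i j \<cdot>\<^sub>m 1\<^sub>m ?n - ?dH)"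
    unfolding L tens_lin(3)[OF I I pc, symmetric] using pdiff_square(2)[OF Xk, of "ys ! i" j] pdiff_VW[OF ij(2)] ij
    by (simp add: partials_def)
  have FG: "(lam Y X i * lam Y X j + lam Y X j * lam Y X i) - Vd i j \<cdot>\<^sub>m 1\<^sub>m NN = dcomm (\<not> False) (tmf Y X) (tmf Y X) (- tens_mat True (mf_par Y) ?I ?H)"
  proof -
    have s: "Vd i j \<cdot>\<^sub>m 1\<^sub>m ?n \<in> carrier_mat ?n ?n" by simp
    have m: "Vd i j \<cdot>\<^sub>m 1\<^sub>m ?n - ?dH - Vd i j \<cdot>\<^sub>m 1\<^sub>m ?n = - ?dH"
      by (rule mat_diff_diff[OF s dHc])
    have "(lam Y X i * lam Y X j + lam Y X j * lam Y X i) - Vd i j \<cdot>\<^sub>m 1\<^sub>m NN = tens_mat False (mf_par Y) ?I (Vd i j \<cdot>\<^sub>m 1\<^sub>m ?n - ?dH - Vd i j \<cdot>\<^sub>m 1\<^sub>m ?n)"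
      unfolding sum sc by (rule tens_lin(4)[OF I I minus_carrier_mat[OF dHc] s, symmetric])
    then show ?thesis unfolding m using dn tens_lin(8)[OF I I dHc dHc, of False "mf_par Y"] by simp
  qed
  have "em (C0 (lam Y X i * lam Y X j + lam Y X j * lam Y X i)) = Sc i j"
    by (rule C0_null[OF AE mY' mX' mY' mX' _ F _ G nH FG]) (use F0 Sc_closed[OF Vd_E] in \<open>simp_all add: E_A\<close>)
  then show ?thesis
    unfolding lsum using emb_add_R[OF mM' mM' lc(1)[OF ij] lc(1)[OF ij(2,1)]] lc(2)[OF ij] lc(2)[OF ij(2,1)] by simp
qed

abbreviation "gd i \<equiv> cut_gamd ys V bs \<sigma> Y X i"

lemma gd_closed_eq:
  assumes i: "i < length ys"
  shows "gd i \<in> closed_maps R True MM MM \<and> em (gd i) = - Lam i - scl (pconst half) (\<Sum>q<length ys. Sc q i * At q)"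
proof -
  let ?n = "NN * \<mu>"
  define B where "B q = C0 (Vd q i \<cdot>\<^sub>m 1\<^sub>m NN) * atiyah ys V bs \<sigma> Y X q" for q
  \<comment> \<open>\<open>cut_gamd\<close> sums matrices entrywise. The partial sums are made into
    matrices so that closedness and class can be obtained by induction on the number of
    summands.\<close>
  define ms where "ms k = mat ?n ?n (\<lambda>(P, Q). \<Sum>q<k. B q $$ (P, Q))" for k
  have Bc: "B q \<in> closed_maps R True MM MM" "em (B q) = Sc q i * At q" if "q < length ys" for q
    using pr.closed_maps_mult[OF mM' mM' mM' at_closed[OF that] Sc_closed[OF Vd_E]]
      emb_mult_R[OF mM' mM' mM' at_closed[OF that] Sc_closed[OF Vd_E]] by (simp_all add: B_def)
  have ms: "ms k \<in> closed_maps R True MM MM \<and> em (ms k) = (\<Sum>q<k. Sc q i * At q)" if "k \<le> length ys" for k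
    using that
  proof (induction k)
    case 0
    have "ms 0 = 0\<^sub>m (mf_rank MM) (mf_rank MM)" by (auto simp: ms_def rank_MM)
    then show ?case using pr.closed_maps_ops(5)[OF mM' mM'] by (simp add: emb_0)
  next
    case (Suc k)
    then have k: "k < length ys" by simp
    have "ms (Suc k) = ms k + B k"
      using pr.closed_carrier[OF Bc(1)[OF k]] by (intro eq_matI) (auto simp: ms_def rank_MM)
    then show ?case using Suc Bc[OF k] pr.closed_maps_ops(1)[OF mM' mM'] emb_add_R[OF mM' mM'] by auto
  qed
  let ?K = "pconst half \<cdot>\<^sub>m ms (length ys)"
  have K: "?K \<in> closed_maps R True MM MM" "em ?K = scl (pconst half) (\<Sum>q<length ys. Sc q i * At q)"
    using pr.closed_maps_ops(4)[OF mM' mM'] ms[OF le_refl] emb_smult_R(1)[OF mM' mM'] by auto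
  have L: "- C0 (lam Y X i) \<in> closed_maps R True MM MM" "em (- C0 (lam Y X i)) = - Lam i"
    using pr.closed_maps_ops(3)[OF mM' mM' lam_closed[OF i]] emb_smult_R(2)[OF mM' mM' lam_closed[OF i]] by auto
  have nK: "- ?K \<in> closed_maps R True MM MM" "em (- ?K) = - scl (pconst half) (\<Sum>q<length ys. Sc q i * At q)"
    using pr.closed_maps_ops(3)[OF mM' mM' K(1)] emb_smult_R(2)[OF mM' mM' K(1)] K(2) by auto
  have "gd i = - C0 (lam Y X i) + - ?K"
  proof -
    have "cut_mat ys V bs True (mf_par Y) (1\<^sub>m (mf_rank Y)) (map_mat (pdiff (ys ! i)) (mf_d X)) = C0 (lam Y X i)"
      unfolding lam_def by (rule cut_mat_C0) (use hom_mapsD(1)[OF dX_hom] in auto)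
    moreover have "mat (mf_rank MM) (mf_rank MM) (\<lambda>(P, Q). pconst half * (\<Sum>q<length ys.
        (cut_scalar ys V bs Y X (Vd q i) * atiyah ys V bs \<sigma> Y X q) $$ (P, Q))) = ?K"
      by (auto intro!: eq_matI simp: ms_def B_def rank_MM cut_scalar_C0 simp del: index_mult_mat(1))
    ultimately show ?thesis unfolding cut_gamd_def
      using blk_carrier[OF lam_carrier, of phi0 i] by (auto simp: ms_def intro!: eq_matI)
  qed
  then show ?thesis using pr.closed_maps_ops(1)[OF mM' mM' L(1) nK(1)] emb_add_R[OF mM' mM' L(1) nK(1)] L(2) nK(2) by simp
qed

lemma scl_half: "scl (pconst half) x + scl (pconst half) x = (x :: ('v, 'k) mpol hm)"
  by (simp add: half_half[OF rat] scl_props(4) flip: scl_props(2) pconst_add)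

lemma gd_relations:
  assumes ij: "i < length ys" "j < length ys"
  shows "At i * em (gd j) + em (gd j) * At i = (if i = j then on else 0)"
    "em (gd i) * em (gd j) + em (gd j) * em (gd i) = 0"
proof -
  note S = AtSc[OF _ Vd_E] LamSc[OF _ Vd_E] ScSc[OF Vd_E Vd_E] arg_cong[OF pdiff_commute, of "\<lambda>c. em (C0 (c \<cdot>\<^sub>m 1\<^sub>m NN))"] on_unit(1)[OF Sc_closed[OF Vd_E]]
  note * = clifford_from_atiyah[of "length ys" At Lam on Sc "scl (pconst half)" "\<lambda>i. em (gd i)", OF AtAt AtLam LamLam S
      scl_props(1) scl_props(5) scl_props(6) scl_half _ ij]
  show "At i * em (gd j) + em (gd j) * At i = (if i = j then on else 0)"
    "em (gd i) * em (gd j) + em (gd j) * em (gd i) = 0"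
    by (rule *; use gd_closed_eq in auto)+
qed

end

end

lemma poly_in_UNIV: "poly_in UNIV = UNIV" by (auto simp: poly_in_def)

lemma mat_eq_sgn:
  assumes "P \<in> carrier_mat n k" "Q \<in> carrier_mat n k"
  shows "- P - - Q = - (P - (Q :: 'a::comm_ring_1 mat))" "P - (- Q) = P + Q" "- P - Q = - (P + Q)"
  using assms by (auto intro!: eq_matI)

section \<open>Naturality with respect to maps of both factors\<close>

context cut_full
begin

lemma C0_smult: assumes "c \<in> R'" "F \<in> carrier_mat n k" shows "C0 (c \<cdot>\<^sub>m F) = c \<cdot>\<^sub>m C0 F"
proof -
  have "c \<cdot>\<^sub>m F = (c \<cdot>\<^sub>m 1\<^sub>m n) * F" using assms(2) by (simp add: mult_smult_assoc_mat[of _ n n _ k])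
  then have "C0 (c \<cdot>\<^sub>m F) = C0 (c \<cdot>\<^sub>m 1\<^sub>m n) * C0 F" using blk_mult(1)[of "c \<cdot>\<^sub>m 1\<^sub>m n" n n F k] assms(2) by simp
  also have "\<dots> = c \<cdot>\<^sub>m C0 F" unfolding blk_scalar(1)[OF assms(1)]
    using blk_carrier[OF assms(2), of phi0] by (simp add: mult_smult_assoc_mat[of _ "n * \<mu>" "n * \<mu>" _ "k * \<mu>"])
  finally show ?thesis .
qed

lemma pconst_R': "pconst c \<in> R'" by (rule poly_in_pconst)

abbreviation "tm q Y f g \<equiv> tens_mat q (mf_par Y) f g"

lemmas closedE1 = closed_maps_mono[OF _ R1E] and closedE2 = closed_maps_mono[OF _ R2E]

lemma tens_closed_gen:
  fixes Y :: "('v, 'k) mpol mf"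
  assumes m: "mfR (poly_in B) Y" "mfR (poly_in B) Y'" "mfR (poly_in B) X" "mfR (poly_in B) X'"
    and f: "f \<in> closed_maps (poly_in B) pf Y Y'" and g: "g \<in> closed_maps (poly_in B) q X X'"
  shows "tm q Y f g \<in> closed_maps (poly_in B) (pf \<noteq> q) (tmf Y X) (tmf Y' X')"
proof -
  have h: "f \<in> hom_maps (poly_in B) pf Y Y'" "g \<in> hom_maps (poly_in B) q X X'" using f g by (auto simp: closed_maps_def)
  note c = hom_mapsD(1)[OF h(1)] hom_mapsD(1)[OF h(2)]
  have z: "tm q Y (0\<^sub>m (mf_rank Y') (mf_rank Y)) g = 0\<^sub>m (mf_rank Y' * mf_rank X') (mf_rank Y * mf_rank X)"
    "tm (\<not> q) Y f (0\<^sub>m (mf_rank X') (mf_rank X)) = 0\<^sub>m (mf_rank Y' * mf_rank X') (mf_rank Y * mf_rank X)"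
    unfolding tens_zero using c by simp_all
  have d: "dcomm pf Y Y' f = 0\<^sub>m (mf_rank Y') (mf_rank Y)" "dcomm q X X' g = 0\<^sub>m (mf_rank X') (mf_rank X)"
    using f g by (simp_all add: closed_maps_def)
  have "dcomm (pf \<noteq> q) (tmf Y X) (tmf Y' X') (tm q Y f g) = 0\<^sub>m (mf_rank (tmf Y' X')) (mf_rank (tmf Y X))"
    unfolding dcomm_tens[OF m h] d z by simp
  then show ?thesis using tens_hom[OF h] by (simp only: closed_maps_def mem_Collect_eq)
qed

context
  fixes Y Y' X X' :: "('v, 'k) mpol mf"
  assumes Yk: "Yok Y" "Yok Y'" and Xk: "Xok X" "Xok X'"
begin

lemmas mY = Yok_mf(2)[OF Yk(1)] Yok_mf(2)[OF Yk(2)] and mX = Xok_mf(2)[OF Xk(1)] Xok_mf(2)[OF Xk(2)]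
lemmas mY1 = Yok_mf(1)[OF Yk(1)] Yok_mf(1)[OF Yk(2)] and mX1 = Xok_mf(1)[OF Xk(1)] Xok_mf(1)[OF Xk(2)]
lemmas mM = mcR[OF Yk(1) Xk(1)] mcR[OF Yk(2) Xk(2)]

lemma mfU: "mfR (poly_in UNIV) Y" "mfR (poly_in UNIV) Y'" "mfR (poly_in UNIV) X" "mfR (poly_in UNIV) X'"
  using mY mX hom_maps_mono[of _ "poly_in E" _ _ _ "poly_in UNIV"] by (auto simp: mfR_def poly_in_UNIV)

lemma tens_closed:
  assumes "f \<in> closed_maps R1 pf Y Y'" "g \<in> closed_maps R2 q X X'"
  shows "tm q Y f g \<in> closed_maps (poly_in E) (pf \<noteq> q) (tmf Y X) (tmf Y' X')"
    "C0 (tm q Y f g) \<in> closed_maps R (pf \<noteq> q) (mc Y X) (mc Y' X')"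
proof -
  show *: "tm q Y f g \<in> closed_maps (poly_in E) (pf \<noteq> q) (tmf Y X) (tmf Y' X')"
    by (rule tens_closed_gen[OF mY mX closedE1[OF assms(1)] closedE2[OF assms(2)]])
  show "C0 (tm q Y f g) \<in> closed_maps R (pf \<noteq> q) (mc Y X) (mc Y' X')"
    using C0_closed[OF AE mY(1) mX(1) mY(2) mX(2) *] by (simp add: E_A)
qed

abbreviation "ch q f g \<equiv> emb (mc Y X) (mc Y' X') (C0 (tens_mat q (mf_par Y) f g))"

lemma closedU: assumes "f \<in> closed_maps R1 pf Y Y'" "g \<in> closed_maps R2 q X X'"
  shows "C0 (tm q Y f g) \<in> closed_maps (poly_in (UNIV - set ys)) (pf \<noteq> q) (mc Y X) (mc Y' X')"
    "tm q Y f g \<in> hom_maps (poly_in UNIV) (pf \<noteq> q) (tmf Y X) (tmf Y' X')"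
proof -
  have "R \<subseteq> poly_in (UNIV - set ys)" by (rule poly_in_subset) (use dist3 in auto)
  then show "C0 (tm q Y f g) \<in> closed_maps (poly_in (UNIV - set ys)) (pf \<noteq> q) (mc Y X) (mc Y' X')"
    by (rule closed_maps_mono[OF tens_closed(2)[OF assms]])
  have "tm q Y f g \<in> hom_maps (poly_in E) (pf \<noteq> q) (tmf Y X) (tmf Y' X')"
    using tens_closed(1)[OF assms] by (simp only: closed_maps_def mem_Collect_eq)
  then show "tm q Y f g \<in> hom_maps (poly_in UNIV) (pf \<noteq> q) (tmf Y X) (tmf Y' X')"
    by (rule hom_maps_mono) (simp add: poly_in_UNIV)
qed

text \<open>If \<open>h\<close> is a homotopy for \<open>f - f'\<close>, then \<open>h\<close>
  tensored with the closed map \<open>g\<close> is one for the tensor products. Since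
  \<open>emb_eqD\<close> supplies \<open>h\<close> over the whole ambient ring only, the argument is
  carried out over \<open>poly_in UNIV\<close>.\<close>

lemma ch_cong_left:
  assumes f: "f \<in> closed_maps R1 pf Y Y'" "f' \<in> closed_maps R1 pf Y Y'" and g: "g \<in> closed_maps R2 q X X'"
    and e: "emb Y Y' f = emb Y Y' f'"
  shows "ch q f g = ch q f' g"
proof -
  obtain h where h: "h \<in> hom_maps UNIV (\<not> pf) Y Y'" "f - f' = dcomm (\<not> pf) Y Y' h"
    using emb_eqD[OF mY1[unfolded mfR_def] f e] by blast
  have h': "h \<in> hom_maps (poly_in UNIV) (\<not> pf) Y Y'" using h by (simp add: poly_in_UNIV)
  have gU: "g \<in> hom_maps (poly_in UNIV) q X X'" "dcomm q X X' g = 0\<^sub>m (mf_rank X') (mf_rank X)"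
    using g hom_maps_mono[of g R2 q X X' "poly_in UNIV"] by (auto simp: closed_maps_def poly_in_UNIV)
  note c = pr.closed_carrier[OF f(1)] pr.closed_carrier[OF f(2)] pr.closed_carrier[OF g]
  note hc = hom_mapsD(1)[OF h(1)]
  have dc: "dcomm (\<not> pf) Y Y' h \<in> carrier_mat (mf_rank Y') (mf_rank Y)"
    unfolding h(2)[symmetric] using c by (auto intro: minus_carrier_mat)
  have H: "tm q Y h g \<in> hom_maps (poly_in UNIV) (\<not> (pf \<noteq> q)) (tmf Y X) (tmf Y' X')"
    using tens_hom[OF h' gU(1)] by (metis (full_types))
  have "tm q Y f g - tm q Y f' g = tm q Y (dcomm (\<not> pf) Y Y' h) g"
    unfolding h(2)[symmetric] by (rule tens_lin(2)[OF c(1,2,3,3), symmetric])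
  also have "\<dots> = dcomm ((\<not> pf) \<noteq> q) (tmf Y X) (tmf Y' X') (tm q Y h g)"
    using dcomm_tens[OF mfU h' gU(1)] hc dc c(3) tens_carrier[OF dc c(3), of q "mf_par Y"] by (simp add: gU(2) tens_zero)
  finally have D: "tm q Y f g - tm q Y f' g = dcomm (\<not> (pf \<noteq> q)) (tmf Y X) (tmf Y' X') (tm q Y h g)"
    by (metis (full_types))
  show ?thesis
    by (rule C0_null[OF _ mfU(1) mfU(3) mfU(2) mfU(4) closedU[OF f(1) g] closedU[OF f(2) g] H D]) simp
qed

text \<open>Moving the differential past \<open>f\<close> gives the sign of \<open>f\<close>. For
  odd \<open>f\<close> a homotopy for \<open>g' - g\<close> is therefore used in place of one for
  \<open>g - g'\<close>.\<close>

lemma ch_cong_right: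
  assumes f: "f \<in> closed_maps R1 pf Y Y'" and g: "g \<in> closed_maps R2 q X X'" "g' \<in> closed_maps R2 q X X'"
    and e: "emb X X' g = emb X X' g'"
  shows "ch q f g = ch q f g'"
proof -
  have key: "ch q f g = ch q f g'" if g: "g \<in> closed_maps R2 q X X'" "g' \<in> closed_maps R2 q X X'"
    and h: "h \<in> hom_maps UNIV (\<not> q) X X'" "sgn_of pf \<cdot>\<^sub>m (g - g') = dcomm (\<not> q) X X' h" for g g' h
  proof -
    have h': "h \<in> hom_maps (poly_in UNIV) (\<not> q) X X'" using h by (simp add: poly_in_UNIV)
    have fU: "f \<in> hom_maps (poly_in UNIV) pf Y Y'" "dcomm pf Y Y' f = 0\<^sub>m (mf_rank Y') (mf_rank Y)"
      using f hom_maps_mono[of f R1 pf Y Y' "poly_in UNIV"] by (auto simp: closed_maps_def poly_in_UNIV)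
    note c = pr.closed_carrier[OF g(1)] pr.closed_carrier[OF g(2)] pr.closed_carrier[OF f]
    note hc = hom_mapsD(1)[OF h(1)]
    have gg: "g - g' \<in> carrier_mat (mf_rank X') (mf_rank X)" using c by (auto intro: minus_carrier_mat)
    have dc: "dcomm (\<not> q) X X' h \<in> carrier_mat (mf_rank X') (mf_rank X)"
      unfolding h(2)[symmetric] using gg by auto
    have H: "tm (\<not> q) Y f h \<in> hom_maps (poly_in UNIV) (\<not> (pf \<noteq> q)) (tmf Y X) (tmf Y' X')"
      using tens_hom[OF fU(1) h'] by (metis (full_types))
    have "sgn_of pf \<cdot>\<^sub>m tm q Y f (dcomm (\<not> q) X X' h) = dcomm (pf \<noteq> (\<not> q)) (tmf Y X) (tmf Y' X') (tm (\<not> q) Y f h)"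
      using dcomm_tens[OF mfU fU(1) h'] hc dc c(3) tens_carrier[OF c(3) dc, of q "mf_par Y"] by (simp add: fU(2) tens_zero)
    moreover have "sgn_of pf \<cdot>\<^sub>m tm q Y f (dcomm (\<not> q) X X' h) = tm q Y f (g - g')"
      unfolding h(2)[symmetric] tens_lin(6)[OF c(3,3) gg gg] by (simp split: if_splits)
    moreover have "tm q Y f (g - g') = tm q Y f g - tm q Y f g'" by (rule tens_lin(4)[OF c(3,3,1,2)])
    ultimately have D: "tm q Y f g - tm q Y f g' = dcomm (\<not> (pf \<noteq> q)) (tmf Y X) (tmf Y' X') (tm (\<not> q) Y f h)"
      by (metis (full_types))
    show ?thesis
      by (rule C0_null[OF _ mfU(1) mfU(3) mfU(2) mfU(4) closedU[OF f g(1)] closedU[OF f g(2)] H D]) simp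
  qed
  show ?thesis
  proof (cases pf)
    case False
    obtain h where "h \<in> hom_maps UNIV (\<not> q) X X'" "g - g' = dcomm (\<not> q) X X' h"
      using emb_eqD[OF mX1[unfolded mfR_def] g e] by blast
    then show ?thesis using key[OF g] False by simp
  next
    case True
    obtain h where h: "h \<in> hom_maps UNIV (\<not> q) X X'" "g' - g = dcomm (\<not> q) X X' h"
      using emb_eqD[OF mX1[unfolded mfR_def] g(2,1) e[symmetric]] by blast
    have "- (g - g') = g' - g" using pr.closed_carrier[OF g(1)] pr.closed_carrier[OF g(2)] by (auto intro!: eq_matI)
    then show ?thesis using key[OF g, of h] True h by simp
  qed
qed

lemma ch_lin:
  assumes f: "f \<in> closed_maps R1 pf Y Y'" "f' \<in> closed_maps R1 pf Y Y'" and g: "g \<in> closed_maps R2 q X X'" "g' \<in> closed_maps R2 q X X'"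
  shows "ch q (f + f') g = ch q f g + ch q f' g" "ch q f (g + g') = ch q f g + ch q f g'"
    "ch q (pconst c \<cdot>\<^sub>m f) g = scl (pconst c) (ch q f g)" "ch q f (pconst c \<cdot>\<^sub>m g) = scl (pconst c) (ch q f g)"
proof -
  note c = pr.closed_carrier[OF f(1)] pr.closed_carrier[OF f(2)] pr.closed_carrier[OF g(1)] pr.closed_carrier[OF g(2)]
  note T = tens_closed(2)[OF f(1) g(1)] tens_closed(2)[OF f(2) g(1)] tens_closed(2)[OF f(1) g(2)]
  note tc = tens_carrier[OF c(1,3)] tens_carrier[OF c(2,3)] tens_carrier[OF c(1,4)]
  show "ch q (f + f') g = ch q f g + ch q f' g"
    using emb_add_R[OF mM T(1,2)] by (simp add: tens_lin(1)[OF c] blk_add(1)[OF tc(1,2)])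
  show "ch q f (g + g') = ch q f g + ch q f g'"
    using emb_add_R[OF mM T(1,3)] by (simp add: tens_lin(3)[OF c] blk_add(1)[OF tc(1,3)])
  have s: "C0 (pconst c \<cdot>\<^sub>m tm q Y f g) = pconst c \<cdot>\<^sub>m C0 (tm q Y f g)"
    by (rule C0_smult[OF pconst_R' tc(1)])
  show "ch q (pconst c \<cdot>\<^sub>m f) g = scl (pconst c) (ch q f g)" "ch q f (pconst c \<cdot>\<^sub>m g) = scl (pconst c) (ch q f g)"
    using emb_smult_R(1)[OF mM T(1)] by (simp_all add: tens_lin(5,6)[OF c] s)
qed

lemma At_nat:
  assumes f: "f \<in> closed_maps R1 pf Y Y'" and g: "g \<in> closed_maps R2 q X X'" and i: "i < length ys"
  shows "At Y' X' i * ch q f g = (if pf \<noteq> q then - (ch q f g * At Y X i) else ch q f g * At Y X i)"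
  using At_natural[OF AE mY(1) mX(1) mY(2) mX(2) w_R' w_R' sq[OF Yk(1) Xk(1)] sq[OF Yk(2) Xk(2)] tens_closed(1)[OF f g] i]
  unfolding At_eq[OF Yk(1) Xk(1) i] At_eq[OF Yk(2) Xk(2) i]
  by (cases "pf \<noteq> q") simp_all

lemma ch_Sc:
  assumes f: "f \<in> closed_maps R1 pf Y Y'" and g: "g \<in> closed_maps R2 q X X'"
  shows "Sc Y' X' i j * ch q f g = ch q f g * Sc Y X i j"
proof -
  let ?c = "Vd i j" and ?N = "mf_rank Y * mf_rank X" and ?N' = "mf_rank Y' * mf_rank X'"
  have T: "tm q Y f g \<in> carrier_mat ?N' ?N" by (rule tens_carrier[OF pr.closed_carrier[OF f] pr.closed_carrier[OF g]])
  have s: "?c \<cdot>\<^sub>m 1\<^sub>m ?N \<in> carrier_mat ?N ?N" "?c \<cdot>\<^sub>m 1\<^sub>m ?N' \<in> carrier_mat ?N' ?N'" by simp_all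
  have "?c \<cdot>\<^sub>m 1\<^sub>m ?N' * tm q Y f g = tm q Y f g * (?c \<cdot>\<^sub>m 1\<^sub>m ?N)"
    using T by (simp add: mult_smult_distrib[of _ ?N' ?N _ ?N] mult_smult_assoc_mat[of _ ?N' ?N' _ ?N])
  then have "C0 (?c \<cdot>\<^sub>m 1\<^sub>m ?N') * C0 (tm q Y f g) = C0 (tm q Y f g) * C0 (?c \<cdot>\<^sub>m 1\<^sub>m ?N)"
    by (simp flip: blk_mult(1)[OF s(2) T] blk_mult(1)[OF T s(1)])
  then show ?thesis
    using emb_mult_R[OF mM(1,2,2) tens_closed(2)[OF f g] Sc_closed[OF Yk(2) Xk(2) Vd_E[OF Yk(2) Xk(2), of i j]]]
      emb_mult_R[OF mM(1,1,2) Sc_closed[OF Yk(1) Xk(1) Vd_E[OF Yk(1) Xk(1), of i j]] tens_closed(2)[OF f g]] by simp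
qed

text \<open>The homotopy is \<open>f\<close> tensored with minus the derivative of \<open>g\<close>,
  by \<open>dcomm_pdiff\<close>. No derivative of \<open>f\<close> enters, since \<open>lam\<close>
  differentiates only the right-hand differential.\<close>

lemma Lam_nat:
  assumes f: "f \<in> closed_maps R1 pf Y Y'" and g: "g \<in> closed_maps R2 q X X'" and l: "l < length ys"
  shows "Lam Y' X' l * ch q f g = (if pf \<noteq> q then - (ch q f g * Lam Y X l) else ch q f g * Lam Y X l)"
proof -
  let ?D = "map_mat (pdiff (ys ! l))"
  let ?d = "?D (mf_d X)" and ?d' = "?D (mf_d X')" and ?s = "sgn_of (pf \<noteq> q) :: ('v, 'k) mpol"
  have fE: "f \<in> hom_maps (poly_in E) pf Y Y'" "dcomm pf Y Y' f = 0\<^sub>m (mf_rank Y') (mf_rank Y)"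
    using closedE1[OF f] by (simp_all add: closed_maps_def)
  have gE: "g \<in> hom_maps (poly_in E) q X X'" "dcomm q X X' g = 0\<^sub>m (mf_rank X') (mf_rank X)"
    using closedE2[OF g] by (simp_all add: closed_maps_def)
  have fU: "f \<in> hom_maps UNIV pf Y Y'" by (rule hom_maps_mono[OF fE(1)]) (rule subset_UNIV)
  have oU: "1\<^sub>m (mf_rank Y) \<in> hom_maps UNIV False Y Y" by (rule hom_maps_mono[OF one_hom[OF Yk(1) Xk(1)]]) (rule subset_UNIV)
  have o: "1\<^sub>m (mf_rank Y) \<in> carrier_mat (mf_rank Y) (mf_rank Y)" "1\<^sub>m (mf_rank Y') \<in> carrier_mat (mf_rank Y') (mf_rank Y')" by simp_all
  have dc: "?d \<in> carrier_mat (mf_rank X) (mf_rank X)" "?d' \<in> carrier_mat (mf_rank X') (mf_rank X')"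
    using hom_mapsD(1)[OF pdiff_hom[OF dX_hom[OF Yk(1) Xk(1)]]] hom_mapsD(1)[OF pdiff_hom[OF dX_hom[OF Yk(2) Xk(2)]]] by simp_all
  note c = hom_mapsD(1)[OF fE(1)] hom_mapsD(1)[OF gE(1)]
  have Dg: "?D g \<in> hom_maps (poly_in E) q X X'" by (rule pdiff_hom[OF gE(1)])
  have pc: "?d' * g \<in> carrier_mat (mf_rank X') (mf_rank X)" "g * ?d \<in> carrier_mat (mf_rank X') (mf_rank X)" using dc c by auto
  let ?F = "lam Y' X' l * tm q Y f g" and ?G = "?s \<cdot>\<^sub>m (tm q Y f g * lam Y X l)" and ?H = "(- 1) \<cdot>\<^sub>m tm q Y f (?D g)"
  have F: "?F = sgn_of pf \<cdot>\<^sub>m tm (\<not> q) Y f (?d' * g)"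
    unfolding lam_def using tens_mult[OF fU c(2) o(2) dc(2), where q'=True and q=q] c by simp
  have FG: "tm q Y f g * lam Y X l = tm (\<not> q) Y f (g * ?d)"
    unfolding lam_def using tens_mult[OF oU dc(1) c, where q'=q and q=True] c by simp
  have G: "?G = ?s \<cdot>\<^sub>m tm (\<not> q) Y f (g * ?d)" unfolding FG by (rule refl)
  have Tc: "tm (\<not> q) Y f (?d' * g) \<in> carrier_mat (mf_rank Y' * mf_rank X') (mf_rank Y * mf_rank X)"
     "tm (\<not> q) Y f (g * ?d) \<in> carrier_mat (mf_rank Y' * mf_rank X') (mf_rank Y * mf_rank X)"
    by (rule tens_carrier[OF c(1) pc(1)], rule tens_carrier[OF c(1) pc(2)])
  have TDg: "tm q Y f (?D g) \<in> hom_maps (poly_in E) (pf \<noteq> q) (tmf Y X) (tmf Y' X')" by (rule tens_hom[OF fE(1) Dg])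
  note TDc = hom_tmf_carrier[OF AE TDg]
  note d2 = tens_d_carrier[OF mY(1) mX(1)] tens_d_carrier[OF mY(2) mX(2)]
  have dT: "dcomm (pf \<noteq> q) (tmf Y X) (tmf Y' X') (tm q Y f (?D g)) = sgn_of pf \<cdot>\<^sub>m tm (\<not> q) Y f (dcomm q X X' (?D g))"
  proof -
    have z: "tm q Y (0\<^sub>m (mf_rank Y') (mf_rank Y)) (?D g) = 0\<^sub>m (mf_rank Y' * mf_rank X') (mf_rank Y * mf_rank X)"
      unfolding tens_zero using hom_mapsD(1)[OF Dg] by simp
    have "dcomm q X X' (?D g) \<in> carrier_mat (mf_rank X') (mf_rank X)"
      using mX hom_mapsD(1)[OF Dg] by (intro dcomm_carrier[of X "poly_in E" X']) (simp_all add: mfR_def)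
    then have "tm (\<not> q) Y f (dcomm q X X' (?D g)) \<in> carrier_mat (mf_rank Y' * mf_rank X') (mf_rank Y * mf_rank X)"
      by (rule tens_carrier[OF c(1)])
    then show ?thesis unfolding dcomm_tens[OF mY mX fE(1) Dg] fE(2) z by simp
  qed
  have dD: "dcomm q X X' (?D g) = (if q then - (?d' * g + g * ?d) else g * ?d - ?d' * g)"
    by (rule dcomm_pdiff[OF mX gE])
  have split: "tm (\<not> q) Y f (?d' * g + g * ?d) = tm (\<not> q) Y f (?d' * g) + tm (\<not> q) Y f (g * ?d)"
    "tm (\<not> q) Y f (g * ?d - ?d' * g) = tm (\<not> q) Y f (g * ?d) - tm (\<not> q) Y f (?d' * g)"
    "tm (\<not> q) Y f (- (?d' * g + g * ?d)) = - tm (\<not> q) Y f (?d' * g + g * ?d)"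
    by (rule tens_lin(3)[OF c(1,1) pc], rule tens_lin(4)[OF c(1,1) pc(2,1)],
        rule tens_lin(8)[OF c(1,1) add_carrier_mat[OF pc(2)] add_carrier_mat[OF pc(2)]])
  have nd: "dcomm (pf \<noteq> q) (tmf Y X) (tmf Y' X') ?H = - dcomm (pf \<noteq> q) (tmf Y X) (tmf Y' X') (tm q Y f (?D g))"
  proof -
    have p: "tens_d Y' X' * tm q Y f (?D g) \<in> carrier_mat (mf_rank Y' * mf_rank X') (mf_rank Y * mf_rank X)"
      "tm q Y f (?D g) * tens_d Y X \<in> carrier_mat (mf_rank Y' * mf_rank X') (mf_rank Y * mf_rank X)"
      using d2 TDc by auto
    show ?thesis unfolding dcomm_def tmf_simps one_smult mult_uminus_mat(1)[OF d2(2) TDc] mult_uminus_mat(2)[OF TDc d2(1)]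
      using mat_neg_add[OF p] mat_eq_sgn(1)[OF p] by (simp only: split: if_splits) simp
  qed
  have HD: "?F - ?G = dcomm (pf \<noteq> q) (tmf Y X) (tmf Y' X') ?H"
    unfolding F G nd dT dD using split Tc
    by (cases pf; cases q) (auto intro!: eq_matI)
  have lh: "lam Y X l \<in> hom_maps (poly_in E) True (tmf Y X) (tmf Y X)" "lam Y' X' l \<in> hom_maps (poly_in E) True (tmf Y' X') (tmf Y' X')"
    by (rule lam_hom[OF Yk(1) Xk(1)], rule lam_hom[OF Yk(2) Xk(2)])
  have lc: "lam Y X l \<in> carrier_mat (mf_rank Y * mf_rank X) (mf_rank Y * mf_rank X)"
     "lam Y' X' l \<in> carrier_mat (mf_rank Y' * mf_rank X') (mf_rank Y' * mf_rank X')"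
    by (rule hom_tmf_carrier[OF AE lh(1)], rule hom_tmf_carrier[OF AE lh(2)])
  have TE: "tm q Y f g \<in> hom_maps (poly_in E) (pf \<noteq> q) (tmf Y X) (tmf Y' X')"
    using tens_closed(1)[OF f g] by (simp only: closed_maps_def mem_Collect_eq)
  note TEc = hom_tmf_carrier[OF AE TE]
  note cl = tens_closed(2)[OF f g] lam_closed[OF Yk(1) Xk(1) l] lam_closed[OF Yk(2) Xk(2) l]
  have Fc: "C0 ?F \<in> closed_maps R (\<not> (pf \<noteq> q)) (mc Y X) (mc Y' X')" "emb (mc Y X) (mc Y' X') (C0 ?F) = Lam Y' X' l * ch q f g"
    using pr.closed_maps_mult[OF mM(1,2,2) cl(1,3)] emb_mult_R[OF mM(1,2,2) cl(1,3)] by (simp_all add: blk_mult(1)[OF lc(2) TEc])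
  have FLc: "C0 (tm q Y f g * lam Y X l) \<in> closed_maps R (\<not> (pf \<noteq> q)) (mc Y X) (mc Y' X')"
      "emb (mc Y X) (mc Y' X') (C0 (tm q Y f g * lam Y X l)) = ch q f g * Lam Y X l"
    using pr.closed_maps_mult[OF mM(1,1,2) cl(2,1)] emb_mult_R[OF mM(1,1,2) cl(2,1)] by (simp_all add: blk_mult(1)[OF TEc lc(1)])
  have sR: "?s \<in> R'" "?s \<in> R" by (auto intro: pr.R_minus)
  have GC: "C0 ?G = ?s \<cdot>\<^sub>m C0 (tm q Y f g * lam Y X l)" by (rule C0_smult[OF sR(1) mult_carrier_mat[OF TEc lc(1)]])
  have Gc: "C0 ?G \<in> closed_maps R (\<not> (pf \<noteq> q)) (mc Y X) (mc Y' X')"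
    unfolding GC by (rule pr.closed_maps_ops(4)[OF mM FLc(1) sR(2)])
  have Ge: "emb (mc Y X) (mc Y' X') (C0 ?G) = (if pf \<noteq> q then - (ch q f g * Lam Y X l) else ch q f g * Lam Y X l)"
    unfolding GC using emb_smult_R(2)[OF mM FLc(1)] FLc(2) by (cases "pf \<noteq> q") simp_all
  have Fh: "?F \<in> hom_maps (poly_in E) (\<not> (pf \<noteq> q)) (tmf Y X) (tmf Y' X')"
    using pr.hom_maps_mult[OF TE lh(2)] by simp
  have FLh: "tm q Y f g * lam Y X l \<in> hom_maps (poly_in E) (\<not> (pf \<noteq> q)) (tmf Y X) (tmf Y' X')"
    using pr.hom_maps_mult[OF lh(1) TE] by simp
  have Gh: "?G \<in> hom_maps (poly_in E) (\<not> (pf \<noteq> q)) (tmf Y X) (tmf Y' X')"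
    by (rule pr.hom_maps_add(4)[OF FLh FLh]) (auto intro: pr.R_minus)
  have Hh: "?H \<in> hom_maps (poly_in E) (\<not> \<not> (pf \<noteq> q)) (tmf Y X) (tmf Y' X')"
    unfolding not_not one_smult by (rule pr.hom_maps_add(3)[OF TDg TDg])
  have "emb (mc Y X) (mc Y' X') (C0 ?F) = emb (mc Y X) (mc Y' X') (C0 ?G)"
    by (rule C0_null[OF AE mY(1) mX(1) mY(2) mX(2) _ Fh _ Gh Hh])
      (use Fc(1) Gc HD in \<open>simp_all only: E_A not_not\<close>)
  then show ?thesis unfolding Fc(2) Ge .
qed

lemma Gd_nat:
  assumes f: "f \<in> closed_maps R1 pf Y Y'" and g: "g \<in> closed_maps R2 q X X'" and i: "i < length ys"
  shows "emb (mc Y' X') (mc Y' X') (gd Y' X' i) * ch q f g =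
    (if pf \<noteq> q then - (ch q f g * emb (mc Y X) (mc Y X) (gd Y X i)) else ch q f g * emb (mc Y X) (mc Y X) (gd Y X i))"
proof -
  let ?x = "ch q f g" and ?S = "\<Sum>q<length ys. Sc Y X q i * At Y X q" and ?S' = "\<Sum>q<length ys. Sc Y' X' q i * At Y' X' q"
  have "Sc Y' X' j i * At Y' X' j * ?x = (if pf \<noteq> q then - (?x * (Sc Y X j i * At Y X j)) else ?x * (Sc Y X j i * At Y X j))"
    if "j < length ys" for j
    using At_nat[OF f g that] ch_Sc[OF f g, of j i] by (simp add: mult.assoc) (simp flip: mult.assoc)
  then have "?S' * ?x = (if pf \<noteq> q then - ?x else ?x) * ?S"
    by (simp add: sum_distrib_left sum_distrib_right sum_negf)
  then have "scl (pconst half) ?S' * ?x = scl (pconst half) ((if pf \<noteq> q then - ?x else ?x) * ?S)"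
    by (simp only: scl_props(5)[symmetric])
  then have "scl (pconst half) ?S' * ?x = (if pf \<noteq> q then - ?x else ?x) * scl (pconst half) ?S"
    by (simp only: scl_props(6))
  then show ?thesis
    using Lam_nat[OF f g i] gd_closed_eq[OF Yk(1) Xk(1) i] gd_closed_eq[OF Yk(2) Xk(2) i]
    by (simp add: left_diff_distrib right_diff_distrib)
qed

end

end

section \<open>The cut of homotopy classes\<close>

context cut_full
begin

lemma ch_mult:
  assumes Y: "Yok Y" "Yok Y'" "Yok Y''" and X: "Xok X" "Xok X'" "Xok X''"
    and f: "f \<in> closed_maps R1 p Y Y'" "f' \<in> closed_maps R1 p' Y' Y''"
    and g: "g \<in> closed_maps R2 q X X'" "g' \<in> closed_maps R2 q' X' X''"
  shows "ch Y' Y'' X' X'' q' f' g' * ch Y Y' X X' q f g =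
    (if q' \<and> p then - ch Y Y'' X X'' (q' \<noteq> q) (f' * f) (g' * g) else ch Y Y'' X X'' (q' \<noteq> q) (f' * f) (g' * g))"
proof -
  note c = tens_closed(2)[OF Y(1,2) X(1,2) f(1) g(1)] tens_closed(2)[OF Y(2,3) X(2,3) f(2) g(2)]
  note m = mcR[OF Y(1) X(1)] mcR[OF Y(2) X(2)] mcR[OF Y(3) X(3)]
  note fc = pr.closed_carrier[OF f(1)] pr.closed_carrier[OF f(2)] and gc = pr.closed_carrier[OF g(1)] pr.closed_carrier[OF g(2)]
  have ff: "f' * f \<in> closed_maps R1 (p' \<noteq> p) Y Y''" "g' * g \<in> closed_maps R2 (q' \<noteq> q) X X''"
    by (rule pr.closed_maps_mult[OF Yok_mf(1)[OF Y(1)] Yok_mf(1)[OF Y(2)] Yok_mf(1)[OF Y(3)] f],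
        rule pr.closed_maps_mult[OF Xok_mf(1)[OF X(1)] Xok_mf(1)[OF X(2)] Xok_mf(1)[OF X(3)] g])
  note ffc = tens_closed(2)[OF Y(1,3) X(1,3) ff]
  note tc = tens_carrier[OF pr.closed_carrier[OF ff(1)] pr.closed_carrier[OF ff(2)], of "q' \<noteq> q" "mf_par Y"]
  have fU: "f \<in> hom_maps UNIV p Y Y'"
    using f(1) hom_maps_mono[OF _ subset_UNIV] by (auto simp: closed_maps_def)
  have s: "sgn_of (q' \<and> p) \<in> R'" by (auto intro: pr.R_minus)
  have "C0 (tm q' Y' f' g') * C0 (tm q Y f g) = C0 (sgn_of (q' \<and> p) \<cdot>\<^sub>m tm (q' \<noteq> q) Y (f' * f) (g' * g))"
    unfolding blk_mult(1)[OF tens_carrier[OF fc(2) gc(2)] tens_carrier[OF fc(1) gc(1)], symmetric] tens_mult[OF fU gc(1) fc(2) gc(2)] ..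
  also have "\<dots> = sgn_of (q' \<and> p) \<cdot>\<^sub>m C0 (tm (q' \<noteq> q) Y (f' * f) (g' * g))" by (rule C0_smult[OF s tc])
  finally have *: "C0 (tm q' Y' f' g') * C0 (tm q Y f g) = sgn_of (q' \<and> p) \<cdot>\<^sub>m C0 (tm (q' \<noteq> q) Y (f' * f) (g' * g))" .
  show ?thesis
    unfolding emb_mult_R[OF m c, symmetric] *
  proof (cases "q' \<and> p")
    case True
    then show "emb (mc Y X) (mc Y'' X'') (sgn_of (q' \<and> p) \<cdot>\<^sub>m C0 (tm (q' \<noteq> q) Y (f' * f) (g' * g))) =
      (if q' \<and> p then - ch Y Y'' X X'' (q' \<noteq> q) (f' * f) (g' * g) else ch Y Y'' X X'' (q' \<noteq> q) (f' * f) (g' * g))"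
      using emb_smult_R(2)[OF m(1,3) ffc] by (simp only: simp_thms True if_True one_smult)
  next
    case False
    show "emb (mc Y X) (mc Y'' X'') (sgn_of (q' \<and> p) \<cdot>\<^sub>m C0 (tm (q' \<noteq> q) Y (f' * f) (g' * g))) =
      (if q' \<and> p then - ch Y Y'' X X'' (q' \<noteq> q) (f' * f) (g' * g) else ch Y Y'' X X'' (q' \<noteq> q) (f' * f) (g' * g))"
      by (simp only: False if_False one_smult)
  qed
qed

definition pc :: "bool => bool => ('v, 'k) mpol mf => ('v, 'k) mpol mf => ('v, 'k) mpol mf => ('v, 'k) mpol mf =>
    ('v, 'k) mpol mat set => ('v, 'k) mpol mat set => ('v, 'k) mpol mat set" where
  "pc = cut_cl R ys V bs"

abbreviation "ct p q Y Y' X X' F G \<equiv> eta (mc Y X) (mc Y' X') (pc p q Y Y' X X' F G)"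

definition idc :: "'v set => ('v, 'k) mpol mf => ('v, 'k) mpol mat set" where
  "idc B X = hcl (poly_in B) False X X (1\<^sub>m (mf_rank X))"

lemma idc_Hm:
  assumes "mfR (poly_in B) X" shows "idc B X \<in> Hm (poly_in B) False X X" "1\<^sub>m (mf_rank X) \<in> idc B X"
    "F \<in> Hm (poly_in B) p Y X ==> mfR (poly_in B) Y ==> eta X X (idc B X) * eta Y X F = eta Y X F"
    "G \<in> Hm (poly_in B) p X Y ==> mfR (poly_in B) Y ==> eta X Y G * eta X X (idc B X) = eta X Y G"
proof -
  note o = pr.closed_maps_ops(6)[OF assms assms]
  show "idc B X \<in> Hm (poly_in B) False X X" "1\<^sub>m (mf_rank X) \<in> idc B X"
    unfolding idc_def by (rule pr.HmI[OF o], rule pr.hcl_self[OF assms assms o])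
  have e: "eta X X (idc B X) = emb X X (1\<^sub>m (mf_rank X))" unfolding idc_def by (rule pr.eta_hcl[OF assms assms o])
  show "eta X X (idc B X) * eta Y X F = eta Y X F" if F: "F \<in> Hm (poly_in B) p Y X" and Y: "mfR (poly_in B) Y"
  proof -
    obtain f where f: "f \<in> F" using pr.Hm_ex[OF Y assms F] by blast
    note fc = pr.Hm_memb(1,2)[OF Y assms F f]
    show ?thesis unfolding e fc(2)[symmetric] using emb_mult_R[OF Y assms assms fc(1) o] pr.closed_carrier[OF fc(1)] by simp
  qed
  show "eta X Y G * eta X X (idc B X) = eta X Y G" if G: "G \<in> Hm (poly_in B) p X Y" and Y: "mfR (poly_in B) Y"
  proof -
    obtain f where f: "f \<in> G" using pr.Hm_ex[OF assms Y G] by blast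
    note fc = pr.Hm_memb(1,2)[OF assms Y G f]
    show ?thesis unfolding e fc(2)[symmetric] using emb_mult_R[OF assms assms Y o fc(1)] pr.closed_carrier[OF fc(1)] by simp
  qed
qed

context
  fixes Y Y' X X' :: "('v, 'k) mpol mf"
  assumes Yk: "Yok Y" "Yok Y'" and Xk: "Xok X" "Xok X'"
begin

text \<open>Stated for arbitrary sets of mutually homotopic representatives, not only for full
  classes, so that it also covers the singletons of unit matrices in \<open>cut_left\<close> and
  \<open>cut_right\<close>.\<close>

lemma pc_hcl:
  assumes f: "f \<in> F" "\<And>f'. f' \<in> F ==> f' \<in> closed_maps R1 p Y Y' \<and> emb Y Y' f' = emb Y Y' f"
    and g: "g \<in> G" "\<And>g'. g' \<in> G ==> g' \<in> closed_maps R2 q X X' \<and> emb X X' g' = emb X X' g"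
  shows "pc p q Y Y' X X' F G = hcl R (p \<noteq> q) (mc Y X) (mc Y' X') (C0 (tm q Y f g))"
proof -
  note fc = f(2)[OF f(1)] and gc = g(2)[OF g(1)]
  have "hcl R (p \<noteq> q) (mc Y X) (mc Y' X') (cut_mat ys V bs q (mf_par Y) f' g') = hcl R (p \<noteq> q) (mc Y X) (mc Y' X') (C0 (tm q Y f g))"
    if "f' \<in> F" "g' \<in> G" for f' g'
  proof -
    note f' = f(2)[OF that(1)] and g' = g(2)[OF that(2)]
    have "cut_mat ys V bs q (mf_par Y) f' g' = C0 (tm q Y f' g')"
      by (rule cut_mat_C0) (use f' g' pr.closed_carrier in blast)+
    moreover have e: "ch Y Y' X X' q f' g' = ch Y Y' X X' q f g"
      by (rule trans[OF ch_cong_left[OF Yk Xk conjunct1[OF f'] conjunct1[OF fc] conjunct1[OF g'] conjunct2[OF f']]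
          ch_cong_right[OF Yk Xk conjunct1[OF fc] conjunct1[OF g'] conjunct1[OF gc] conjunct2[OF g']]])
    have "hcl R (p \<noteq> q) (mc Y X) (mc Y' X') (C0 (tm q Y f' g')) = hcl R (p \<noteq> q) (mc Y X) (mc Y' X') (C0 (tm q Y f g))"
      by (rule pr.hcl_cong[OF mcR[OF Yk(1) Xk(1)] mcR[OF Yk(2) Xk(2)] tens_closed(2)[OF Yk Xk conjunct1[OF f'] conjunct1[OF g']]
        tens_closed(2)[OF Yk Xk conjunct1[OF fc] conjunct1[OF gc]] e])
    ultimately show ?thesis by simp
  qed
  then show ?thesis unfolding pc_def cut_cl_def using f(1) g(1) by (intro pr.UN_eqI) auto
qed

lemma pc_Hm:
  assumes F: "F \<in> Hm R1 p Y Y'" and G: "G \<in> Hm R2 q X X'"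
  shows "pc p q Y Y' X X' F G \<in> Hm R (p \<noteq> q) (mc Y X) (mc Y' X')"
    "f \<in> F ==> g \<in> G ==> ct p q Y Y' X X' F G = ch Y Y' X X' q f g"
    "p = q ==> pc p q Y Y' X X' F G \<in> Hm R False (mc Y X) (mc Y' X')"
    "p \<noteq> q ==> pc p q Y Y' X X' F G \<in> Hm R True (mc Y X) (mc Y' X')"
proof -
  note m = Yok_mf(1)[OF Yk(1)] Yok_mf(1)[OF Yk(2)] Xok_mf(1)[OF Xk(1)] Xok_mf(1)[OF Xk(2)]
  have cl: "f \<in> closed_maps R1 p Y Y' \<and> emb Y Y' f = eta Y Y' F" if "f \<in> F" for f
    using pr.Hm_memb(1,2)[OF m(1,2) F that] by blast
  have cl': "g \<in> closed_maps R2 q X X' \<and> emb X X' g = eta X X' G" if "g \<in> G" for g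
    using pr.Hm_memb(1,2)[OF m(3,4) G that] by blast
  have h: "pc p q Y Y' X X' F G = hcl R (p \<noteq> q) (mc Y X) (mc Y' X') (C0 (tm q Y f g))"
     "C0 (tm q Y f g) \<in> closed_maps R (p \<noteq> q) (mc Y X) (mc Y' X')" if "f \<in> F" "g \<in> G" for f g
  proof -
    show "pc p q Y Y' X X' F G = hcl R (p \<noteq> q) (mc Y X) (mc Y' X') (C0 (tm q Y f g))"
      by (rule pc_hcl[OF that(1) _ that(2)]) (simp_all only: cl cl' that simp_thms)
    show "C0 (tm q Y f g) \<in> closed_maps R (p \<noteq> q) (mc Y X) (mc Y' X')"
      by (rule tens_closed(2)[OF Yk Xk conjunct1[OF cl[OF that(1)]] conjunct1[OF cl'[OF that(2)]]])
  qed
  show *: "pc p q Y Y' X X' F G \<in> Hm R (p \<noteq> q) (mc Y X) (mc Y' X')"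
  proof -
    obtain f g where fg: "f \<in> F" "g \<in> G" using pr.Hm_ex[OF m(1,2) F] pr.Hm_ex[OF m(3,4) G] by blast
    show ?thesis unfolding h(1)[OF fg] by (rule pr.HmI[OF h(2)[OF fg]])
  qed
  then show "p = q ==> pc p q Y Y' X X' F G \<in> Hm R False (mc Y X) (mc Y' X')"
    "p \<noteq> q ==> pc p q Y Y' X X' F G \<in> Hm R True (mc Y X) (mc Y' X')" by simp_all
  show "ct p q Y Y' X X' F G = ch Y Y' X X' q f g" if "f \<in> F" "g \<in> G"
    unfolding h(1)[OF that] by (rule pr.eta_hcl[OF mcR[OF Yk(1) Xk(1)] mcR[OF Yk(2) Xk(2)] h(2)[OF that]])
qed

lemma ct_add:
  assumes F: "F \<in> Hm R1 p Y Y'" "F' \<in> Hm R1 p Y Y'" and G: "G \<in> Hm R2 q X X'" "G' \<in> Hm R2 q X X'"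
  shows "ct p q Y Y' X X' (hadd R1 p Y Y' F F') G = ct p q Y Y' X X' F G + ct p q Y Y' X X' F' G"
    "ct p q Y Y' X X' F (hadd R2 q X X' G G') = ct p q Y Y' X X' F G + ct p q Y Y' X X' F G'"
    "ct p q Y Y' X X' (hscale R1 p Y Y' (pconst c) F) G = scl (pconst c) (ct p q Y Y' X X' F G)"
    "ct p q Y Y' X X' F (hscale R2 q X X' (pconst c) G) = scl (pconst c) (ct p q Y Y' X X' F G)"
proof -
  note m = Yok_mf(1)[OF Yk(1)] Yok_mf(1)[OF Yk(2)] Xok_mf(1)[OF Xk(1)] Xok_mf(1)[OF Xk(2)]
  obtain f f' g g' where fg: "f \<in> F" "g \<in> G" "f' \<in> F'" "g' \<in> G'"
    using pr.Hm_ex[OF m(1,2) F(1)] pr.Hm_ex[OF m(1,2) F(2)] pr.Hm_ex[OF m(3,4) G(1)] pr.Hm_ex[OF m(3,4) G(2)] by blast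
  have cl: "f \<in> closed_maps R1 p Y Y'" "f' \<in> closed_maps R1 p Y Y'" "g \<in> closed_maps R2 q X X'" "g' \<in> closed_maps R2 q X X'"
    using pr.Hm_memb(1)[OF m(1,2) F(1) fg(1)] pr.Hm_memb(1)[OF m(1,2) F(2) fg(3)] pr.Hm_memb(1)[OF m(3,4) G(1) fg(2)] pr.Hm_memb(1)[OF m(3,4) G(2) fg(4)] by simp_all
  have e: "f + f' \<in> hadd R1 p Y Y' F F'" "pconst c \<cdot>\<^sub>m f \<in> hscale R1 p Y Y' (pconst c) F"
    unfolding hadd_def hscale_def
    using pr.hcl_self[OF m(1,2) pr.closed_maps_ops(1)[OF m(1,2) cl(1,2)]] fg pr.hcl_self[OF m(1,2) pr.closed_maps_ops(4)[OF m(1,2) cl(1) poly_in_pconst]] by blast+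
  have e': "g + g' \<in> hadd R2 q X X' G G'" "pconst c \<cdot>\<^sub>m g \<in> hscale R2 q X X' (pconst c) G"
    unfolding hadd_def hscale_def
    using pr.hcl_self[OF m(3,4) pr.closed_maps_ops(1)[OF m(3,4) cl(3,4)]] fg pr.hcl_self[OF m(3,4) pr.closed_maps_ops(4)[OF m(3,4) cl(3) poly_in_pconst]] by blast+
  note l = ch_lin[OF Yk Xk cl]
  show "ct p q Y Y' X X' (hadd R1 p Y Y' F F') G = ct p q Y Y' X X' F G + ct p q Y Y' X X' F' G"
    using pc_Hm(2)[OF pr.Hm_hadd(1)[OF m(1,2) F] G(1) e(1) fg(2)] pc_Hm(2)[OF F(1) G(1) fg(1,2)] pc_Hm(2)[OF F(2) G(1) fg(3,2)] l(1) by simp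
  show "ct p q Y Y' X X' F (hadd R2 q X X' G G') = ct p q Y Y' X X' F G + ct p q Y Y' X X' F G'"
    using pc_Hm(2)[OF F(1) pr.Hm_hadd(1)[OF m(3,4) G] fg(1) e'(1)] pc_Hm(2)[OF F(1) G(1) fg(1,2)] pc_Hm(2)[OF F(1) G(2) fg(1,4)] l(2) by simp
  show "ct p q Y Y' X X' (hscale R1 p Y Y' (pconst c) F) G = scl (pconst c) (ct p q Y Y' X X' F G)"
    using pc_Hm(2)[OF pr.Hm_hscale(1)[OF m(1,2) F(1) poly_in_pconst] G(1) e(2) fg(2)] pc_Hm(2)[OF F(1) G(1) fg(1,2)] l(3) by simp
  show "ct p q Y Y' X X' F (hscale R2 q X X' (pconst c) G) = scl (pconst c) (ct p q Y Y' X X' F G)"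
    using pc_Hm(2)[OF F(1) pr.Hm_hscale(1)[OF m(3,4) G(1) poly_in_pconst] fg(1) e'(2)] pc_Hm(2)[OF F(1) G(1) fg(1,2)] l(4) by simp
qed

lemma ct_0:
  assumes F: "F \<in> Hm R1 p Y Y'" and G: "G \<in> Hm R2 q X X'"
  shows "ct p q Y Y' X X' (hzero R1 p Y Y') G = 0" "ct p q Y Y' X X' F (hzero R2 q X X') = 0"
proof -
  note m = Yok_mf(1)[OF Yk(1)] Yok_mf(1)[OF Yk(2)] Xok_mf(1)[OF Xk(1)] Xok_mf(1)[OF Xk(2)]
  note z = pr.Hm_hzero[OF m(1,2), of p] and z' = pr.Hm_hzero[OF m(3,4), of q]
  have "hadd R1 p Y Y' (hzero R1 p Y Y') (hzero R1 p Y Y') = hzero R1 p Y Y'"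
    using pr.eta_inj[OF m(1,2) pr.Hm_hadd(1)[OF m(1,2) z(1) z(1)] z(1)] pr.Hm_hadd(2)[OF m(1,2) z(1) z(1)] z(2) by simp
  then show "ct p q Y Y' X X' (hzero R1 p Y Y') G = 0" using ct_add(1)[OF z(1) z(1) G G] by simp
  have "hadd R2 q X X' (hzero R2 q X X') (hzero R2 q X X') = hzero R2 q X X'"
    using pr.eta_inj[OF m(3,4) pr.Hm_hadd(1)[OF m(3,4) z'(1) z'(1)] z'(1)] pr.Hm_hadd(2)[OF m(3,4) z'(1) z'(1)] z'(2) by simp
  then show "ct p q Y Y' X X' F (hzero R2 q X X') = 0" using ct_add(2)[OF F F z'(1) z'(1)] by simp
qed

lemma ct_nat:
  assumes F: "F \<in> Hm R1 p Y Y'" and G: "G \<in> Hm R2 q X X'" and i: "i < length ys"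
  shows "At Y' X' i * ct p q Y Y' X X' F G = (if p \<noteq> q then - (ct p q Y Y' X X' F G * At Y X i) else ct p q Y Y' X X' F G * At Y X i)"
    "emb (mc Y' X') (mc Y' X') (gd Y' X' i) * ct p q Y Y' X X' F G = (if p \<noteq> q then - (ct p q Y Y' X X' F G * emb (mc Y X) (mc Y X) (gd Y X i))
       else ct p q Y Y' X X' F G * emb (mc Y X) (mc Y X) (gd Y X i))"
proof -
  note m = Yok_mf(1)[OF Yk(1)] Yok_mf(1)[OF Yk(2)] Xok_mf(1)[OF Xk(1)] Xok_mf(1)[OF Xk(2)]
  obtain f g where fg: "f \<in> F" "g \<in> G" using pr.Hm_ex[OF m(1,2) F] pr.Hm_ex[OF m(3,4) G] by blast
  note cl = pr.Hm_memb(1)[OF m(1,2) F fg(1)] pr.Hm_memb(1)[OF m(3,4) G fg(2)]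
  show "At Y' X' i * ct p q Y Y' X X' F G = (if p \<noteq> q then - (ct p q Y Y' X X' F G * At Y X i) else ct p q Y Y' X X' F G * At Y X i)"
    unfolding pc_Hm(2)[OF F G fg] by (rule At_nat[OF Yk Xk cl i])
  show "emb (mc Y' X') (mc Y' X') (gd Y' X' i) * ct p q Y Y' X X' F G = (if p \<noteq> q then - (ct p q Y Y' X X' F G * emb (mc Y X) (mc Y X) (gd Y X i))
       else ct p q Y Y' X X' F G * emb (mc Y X) (mc Y X) (gd Y X i))"
    unfolding pc_Hm(2)[OF F G fg] by (rule Gd_nat[OF Yk Xk cl i])
qed

end

text \<open>The interchange law; the sign arises when the odd second right-hand map passes the odd
  first left-hand map.\<close>

lemma ct_mult:
  assumes Y: "Yok Y" "Yok Y'" "Yok Y''" and X: "Xok X" "Xok X'" "Xok X''"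
    and F: "F \<in> Hm R1 p Y Y'" "F' \<in> Hm R1 p' Y' Y''"
    and G: "G \<in> Hm R2 q X X'" "G' \<in> Hm R2 q' X' X''" and pq: "p'' = (p' \<noteq> p)" "q'' = (q' \<noteq> q)"
  shows "ct p' q' Y' Y'' X' X'' F' G' * ct p q Y Y' X X' F G =
    (if q' \<and> p then - ct p'' q'' Y Y'' X X'' (hcomp R1 p'' Y Y'' F' F) (hcomp R2 q'' X X'' G' G)
     else ct p'' q'' Y Y'' X X'' (hcomp R1 p'' Y Y'' F' F) (hcomp R2 q'' X X'' G' G))"
proof -
  note my = Yok_mf(1)[OF Y(1)] Yok_mf(1)[OF Y(2)] Yok_mf(1)[OF Y(3)] and mx = Xok_mf(1)[OF X(1)] Xok_mf(1)[OF X(2)] Xok_mf(1)[OF X(3)]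
  obtain f f' g g' where fg: "f \<in> F" "g \<in> G" "f' \<in> F'" "g' \<in> G'"
    using pr.Hm_ex[OF my(1,2) F(1)] pr.Hm_ex[OF my(2,3) F(2)] pr.Hm_ex[OF mx(1,2) G(1)] pr.Hm_ex[OF mx(2,3) G(2)] by blast
  note cl = pr.Hm_memb(1)[OF my(1,2) F(1) fg(1)] pr.Hm_memb(1)[OF my(2,3) F(2) fg(3)] pr.Hm_memb(1)[OF mx(1,2) G(1) fg(2)] pr.Hm_memb(1)[OF mx(2,3) G(2) fg(4)]
  have e: "f' * f \<in> hcomp R1 p'' Y Y'' F' F" "g' * g \<in> hcomp R2 q'' X X'' G' G"
    unfolding hcomp_def pq using pr.hcl_self[OF my(1,3) pr.closed_maps_mult[OF my cl(1,2)]] pr.hcl_self[OF mx(1,3) pr.closed_maps_mult[OF mx cl(3,4)]] fg by blast+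
  show ?thesis
    unfolding pc_Hm(2)[OF Y(1,2) X(1,2) F(1) G(1) fg(1,2)] pc_Hm(2)[OF Y(2,3) X(2,3) F(2) G(2) fg(3,4)]
      pc_Hm(2)[OF Y(1,3) X(1,3) pr.Hm_hcomp(1)[OF my F pq(1)] pr.Hm_hcomp(1)[OF mx G pq(2)] e]
    unfolding pq by (rule ch_mult[OF Y X cl])
qed

text \<open>The definitions of the outer generators use the singleton of the unit matrix; by
  independence of representatives its full class may be used instead, and this makes the
  multiplicativity of \<open>ct\<close> applicable.\<close>

lemma pc_one:
  assumes Y: "Yok Y" and X: "Xok X"
  shows "F \<in> Hm R1 p Y Y ==> pc p False Y Y X X F {1\<^sub>m (mf_rank X)} = pc p False Y Y X X F (idc (set xs \<union> set ys) X)"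
    "G \<in> Hm R2 q X X ==> pc False q Y Y X X {1\<^sub>m (mf_rank Y)} G = pc False q Y Y X X (idc (set ys \<union> set zs) Y) G"
proof -
  note m = Yok_mf(1)[OF Y] Xok_mf(1)[OF X]
  note iX = idc_Hm(1,2)[OF m(2)] and iY = idc_Hm(1,2)[OF m(1)]
  show "pc p False Y Y X X F {1\<^sub>m (mf_rank X)} = pc p False Y Y X X F (idc (set xs \<union> set ys) X)" if F: "F \<in> Hm R1 p Y Y"
  proof -
    obtain f where f: "f \<in> F" using pr.Hm_ex[OF m(1,1) F] by blast
    have f': "f' \<in> closed_maps R1 p Y Y \<and> emb Y Y f' = emb Y Y f" if "f' \<in> F" for f'
      using pr.Hm_memb(1,2)[OF m(1,1) F that] pr.Hm_memb(2)[OF m(1,1) F f] by simp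
    show ?thesis
      by (rule trans[OF pc_hcl[OF Y Y X X f f', of "1\<^sub>m (mf_rank X)"] pc_hcl[OF Y Y X X f f' iX(2), symmetric]])
        (use pr.closed_maps_ops(6)[OF m(2,2)] pr.Hm_memb(1,2)[OF m(2,2) iX(1)] iX(2) in auto)
  qed
  show "pc False q Y Y X X {1\<^sub>m (mf_rank Y)} G = pc False q Y Y X X (idc (set ys \<union> set zs) Y) G" if G: "G \<in> Hm R2 q X X"
  proof -
    obtain g where g: "g \<in> G" using pr.Hm_ex[OF m(2,2) G] by blast
    have g': "g' \<in> closed_maps R2 q X X \<and> emb X X g' = emb X X g" if "g' \<in> G" for g'
      using pr.Hm_memb(1,2)[OF m(2,2) G that] pr.Hm_memb(2)[OF m(2,2) G g] by simp
    show ?thesis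
      by (rule trans[OF pc_hcl[OF Y Y X X _ _ g g', of "1\<^sub>m (mf_rank Y)"] pc_hcl[OF Y Y X X iY(2) _ g g', symmetric]])
        (use pr.closed_maps_ops(6)[OF m(1,1)] pr.Hm_memb(1,2)[OF m(1,1) iY(1)] iY(2) in auto)
  qed
qed

end

section \<open>Tensor products of linear categories\<close>

abbreviation "tyring \<equiv> (ring_of_type_algebra :: 'k::comm_ring_1 ring)"
abbreviation "sc c p \<equiv> Poly_Mapping.map (\<lambda>a. c * a) p"

lemma lookup_sc: "lookup (sc (c :: 'k::comm_ring_1) p) k = c * lookup p k"
  by (simp add: map.rep_eq when_def)

lemma sc_props:
  fixes c :: "'k::comm_ring_1"
  shows "sc c (p + q) = sc c p + sc c q" "sc (c + e) p = sc c p + sc e p" "sc (c * e) p = sc c (sc e p)" "sc 1 p = p"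
    "sc c (p - q) = sc c p - sc c q" "sc (- 1) p = - p" "sc c (single k a) = single k (c * a)"
  by (rule poly_mapping_eqI, simp only: lookup_sc lookup_add lookup_minus lookup_uminus lookup_single when_def, simp add: ring_distribs mult.assoc)+

text \<open>The support of a sum can be smaller than the union of the supports. As
  \<open>F k 0 = 0\<close>, all three sums may run over the union.\<close>

lemma sum_keys_add:
  assumes "\<And>k. F k 0 = 0" "\<And>k a b. F k (a + b) = F k a + F k b"
  shows "(\<Sum>k\<in>keys (p + q). F k (lookup (p + q) k)) =
    (\<Sum>k\<in>keys p. F k (lookup p k)) + (\<Sum>k\<in>keys q. F k (lookup q k) :: 'a::ab_group_add)"
proof -
  let ?S = "keys p \<union> keys q"
  have s: "(\<Sum>k\<in>keys r. F k (lookup r k)) = (\<Sum>k\<in>?S. F k (lookup r k))" if "keys r \<subseteq> ?S" for r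
    by (rule sum.mono_neutral_left) (use that assms(1) in \<open>auto simp: in_keys_iff\<close>)
  show ?thesis
    unfolding s[OF keys_add] s[OF Un_upper1] s[OF Un_upper2] by (simp add: lookup_add assms(2) sum.distrib)
qed

lemma tyring_simps: "carrier tyring = UNIV" "a \<oplus>\<^bsub>tyring\<^esub> b = a + b" "a \<otimes>\<^bsub>tyring\<^esub> b = a * b" "\<one>\<^bsub>tyring\<^esub> = 1" "\<zero>\<^bsub>tyring\<^esub> = 0"
  by (simp_all add: ring_of_type_algebra_def)

section \<open>The tensor product of two modules\<close>

lemma tfree_iff: "p \<in> tensor_free M N \<longleftrightarrow> (\<forall>k. lookup p k \<noteq> 0 \<longrightarrow> k \<in> carrier M \<times> carrier N)"
  by (auto simp: tensor_free_def in_keys_iff)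

lemma tfree_closed:
  "0 \<in> tensor_free M N" "p \<in> tensor_free M N ==> q \<in> tensor_free M N ==> p + q \<in> tensor_free M N"
  "p \<in> tensor_free M N ==> q \<in> tensor_free M N ==> p - q \<in> tensor_free M N"
  "p \<in> tensor_free M N ==> sc c p \<in> tensor_free M N"
  "x \<in> carrier M ==> y \<in> carrier N ==> single (x, y) c \<in> tensor_free M N"
proof -
  show "0 \<in> tensor_free M N" by (simp add: tensor_free_def)
  show "p \<in> tensor_free M N ==> q \<in> tensor_free M N ==> p + q \<in> tensor_free M N"
    unfolding tensor_free_def using keys_add[of p q] by blast
  show "p \<in> tensor_free M N ==> q \<in> tensor_free M N ==> p - q \<in> tensor_free M N"
    unfolding tensor_free_def using keys_diff[of p q] by blast
  show "p \<in> tensor_free M N ==> sc c p \<in> tensor_free M N"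
    unfolding tfree_iff lookup_sc by (intro allI impI, erule allE, erule mp, rule notI, simp)
  show "x \<in> carrier M ==> y \<in> carrier N ==> single (x, y) c \<in> tensor_free M N"
    by (simp add: tensor_free_def)
qed

lemma tfree_induct [consumes 1, case_names zero add]:
  assumes "p \<in> tensor_free M N" and "Q 0"
    and add: "\<And>p x y c. p \<in> tensor_free M N ==> Q p ==> x \<in> carrier M ==> y \<in> carrier N ==> Q (p + single (x, y) c)"
  shows "Q p"
  using assms(1)
proof (induction "card (keys p)" arbitrary: p)
  case 0
  then show ?case using assms(2) by simp
next
  case (Suc n)
  then obtain k where k: "k \<in> keys p" by (metis card_eq_SucD insertI1)
  obtain x y where xy: "k = (x, y)" by (cases k)
  let ?p = "p - single k (lookup p k)"
  have mem: "x \<in> carrier M" "y \<in> carrier N" using Suc.prems k xy by (auto simp: tensor_free_def)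
  have keys: "keys ?p = keys p - {k}"
    by (auto simp: in_keys_iff lookup_minus lookup_single when_def split: if_splits)
  have "Q (?p + single (x, y) (lookup p k))"
  proof (rule add[OF _ _ mem])
    show "?p \<in> tensor_free M N" using Suc.prems mem unfolding xy by (intro tfree_closed)
    then show "Q ?p" using Suc.hyps(1)[of ?p] Suc.hyps(2) keys k by simp
  qed
  then show ?case by (simp add: xy)
qed

lemma additive_eq:
  fixes T T' :: "('m \<times> 'n \<Rightarrow>\<^sub>0 'k::comm_ring_1) => 'a::ab_group_add"
  assumes p: "p \<in> tensor_free M N" and "\<And>p q. T (p + q) = T p + T q" "\<And>p q. T' (p + q) = T' p + T' q"
    and "\<And>x y c. x \<in> carrier M ==> y \<in> carrier N ==> T (single (x, y) c) = T' (single (x, y) c)"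
  shows "T p = T' p"
  using p
proof (induction rule: tfree_induct)
  case zero
  show ?case using assms(2)[of 0 0] assms(3)[of 0 0] by simp
qed (simp add: assms)

lemma trel_free:
  assumes "module tyring M" "module tyring N"
  shows "p \<in> tensor_rel M N ==> p \<in> tensor_free M N"
proof -
  interpret M: module tyring M by (rule assms(1))
  interpret N: module tyring N by (rule assms(2))
  show "p \<in> tensor_rel M N ==> p \<in> tensor_free M N"
  proof (induction rule: tensor_rel.induct)
    case (scale p c)
    then show ?case using tfree_closed(4)[of p M N c] by simp
  qed (use M.smult_closed N.smult_closed in \<open>auto intro!: tfree_closed simp: tyring_simps\<close>)
qed

lemma trel_neg: "p \<in> tensor_rel M N ==> - p \<in> tensor_rel M N"
  using tensor_rel.scale[of p M N "- 1"] by (simp only: sc_props(6))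

lemma trel_diff: "p \<in> tensor_rel M N ==> q \<in> tensor_rel M N ==> p - q \<in> tensor_rel M N"
  using tensor_rel.add[OF _ trel_neg, of p M N q] by simp

lemma trel_gens:
  assumes "x \<in> carrier M" "x' \<in> carrier M" "y \<in> carrier N" "y' \<in> carrier N"
  shows "single (x \<oplus>\<^bsub>M\<^esub> x', y) c - single (x, y) c - single (x', y) c \<in> tensor_rel M N"
    "single (x, y \<oplus>\<^bsub>N\<^esub> y') c - single (x, y) c - single (x, y') c \<in> tensor_rel M N"
    "single (e \<odot>\<^bsub>M\<^esub> x, y) c - single (x, y) (c * e) \<in> tensor_rel M N"
    "single (x, e \<odot>\<^bsub>N\<^esub> y) c - single (x, y) (c * e) \<in> tensor_rel M N"
  using tensor_rel.scale[OF tensor_rel.add_left[OF assms(1,2,3)], of c] tensor_rel.scale[OF tensor_rel.add_right[OF assms(1,3,4)], of c]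
    tensor_rel.scale[OF tensor_rel.scale_left[OF assms(1,3), of e], of c] tensor_rel.scale[OF tensor_rel.scale_right[OF assms(1,3), of e], of c]
  by (simp_all add: sc_props(5,7))

text \<open>The form taken by composition with one fixed generator: linear in each slot up to a
  common scalar \<open>s\<close>. Sending relations to relations is thus reduced to the linearity of
  composition in the two categories.\<close>

lemma trel_map:
  assumes M: "module tyring M" and N: "module tyring N" and lin: "linear_map M M' \<alpha>" "linear_map N N' \<beta>"
    and T: "\<And>p q. T (p + q) = T p + T q" "\<And>x y c. T (single (x, y) c) = single (\<alpha> x, \<beta> y) (c * s)"
    and p: "p \<in> tensor_rel M N"
  shows "T p \<in> tensor_rel M' N'"
proof -
  have T0: "T 0 = 0" using T(1)[of 0 0] by simp
  have Td: "T (p - q) = T p - T q" for p q using T(1)[of "p - q" q] by simp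
  have Tsc: "T (sc c p) = sc c (T p)" if "p \<in> tensor_free M N" for c p
    by (rule additive_eq[OF that, where T = "\<lambda>p. T (sc c p)" and T' = "\<lambda>p. sc c (T p)"]) (simp_all only: T sc_props(1,7) mult.assoc)
  have \<alpha>: "\<alpha> x \<in> carrier M'" "\<alpha> (c \<odot>\<^bsub>M\<^esub> x) = c \<odot>\<^bsub>M'\<^esub> \<alpha> x" "x' \<in> carrier M ==> \<alpha> (x \<oplus>\<^bsub>M\<^esub> x') = \<alpha> x \<oplus>\<^bsub>M'\<^esub> \<alpha> x'"
    if "x \<in> carrier M" for x x' c using lin(1) that unfolding linear_map_def by blast+
  have \<beta>: "\<beta> x \<in> carrier N'" "\<beta> (c \<odot>\<^bsub>N\<^esub> x) = c \<odot>\<^bsub>N'\<^esub> \<beta> x" "x' \<in> carrier N ==> \<beta> (x \<oplus>\<^bsub>N\<^esub> x') = \<beta> x \<oplus>\<^bsub>N'\<^esub> \<beta> x'"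
    if "x \<in> carrier N" for x x' c using lin(2) that unfolding linear_map_def by blast+
  show ?thesis using p
  proof (induction rule: tensor_rel.induct)
    case zero
    show ?case by (simp only: T0 tensor_rel.zero)
  next
    case (add p q)
    then show ?case by (simp only: T tensor_rel.add)
  next
    case (scale p c)
    show ?case unfolding Tsc[OF trel_free[OF M N scale(1)]] by (rule tensor_rel.scale[OF scale(2)])
  next
    case (add_left x x' y)
    then show ?case using trel_gens(1)[OF \<alpha>(1) \<alpha>(1) \<beta>(1) \<beta>(1), of x x' y y s] by (simp add: Td T(2) \<alpha>)
  next
    case (add_right x y y')
    then show ?case using trel_gens(2)[OF \<alpha>(1) \<alpha>(1) \<beta>(1) \<beta>(1), of x x y y' s] by (simp add: Td T(2) \<beta>)
  next
    case (scale_left x y c)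
    then show ?case using trel_gens(3)[OF \<alpha>(1) \<alpha>(1) \<beta>(1) \<beta>(1), of x x y y c s] by (simp add: Td T(2) \<alpha> mult.commute)
  next
    case (scale_right x y c)
    then show ?case using trel_gens(4)[OF \<alpha>(1) \<alpha>(1) \<beta>(1) \<beta>(1), of x x y y c s] by (simp add: Td T(2) \<beta> mult.commute)
  qed
qed

lemma tcl_eq:
  assumes "p \<in> tensor_free M N" "q \<in> tensor_free M N"
  shows "tensor_cl M N p = tensor_cl M N q \<longleftrightarrow> p - q \<in> tensor_rel M N"
proof
  assume "tensor_cl M N p = tensor_cl M N q"
  moreover have "p \<in> tensor_cl M N p" using assms(1) tensor_rel.zero[of M N] by (simp add: tensor_cl_def)
  ultimately have "p \<in> tensor_cl M N q" by simp
  then show "p - q \<in> tensor_rel M N" by (simp add: tensor_cl_def)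
next
  assume r: "p - q \<in> tensor_rel M N"
  have "s - p \<in> tensor_rel M N \<longleftrightarrow> s - q \<in> tensor_rel M N" for s
  proof
    show "s - q \<in> tensor_rel M N" if "s - p \<in> tensor_rel M N" using tensor_rel.add[OF that r] by simp
    show "s - p \<in> tensor_rel M N" if "s - q \<in> tensor_rel M N" using trel_diff[OF that r] by simp
  qed
  then show "tensor_cl M N p = tensor_cl M N q" by (simp only: tensor_cl_def)
qed

lemma tcl_self: "p \<in> tensor_free M N ==> p \<in> tensor_cl M N p"
  using tensor_rel.zero[of M N] by (simp add: tensor_cl_def)

lemma tcl_memb: "q \<in> tensor_cl M N p ==> q \<in> tensor_free M N \<and> q - p \<in> tensor_rel M N"
  by (simp add: tensor_cl_def)

text \<open>The operations on cosets are written as unions over representatives; this collapses them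
  once independence is known.\<close>

lemma tcl_UN:
  assumes "p \<in> tensor_free M N" "\<And>p'. p' \<in> tensor_free M N ==> p' - p \<in> tensor_rel M N ==> A p' = C"
  shows "(\<Union>p'\<in>tensor_cl M N p. A p') = C"
proof -
  have "(\<Union>p'\<in>tensor_cl M N p. A p') = (\<Union>p'\<in>tensor_cl M N p. C)"
    by (rule SUP_cong[OF refl]) (use assms(2) tcl_memb in blast)
  also have "\<dots> = C" using tcl_self[OF assms(1)] by blast
  finally show ?thesis .
qed

lemma tmod_ops:
  assumes "p \<in> tensor_free M N" "q \<in> tensor_free M N"
  shows "tensor_cl M N p \<oplus>\<^bsub>tensor_module M N\<^esub> tensor_cl M N q = tensor_cl M N (p + q)"
    "c \<odot>\<^bsub>tensor_module M N\<^esub> tensor_cl M N p = tensor_cl M N (sc c p)"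
proof -
  have "(\<Union>p'\<in>tensor_cl M N p. \<Union>q'\<in>tensor_cl M N q. tensor_cl M N (p' + q')) = tensor_cl M N (p + q)"
  proof (rule tcl_UN[OF assms(1)], rule tcl_UN[OF assms(2)])
    fix p' q' assume *: "p' \<in> tensor_free M N" "p' - p \<in> tensor_rel M N" "q' \<in> tensor_free M N" "q' - q \<in> tensor_rel M N"
    have "p' + q' - (p + q) \<in> tensor_rel M N"
      using tensor_rel.add[OF *(2,4)] by (simp add: add_diff_add)
    then show "tensor_cl M N (p' + q') = tensor_cl M N (p + q)"
      using tcl_eq[of "p' + q'" M N "p + q"] tfree_closed(2) assms * by blast
  qed
  then show "tensor_cl M N p \<oplus>\<^bsub>tensor_module M N\<^esub> tensor_cl M N q = tensor_cl M N (p + q)"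
    by (simp add: tensor_module_def)
  have "(\<Union>p'\<in>tensor_cl M N p. tensor_cl M N (sc c p')) = tensor_cl M N (sc c p)"
  proof (rule tcl_UN[OF assms(1)])
    fix p' assume *: "p' \<in> tensor_free M N" "p' - p \<in> tensor_rel M N"
    have "sc c p' - sc c p \<in> tensor_rel M N" using tensor_rel.scale[OF *(2), of c] by (simp only: sc_props(5))
    then show "tensor_cl M N (sc c p') = tensor_cl M N (sc c p)"
      using tcl_eq[of "sc c p'" M N "sc c p"] tfree_closed(4) assms(1) *(1) by blast
  qed
  then show "c \<odot>\<^bsub>tensor_module M N\<^esub> tensor_cl M N p = tensor_cl M N (sc c p)"
    by (simp add: tensor_module_def)
qed

lemma tmod_smult: "p \<in> tensor_free M N ==> c \<odot>\<^bsub>tensor_module M N\<^esub> tensor_cl M N p = tensor_cl M N (sc c p)"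
  and tmod_zero: "\<zero>\<^bsub>tensor_module M N\<^esub> = tensor_cl M N 0"
  using tmod_ops(2) by blast (simp add: tensor_module_def)

lemma tmod_carrier: "P \<in> carrier (tensor_module M N) \<longleftrightarrow> (\<exists>p\<in>tensor_free M N. P = tensor_cl M N p)"
  by (auto simp: tensor_module_def)

lemma tmod_module: "module tyring (tensor_module M N)"
proof (rule moduleI)
  let ?T = "tensor_module M N"
  note simps = tmod_ops(1) tmod_smult tmod_zero tfree_closed tyring_simps
  show "cring tyring" by (rule cring_from_type_algebra)
  show "abelian_group ?T"
  proof (rule abelian_groupI)
    show "\<zero>\<^bsub>?T\<^esub> \<in> carrier ?T" using tfree_closed(1) by (auto simp: tmod_carrier tensor_module_def)
  next
    fix x assume "x \<in> carrier ?T"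
    then obtain p where p: "p \<in> tensor_free M N" "x = tensor_cl M N p" by (auto simp: tmod_carrier)
    have n: "- p \<in> tensor_free M N" using tfree_closed(3)[OF tfree_closed(1) p(1)] by simp
    show "\<exists>y\<in>carrier ?T. y \<oplus>\<^bsub>?T\<^esub> x = \<zero>\<^bsub>?T\<^esub>"
      by (rule bexI[of _ "tensor_cl M N (- p)"]) (use n p in \<open>auto simp: simps tmod_carrier\<close>)
  qed (auto simp: tmod_carrier simps add_ac)
next
  fix a x assume "x \<in> carrier (tensor_module M N)"
  then show "a \<odot>\<^bsub>tensor_module M N\<^esub> x \<in> carrier (tensor_module M N)"
    by (auto simp: tmod_carrier tmod_smult intro: tfree_closed)
next
  fix a b x assume "x \<in> carrier (tensor_module M N)"
  then obtain p where p: "p \<in> tensor_free M N" "x = tensor_cl M N p" by (auto simp: tmod_carrier)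
  show "(a \<oplus>\<^bsub>tyring\<^esub> b) \<odot>\<^bsub>tensor_module M N\<^esub> x = a \<odot>\<^bsub>tensor_module M N\<^esub> x \<oplus>\<^bsub>tensor_module M N\<^esub> b \<odot>\<^bsub>tensor_module M N\<^esub> x"
    "a \<otimes>\<^bsub>tyring\<^esub> b \<odot>\<^bsub>tensor_module M N\<^esub> x = a \<odot>\<^bsub>tensor_module M N\<^esub> (b \<odot>\<^bsub>tensor_module M N\<^esub> x)"
    unfolding p(2) tyring_simps using p(1) by (simp_all only: tmod_smult tmod_ops(1) tfree_closed(4) sc_props(2,3))
next
  fix a x y assume "x \<in> carrier (tensor_module M N)" "y \<in> carrier (tensor_module M N)"
  then obtain p q where "p \<in> tensor_free M N" "x = tensor_cl M N p" "q \<in> tensor_free M N" "y = tensor_cl M N q" by (auto simp: tmod_carrier)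
  then show "a \<odot>\<^bsub>tensor_module M N\<^esub> (x \<oplus>\<^bsub>tensor_module M N\<^esub> y) = a \<odot>\<^bsub>tensor_module M N\<^esub> x \<oplus>\<^bsub>tensor_module M N\<^esub> a \<odot>\<^bsub>tensor_module M N\<^esub> y"
    by (simp only: tmod_smult tmod_ops(1) tfree_closed(2,4) sc_props(1))
next
  fix x assume "x \<in> carrier (tensor_module M N)"
  then obtain p where p: "p \<in> tensor_free M N" "x = tensor_cl M N p" by (auto simp: tmod_carrier)
  show "\<one>\<^bsub>tyring\<^esub> \<odot>\<^bsub>tensor_module M N\<^esub> x = x"
    unfolding p(2) tyring_simps using p(1) by (simp only: tmod_smult sc_props(4))
qed

section \<open>The universal property of the tensor product\<close>

context
  fixes M :: "('k::comm_ring_1, 'm) module" and N :: "('k, 'n) module" and Q :: "('k, 'q) module" and B :: "'m => 'n => 'q"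
  assumes M: "module tyring M" and N: "module tyring N" and Q: "module tyring Q"
    and B: "\<And>x y. x \<in> carrier M ==> y \<in> carrier N ==> B x y \<in> carrier Q"
      "\<And>x x' y. x \<in> carrier M ==> x' \<in> carrier M ==> y \<in> carrier N ==> B (x \<oplus>\<^bsub>M\<^esub> x') y = B x y \<oplus>\<^bsub>Q\<^esub> B x' y"
      "\<And>x y y'. x \<in> carrier M ==> y \<in> carrier N ==> y' \<in> carrier N ==> B x (y \<oplus>\<^bsub>N\<^esub> y') = B x y \<oplus>\<^bsub>Q\<^esub> B x y'"
      "\<And>c x y. x \<in> carrier M ==> y \<in> carrier N ==> B (c \<odot>\<^bsub>M\<^esub> x) y = c \<odot>\<^bsub>Q\<^esub> B x y"
      "\<And>c x y. x \<in> carrier M ==> y \<in> carrier N ==> B x (c \<odot>\<^bsub>N\<^esub> y) = c \<odot>\<^bsub>Q\<^esub> B x y"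
begin

interpretation Q: module tyring Q by (rule Q)

lemma Qs:
  "x \<in> carrier Q ==> c \<odot>\<^bsub>Q\<^esub> x \<in> carrier Q" "x \<in> carrier Q ==> (c + e) \<odot>\<^bsub>Q\<^esub> x = c \<odot>\<^bsub>Q\<^esub> x \<oplus>\<^bsub>Q\<^esub> e \<odot>\<^bsub>Q\<^esub> x"
  "x \<in> carrier Q ==> (c * e) \<odot>\<^bsub>Q\<^esub> x = c \<odot>\<^bsub>Q\<^esub> (e \<odot>\<^bsub>Q\<^esub> x)" "x \<in> carrier Q ==> 1 \<odot>\<^bsub>Q\<^esub> x = x"
  "x \<in> carrier Q ==> 0 \<odot>\<^bsub>Q\<^esub> x = \<zero>\<^bsub>Q\<^esub>" "x \<in> carrier Q ==> (- c) \<odot>\<^bsub>Q\<^esub> x = \<ominus>\<^bsub>Q\<^esub> (c \<odot>\<^bsub>Q\<^esub> x)"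
proof -
  assume x: "x \<in> carrier Q"
  show "c \<odot>\<^bsub>Q\<^esub> x \<in> carrier Q" using Q.smult_closed[of c x] x by (simp add: tyring_simps)
  show a: "(c + e) \<odot>\<^bsub>Q\<^esub> x = c \<odot>\<^bsub>Q\<^esub> x \<oplus>\<^bsub>Q\<^esub> e \<odot>\<^bsub>Q\<^esub> x" for c e
    using Q.smult_l_distr[of c e x] x by (simp add: tyring_simps)
  show "(c * e) \<odot>\<^bsub>Q\<^esub> x = c \<odot>\<^bsub>Q\<^esub> (e \<odot>\<^bsub>Q\<^esub> x)" using Q.smult_assoc1[of c e x] x by (simp add: tyring_simps)
  show "1 \<odot>\<^bsub>Q\<^esub> x = x" using Q.smult_one[OF x] by (simp add: tyring_simps)
  show z: "0 \<odot>\<^bsub>Q\<^esub> x = \<zero>\<^bsub>Q\<^esub>" using Q.smult_l_null[OF x] by (simp add: tyring_simps)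
  have cl: "c \<odot>\<^bsub>Q\<^esub> x \<in> carrier Q" for c using Q.smult_closed[of c x] x by (simp add: tyring_simps)
  show "(- c) \<odot>\<^bsub>Q\<^esub> x = \<ominus>\<^bsub>Q\<^esub> (c \<odot>\<^bsub>Q\<^esub> x)"
    using a[of "- c" c] z cl by (intro Q.M.minus_equality[symmetric]) auto
qed

definition "ext p = (\<Oplus>\<^bsub>Q\<^esub>k\<in>keys p. lookup p k \<odot>\<^bsub>Q\<^esub> B (fst k) (snd k))"

text \<open>The summation set can be enlarged, since coefficients 0 contribute the zero of
  \<open>Q\<close>; additivity then follows by summing over a common set.\<close>

lemma ext_superset:
  assumes "finite S" "keys p \<subseteq> S" "S \<subseteq> carrier M \<times> carrier N"
  shows "ext p = (\<Oplus>\<^bsub>Q\<^esub>k\<in>S. lookup p k \<odot>\<^bsub>Q\<^esub> B (fst k) (snd k))"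
  unfolding ext_def
  by (rule Q.M.add.finprod_mono_neutral_cong_left) (use assms B(1) Qs(1,5) in \<open>auto simp: in_keys_iff\<close>)

lemma ext_closed: "p \<in> tensor_free M N ==> ext p \<in> carrier Q"
  unfolding ext_def by (rule Q.M.finsum_closed) (auto simp: tensor_free_def intro!: Qs(1) B(1))

lemma ext_add:
  assumes "p \<in> tensor_free M N" "q \<in> tensor_free M N"
  shows "ext (p + q) = ext p \<oplus>\<^bsub>Q\<^esub> ext q"
proof -
  let ?S = "keys p \<union> keys q"
  have S: "finite ?S" "?S \<subseteq> carrier M \<times> carrier N" using assms by (auto simp: tensor_free_def)
  have b: "B (fst k) (snd k) \<in> carrier Q" if "k \<in> ?S" for k using S(2) that B(1) by auto
  have "(\<Oplus>\<^bsub>Q\<^esub>k\<in>?S. lookup (p + q) k \<odot>\<^bsub>Q\<^esub> B (fst k) (snd k)) =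
    (\<Oplus>\<^bsub>Q\<^esub>k\<in>?S. lookup p k \<odot>\<^bsub>Q\<^esub> B (fst k) (snd k) \<oplus>\<^bsub>Q\<^esub> lookup q k \<odot>\<^bsub>Q\<^esub> B (fst k) (snd k))"
    by (rule Q.M.finsum_cong') (use b Qs in \<open>auto simp: lookup_add\<close>)
  also have "\<dots> = (\<Oplus>\<^bsub>Q\<^esub>k\<in>?S. lookup p k \<odot>\<^bsub>Q\<^esub> B (fst k) (snd k)) \<oplus>\<^bsub>Q\<^esub> (\<Oplus>\<^bsub>Q\<^esub>k\<in>?S. lookup q k \<odot>\<^bsub>Q\<^esub> B (fst k) (snd k))"
    by (rule Q.M.finsum_addf) (use b Qs(1) in auto)
  finally show ?thesis
    using ext_superset[OF S(1) keys_add S(2)] ext_superset[OF S(1) Un_upper1 S(2)] ext_superset[OF S(1) Un_upper2 S(2)] by simp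
qed

lemma ext_single: "x \<in> carrier M ==> y \<in> carrier N ==> ext (single (x, y) c) = c \<odot>\<^bsub>Q\<^esub> B x y"
  using ext_superset[of "{(x, y)}" "single (x, y) c"] B(1)[of x y] Qs(1)[of "B x y" c]
  by (simp add: Q.M.finsum_insert split: if_splits)

lemma ext_0: "ext 0 = \<zero>\<^bsub>Q\<^esub>" by (simp add: ext_def)

lemma ext_sc:
  assumes "p \<in> tensor_free M N" shows "ext (sc c p) = c \<odot>\<^bsub>Q\<^esub> ext p"
  using assms
proof (induction rule: tfree_induct)
  case zero
  have "sc c 0 = (0 :: 'm \<times> 'n \<Rightarrow>\<^sub>0 'k)" by (auto intro!: poly_mapping_eqI simp: lookup_sc)
  moreover have "c \<odot>\<^bsub>Q\<^esub> \<zero>\<^bsub>Q\<^esub> = \<zero>\<^bsub>Q\<^esub>" using Q.smult_r_null[of c] by (simp add: tyring_simps)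
  ultimately show ?case by (simp only: ext_0)
next
  case (add p x y a)
  have "c \<odot>\<^bsub>Q\<^esub> (ext p \<oplus>\<^bsub>Q\<^esub> ext (single (x, y) a)) = c \<odot>\<^bsub>Q\<^esub> ext p \<oplus>\<^bsub>Q\<^esub> c \<odot>\<^bsub>Q\<^esub> ext (single (x, y) a)"
    by (rule Q.smult_r_distr) (simp_all add: tyring_simps ext_closed add tfree_closed(5))
  then show ?case using add by (simp add: ext_add tfree_closed sc_props(1,7) ext_single Qs(3)[OF B(1)])
qed

lemma ext_diff:
  assumes "p \<in> tensor_free M N" "q \<in> tensor_free M N"
  shows "ext (p - q) = ext p \<ominus>\<^bsub>Q\<^esub> ext q"
proof -
  have n: "- q \<in> tensor_free M N" using tfree_closed(3)[OF tfree_closed(1) assms(2)] by simp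
  have "ext (- q) = (- 1) \<odot>\<^bsub>Q\<^esub> ext q" using ext_sc[OF assms(2), of "- 1"] by (simp only: sc_props(6))
  also have "\<dots> = \<ominus>\<^bsub>Q\<^esub> ext q" using Qs(6,4)[OF ext_closed[OF assms(2)]] by simp
  finally show ?thesis using ext_add[OF assms(1) n] by (simp add: a_minus_def)
qed

lemmas rel_free = trel_free[OF M N]

lemma M_closed: "x \<in> carrier M ==> x' \<in> carrier M ==> x \<oplus>\<^bsub>M\<^esub> x' \<in> carrier M" "x \<in> carrier M ==> c \<odot>\<^bsub>M\<^esub> x \<in> carrier M"
  "y \<in> carrier N ==> y' \<in> carrier N ==> y \<oplus>\<^bsub>N\<^esub> y' \<in> carrier N" "y \<in> carrier N ==> c \<odot>\<^bsub>N\<^esub> y \<in> carrier N"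
proof -
  interpret M: module tyring M by (rule M)
  interpret N: module tyring N by (rule N)
  show "x \<in> carrier M ==> x' \<in> carrier M ==> x \<oplus>\<^bsub>M\<^esub> x' \<in> carrier M" "x \<in> carrier M ==> c \<odot>\<^bsub>M\<^esub> x \<in> carrier M"
    "y \<in> carrier N ==> y' \<in> carrier N ==> y \<oplus>\<^bsub>N\<^esub> y' \<in> carrier N" "y \<in> carrier N ==> c \<odot>\<^bsub>N\<^esub> y \<in> carrier N"
    using M.smult_closed[of c x] N.smult_closed[of c y] by (auto simp: tyring_simps)
qed

lemma ext_rel: "p \<in> tensor_rel M N ==> ext p = \<zero>\<^bsub>Q\<^esub>"
proof (induction rule: tensor_rel.induct)
  case zero
  show ?case by (rule ext_0)
next
  case (add p q)
  then show ?case using ext_add[OF rel_free rel_free] by simp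
next
  case (scale p c)
  have "c \<odot>\<^bsub>Q\<^esub> \<zero>\<^bsub>Q\<^esub> = \<zero>\<^bsub>Q\<^esub>" using Q.smult_r_null[of c] by (simp add: tyring_simps)
  then show ?case using ext_sc[OF rel_free[OF scale(1)], of c] scale by simp
next
  case (add_left x x' y)
  have "(b \<oplus>\<^bsub>Q\<^esub> b') \<ominus>\<^bsub>Q\<^esub> b \<ominus>\<^bsub>Q\<^esub> b' = \<zero>\<^bsub>Q\<^esub>" if "b \<in> carrier Q" "b' \<in> carrier Q" for b b'
    using that by (simp add: a_minus_def Q.M.a_ac Q.M.r_neg1 Q.M.r_neg2 Q.M.r_neg)
  then show ?case using add_left B
    by (simp add: ext_diff tfree_closed M_closed ext_single Qs(4))
next
  case (add_right x y y')
  have "(b \<oplus>\<^bsub>Q\<^esub> b') \<ominus>\<^bsub>Q\<^esub> b \<ominus>\<^bsub>Q\<^esub> b' = \<zero>\<^bsub>Q\<^esub>" if "b \<in> carrier Q" "b' \<in> carrier Q" for b b'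
    using that by (simp add: a_minus_def Q.M.a_ac Q.M.r_neg1 Q.M.r_neg2 Q.M.r_neg)
  then show ?case using add_right B
    by (simp add: ext_diff tfree_closed M_closed ext_single Qs(4))
next
  case (scale_left x y c)
  then show ?case using B Qs(1)[OF B(1), of x y c]
    by (simp add: ext_diff tfree_closed M_closed ext_single Qs(4) a_minus_def Q.M.r_neg)
next
  case (scale_right x y c)
  then show ?case using B Qs(1)[OF B(1), of x y c]
    by (simp add: ext_diff tfree_closed M_closed ext_single Qs(4) a_minus_def Q.M.r_neg)
qed

definition "lift P = ext (SOME p. p \<in> P)"

lemma lift_cl: assumes "p \<in> tensor_free M N" shows "lift (tensor_cl M N p) = ext p"
proof -
  let ?q = "SOME q. q \<in> tensor_cl M N p"
  have "?q \<in> tensor_cl M N p" by (rule someI[of "\<lambda>q. q \<in> tensor_cl M N p", OF tcl_self[OF assms]])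
  then have q: "?q \<in> tensor_free M N" "?q - p \<in> tensor_rel M N" by (auto dest: tcl_memb)
  have "ext ?q = ext (p + (?q - p))" by simp
  also have "\<dots> = ext p \<oplus>\<^bsub>Q\<^esub> \<zero>\<^bsub>Q\<^esub>" using ext_add[OF assms rel_free[OF q(2)]] ext_rel[OF q(2)] by simp
  finally show ?thesis using ext_closed[OF assms] by (simp add: lift_def)
qed

lemma lift_linear: "linear_map (tensor_module M N) Q lift"
  unfolding linear_map_def
  by (auto simp: tmod_carrier tmod_ops(1) tmod_smult lift_cl ext_closed tfree_closed ext_add ext_sc)

lemma lift_pure: "x \<in> carrier M ==> y \<in> carrier N ==> lift (pure_tensor M N x y) = B x y"
  by (simp add: pure_tensor_def lift_cl tfree_closed ext_single Qs(4) B(1))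

end

lemma linear_categoryD:
  assumes "linear_category C" "a \<in> ob C" "b \<in> ob C"
  shows "module tyring (hom_mod C a b)" "idt C a \<in> carrier (hom_mod C a a)"
    "f \<in> carrier (hom_mod C a b) ==> cmp C a b b (idt C b) f = f" "f \<in> carrier (hom_mod C a b) ==> cmp C a a b f (idt C a) = f"
    "c \<in> ob C ==> g \<in> carrier (hom_mod C b c) ==> linear_map (hom_mod C a b) (hom_mod C a c) (\<lambda>f. cmp C a b c g f)"
    "c \<in> ob C ==> f \<in> carrier (hom_mod C a b) ==> linear_map (hom_mod C b c) (hom_mod C a c) (\<lambda>g. cmp C a b c g f)"
proof -
  note L = assms(1)[unfolded linear_category_def]
  note L1 = conjunct1[OF L] and R1 = conjunct2[OF L]
  note L2 = conjunct1[OF R1] and R2 = conjunct2[OF R1]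
  note L3 = conjunct1[OF R2] and R3 = conjunct2[OF R2]
  note L4 = conjunct1[OF R3] and R4 = conjunct2[OF R3]
  note L5 = conjunct1[OF R4]
  show "module tyring (hom_mod C a b)" by (rule L1[rule_format, OF assms(2,3)])
  show "idt C a \<in> carrier (hom_mod C a a)" by (rule L4[rule_format, OF assms(2)])
  show "cmp C a b b (idt C b) f = f" "cmp C a a b f (idt C a) = f" if "f \<in> carrier (hom_mod C a b)"
    using L5[rule_format, OF assms(2,3) that] by simp_all
  show "linear_map (hom_mod C a b) (hom_mod C a c) (\<lambda>f. cmp C a b c g f)" if "c \<in> ob C" "g \<in> carrier (hom_mod C b c)"
    by (rule L2[rule_format, OF assms(2,3) that])
  show "linear_map (hom_mod C b c) (hom_mod C a c) (\<lambda>g. cmp C a b c g f)" if "c \<in> ob C" "f \<in> carrier (hom_mod C a b)"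
    by (rule L3[rule_format, OF assms(2,3) that])
qed

lemma linear_category_assoc:
  assumes "linear_category C" "a \<in> ob C" "b \<in> ob C" "c \<in> ob C" "d \<in> ob C"
    "f \<in> carrier (hom_mod C a b)" "g \<in> carrier (hom_mod C b c)" "h \<in> carrier (hom_mod C c d)"
  shows "cmp C a c d h (cmp C a b c g f) = cmp C a b d (cmp C b c d h g) f"
  using assms unfolding linear_category_def by blast

lemma cmp_props:
  assumes C: "linear_category C" and ob: "a \<in> ob C" "b \<in> ob C" "c \<in> ob C"
    and f: "f \<in> carrier (hom_mod C a b)" "f' \<in> carrier (hom_mod C a b)" and g: "g \<in> carrier (hom_mod C b c)" "g' \<in> carrier (hom_mod C b c)"
  shows "cmp C a b c g f \<in> carrier (hom_mod C a c)"
    "cmp C a b c g (f \<oplus>\<^bsub>hom_mod C a b\<^esub> f') = cmp C a b c g f \<oplus>\<^bsub>hom_mod C a c\<^esub> cmp C a b c g f'"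
    "cmp C a b c (g \<oplus>\<^bsub>hom_mod C b c\<^esub> g') f = cmp C a b c g f \<oplus>\<^bsub>hom_mod C a c\<^esub> cmp C a b c g' f"
    "cmp C a b c g (e \<odot>\<^bsub>hom_mod C a b\<^esub> f) = e \<odot>\<^bsub>hom_mod C a c\<^esub> cmp C a b c g f"
    "cmp C a b c (e \<odot>\<^bsub>hom_mod C b c\<^esub> g) f = e \<odot>\<^bsub>hom_mod C a c\<^esub> cmp C a b c g f"
  using linear_categoryD(5)[OF C ob g(1)] linear_categoryD(6)[OF C ob f(1)] f g unfolding linear_map_def by blast+

text \<open>The composition of the tensor category, lifted to the free modules and written with
  projections so that objects stay variables. Bilinear identities are then checked on generators by
  \<open>additive_eq\<close>.\<close>

definition tensor_cmp :: "('o, 'm, 'k::comm_ring_1) lincat => ('p, 'n, 'k) lincat => 'o \<times> 'p => 'o \<times> 'p => 'o \<times> 'p =>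
    ('m \<times> 'n \<Rightarrow>\<^sub>0 'k) => ('m \<times> 'n \<Rightarrow>\<^sub>0 'k) => ('m \<times> 'n \<Rightarrow>\<^sub>0 'k)" where
  "tensor_cmp C D A B X p q = (\<Sum>k\<in>keys p. \<Sum>l\<in>keys q.
     single (cmp C (fst A) (fst B) (fst X) (fst k) (fst l), cmp D (snd A) (snd B) (snd X) (snd k) (snd l))
       (lookup p k * lookup q l))"

lemma tensor_cmp_add:
  "tensor_cmp C D A B X (p + p') q = tensor_cmp C D A B X p q + tensor_cmp C D A B X p' q"
  "tensor_cmp C D A B X p (q + q') = tensor_cmp C D A B X p q + tensor_cmp C D A B X p q'"
proof -
  let ?s = "\<lambda>k l. single (cmp C (fst A) (fst B) (fst X) (fst k) (fst l), cmp D (snd A) (snd B) (snd X) (snd k) (snd l))"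
  show "tensor_cmp C D A B X (p + p') q = tensor_cmp C D A B X p q + tensor_cmp C D A B X p' q"
    unfolding tensor_cmp_def
    by (rule sum_keys_add[where F = "\<lambda>k a. \<Sum>l\<in>keys q. ?s k l (a * lookup q l)"])
      (simp_all add: distrib_right single_add sum.distrib)
  have "(\<Sum>l\<in>keys (q + q'). ?s k l (a * lookup (q + q') l)) =
    (\<Sum>l\<in>keys q. ?s k l (a * lookup q l)) + (\<Sum>l\<in>keys q'. ?s k l (a * lookup q' l))" for k a
    by (rule sum_keys_add[where F = "\<lambda>l b. ?s k l (a * b)"]) (simp_all add: distrib_left single_add)
  then show "tensor_cmp C D A B X p (q + q') = tensor_cmp C D A B X p q + tensor_cmp C D A B X p q'"
    unfolding tensor_cmp_def by (simp only: sum.distrib)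
qed

lemma tensor_cmp_0: "tensor_cmp C D A B X 0 q = 0" "tensor_cmp C D A B X p 0 = 0"
  by (simp_all add: tensor_cmp_def)

lemma tensor_cmp_single:
  "tensor_cmp C D (a, a') (b, b') (c, c') (single (g, g') r) (single (f, f') s) =
    single (cmp C a b c g f, cmp D a' b' c' g' f') (r * s)"
  by (cases "r = 0"; cases "s = 0") (simp_all add: tensor_cmp_def)

lemma tensor_cmp_diff:
  "tensor_cmp C D A B X (p - p') q = tensor_cmp C D A B X p q - tensor_cmp C D A B X p' q"
  "tensor_cmp C D A B X p (q - q') = tensor_cmp C D A B X p q - tensor_cmp C D A B X p q'"
proof -
  show "tensor_cmp C D A B X (p - p') q = tensor_cmp C D A B X p q - tensor_cmp C D A B X p' q"
    using tensor_cmp_add(1)[of C D A B X "p - p'" p' q] by simp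
  show "tensor_cmp C D A B X p (q - q') = tensor_cmp C D A B X p q - tensor_cmp C D A B X p q'"
    using tensor_cmp_add(2)[of C D A B X p "q - q'" q'] by simp
qed

lemma tensor_cmp_sc:
  assumes p: "p \<in> tensor_free M N" and q: "q \<in> tensor_free M' N'"
  shows "tensor_cmp C D A B X (sc c p) q = sc c (tensor_cmp C D A B X p q)"
    "tensor_cmp C D A B X p (sc c q) = sc c (tensor_cmp C D A B X p q)"
proof -
  note s = tensor_cmp_single[of C D "fst A" "snd A" "fst B" "snd B" "fst X" "snd X", unfolded prod.collapse]
  let ?t = "tensor_cmp C D A B X"
  have "?t (single (x, y) (c * a)) q = sc c (?t (single (x, y) a) q)" for x y a
    by (rule additive_eq[OF q, where T = "?t (single (x, y) (c * a))" and T' = "\<lambda>q. sc c (?t (single (x, y) a) q)"])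
      (simp_all only: tensor_cmp_add sc_props(1,7) s mult.assoc)
  then show "?t (sc c p) q = sc c (?t p q)"
    by (intro additive_eq[OF p, where T = "\<lambda>p. ?t (sc c p) q" and T' = "\<lambda>p. sc c (?t p q)"]) (simp_all only: tensor_cmp_add sc_props(1,7))
  have "?t (single (x, y) a) (sc c q) = sc c (?t (single (x, y) a) q)" for x y a
    by (rule additive_eq[OF q, where T = "\<lambda>q. ?t (single (x, y) a) (sc c q)" and T' = "\<lambda>q. sc c (?t (single (x, y) a) q)"])
      (simp_all only: tensor_cmp_add sc_props(1,7) s mult.left_commute)
  then show "?t p (sc c q) = sc c (?t p q)"
    by (intro additive_eq[OF p, where T = "\<lambda>p. ?t p (sc c q)" and T' = "\<lambda>p. sc c (?t p q)"]) (simp_all only: tensor_cmp_add sc_props(1,7))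
qed

context
  fixes C :: "('o, 'm, 'k::comm_ring_1) lincat" and D :: "('p, 'n, 'k) lincat"
  assumes C: "linear_category C" and D: "linear_category D"
begin

abbreviation "TC \<equiv> tensor_category C D"
abbreviation "fr A B \<equiv> tensor_free (hom_mod C (fst A) (fst B)) (hom_mod D (snd A) (snd B))"
abbreviation "rl A B \<equiv> tensor_rel (hom_mod C (fst A) (fst B)) (hom_mod D (snd A) (snd B))"
abbreviation "tcl A B \<equiv> tensor_cl (hom_mod C (fst A) (fst B)) (hom_mod D (snd A) (snd B))"

lemma tc_simps:
  "ob TC = ob C \<times> ob D" "hom_mod TC A B = tensor_module (hom_mod C (fst A) (fst B)) (hom_mod D (snd A) (snd B))"
  "idt TC A = tcl A A (single (idt C (fst A), idt D (snd A)) 1)"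
  "cmp TC A B X P Q = (\<Union>p\<in>P. \<Union>q\<in>Q. tcl A X (tensor_cmp C D A B X p q))"
  by (simp_all add: tensor_category_def pure_tensor_def tensor_cmp_def split_beta)

context
  fixes A B X
  assumes ob: "A \<in> ob TC" "B \<in> ob TC" "X \<in> ob TC"
begin

lemma obs: "fst A \<in> ob C" "fst B \<in> ob C" "fst X \<in> ob C" "snd A \<in> ob D" "snd B \<in> ob D" "snd X \<in> ob D"
  using ob by (auto simp: tc_simps)

lemmas cC = cmp_props[OF C obs(1-3)] and cD = cmp_props[OF D obs(4-6)]

abbreviation "tk \<equiv> tensor_cmp C D A B X"

lemma tk_single: "tk (single (g, g') r) (single (f, f') s) =
    single (cmp C (fst A) (fst B) (fst X) g f, cmp D (snd A) (snd B) (snd X) g' f') (r * s)"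
  using tensor_cmp_single[of C D "fst A" "snd A" "fst B" "snd B" "fst X" "snd X"] by simp

lemma tk_free: "p \<in> fr B X ==> q \<in> fr A B ==> tk p q \<in> fr A X"
proof (induction p rule: tfree_induct)
  case zero
  then show ?case by (simp only: tensor_cmp_0 tfree_closed(1))
next
  case (add p g g' r)
  have "tk (single (g, g') r) q \<in> fr A X" using add.prems
  proof (induction q rule: tfree_induct)
    case zero
    then show ?case by (simp only: tensor_cmp_0 tfree_closed(1))
  next
    case (add q f f' s)
    then show ?case unfolding tensor_cmp_add tk_single
      using \<open>g \<in> _\<close> \<open>g' \<in> _\<close> cC(1)[of f f g g] cD(1)[of f' f' g' g'] by (intro tfree_closed(2,5)) auto
  qed
  then show ?case unfolding tensor_cmp_add using add by (intro tfree_closed(2)) auto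
qed

lemma tk_rel_left: assumes p: "p \<in> rl B X" and q: "q \<in> fr A B" shows "tk p q \<in> rl A X"
  using q
proof (induction q rule: tfree_induct)
  case zero
  show ?case by (simp only: tensor_cmp_0 tensor_rel.zero)
next
  case (add q f f' s)
  have "tk p (single (f, f') s) \<in> rl A X"
    by (rule trel_map[OF linear_categoryD(1)[OF C obs(2,3)] linear_categoryD(1)[OF D obs(5,6)]
        linear_categoryD(6)[OF C obs(1-3) add.hyps(2)] linear_categoryD(6)[OF D obs(4-6) add.hyps(3)] _ _ p, where T = "\<lambda>p. tk p (single (f, f') s)"])
      (simp_all only: tensor_cmp_add tk_single)
  then show ?case unfolding tensor_cmp_add by (rule tensor_rel.add[OF add.IH])
qed

lemma tk_rel_right: assumes p: "p \<in> fr B X" and q: "q \<in> rl A B" shows "tk p q \<in> rl A X"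
  using p
proof (induction p rule: tfree_induct)
  case zero
  show ?case by (simp only: tensor_cmp_0 tensor_rel.zero)
next
  case (add p g g' r)
  have "tk (single (g, g') r) q \<in> rl A X"
    by (rule trel_map[OF linear_categoryD(1)[OF C obs(1,2)] linear_categoryD(1)[OF D obs(4,5)]
        linear_categoryD(5)[OF C obs(1-3) add.hyps(2)] linear_categoryD(5)[OF D obs(4-6) add.hyps(3)] _ _ q, where T = "tk (single (g, g') r)"])
      (simp_all only: tensor_cmp_add tk_single mult.commute)
  then show ?case unfolding tensor_cmp_add by (rule tensor_rel.add[OF add.IH])
qed

text \<open>Independence of both representatives, from the splitting of the difference of two
  products into a part with a relation on the left and one with a relation on the right.\<close>

lemma tc_cmp: assumes p: "p \<in> fr B X" and q: "q \<in> fr A B"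
  shows "cmp TC A B X (tcl B X p) (tcl A B q) = tcl A X (tk p q)"
  unfolding tc_simps
proof (rule tcl_UN[OF p], rule tcl_UN[OF q])
  fix p' q' assume *: "p' \<in> fr B X" "p' - p \<in> rl B X" "q' \<in> fr A B" "q' - q \<in> rl A B"
  have "tk p' q' - tk p q = tk (p' - p) q' + tk p (q' - q)" by (simp add: tensor_cmp_diff)
  also have "\<dots> \<in> rl A X" by (rule tensor_rel.add[OF tk_rel_left[OF *(2,3)] tk_rel_right[OF p *(4)]])
  finally show "tcl A X (tk p' q') = tcl A X (tk p q)" using tcl_eq tk_free[OF *(1,3)] tk_free[OF p q] by blast
qed

end

lemma tk_id:
  assumes ob: "A \<in> ob TC" "B \<in> ob TC" and q: "q \<in> fr A B"
  shows "tensor_cmp C D A B B (single (idt C (fst B), idt D (snd B)) 1) q = q"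
    "tensor_cmp C D A A B q (single (idt C (fst A), idt D (snd A)) 1) = q"
proof -
  note o = obs[OF ob(1,2,2)]
  show "tensor_cmp C D A B B (single (idt C (fst B), idt D (snd B)) 1) q = q"
    by (rule additive_eq[OF q, where T = "tensor_cmp C D A B B (single (idt C (fst B), idt D (snd B)) 1)" and T' = "\<lambda>q. q"])
      (simp_all add: tensor_cmp_add tk_single[OF ob(1,2,2)] linear_categoryD(3)[OF C o(1,2)] linear_categoryD(3)[OF D o(4,5)])
  show "tensor_cmp C D A A B q (single (idt C (fst A), idt D (snd A)) 1) = q"
    by (rule additive_eq[OF q, where T = "\<lambda>q. tensor_cmp C D A A B q (single (idt C (fst A), idt D (snd A)) 1)" and T' = "\<lambda>q. q"])
      (simp_all add: tensor_cmp_add tk_single[OF ob(1,1,2)] linear_categoryD(4)[OF C o(1,2)] linear_categoryD(4)[OF D o(4,5)])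
qed

lemma tk_assoc:
  assumes ob: "A \<in> ob TC" "B \<in> ob TC" "X \<in> ob TC" "Y \<in> ob TC" and p: "p \<in> fr A B" and q: "q \<in> fr B X" and r: "r \<in> fr X Y"
  shows "tensor_cmp C D A X Y r (tensor_cmp C D A B X q p) = tensor_cmp C D A B Y (tensor_cmp C D B X Y r q) p"
proof -
  have o: "fst A \<in> ob C" "fst B \<in> ob C" "fst X \<in> ob C" "fst Y \<in> ob C" "snd A \<in> ob D" "snd B \<in> ob D" "snd X \<in> ob D" "snd Y \<in> ob D"
    using ob by (auto simp: tc_simps)
  let ?L = "\<lambda>p q r. tensor_cmp C D A X Y r (tensor_cmp C D A B X q p)" and ?R = "\<lambda>p q r. tensor_cmp C D A B Y (tensor_cmp C D B X Y r q) p"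
  show "?L p q r = ?R p q r"
  proof (rule additive_eq[OF p, where T = "\<lambda>p. ?L p q r" and T' = "\<lambda>p. ?R p q r"])
    fix f f' and s :: 'k assume f: "f \<in> carrier (hom_mod C (fst A) (fst B))" "f' \<in> carrier (hom_mod D (snd A) (snd B))"
    let ?f = "single (f, f') s"
    show "?L ?f q r = ?R ?f q r"
    proof (rule additive_eq[OF q, where T = "\<lambda>q. ?L ?f q r" and T' = "\<lambda>q. ?R ?f q r"])
      fix g g' and t :: 'k assume g: "g \<in> carrier (hom_mod C (fst B) (fst X))" "g' \<in> carrier (hom_mod D (snd B) (snd X))"
      let ?g = "single (g, g') t"
      show "?L ?f ?g r = ?R ?f ?g r"
        by (rule additive_eq[OF r, where T = "?L ?f ?g" and T' = "?R ?f ?g"])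
          (simp_all only: tensor_cmp_add tk_single[OF ob(1-3)] tk_single[OF ob(2-4)] tk_single[OF ob(1,3,4)] tk_single[OF ob(1,2,4)]
            linear_category_assoc[OF C o(1-4) f(1) g(1)] linear_category_assoc[OF D o(5-8) f(2) g(2)] mult.assoc)
    qed (simp_all only: tensor_cmp_add)
  qed (simp_all only: tensor_cmp_add)
qed

lemma id_free: "A \<in> ob TC ==> single (idt C (fst A), idt D (snd A)) 1 \<in> fr A A"
  using linear_categoryD(2)[OF C] linear_categoryD(2)[OF D] by (intro tfree_closed(5)) (auto simp: tc_simps)

lemma tensor_linear_category: "linear_category TC"
  unfolding linear_category_def linear_map_def
proof (intro conjI ballI allI funcsetI)
  fix A B assume ob: "A \<in> ob TC" "B \<in> ob TC"
  show "module tyring (hom_mod TC A B)" unfolding tc_simps by (rule tmod_module)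
  fix X P assume X: "X \<in> ob TC" and P: "P \<in> carrier (hom_mod TC B X)"
  then obtain p where p: "p \<in> fr B X" "P = tcl B X p" by (auto simp: tc_simps(2) tmod_carrier)
  note tc = tc_cmp[OF ob X p(1), folded p(2)] and tf = tk_free[OF ob X p(1)]
  fix Q assume Q: "Q \<in> carrier (hom_mod TC A B)"
  then obtain q where q: "q \<in> fr A B" "Q = tcl A B q" by (auto simp: tc_simps(2) tmod_carrier)
  show "cmp TC A B X P Q \<in> carrier (hom_mod TC A X)" unfolding q(2) tc[OF q(1)] tc_simps(2) tmod_carrier using tf[OF q(1)] by blast
  show "cmp TC A B X P (Q \<oplus>\<^bsub>hom_mod TC A B\<^esub> Q') = cmp TC A B X P Q \<oplus>\<^bsub>hom_mod TC A X\<^esub> cmp TC A B X P Q'" if Q': "Q' \<in> carrier (hom_mod TC A B)" for Q'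
  proof -
    obtain q' where q': "q' \<in> fr A B" "Q' = tcl A B q'" using Q' by (auto simp: tc_simps(2) tmod_carrier)
    show ?thesis unfolding q(2) q'(2) tc_simps(2) tmod_ops(1)[OF q(1) q'(1)] tc[OF tfree_closed(2)[OF q(1) q'(1)]] tc[OF q(1)] tc[OF q'(1)] tmod_ops(1)[OF tf[OF q(1)] tf[OF q'(1)]] tensor_cmp_add ..
  qed
  show "cmp TC A B X P (c \<odot>\<^bsub>hom_mod TC A B\<^esub> Q) = c \<odot>\<^bsub>hom_mod TC A X\<^esub> cmp TC A B X P Q" for c
    unfolding q(2) tc_simps(2) tmod_smult[OF q(1)] tc[OF tfree_closed(4)[OF q(1)]] tc[OF q(1)] tmod_smult[OF tf[OF q(1)]] tensor_cmp_sc(2)[OF p(1) q(1)] ..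
next
  fix A B X Q assume ob: "A \<in> ob TC" "B \<in> ob TC" and X: "X \<in> ob TC" and Q: "Q \<in> carrier (hom_mod TC A B)"
  then obtain q where q: "q \<in> fr A B" "Q = tcl A B q" by (auto simp: tc_simps(2) tmod_carrier)
  note tc = tc_cmp[OF ob X _ q(1), folded q(2)] and tf = tk_free[OF ob X _ q(1)]
  fix P assume P: "P \<in> carrier (hom_mod TC B X)"
  then obtain p where p: "p \<in> fr B X" "P = tcl B X p" by (auto simp: tc_simps(2) tmod_carrier)
  show "cmp TC A B X P Q \<in> carrier (hom_mod TC A X)" unfolding p(2) tc[OF p(1)] tc_simps(2) tmod_carrier using tf[OF p(1)] by blast
  show "cmp TC A B X (P \<oplus>\<^bsub>hom_mod TC B X\<^esub> P') Q = cmp TC A B X P Q \<oplus>\<^bsub>hom_mod TC A X\<^esub> cmp TC A B X P' Q" if P': "P' \<in> carrier (hom_mod TC B X)" for P'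
  proof -
    obtain p' where p': "p' \<in> fr B X" "P' = tcl B X p'" using P' by (auto simp: tc_simps(2) tmod_carrier)
    show ?thesis unfolding p(2) p'(2) tc_simps(2) tmod_ops(1)[OF p(1) p'(1)] tc[OF tfree_closed(2)[OF p(1) p'(1)]] tc[OF p(1)] tc[OF p'(1)] tmod_ops(1)[OF tf[OF p(1)] tf[OF p'(1)]] tensor_cmp_add ..
  qed
  show "cmp TC A B X (c \<odot>\<^bsub>hom_mod TC B X\<^esub> P) Q = c \<odot>\<^bsub>hom_mod TC A X\<^esub> cmp TC A B X P Q" for c
    unfolding p(2) tc_simps(2) tmod_smult[OF p(1)] tc[OF tfree_closed(4)[OF p(1)]] tc[OF p(1)] tmod_smult[OF tf[OF p(1)]] tensor_cmp_sc(1)[OF p(1) q(1)] ..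
next
  fix A assume A: "A \<in> ob TC"
  show "idt TC A \<in> carrier (hom_mod TC A A)" unfolding tc_simps(2,3) tmod_carrier using id_free[OF A] by blast
next
  fix A B Q assume ob: "A \<in> ob TC" "B \<in> ob TC" and Q: "Q \<in> carrier (hom_mod TC A B)"
  then obtain q where q: "q \<in> fr A B" "Q = tcl A B q" by (auto simp: tc_simps(2) tmod_carrier)
  show "cmp TC A B B (idt TC B) Q = Q" unfolding q(2) tc_simps(3) tc_cmp[OF ob(1,2,2) id_free[OF ob(2)] q(1)] tk_id(1)[OF ob q(1)] ..
  show "cmp TC A A B Q (idt TC A) = Q" unfolding q(2) tc_simps(3) tc_cmp[OF ob(1,1,2) q(1) id_free[OF ob(1)]] tk_id(2)[OF ob q(1)] ..
next
  fix A B X Y P Q S assume ob: "A \<in> ob TC" "B \<in> ob TC" "X \<in> ob TC" "Y \<in> ob TC"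
    and "P \<in> carrier (hom_mod TC A B)" "Q \<in> carrier (hom_mod TC B X)" "S \<in> carrier (hom_mod TC X Y)"
  then obtain p q r where p: "p \<in> fr A B" "P = tcl A B p" and q: "q \<in> fr B X" "Q = tcl B X q" and r: "r \<in> fr X Y" "S = tcl X Y r"
    by (auto simp: tc_simps(2) tmod_carrier)
  note t = tc_cmp[OF ob(1-3) q(1) p(1)] tc_cmp[OF ob(2-4) r(1) q(1)]
    tc_cmp[OF ob(1,3,4) r(1) tk_free[OF ob(1-3) q(1) p(1)]] tc_cmp[OF ob(1,2,4) tk_free[OF ob(2-4) r(1) q(1)] p(1)]
  show "cmp TC A X Y S (cmp TC A B X Q P) = cmp TC A B Y (cmp TC B X Y S Q) P"
    unfolding p(2) q(2) r(2) t tk_assoc[OF ob p(1) q(1) r(1)] ..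
qed

end

text \<open>What a functor on the tensor category amounts to: bilinear maps on morphisms that
  respect identities and composites of pure tensors. It separates the quotient construction of the
  tensor product from the cut.\<close>

locale bilinear_functor =
  fixes C :: "('o, 'm, 'k::comm_ring_1) lincat" and D :: "('p, 'n, 'k) lincat" and S :: "('s, 'q, 'k) lincat"
    and Fo :: "'o \<times> 'p => 's" and B :: "'o \<times> 'p => 'o \<times> 'p => 'm => 'n => 'q"
  assumes cats: "linear_category C" "linear_category D" "linear_category S"
    and Fo: "U \<in> ob C \<times> ob D ==> Fo U \<in> ob S"
    and B: "[|U \<in> ob C \<times> ob D; Z \<in> ob C \<times> ob D; x \<in> carrier (hom_mod C (fst U) (fst Z)); y \<in> carrier (hom_mod D (snd U) (snd Z))|]
        ==> B U Z x y \<in> carrier (hom_mod S (Fo U) (Fo Z))"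
      "[|U \<in> ob C \<times> ob D; Z \<in> ob C \<times> ob D; x \<in> carrier (hom_mod C (fst U) (fst Z)); x' \<in> carrier (hom_mod C (fst U) (fst Z)); y \<in> carrier (hom_mod D (snd U) (snd Z))|]
        ==> B U Z (x \<oplus>\<^bsub>hom_mod C (fst U) (fst Z)\<^esub> x') y = B U Z x y \<oplus>\<^bsub>hom_mod S (Fo U) (Fo Z)\<^esub> B U Z x' y"
      "[|U \<in> ob C \<times> ob D; Z \<in> ob C \<times> ob D; x \<in> carrier (hom_mod C (fst U) (fst Z)); y \<in> carrier (hom_mod D (snd U) (snd Z)); y' \<in> carrier (hom_mod D (snd U) (snd Z))|]
        ==> B U Z x (y \<oplus>\<^bsub>hom_mod D (snd U) (snd Z)\<^esub> y') = B U Z x y \<oplus>\<^bsub>hom_mod S (Fo U) (Fo Z)\<^esub> B U Z x y'"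
      "[|U \<in> ob C \<times> ob D; Z \<in> ob C \<times> ob D; x \<in> carrier (hom_mod C (fst U) (fst Z)); y \<in> carrier (hom_mod D (snd U) (snd Z))|]
        ==> B U Z (c \<odot>\<^bsub>hom_mod C (fst U) (fst Z)\<^esub> x) y = c \<odot>\<^bsub>hom_mod S (Fo U) (Fo Z)\<^esub> B U Z x y"
      "[|U \<in> ob C \<times> ob D; Z \<in> ob C \<times> ob D; x \<in> carrier (hom_mod C (fst U) (fst Z)); y \<in> carrier (hom_mod D (snd U) (snd Z))|]
        ==> B U Z x (c \<odot>\<^bsub>hom_mod D (snd U) (snd Z)\<^esub> y) = c \<odot>\<^bsub>hom_mod S (Fo U) (Fo Z)\<^esub> B U Z x y"
    and B_id: "U \<in> ob C \<times> ob D ==> B U U (idt C (fst U)) (idt D (snd U)) = idt S (Fo U)"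
    and B_cmp: "[|U \<in> ob C \<times> ob D; Z \<in> ob C \<times> ob D; Y \<in> ob C \<times> ob D; x \<in> carrier (hom_mod C (fst U) (fst Z)); x' \<in> carrier (hom_mod C (fst Z) (fst Y));
        y \<in> carrier (hom_mod D (snd U) (snd Z)); y' \<in> carrier (hom_mod D (snd Z) (snd Y))|]
        ==> B U Y (cmp C (fst U) (fst Z) (fst Y) x' x) (cmp D (snd U) (snd Z) (snd Y) y' y) = cmp S (Fo U) (Fo Z) (Fo Y) (B Z Y x' y') (B U Z x y)"
begin

abbreviation "T \<equiv> tensor_category C D"
abbreviation "hC U Z \<equiv> hom_mod C (fst U) (fst Z)"
abbreviation "hD U Z \<equiv> hom_mod D (snd U) (snd Z)"
abbreviation "hS U Z \<equiv> hom_mod S (Fo U) (Fo Z)"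
abbreviation "e U Z \<equiv> ext (hS U Z) (B U Z)"
abbreviation "F U Z \<equiv> lift (hS U Z) (B U Z)"

lemmas T = tc_simps[OF cats(1,2)]

lemma obT: "U \<in> ob T \<longleftrightarrow> U \<in> ob C \<times> ob D" by (simp only: T(1))

context
  fixes U Z
  assumes U: "U \<in> ob T" and Z: "Z \<in> ob T"
begin

lemma mods: "module tyring (hC U Z)" "module tyring (hD U Z)" "module tyring (hS U Z)"
  using linear_categoryD(1)[OF cats(1)] linear_categoryD(1)[OF cats(2)] linear_categoryD(1)[OF cats(3)] Fo U Z by (auto simp: obT mem_Times_iff)

lemmas BUZ = B[OF U[unfolded obT] Z[unfolded obT]]

lemma F_linear: "linear_map (hom_mod T U Z) (hS U Z) (F U Z)"
  unfolding T(2) by (rule lift_linear) (fact mods | (rule BUZ; assumption))+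

lemma F_pure: assumes "x \<in> carrier (hC U Z)" "y \<in> carrier (hD U Z)"
  shows "F U Z (pure_tensor (hC U Z) (hD U Z) x y) = B U Z x y"
  by (rule lift_pure[OF _ _ _ _ _ _ _ _ assms]) (fact mods | (rule BUZ; assumption))+

lemma F_cl: assumes "p \<in> tensor_free (hC U Z) (hD U Z)"
  shows "F U Z (tensor_cl (hC U Z) (hD U Z) p) = e U Z p"
  by (rule lift_cl[OF _ _ _ _ _ _ _ _ assms]) (fact mods | (rule BUZ; assumption))+

lemma e_add: assumes "p \<in> tensor_free (hC U Z) (hD U Z)" "q \<in> tensor_free (hC U Z) (hD U Z)"
  shows "e U Z (p + q) = e U Z p \<oplus>\<^bsub>hS U Z\<^esub> e U Z q"
  by (rule ext_add[OF _ _ _ _ _ _ _ _ assms]) (fact mods | (rule BUZ; assumption))+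

lemma e_single: assumes "x \<in> carrier (hC U Z)" "y \<in> carrier (hD U Z)"
  shows "e U Z (single (x, y) c) = c \<odot>\<^bsub>hS U Z\<^esub> B U Z x y"
  by (rule ext_single[OF _ _ _ _ _ _ _ _ assms]) (fact mods | (rule BUZ; assumption))+

lemma e_0: "e U Z 0 = \<zero>\<^bsub>hS U Z\<^esub>"
  by (rule ext_0[where M = "hC U Z" and N = "hD U Z"]) (fact mods | (rule BUZ; assumption))+

lemma e_closed: assumes "p \<in> tensor_free (hC U Z) (hD U Z)" shows "e U Z p \<in> carrier (hS U Z)"
  by (rule ext_closed[OF _ _ _ _ _ _ _ _ assms]) (fact mods | (rule BUZ; assumption))+

end

lemma linear_map_0:
  assumes "module tyring M" "module tyring N" "linear_map M N f" shows "f \<zero>\<^bsub>M\<^esub> = \<zero>\<^bsub>N\<^esub>"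
proof -
  interpret M: module tyring M by (rule assms(1))
  interpret N: module tyring N by (rule assms(2))
  have "f \<zero>\<^bsub>M\<^esub> \<in> carrier N" "f (\<zero>\<^bsub>M\<^esub> \<oplus>\<^bsub>M\<^esub> \<zero>\<^bsub>M\<^esub>) = f \<zero>\<^bsub>M\<^esub> \<oplus>\<^bsub>N\<^esub> f \<zero>\<^bsub>M\<^esub>"
    using assms(3) M.M.zero_closed unfolding linear_map_def by blast+
  then show ?thesis using N.M.add.l_cancel_one by simp
qed

text \<open>Compatibility with composition is known on generators only; it spreads to the free
  modules by induction in each of the two arguments, using that composition in the target is
  bilinear.\<close>

lemma e_cmp:
  assumes ob: "U \<in> ob T" "Z \<in> ob T" "Y \<in> ob T" and p: "p \<in> tensor_free (hC Z Y) (hD Z Y)" and q: "q \<in> tensor_free (hC U Z) (hD U Z)"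
  shows "e U Y (tensor_cmp C D U Z Y p q) = cmp S (Fo U) (Fo Z) (Fo Y) (e Z Y p) (e U Z q)"
proof -
  note o = obs[OF cats(1,2) ob] and os = Fo[OF ob(1)[unfolded obT]] Fo[OF ob(2)[unfolded obT]] Fo[OF ob(3)[unfolded obT]]
  interpret UZ: module tyring "hS U Z" by (rule mods(3)[OF ob(1,2)])
  interpret ZY: module tyring "hS Z Y" by (rule mods(3)[OF ob(2,3)])
  interpret UY: module tyring "hS U Y" by (rule mods(3)[OF ob(1,3)])
  note cS = cmp_props[OF cats(3) os] and tf = tk_free[OF cats(1,2) ob]
  note z = linear_map_0[OF ZY.module_axioms UY.module_axioms linear_categoryD(6)[OF cats(3) os]]
  note z' = linear_map_0[OF UZ.module_axioms UY.module_axioms linear_categoryD(5)[OF cats(3) os]]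
  note eu = e_closed[OF ob(1,2)] and ez = e_closed[OF ob(2,3)]
  show ?thesis using p
  proof (induction rule: tfree_induct)
    case zero
    show ?case unfolding tensor_cmp_0 e_0[OF ob(1,3)] e_0[OF ob(2,3)] using z[OF eu[OF q]] by simp
  next
    case (add p g g' r)
    note g = add.hyps(2,3)
    let ?s = "single (g, g') r"
    have sf: "?s \<in> tensor_free (hC Z Y) (hD Z Y)" by (rule tfree_closed(5)[OF g])
    have "e U Y (tensor_cmp C D U Z Y ?s q) = cmp S (Fo U) (Fo Z) (Fo Y) (e Z Y ?s) (e U Z q)"
      using q
    proof (induction rule: tfree_induct)
      case zero
      show ?case unfolding tensor_cmp_0 e_0[OF ob(1,3)] e_0[OF ob(1,2)] using z'[OF ez[OF sf]] by simp
    next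
      case (add q f f' t)
      note f = add.hyps(2,3)
      let ?q = "single (f, f') t"
      have qf: "?q \<in> tensor_free (hC U Z) (hD U Z)" by (rule tfree_closed(5)[OF f])
      note fg = BUZ(1)[OF ob(1,2) f] BUZ(1)[OF ob(2,3) g]
      note cc = cmp_props(1)[OF cats(1) o(1-3) f(1,1) g(1,1)] cmp_props(1)[OF cats(2) o(4-6) f(2,2) g(2,2)]
      let ?b = "cmp S (Fo U) (Fo Z) (Fo Y) (B Z Y g g') (B U Z f f')"
      have bc: "?b \<in> carrier (hS U Y)" by (rule cS(1)[OF fg(1,1) fg(2,2)])
      have sm: "r \<odot>\<^bsub>hS Z Y\<^esub> B Z Y g g' \<in> carrier (hS Z Y)" "t \<odot>\<^bsub>hS U Z\<^esub> B U Z f f' \<in> carrier (hS U Z)"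
        using ZY.smult_closed[OF _ fg(2), of r] UZ.smult_closed[OF _ fg(1), of t] by (simp_all add: tyring_simps)
      have "e U Y (tensor_cmp C D U Z Y ?s ?q) = (r * t) \<odot>\<^bsub>hS U Y\<^esub> ?b"
        unfolding tk_single[OF cats(1,2) ob] e_single[OF ob(1,3) cc] B_cmp[OF ob[unfolded obT] f(1) g(1) f(2) g(2)] ..
      also have "\<dots> = r \<odot>\<^bsub>hS U Y\<^esub> (t \<odot>\<^bsub>hS U Y\<^esub> ?b)"
        using UY.smult_assoc1[OF _ _ bc, of r t] by (simp add: tyring_simps)
      also have "\<dots> = cmp S (Fo U) (Fo Z) (Fo Y) (e Z Y ?s) (e U Z ?q)"
        unfolding e_single[OF ob(2,3) g] e_single[OF ob(1,2) f] cS(5)[OF sm(2,2) fg(2,2)] cS(4)[OF fg(1,1) fg(2,2)] ..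
      finally have 1: "e U Y (tensor_cmp C D U Z Y ?s ?q) = cmp S (Fo U) (Fo Z) (Fo Y) (e Z Y ?s) (e U Z ?q)" .
      show ?case
        unfolding tensor_cmp_add e_add[OF ob(1,3) tf[OF sf add.hyps(1)] tf[OF sf qf]] add.IH 1 e_add[OF ob(1,2) add.hyps(1) qf]
        by (rule cS(2)[OF eu[OF add.hyps(1)] eu[OF qf] ez[OF sf] ez[OF sf], symmetric])
    qed
    then show ?case
      unfolding tensor_cmp_add e_add[OF ob(1,3) tf[OF add.hyps(1) q] tf[OF sf q]] add.IH e_add[OF ob(2,3) add.hyps(1) sf]
      using cS(3)[OF eu[OF q] eu[OF q] ez[OF add.hyps(1)] ez[OF sf]] by simp
  qed
qed

lemma F_functor: "linear_functor T S Fo F"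
  unfolding linear_functor_def
proof (intro conjI ballI funcsetI)
  show "linear_category T" by (rule tensor_linear_category[OF cats(1,2)])
  show "Fo U \<in> ob S" if "U \<in> ob T" for U using that Fo by (simp only: obT)
  show "F U U (idt T U) = idt S (Fo U)" if U: "U \<in> ob T" for U
    using F_pure[OF U U linear_categoryD(2)[OF cats(1)] linear_categoryD(2)[OF cats(2)]] B_id[OF U[unfolded obT]] obs[OF cats(1,2) U U U]
    by (simp add: T(3) pure_tensor_def)
  show "F U Y (cmp T U Z Y Q P) = cmp S (Fo U) (Fo Z) (Fo Y) (F Z Y Q) (F U Z P)"
    if ob: "U \<in> ob T" "Z \<in> ob T" "Y \<in> ob T" and P: "P \<in> carrier (hom_mod T U Z)" and Q: "Q \<in> carrier (hom_mod T Z Y)" for U Z Y P Q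
  proof -
    obtain p q where p: "p \<in> fr C D U Z" "P = tcl C D U Z p" and q: "q \<in> fr C D Z Y" "Q = tcl C D Z Y q"
      using P Q by (auto simp: T(2) tmod_carrier)
    show ?thesis
      unfolding p(2) q(2) tc_cmp[OF cats(1,2) ob q(1) p(1)] F_cl[OF ob(1,2) p(1)] F_cl[OF ob(2,3) q(1)] F_cl[OF ob(1,3) tk_free[OF cats(1,2) ob q(1) p(1)]]
      by (rule e_cmp[OF ob q(1) p(1)])
  qed
qed (rule cats F_linear; assumption?)+

end

section \<open>The thickening as a linear category\<close>

text \<open>Division by 2 by means of the action of the constants; the ring of classes itself
  contains no element one half.\<close>

lemma hm_two:
  fixes x :: "('v, 'k::comm_ring_1) mpol hm"
  assumes "rat_algebra TYPE('k)" "x + x = 0" shows "x = 0"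
proof -
  have "x = scl (pconst (half + half)) x" unfolding half_half[OF assms(1)] pconst_1 scl_props(4) ..
  also have "\<dots> = scl (pconst half) (x + x)" by (simp only: pconst_add scl_props(1,2))
  also have "\<dots> = scl (pconst half) 0" unfolding assms(2) ..
  also have "\<dots> = 0" using scl_props(1)[of "pconst half" 0 0] by simp
  finally show ?thesis .
qed

context
  fixes S :: "'v set" and w :: "('v, 'k::comm_ring_1) mpol"
begin

abbreviation "P \<equiv> poly_in S :: ('v, 'k) mpol set"
abbreviation "Th \<equiv> thickening P w"
abbreviation "eI A \<equiv> eta (c_mf A) (c_mf A) (c_idem A)"
abbreviation "ga A \<equiv> map (eta (c_mf A) (c_mf A)) (c_gam A)"
abbreviation "gb A \<equiv> map (eta (c_mf A) (c_mf A)) (c_gamd A)"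

lemma idem_hom_iff:
  assumes X: "mfR P X" "mfR P Y" and e: "e \<in> Hm P False X X" "e' \<in> Hm P False Y Y"
  shows "F \<in> idem_hom P p X e Y e' \<longleftrightarrow> F \<in> Hm P p X Y \<and> eta X Y F * eta X X e = eta X Y F \<and> eta Y Y e' * eta X Y F = eta X Y F"
proof -
  have "hcomp P p X Y F e = F \<longleftrightarrow> eta X Y F * eta X X e = eta X Y F"
    "hcomp P p X Y e' F = F \<longleftrightarrow> eta Y Y e' * eta X Y F = eta X Y F" if "F \<in> Hm P p X Y"
    using pr.Hm_hcomp[OF X(1,1,2) e(1) that, of p] pr.Hm_hcomp[OF X(1,2,2) that e(2), of p]
      pr.eta_inj[OF X _ that] by auto
  then show ?thesis unfolding idem_hom_def Hm_def[symmetric] by auto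
qed

lemma hm_rel:
  assumes X: "mfR P X" and F: "F \<in> Hm P True X X" "G \<in> Hm P True X X" and z: "z \<in> Hm P False X X"
  shows "hadd P False X X (hcomp P False X X F G) (hcomp P False X X G F) = z \<longleftrightarrow>
    eta X X F * eta X X G + eta X X G * eta X X F = eta X X z"
proof -
  have c: "hcomp P False X X F G \<in> Hm P False X X" "eta X X (hcomp P False X X F G) = eta X X F * eta X X G"
    "hcomp P False X X G F \<in> Hm P False X X" "eta X X (hcomp P False X X G F) = eta X X G * eta X X F"
    using pr.Hm_hcomp[OF X X X F(1) F(2), of False] pr.Hm_hcomp[OF X X X F(2) F(1), of False] by simp_all
  show ?thesis using pr.eta_inj[OF X X pr.Hm_hadd(1)[OF X X c(1) c(3)] z] pr.Hm_hadd(2)[OF X X c(1) c(3)] c by simp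
qed

text \<open>Together with \<open>thick_hom_iff\<close> this is the dictionary between the thickening
  and the ring: afterwards objects and morphisms enter only through Clifford systems and
  annihilation conditions in \<open>hm\<close>.\<close>

lemma thick_ob:
  "A \<in> ob Th \<longleftrightarrow> matrix_factorisation P w (c_mf A) \<and> c_idem A \<in> Hm P False (c_mf A) (c_mf A) \<and>
     set (c_gam A) \<union> set (c_gamd A) \<subseteq> Hm P True (c_mf A) (c_mf A) \<and> cliff (eI A) (ga A) (gb A)"
proof (cases "matrix_factorisation P w (c_mf A) \<and> c_idem A \<in> Hm P False (c_mf A) (c_mf A)")
  case True
  let ?X = "c_mf A" and ?e = "c_idem A"
  have X: "mfR P ?X" using True by (simp add: mfR_def matrix_factorisation_def)
  have e: "?e \<in> Hm P False ?X ?X" using True by simp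
  note z = pr.Hm_hzero[OF X X, of False]
  have eI: "hcomp P False ?X ?X ?e ?e = ?e \<longleftrightarrow> eI A * eI A = eI A"
    using pr.Hm_hcomp[OF X X X e e, of False] pr.eta_inj[OF X X _ e] by simp
  have mem: "F \<in> idem_hom P True ?X ?e ?X ?e \<longleftrightarrow> F \<in> Hm P True ?X ?X \<and> eta ?X ?X F * eI A = eta ?X ?X F \<and> eI A * eta ?X ?X F = eta ?X ?X F" for F
    by (rule idem_hom_iff[OF X X e e])
  have zd: "(if i = j then ?e else hzero P False ?X ?X) \<in> Hm P False ?X ?X" for i j :: nat using e z by simp
  \<comment> \<open>The relations between classes and their images in the ring are named because
    they are equivalent only after the lengths and the membership in \<open>Hm\<close> are
    known.\<close>
  define REL1 where "REL1 \<longleftrightarrow> (\<forall>i<length (c_gam A). \<forall>j<length (c_gam A).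
        hadd P False ?X ?X (hcomp P False ?X ?X (c_gam A ! i) (c_gam A ! j)) (hcomp P False ?X ?X (c_gam A ! j) (c_gam A ! i)) = hzero P False ?X ?X \<and>
        hadd P False ?X ?X (hcomp P False ?X ?X (c_gamd A ! i) (c_gamd A ! j)) (hcomp P False ?X ?X (c_gamd A ! j) (c_gamd A ! i)) = hzero P False ?X ?X \<and>
        hadd P False ?X ?X (hcomp P False ?X ?X (c_gam A ! i) (c_gamd A ! j)) (hcomp P False ?X ?X (c_gamd A ! j) (c_gam A ! i))
          = (if i = j then ?e else hzero P False ?X ?X))"
  define REL2 where "REL2 \<longleftrightarrow> (\<forall>i<length (c_gam A). \<forall>j<length (c_gam A). ga A ! i * ga A ! j + ga A ! j * ga A ! i = 0 \<and>
        gb A ! i * gb A ! j + gb A ! j * gb A ! i = 0 \<and> ga A ! i * gb A ! j + gb A ! j * ga A ! i = (if i = j then eI A else 0))"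
  have rel: "REL1 \<longleftrightarrow> REL2"
    if len: "length (c_gam A) = length (c_gamd A)" and sub: "set (c_gam A) \<union> set (c_gamd A) \<subseteq> Hm P True ?X ?X"
    unfolding REL1_def REL2_def
  proof (intro all_cong1 imp_cong refl conj_cong)
    fix i j assume ij: "i < length (c_gam A)" "j < length (c_gam A)"
    have m: "c_gam A ! i \<in> Hm P True ?X ?X" "c_gam A ! j \<in> Hm P True ?X ?X" "c_gamd A ! i \<in> Hm P True ?X ?X" "c_gamd A ! j \<in> Hm P True ?X ?X"
      using sub ij len by (auto simp: subset_iff)
    have n: "ga A ! i = eta ?X ?X (c_gam A ! i)" "ga A ! j = eta ?X ?X (c_gam A ! j)" "gb A ! i = eta ?X ?X (c_gamd A ! i)" "gb A ! j = eta ?X ?X (c_gamd A ! j)"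
      using ij len by simp_all
    show "hadd P False ?X ?X (hcomp P False ?X ?X (c_gam A ! i) (c_gam A ! j)) (hcomp P False ?X ?X (c_gam A ! j) (c_gam A ! i)) = hzero P False ?X ?X
      \<longleftrightarrow> ga A ! i * ga A ! j + ga A ! j * ga A ! i = 0"
      unfolding n by (rule hm_rel[OF X m(1,2) z(1), unfolded z(2)])
    show "hadd P False ?X ?X (hcomp P False ?X ?X (c_gamd A ! i) (c_gamd A ! j)) (hcomp P False ?X ?X (c_gamd A ! j) (c_gamd A ! i)) = hzero P False ?X ?X
      \<longleftrightarrow> gb A ! i * gb A ! j + gb A ! j * gb A ! i = 0"
      unfolding n by (rule hm_rel[OF X m(3,4) z(1), unfolded z(2)])
    show "hadd P False ?X ?X (hcomp P False ?X ?X (c_gam A ! i) (c_gamd A ! j)) (hcomp P False ?X ?X (c_gamd A ! j) (c_gam A ! i))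
          = (if i = j then ?e else hzero P False ?X ?X) \<longleftrightarrow> ga A ! i * gb A ! j + gb A ! j * ga A ! i = (if i = j then eI A else 0)"
      unfolding n using hm_rel[OF X m(1,4) zd[of i j]] z(2) by (simp only: if_distrib[of "eta ?X ?X"])
  qed
  let ?sub = "set (c_gam A) \<union> set (c_gamd A) \<subseteq> Hm P True ?X ?X"
  let ?len = "length (c_gam A) = length (c_gamd A)"
  let ?un = "\<forall>x\<in>set (ga A) \<union> set (gb A). eI A * x = x \<and> x * eI A = x"
  have ih: "idem_hom P True ?X ?e ?X ?e = {F \<in> Hm P True ?X ?X. eta ?X ?X F * eI A = eta ?X ?X F \<and> eI A * eta ?X ?X F = eta ?X ?X F}"
    using mem by blast
  have "A \<in> ob Th \<longleftrightarrow> idem_obj P w ?X ?e \<and> clifford_action P ?X ?e (c_gam A) (c_gamd A)" by (simp add: thickening_def)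
  also have "idem_obj P w ?X ?e \<longleftrightarrow> eI A * eI A = eI A"
    unfolding idem_obj_def Hm_def[symmetric] eI using True by blast
  also have "clifford_action P ?X ?e (c_gam A) (c_gamd A) \<longleftrightarrow>
      ?len \<and> set (c_gam A) \<subseteq> idem_hom P True ?X ?e ?X ?e \<and> set (c_gamd A) \<subseteq> idem_hom P True ?X ?e ?X ?e \<and> REL1"
    unfolding clifford_action_def REL1_def by (rule refl)
  also have "\<dots> \<longleftrightarrow> ?len \<and> ?sub \<and> ?un \<and> REL1" unfolding ih set_map by blast
  also have "eI A * eI A = eI A \<and> ?len \<and> ?sub \<and> ?un \<and> REL1 \<longleftrightarrow> ?sub \<and> ?len \<and> eI A * eI A = eI A \<and> ?un \<and> REL2"
    using rel by blast
  also have "\<dots> \<longleftrightarrow> ?sub \<and> cliff (eI A) (ga A) (gb A)"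
    unfolding cliff_def REL2_def length_map by (rule refl)
  finally show ?thesis using True by simp
next
  case False
  then show ?thesis unfolding thickening_def idem_obj_def Hm_def[symmetric] by auto
qed

lemma thick_obD:
  assumes "A \<in> ob Th"
  shows "matrix_factorisation P w (c_mf A)" "mfR P (c_mf A)" "c_idem A \<in> Hm P False (c_mf A) (c_mf A)"
    "F \<in> set (c_gam A) ==> F \<in> Hm P True (c_mf A) (c_mf A)" "F \<in> set (c_gamd A) ==> F \<in> Hm P True (c_mf A) (c_mf A)"
    "cliff (eI A) (ga A) (gb A)" "eI A * eI A = eI A"
  using assms unfolding thick_ob by (auto simp: mfR_def matrix_factorisation_def cliff_def)

lemma thick_hom_iff:
  assumes A: "A \<in> ob Th" and B: "B \<in> ob Th"
  shows "F \<in> carrier (hom_mod Th A B) \<longleftrightarrow> F \<in> Hm P False (c_mf A) (c_mf B) \<and>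
    eta (c_mf A) (c_mf B) F * eI A = eta (c_mf A) (c_mf B) F \<and> eI B * eta (c_mf A) (c_mf B) F = eta (c_mf A) (c_mf B) F \<and>
    (\<forall>b\<in>set (gb A). eta (c_mf A) (c_mf B) F * b = 0) \<and> (\<forall>a\<in>set (ga B). a * eta (c_mf A) (c_mf B) F = 0)"
proof -
  let ?X = "c_mf A" and ?Y = "c_mf B"
  note a = thick_obD[OF A] and b = thick_obD[OF B]
  note z = pr.Hm_hzero[OF a(2) b(2), of True]
  have 1: "hcomp P True ?X ?Y F h = hzero P True ?X ?Y \<longleftrightarrow> eta ?X ?Y F * eta ?X ?X h = 0"
    if "F \<in> Hm P False ?X ?Y" "h \<in> set (c_gamd A)" for h
    using pr.Hm_hcomp[OF a(2,2) b(2) a(5)[OF that(2)] that(1), of True] pr.eta_inj[OF a(2) b(2) _ z(1)] z(2) by simp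
  have 2: "hcomp P True ?X ?Y h F = hzero P True ?X ?Y \<longleftrightarrow> eta ?Y ?Y h * eta ?X ?Y F = 0"
    if "F \<in> Hm P False ?X ?Y" "h \<in> set (c_gam B)" for h
    using pr.Hm_hcomp[OF a(2) b(2,2) that(1) b(4)[OF that(2)], of True] pr.eta_inj[OF a(2) b(2) _ z(1)] z(2) by simp
  show ?thesis unfolding thickening_def thick_hom_def
    using 1 2 idem_hom_iff[OF a(2) b(2) a(3) b(3)] by (auto simp: Let_def)
qed

lemma thick_hom_simps:
  "\<zero>\<^bsub>hom_mod Th A B\<^esub> = hzero P False (c_mf A) (c_mf B)"
  "F \<oplus>\<^bsub>hom_mod Th A B\<^esub> G = hadd P False (c_mf A) (c_mf B) F G"
  "c \<odot>\<^bsub>hom_mod Th A B\<^esub> F = hscale P False (c_mf A) (c_mf B) (pconst c) F"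
  "cmp Th A B C G F = hcomp P False (c_mf A) (c_mf C) G F"
  by (simp_all add: thickening_def thick_hom_def Let_def)

lemma odd_prod_eta:
  assumes X: "mfR P X" and e: "e \<in> Hm P False X X" and gs: "set gs \<subseteq> Hm P True X X"
  shows "odd_prod P X e gs \<in> Hm P (odd (length gs)) X X \<and> eta X X (odd_prod P X e gs) = rprod (eta X X e) (map (eta X X) gs)"
  using gs
proof (induction gs)
  case (Cons g gs)
  then have IH: "odd_prod P X e gs \<in> Hm P (odd (length gs)) X X" "eta X X (odd_prod P X e gs) = rprod (eta X X e) (map (eta X X) gs)"
    and g: "g \<in> Hm P True X X" by auto
  have r: "odd (length (g # gs)) = (True \<noteq> odd (length gs))" by simp
  show ?case using pr.Hm_hcomp[OF X X X IH(1) g r] IH(2) unfolding odd_prod.simps by simp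
qed (use e in simp)

lemma clifford_idem_eta:
  assumes X: "mfR P X" and e: "e \<in> Hm P False X X" and gs: "set gs \<subseteq> Hm P True X X" "set hs \<subseteq> Hm P True X X" "length gs = length hs"
  shows "clifford_idem P X e gs hs \<in> Hm P False X X"
    "eta X X (clifford_idem P X e gs hs) = cliff_idem (eta X X e) (map (eta X X) gs) (map (eta X X) hs)"
  using odd_prod_eta[OF X e, of "gs @ rev hs"] gs by (auto simp: clifford_idem_def cliff_idem_def rev_map)

lemma thick_id:
  assumes A: "A \<in> ob Th"
  shows "idt Th A \<in> Hm P False (c_mf A) (c_mf A)" "eta (c_mf A) (c_mf A) (idt Th A) = cliff_idem (eI A) (ga A) (gb A)"
  using clifford_idem_eta[OF thick_obD(2,3)[OF A], of "c_gam A" "c_gamd A"] thick_obD(4,5)[OF A] thick_obD(6)[OF A]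
  by (auto simp: thickening_def cliff_def)

lemma thick_eqI:
  assumes A: "A \<in> ob Th" and B: "B \<in> ob Th" and F: "F \<in> Hm P False (c_mf A) (c_mf B)" "G \<in> Hm P False (c_mf A) (c_mf B)"
    and "eta (c_mf A) (c_mf B) F = eta (c_mf A) (c_mf B) G"
  shows "F = G"
  using pr.eta_inj[OF thick_obD(2)[OF A] thick_obD(2)[OF B] F] assms(5) by simp

lemma thick_ops:
  assumes A: "A \<in> ob Th" and B: "B \<in> ob Th" and F: "F \<in> carrier (hom_mod Th A B)" and G: "G \<in> carrier (hom_mod Th A B)"
  shows "F \<oplus>\<^bsub>hom_mod Th A B\<^esub> G \<in> carrier (hom_mod Th A B)"
    "eta (c_mf A) (c_mf B) (F \<oplus>\<^bsub>hom_mod Th A B\<^esub> G) = eta (c_mf A) (c_mf B) F + eta (c_mf A) (c_mf B) G"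
    "c \<odot>\<^bsub>hom_mod Th A B\<^esub> F \<in> carrier (hom_mod Th A B)"
    "eta (c_mf A) (c_mf B) (c \<odot>\<^bsub>hom_mod Th A B\<^esub> F) = scl (pconst c) (eta (c_mf A) (c_mf B) F)"
    "\<zero>\<^bsub>hom_mod Th A B\<^esub> \<in> carrier (hom_mod Th A B)"
    "eta (c_mf A) (c_mf B) \<zero>\<^bsub>hom_mod Th A B\<^esub> = 0"
proof -
  note m = thick_obD(2)[OF A] thick_obD(2)[OF B]
  note f = F[unfolded thick_hom_iff[OF A B]] and g = G[unfolded thick_hom_iff[OF A B]]
  note a = pr.Hm_hadd[OF m conjunct1[OF f] conjunct1[OF g]] and s = pr.Hm_hscale[OF m conjunct1[OF f] poly_in_pconst, of c] and z = pr.Hm_hzero[OF m, of False]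
  have s0: "scl (pconst c) 0 = (0 :: ('v, 'k) mpol hm)" using scl_props(1)[of "pconst c" 0 0] by simp
  show "eta (c_mf A) (c_mf B) (F \<oplus>\<^bsub>hom_mod Th A B\<^esub> G) = eta (c_mf A) (c_mf B) F + eta (c_mf A) (c_mf B) G"
    "eta (c_mf A) (c_mf B) (c \<odot>\<^bsub>hom_mod Th A B\<^esub> F) = scl (pconst c) (eta (c_mf A) (c_mf B) F)"
    "eta (c_mf A) (c_mf B) \<zero>\<^bsub>hom_mod Th A B\<^esub> = 0"
    unfolding thick_hom_simps by (rule a(2), rule s(2), rule z(2))
  show "F \<oplus>\<^bsub>hom_mod Th A B\<^esub> G \<in> carrier (hom_mod Th A B)"
    unfolding thick_hom_simps thick_hom_iff[OF A B] a(2) using a(1) f g by (simp add: distrib_left distrib_right)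
  show "c \<odot>\<^bsub>hom_mod Th A B\<^esub> F \<in> carrier (hom_mod Th A B)"
    unfolding thick_hom_simps thick_hom_iff[OF A B] s(2) using s(1) f s0
    by (simp flip: scl_props(5,6))
  show "\<zero>\<^bsub>hom_mod Th A B\<^esub> \<in> carrier (hom_mod Th A B)"
    unfolding thick_hom_simps thick_hom_iff[OF A B] z(2) using z(1) by simp
qed

lemma thick_cmp:
  assumes A: "A \<in> ob Th" and B: "B \<in> ob Th" and C: "C \<in> ob Th" and F: "F \<in> carrier (hom_mod Th A B)" and G: "G \<in> carrier (hom_mod Th B C)"
  shows "cmp Th A B C G F \<in> carrier (hom_mod Th A C)"
    "eta (c_mf A) (c_mf C) (cmp Th A B C G F) = eta (c_mf B) (c_mf C) G * eta (c_mf A) (c_mf B) F"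
proof -
  note m = thick_obD(2)[OF A] thick_obD(2)[OF B] thick_obD(2)[OF C]
  note f = F[unfolded thick_hom_iff[OF A B]] and g = G[unfolded thick_hom_iff[OF B C]]
  note a = pr.Hm_hcomp[OF m conjunct1[OF f] conjunct1[OF g], of False, simplified]
  show e: "eta (c_mf A) (c_mf C) (cmp Th A B C G F) = eta (c_mf B) (c_mf C) G * eta (c_mf A) (c_mf B) F"
    unfolding thick_hom_simps by (rule a(2))
  let ?f = "eta (c_mf A) (c_mf B) F" and ?g = "eta (c_mf B) (c_mf C) G"
  have r: "?g * ?f * x = ?g * (?f * x)" "x * (?g * ?f) = (x * ?g) * ?f" for x by (simp_all only: mult.assoc)
  show "cmp Th A B C G F \<in> carrier (hom_mod Th A C)"
    unfolding thick_hom_iff[OF A C] e r using a(1) f g by (simp add: thick_hom_simps)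
qed

lemma thick_hom_eqI:
  assumes A: "A \<in> ob Th" and B: "B \<in> ob Th" and F: "F \<in> carrier (hom_mod Th A B)" "G \<in> carrier (hom_mod Th A B)"
    and "eta (c_mf A) (c_mf B) F = eta (c_mf A) (c_mf B) G"
  shows "F = G"
  using thick_eqI[OF A B] F assms(5) unfolding thick_hom_iff[OF A B] by blast

text \<open>The Clifford idempotent is killed by the \<open>\<gamma>_i\<close> on its left and by
  their partners on its right, so it satisfies the conditions on morphisms; absorption is what makes
  it neutral.\<close>

lemma thick_id_hom:
  assumes rat: "rat_algebra TYPE('k)" and A: "A \<in> ob Th"
  shows "idt Th A \<in> carrier (hom_mod Th A A)"
  unfolding thick_hom_iff[OF A A] thick_id(2)[OF A]
  using thick_id(1)[OF A] cliff_idem_unit[OF thick_obD(6)[OF A]] cliff_idem_props[OF hm_two[OF rat] thick_obD(6)[OF A]] by blast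

lemma thick_module:
  assumes A: "A \<in> ob Th" and B: "B \<in> ob Th"
  shows "module (ring_of_type_algebra :: 'k ring) (hom_mod Th A B)"
proof -
  let ?M = "hom_mod Th A B" and ?h = "eta (c_mf A) (c_mf B)"
  note ops = thick_ops[OF A B]
  note eq = thick_hom_eqI[OF A B]
  have ex: "\<exists>y\<in>carrier ?M. y \<oplus>\<^bsub>?M\<^esub> x = \<zero>\<^bsub>?M\<^esub>" if x: "x \<in> carrier ?M" for x
  proof (intro bexI[of _ "(- 1) \<odot>\<^bsub>?M\<^esub> x"] eq)
    have "scl (pconst (- 1)) (?h x) + ?h x = scl (pconst (- 1) + pconst 1) (?h x)" by (simp only: scl_props(2,4) pconst_1)
    also have "pconst (- 1) + pconst 1 = (0 :: ('v, 'k) mpol)" unfolding pconst_add[symmetric] by simp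
    also have "scl 0 (?h x) = 0" using scl_props(2)[of 0 0 "?h x"] by simp
    finally show "?h (((- 1) \<odot>\<^bsub>?M\<^esub> x) \<oplus>\<^bsub>?M\<^esub> x) = ?h \<zero>\<^bsub>?M\<^esub>" using ops x by simp
  qed (use ops x in auto)
  have cl: "x \<oplus>\<^bsub>?M\<^esub> y \<in> carrier ?M" "c \<odot>\<^bsub>?M\<^esub> x \<in> carrier ?M" "\<zero>\<^bsub>?M\<^esub> \<in> carrier ?M"
    if "x \<in> carrier ?M" "y \<in> carrier ?M" for x y c using ops that by auto
  have h: "?h (x \<oplus>\<^bsub>?M\<^esub> y) = ?h x + ?h y" "?h (c \<odot>\<^bsub>?M\<^esub> x) = scl (pconst c) (?h x)" "?h \<zero>\<^bsub>?M\<^esub> = 0"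
    if "x \<in> carrier ?M" "y \<in> carrier ?M" for x y c using ops that by auto
  have z: "\<zero>\<^bsub>?M\<^esub> \<in> carrier ?M" "?h \<zero>\<^bsub>?M\<^esub> = 0"
    using pr.Hm_hzero[OF thick_obD(2)[OF A] thick_obD(2)[OF B], of False] by (simp_all add: thick_hom_simps thick_hom_iff[OF A B])
  show ?thesis
  proof (rule moduleI)
    show "cring (ring_of_type_algebra :: 'k ring)" by (rule cring_from_type_algebra)
    show "abelian_group ?M"
    proof (rule abelian_groupI)
      fix x y z assume xyz: "x \<in> carrier ?M" "y \<in> carrier ?M" "z \<in> carrier ?M"
      show "x \<oplus>\<^bsub>?M\<^esub> y \<oplus>\<^bsub>?M\<^esub> z = x \<oplus>\<^bsub>?M\<^esub> (y \<oplus>\<^bsub>?M\<^esub> z)"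
        by (rule eq) (use cl h xyz in \<open>simp_all add: add.assoc\<close>)
    next
      fix x y assume xy: "x \<in> carrier ?M" "y \<in> carrier ?M"
      show "x \<oplus>\<^bsub>?M\<^esub> y \<in> carrier ?M" by (rule cl(1)[OF xy])
      show "x \<oplus>\<^bsub>?M\<^esub> y = y \<oplus>\<^bsub>?M\<^esub> x" by (rule eq) (use cl h xy in \<open>simp_all add: add.commute\<close>)
    next
      fix x assume x: "x \<in> carrier ?M"
      show "\<zero>\<^bsub>?M\<^esub> \<oplus>\<^bsub>?M\<^esub> x = x" by (rule eq) (use cl h z x in simp_all)
      show "\<exists>y\<in>carrier ?M. y \<oplus>\<^bsub>?M\<^esub> x = \<zero>\<^bsub>?M\<^esub>" by (rule ex[OF x])
    qed (rule z(1))
  next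
    fix a x assume x: "x \<in> carrier ?M"
    show "a \<odot>\<^bsub>?M\<^esub> x \<in> carrier ?M" by (rule cl(2)[OF x x])
  next
    fix a b x assume x: "x \<in> carrier ?M"
    show "(a \<oplus>\<^bsub>ring_of_type_algebra\<^esub> b) \<odot>\<^bsub>?M\<^esub> x = a \<odot>\<^bsub>?M\<^esub> x \<oplus>\<^bsub>?M\<^esub> b \<odot>\<^bsub>?M\<^esub> x"
      by (rule eq) (use cl h x in \<open>simp_all add: ring_of_type_algebra_def pconst_add scl_props(2)\<close>)
    show "a \<otimes>\<^bsub>ring_of_type_algebra\<^esub> b \<odot>\<^bsub>?M\<^esub> x = a \<odot>\<^bsub>?M\<^esub> (b \<odot>\<^bsub>?M\<^esub> x)"
      by (rule eq) (use cl h x in \<open>simp_all add: ring_of_type_algebra_def pconst_mult scl_props(3)\<close>)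
  next
    fix a x y assume xy: "x \<in> carrier ?M" "y \<in> carrier ?M"
    show "a \<odot>\<^bsub>?M\<^esub> (x \<oplus>\<^bsub>?M\<^esub> y) = a \<odot>\<^bsub>?M\<^esub> x \<oplus>\<^bsub>?M\<^esub> a \<odot>\<^bsub>?M\<^esub> y"
      by (rule eq) (use cl h xy in \<open>simp_all add: scl_props(1)\<close>)
  next
    fix x assume x: "x \<in> carrier ?M"
    show "\<one>\<^bsub>ring_of_type_algebra\<^esub> \<odot>\<^bsub>?M\<^esub> x = x"
      by (rule eq) (use cl h x in \<open>simp_all add: ring_of_type_algebra_def scl_props(4)\<close>)
  qed
qed

lemma thick_linear_category:
  assumes rat: "rat_algebra TYPE('k)"
  shows "linear_category Th"
  unfolding linear_category_def linear_map_def
proof (intro conjI ballI allI funcsetI)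
  fix A B assume A: "A \<in> ob Th" and B: "B \<in> ob Th"
  show "module (ring_of_type_algebra :: 'k ring) (hom_mod Th A B)" by (rule thick_module[OF A B])
  fix C G assume C: "C \<in> ob Th" and G: "G \<in> carrier (hom_mod Th B C)"
  note cm = thick_cmp[OF A B C _ G] and o1 = thick_ops[OF A B] and o2 = thick_ops[OF A C]
  fix F assume F: "F \<in> carrier (hom_mod Th A B)"
  show "cmp Th A B C G F \<in> carrier (hom_mod Th A C)" by (rule cm(1)[OF F])
  show "cmp Th A B C G (F \<oplus>\<^bsub>hom_mod Th A B\<^esub> F') = cmp Th A B C G F \<oplus>\<^bsub>hom_mod Th A C\<^esub> cmp Th A B C G F'" if F': "F' \<in> carrier (hom_mod Th A B)" for F'
    by (rule thick_hom_eqI[OF A C]) (use cm o1 o2 F F' in \<open>simp_all add: distrib_left\<close>)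
  show "cmp Th A B C G (c \<odot>\<^bsub>hom_mod Th A B\<^esub> F) = c \<odot>\<^bsub>hom_mod Th A C\<^esub> cmp Th A B C G F" for c
    by (rule thick_hom_eqI[OF A C]) (use cm o1[OF F F] o2[OF cm(1)[OF F] cm(1)[OF F]] F in \<open>simp_all add: scl_props(6)\<close>)
next
  fix A B C F assume A: "A \<in> ob Th" and B: "B \<in> ob Th" and C: "C \<in> ob Th" and F: "F \<in> carrier (hom_mod Th A B)"
  note cm = thick_cmp[OF A B C F] and o1 = thick_ops[OF B C] and o2 = thick_ops[OF A C]
  fix G assume G: "G \<in> carrier (hom_mod Th B C)"
  show "cmp Th A B C G F \<in> carrier (hom_mod Th A C)" by (rule cm(1)[OF G])
  show "cmp Th A B C (G \<oplus>\<^bsub>hom_mod Th B C\<^esub> G') F = cmp Th A B C G F \<oplus>\<^bsub>hom_mod Th A C\<^esub> cmp Th A B C G' F" if G': "G' \<in> carrier (hom_mod Th B C)" for G'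
    by (rule thick_hom_eqI[OF A C]) (use cm o1 o2 G G' in \<open>simp_all add: distrib_right\<close>)
  show "cmp Th A B C (c \<odot>\<^bsub>hom_mod Th B C\<^esub> G) F = c \<odot>\<^bsub>hom_mod Th A C\<^esub> cmp Th A B C G F" for c
    by (rule thick_hom_eqI[OF A C]) (use cm o1[OF G G] o2[OF cm(1)[OF G] cm(1)[OF G]] G in \<open>simp_all add: scl_props(5)\<close>)
next
  fix A assume A: "A \<in> ob Th"
  show id: "idt Th A \<in> carrier (hom_mod Th A A)" by (rule thick_id_hom[OF rat A])
next
  fix A B F assume A: "A \<in> ob Th" and B: "B \<in> ob Th" and F: "F \<in> carrier (hom_mod Th A B)"
  note f = F[unfolded thick_hom_iff[OF A B]]
  note iA = thick_id_hom[OF rat A] and iB = thick_id_hom[OF rat B]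
  show "cmp Th A B B (idt Th B) F = F"
    by (rule thick_hom_eqI[OF A B thick_cmp(1)[OF A B B F iB] F])
      (use thick_cmp(2)[OF A B B F iB] thick_id(2)[OF B] f cliff_idem_props[OF hm_two[OF rat] thick_obD(6)[OF B]] in simp)
  show "cmp Th A A B F (idt Th A) = F"
    by (rule thick_hom_eqI[OF A B thick_cmp(1)[OF A A B iA F] F])
      (use thick_cmp(2)[OF A A B iA F] thick_id(2)[OF A] f cliff_idem_props[OF hm_two[OF rat] thick_obD(6)[OF A]] in simp)
next
  fix A B C D F G H assume ob: "A \<in> ob Th" "B \<in> ob Th" "C \<in> ob Th" "D \<in> ob Th"
    and FGH: "F \<in> carrier (hom_mod Th A B)" "G \<in> carrier (hom_mod Th B C)" "H \<in> carrier (hom_mod Th C D)"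
  show "cmp Th A C D H (cmp Th A B C G F) = cmp Th A B D (cmp Th B C D H G) F"
    by (rule thick_hom_eqI[OF ob(1,4)])
      (use thick_cmp[OF ob(1,2,3) FGH(1,2)] thick_cmp[OF ob(2,3,4) FGH(2,3)] thick_cmp[OF ob(1,3,4)] thick_cmp[OF ob(1,2,4)] FGH in \<open>simp_all add: mult.assoc\<close>)
qed

end

section \<open>Combination and transport of Clifford systems\<close>

lemma cliff_append:
  assumes "cliff e as bs" "cliff e as' bs'" and x: "\<And>x y. x \<in> set as \<union> set bs ==> y \<in> set as' \<union> set bs' ==> x * y + y * x = 0"
  shows "cliff e (as @ as') (bs @ bs')"
proof -
  note c = assms(1,2)[unfolded cliff_def]
  have len: "length as = length bs" "length as' = length bs'" using c by blast+
  have rel: "(as @ as') ! i * (as @ as') ! j + (as @ as') ! j * (as @ as') ! i = 0 \<and>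
     (bs @ bs') ! i * (bs @ bs') ! j + (bs @ bs') ! j * (bs @ bs') ! i = 0 \<and>
     (as @ as') ! i * (bs @ bs') ! j + (bs @ bs') ! j * (as @ as') ! i = (if i = j then e else 0)"
    if ij: "i < length (as @ as')" "j < length (as @ as')" for i j
  proof -
    consider "i < length as" "j < length as" | "i < length as" "\<not> j < length as" | "\<not> i < length as" "j < length as" | "\<not> i < length as" "\<not> j < length as" by blast
    then show ?thesis
    proof cases
      case 1
      then show ?thesis using c(1) len by (simp add: nth_append)
    next
      case 2
      let ?j = "j - length as"
      have j: "?j < length as'" using 2 ij by simp
      have m: "as ! i \<in> set as" "bs ! i \<in> set bs" "as' ! ?j \<in> set as'" "bs' ! ?j \<in> set bs'" using 2 j len by simp_all
      have "as ! i * as' ! ?j + as' ! ?j * as ! i = 0" "bs ! i * bs' ! ?j + bs' ! ?j * bs ! i = 0" "as ! i * bs' ! ?j + bs' ! ?j * as ! i = 0"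
        by (rule x; use m in simp)+
      then show ?thesis using 2 len by (auto simp: nth_append)
    next
      case 3
      let ?i = "i - length as"
      have i: "?i < length as'" using 3 ij by simp
      have m: "as ! j \<in> set as" "bs ! j \<in> set bs" "as' ! ?i \<in> set as'" "bs' ! ?i \<in> set bs'" using 3 i len by simp_all
      have "as ! j * as' ! ?i + as' ! ?i * as ! j = 0" "bs ! j * bs' ! ?i + bs' ! ?i * bs ! j = 0" "bs ! j * as' ! ?i + as' ! ?i * bs ! j = 0"
        by (rule x; use m in simp)+
      then show ?thesis using 3 len by (auto simp: nth_append add.commute)
    next
      case 4
      then have "i - length as < length as'" "j - length as < length as'" using ij by auto
      moreover have "i - length as = j - length as \<longleftrightarrow> i = j" using 4 by auto
      ultimately show ?thesis using c(2) len 4 by (simp add: nth_append)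
    qed
  qed
  then show ?thesis unfolding cliff_def using c by auto
qed

text \<open>The boolean \<open>z\<close> covers both right-hand sides, zero and the unit, so that a
  single hypothesis handles all three families of relations.\<close>

lemma cliff_transport:
  assumes c: "cliff e (map g gs) (map g hs)" and E: "E * E = E" "\<And>x. x \<in> set gs \<union> set hs ==> E * f x = f x \<and> f x * E = f x"
    and rel: "\<And>x y z. x \<in> set gs \<union> set hs ==> y \<in> set gs \<union> set hs ==> g x * g y + g y * g x = (if z then e else 0) ==>
      f x * f y + f y * f x = (if z then E else 0)"
  shows "cliff E (map f gs) (map f hs)"
proof -
  note c' = c[unfolded cliff_def length_map]
  have "f (gs ! i) * f (gs ! j) + f (gs ! j) * f (gs ! i) = 0 \<and> f (hs ! i) * f (hs ! j) + f (hs ! j) * f (hs ! i) = 0 \<and>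
      f (gs ! i) * f (hs ! j) + f (hs ! j) * f (gs ! i) = (if i = j then E else 0)" if ij: "i < length gs" "j < length gs" for i j
  proof -
    have len: "length gs = length hs" using c' by (rule conjunct1)
    have n: "map g gs ! i = g (gs ! i)" "map g gs ! j = g (gs ! j)" "map g hs ! i = g (hs ! i)" "map g hs ! j = g (hs ! j)"
      using ij len by simp_all
    have "map g gs ! i * map g gs ! j + map g gs ! j * map g gs ! i = 0 \<and> map g hs ! i * map g hs ! j + map g hs ! j * map g hs ! i = 0 \<and>
      map g gs ! i * map g hs ! j + map g hs ! j * map g gs ! i = (if i = j then e else 0)"
      using c' ij by blast
    then show ?thesis unfolding n
      using ij len rel[of "gs ! i" "gs ! j" False] rel[of "hs ! i" "hs ! j" False] rel[of "gs ! i" "hs ! j" "i = j"] by auto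
  qed
  then show ?thesis unfolding cliff_def using c' E by auto
qed

text \<open>Since the generators commute with \<open>E\<close>, a single factor \<open>E\<close> on
  the left already cuts them down on both sides.\<close>

lemma cliff_cut_down:
  fixes E :: "'a::ring"
  assumes E: "E * E = E" "E * on = E" and comm: "\<And>i. i < m ==> a i * E = E * a i" "\<And>i. i < m ==> b i * E = E * b i"
    and rel: "\<And>i j. i < m ==> j < m ==> a i * a j + a j * a i = 0" "\<And>i j. i < m ==> j < m ==> b i * b j + b j * b i = 0"
      "\<And>i j. i < m ==> j < m ==> a i * b j + b j * a i = (if i = j then on else 0)"
  shows "cliff E (map (\<lambda>i. E * a i) [0..<m]) (map (\<lambda>i. E * b i) [0..<m])"
proof -
  have p: "E * x * (E * y) = E * (x * y)" if "x * E = E * x" for x y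
  proof -
    have "E * x * (E * y) = E * (x * E) * y" by (simp only: mult.assoc)
    also have "\<dots> = E * E * (x * y)" unfolding that by (simp only: mult.assoc)
    finally show ?thesis by (simp only: E)
  qed
  have u: "E * (E * x) = E * x" "E * x * E = E * x" if "x * E = E * x" for x
    using that E by (simp_all add: mult.assoc) (simp_all flip: mult.assoc)
  show ?thesis
    unfolding cliff_def by (auto simp: p comm u E rel simp flip: distrib_left)
qed

text \<open>Both products are indexed by the same list of numbers, so that the generators on source
  and target are matched.\<close>

lemma rprod_intertwine:
  assumes "e' * x = x * (e :: 'a::ring)" "\<And>i. i < m ==> a' i * x = x * a i" "set is \<subseteq> {..<m}"
  shows "rprod e' (map a' is) * x = x * rprod e (map a is)"
  using assms(3)
proof (induction "is")
  case (Cons i "is")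
  then have "rprod e' (map a' (i # is)) * x = a' i * x * rprod e (map a is)" by (simp add: mult.assoc)
  also have "a' i * x = x * a i" using assms(2) Cons.prems by simp
  finally show ?case by (simp add: mult.assoc)
qed (use assms(1) in simp)

context cut_full
begin

abbreviation "CY \<equiv> thickening R1 (U - V)"
abbreviation "CX \<equiv> thickening R2 (V - W)"
abbreviation "CZ \<equiv> thickening R (U - W)"

lemma ct_mult_eta:
  assumes Y: "Yok Y" "Yok Y'" "Yok Y''" and X: "Xok X" "Xok X'" "Xok X''"
    and F: "F \<in> Hm R1 p Y Y'" "F' \<in> Hm R1 p' Y' Y''" "F'' \<in> Hm R1 p'' Y Y''" "eta Y' Y'' F' * eta Y Y' F = eta Y Y'' F''"
    and G: "G \<in> Hm R2 q X X'" "G' \<in> Hm R2 q' X' X''" "G'' \<in> Hm R2 q'' X X''" "eta X' X'' G' * eta X X' G = eta X X'' G''"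
    and pq: "p'' = (p' \<noteq> p)" "q'' = (q' \<noteq> q)"
  shows "ct p' q' Y' Y'' X' X'' F' G' * ct p q Y Y' X X' F G =
    (if q' \<and> p then - ct p'' q'' Y Y'' X X'' F'' G'' else ct p'' q'' Y Y'' X X'' F'' G'')"
proof -
  note my = Yok_mf(1)[OF Y(1)] Yok_mf(1)[OF Y(2)] Yok_mf(1)[OF Y(3)] and mx = Xok_mf(1)[OF X(1)] Xok_mf(1)[OF X(2)] Xok_mf(1)[OF X(3)]
  have "hcomp R1 p'' Y Y'' F' F = F''" "hcomp R2 q'' X X'' G' G = G''"
    using pr.Hm_hcomp[OF my F(1,2) pq(1)] pr.Hm_hcomp[OF mx G(1,2) pq(2)] pr.eta_inj[OF my(1,3) _ F(3)] pr.eta_inj[OF mx(1,3) _ G(3)] F(4) G(4) by simp_all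
  then show ?thesis using ct_mult[OF Y X F(1,2) G(1,2) pq] by simp
qed

section \<open>The cut of two objects\<close>

context
  fixes Y X :: "('v, 'k) mpol cobj"
  assumes Yo: "Y \<in> ob CY" and Xo: "X \<in> ob CX"
begin

lemmas yD = thick_obD[OF Yo] and xD = thick_obD[OF Xo]
abbreviation "my \<equiv> c_mf Y"
abbreviation "mx \<equiv> c_mf X"
abbreviation "mz \<equiv> mc my mx"
abbreviation "EE \<equiv> ct False False my my mx mx (c_idem Y) (c_idem X)"
abbreviation "LL F \<equiv> ct True False my my mx mx F (c_idem X)"
abbreviation "RR G \<equiv> ct False True my my mx mx (c_idem Y) G"
abbreviation "atY i \<equiv> At my mx i"
abbreviation "gdi i \<equiv> emb mz mz (gd my mx i)"

lemmas ok2 = yD(1) yD(1) xD(1) xD(1)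
lemmas ok3 = yD(1) yD(1) yD(1) xD(1) xD(1) xD(1)

lemma mz_mf: "mfR R mz" by (rule mcR[OF yD(1) xD(1)])

lemma cut_idem_ct: "cut_idem R ys V bs Y X \<in> Hm R False mz mz" "eta mz mz (cut_idem R ys V bs Y X) = EE"
  using pc_Hm(3)[OF ok2 yD(3) xD(3)] by (simp_all add: cut_idem_def pc_def)

lemma EE_idem: "EE * EE = EE"
  using ct_mult_eta[OF ok3 yD(3,3,3) yD(7) xD(3,3,3) xD(7)] by simp

lemma cl_gam:
  assumes "F \<in> set (c_gam Y) \<union> set (c_gamd Y)"
  shows "F \<in> Hm R1 True my my" "eI Y * eta my my F = eta my my F" "eta my my F * eI Y = eta my my F"
  using assms yD(4,5,6) by (auto simp: cliff_def)

lemma cl_gam':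
  assumes "F \<in> set (c_gam X) \<union> set (c_gamd X)"
  shows "F \<in> Hm R2 True mx mx" "eI X * eta mx mx F = eta mx mx F" "eta mx mx F * eI X = eta mx mx F"
  using assms xD(4,5,6) by (auto simp: cliff_def)

lemma LL_unit: assumes "F \<in> set (c_gam Y) \<union> set (c_gamd Y)" shows "EE * LL F = LL F" "LL F * EE = LL F"
  using ct_mult_eta[OF ok3 cl_gam(1)[OF assms] yD(3) cl_gam(1)[OF assms] cl_gam(2)[OF assms] xD(3,3,3) xD(7)]
     ct_mult_eta[OF ok3 yD(3) cl_gam(1)[OF assms] cl_gam(1)[OF assms] cl_gam(3)[OF assms] xD(3,3,3) xD(7)] by simp_all

lemma RR_unit: assumes "F \<in> set (c_gam X) \<union> set (c_gamd X)" shows "EE * RR F = RR F" "RR F * EE = RR F"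
  using ct_mult_eta[OF ok3 yD(3,3,3) yD(7) cl_gam'(1)[OF assms] xD(3) cl_gam'(1)[OF assms] cl_gam'(2)[OF assms]]
     ct_mult_eta[OF ok3 yD(3,3,3) yD(7) xD(3) cl_gam'(1)[OF assms] cl_gam'(1)[OF assms] cl_gam'(3)[OF assms]] by simp_all

lemma cut_down_eta:
  assumes "F \<in> Hm R True mz mz"
  shows "cut_down R ys V bs Y X F \<in> Hm R True mz mz" "eta mz mz (cut_down R ys V bs Y X F) = EE * (eta mz mz F * EE)"
proof -
  note a = pr.Hm_hcomp[OF mz_mf mz_mf mz_mf cut_idem_ct(1) assms, of True, simplified]
  note b = pr.Hm_hcomp[OF mz_mf mz_mf mz_mf a(1) cut_idem_ct(1), of True, simplified]
  show "cut_down R ys V bs Y X F \<in> Hm R True mz mz" "eta mz mz (cut_down R ys V bs Y X F) = EE * (eta mz mz F * EE)"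
    using a b by (simp_all add: cut_down_def Let_def cut_idem_ct(2))
qed

text \<open>Composing \<open>F | 1\<close> with the idempotent of the cut gives
  \<open>F | e_X\<close>, because \<open>F\<close> absorbs \<open>e_Y\<close>; the cut down
  generator thus has the simpler form \<open>LL F\<close>.\<close>

lemma cut_left_eta:
  assumes F: "F \<in> set (c_gam Y) \<union> set (c_gamd Y)"
  shows "cut_left R ys V bs Y X F \<in> Hm R True mz mz" "eta mz mz (cut_left R ys V bs Y X F) = LL F"
proof -
  note i = idc_Hm[OF xD(2)]
  have *: "cut_left R ys V bs Y X F = cut_down R ys V bs Y X (pc True False my my mx mx F (idc (set xs \<union> set ys) mx))"
    using pc_one(1)[OF yD(1) xD(1) cl_gam(1)[OF F]] by (simp add: cut_left_def pc_def)
  note h = pc_Hm(4)[OF ok2 cl_gam(1)[OF F] i(1), simplified]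
  have "ct True False my my mx mx F (idc (set xs \<union> set ys) mx) * EE = LL F"
    using ct_mult_eta[OF ok3 yD(3) cl_gam(1)[OF F] cl_gam(1)[OF F] cl_gam(3)[OF F] xD(3) i(1) xD(3) i(3)[OF xD(3) xD(2)]] by simp
  then show "cut_left R ys V bs Y X F \<in> Hm R True mz mz" "eta mz mz (cut_left R ys V bs Y X F) = LL F"
    unfolding * using cut_down_eta[OF h] LL_unit(1)[OF F] by simp_all
qed

lemma cut_right_eta:
  assumes F: "F \<in> set (c_gam X) \<union> set (c_gamd X)"
  shows "cut_right R ys V bs Y X F \<in> Hm R True mz mz" "eta mz mz (cut_right R ys V bs Y X F) = RR F"
proof -
  note i = idc_Hm[OF yD(2)]
  have *: "cut_right R ys V bs Y X F = cut_down R ys V bs Y X (pc False True my my mx mx (idc (set ys \<union> set zs) my) F)"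
    using pc_one(2)[OF yD(1) xD(1) cl_gam'(1)[OF F]] by (simp add: cut_right_def pc_def)
  note h = pc_Hm(4)[OF ok2 i(1) cl_gam'(1)[OF F], simplified]
  have "ct False True my my mx mx (idc (set ys \<union> set zs) my) F * EE = RR F"
    using ct_mult_eta[OF ok3 yD(3) i(1) yD(3) i(3)[OF yD(3) yD(2)] xD(3) cl_gam'(1)[OF F] cl_gam'(1)[OF F] cl_gam'(3)[OF F]] by simp
  then show "cut_right R ys V bs Y X F \<in> Hm R True mz mz" "eta mz mz (cut_right R ys V bs Y X F) = RR F"
    unfolding * using cut_down_eta[OF h] RR_unit(1)[OF F] by simp_all
qed

lemma at_EE: "i < length ys ==> atY i * EE = EE * atY i" "i < length ys ==> gdi i * EE = EE * gdi i"
  using ct_nat[OF ok2 yD(3) xD(3)] by simp_all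

lemma EE_on: "EE * emb mz mz (1\<^sub>m (mf_rank mz)) = EE"
proof -
  obtain f where f: "f \<in> cut_idem R ys V bs Y X" using pr.Hm_ex[OF mz_mf mz_mf cut_idem_ct(1)] by blast
  note fc = pr.Hm_memb(1,2)[OF mz_mf mz_mf cut_idem_ct(1) f]
  show ?thesis using on_unit(1)[OF yD(1) xD(1) fc(1)] unfolding fc(2) cut_idem_ct(2) .
qed

lemma cut_gams_eta:
  "set (cut_gams R ys V bs \<sigma> Y X) \<union> set (cut_gamds R ys V bs \<sigma> Y X) \<subseteq> Hm R True mz mz"
  "map (eta mz mz) (cut_gams R ys V bs \<sigma> Y X) = map (\<lambda>i. EE * atY i) [0..<length ys]"
  "map (eta mz mz) (cut_gamds R ys V bs \<sigma> Y X) = map (\<lambda>i. EE * gdi i) [0..<length ys]"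
proof -
  have EEx: "EE * (x * EE) = EE * x" if "x * EE = EE * x" for x
    unfolding that by (simp only: mult.assoc[symmetric] EE_idem)
  have a: "cut_down R ys V bs Y X (hcl R True mz mz (atiyah ys V bs \<sigma> my mx i)) \<in> Hm R True mz mz"
    "eta mz mz (cut_down R ys V bs Y X (hcl R True mz mz (atiyah ys V bs \<sigma> my mx i))) = EE * atY i" if i: "i < length ys" for i
    using cut_down_eta[OF pr.HmI[OF at_closed[OF yD(1) xD(1) i]]] pr.eta_hcl[OF mz_mf mz_mf at_closed[OF yD(1) xD(1) i]] EEx[OF at_EE(1)[OF i]] by simp_all
  note gc = conjunct1[OF gd_closed_eq[OF yD(1) xD(1)]]
  have g: "cut_down R ys V bs Y X (hcl R True mz mz (gd my mx i)) \<in> Hm R True mz mz"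
    "eta mz mz (cut_down R ys V bs Y X (hcl R True mz mz (gd my mx i))) = EE * gdi i" if i: "i < length ys" for i
    using cut_down_eta[OF pr.HmI[OF gc[OF i]]] pr.eta_hcl[OF mz_mf mz_mf gc[OF i]] EEx[OF at_EE(2)[OF i]] by simp_all
  show "set (cut_gams R ys V bs \<sigma> Y X) \<union> set (cut_gamds R ys V bs \<sigma> Y X) \<subseteq> Hm R True mz mz"
    using a(1) g(1) by (auto simp: cut_gams_def cut_gamds_def Let_def)
  show "map (eta mz mz) (cut_gams R ys V bs \<sigma> Y X) = map (\<lambda>i. EE * atY i) [0..<length ys]"
    "map (eta mz mz) (cut_gamds R ys V bs \<sigma> Y X) = map (\<lambda>i. EE * gdi i) [0..<length ys]"
    using a(2) g(2) by (simp_all add: cut_gams_def cut_gamds_def Let_def)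
qed

abbreviation "AS \<equiv> map (\<lambda>i. EE * atY i) [0..<length ys]"
abbreviation "GS \<equiv> map (\<lambda>i. EE * gdi i) [0..<length ys]"

lemma cliff_mid: "cliff EE AS GS"
  by (rule cliff_cut_down[OF EE_idem EE_on at_EE AtAt[OF yD(1) xD(1)] gd_relations(2)[OF yD(1) xD(1)] gd_relations(1)[OF yD(1) xD(1)]])

lemma LL_rel:
  assumes F: "F \<in> Hm R1 True my my" "G \<in> Hm R1 True my my" and z: "z \<in> Hm R1 False my my"
    and e: "eta my my F * eta my my G + eta my my G * eta my my F = eta my my z"
  shows "LL F * LL G + LL G * LL F = ct False False my my mx mx z (c_idem X)"
proof -
  note h = pr.Hm_hcomp[OF yD(2,2,2) F(2,1), of False, simplified] pr.Hm_hcomp[OF yD(2,2,2) F, of False, simplified]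
  have "LL F * LL G = ct False False my my mx mx (hcomp R1 False my my F G) (c_idem X)"
    "LL G * LL F = ct False False my my mx mx (hcomp R1 False my my G F) (c_idem X)"
    using ct_mult_eta[OF ok3 F(2,1) h(1) h(2)[symmetric] xD(3,3,3) xD(7)] ct_mult_eta[OF ok3 F h(3) h(4)[symmetric] xD(3,3,3) xD(7)] by simp_all
  moreover have "hadd R1 False my my (hcomp R1 False my my F G) (hcomp R1 False my my G F) = z"
    using hm_rel[OF yD(2) F z] e by simp
  ultimately show ?thesis using ct_add(1)[OF ok2 h(1,3) xD(3,3)] by simp
qed

lemma RR_rel:
  assumes F: "F \<in> Hm R2 True mx mx" "G \<in> Hm R2 True mx mx" and z: "z \<in> Hm R2 False mx mx"
    and e: "eta mx mx F * eta mx mx G + eta mx mx G * eta mx mx F = eta mx mx z"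
  shows "RR F * RR G + RR G * RR F = ct False False my my mx mx (c_idem Y) z"
proof -
  note h = pr.Hm_hcomp[OF xD(2,2,2) F(2,1), of False, simplified] pr.Hm_hcomp[OF xD(2,2,2) F, of False, simplified]
  have "RR F * RR G = ct False False my my mx mx (c_idem Y) (hcomp R2 False mx mx F G)"
    "RR G * RR F = ct False False my my mx mx (c_idem Y) (hcomp R2 False mx mx G F)"
    using ct_mult_eta[OF ok3 yD(3,3,3) yD(7) F(2,1) h(1) h(2)[symmetric]] ct_mult_eta[OF ok3 yD(3,3,3) yD(7) F h(3) h(4)[symmetric]] by simp_all
  moreover have "hadd R2 False mx mx (hcomp R2 False mx mx F G) (hcomp R2 False mx mx G F) = z"
    using hm_rel[OF xD(2) F z] e by simp
  ultimately show ?thesis using ct_add(2)[OF ok2 yD(3,3) h(1,3)] by simp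
qed

lemma cliff_LL: "cliff EE (map LL (c_gam Y)) (map LL (c_gamd Y))"
proof (rule cliff_transport[OF yD(6) EE_idem])
  note z = pr.Hm_hzero[OF yD(2,2), of False]
  fix F G d assume F: "F \<in> set (c_gam Y) \<union> set (c_gamd Y)" and G: "G \<in> set (c_gam Y) \<union> set (c_gamd Y)"
    and r: "eta my my F * eta my my G + eta my my G * eta my my F = (if d then eI Y else 0)"
  show "LL F * LL G + LL G * LL F = (if d then EE else 0)"
    using LL_rel[OF cl_gam(1)[OF F] cl_gam(1)[OF G] yD(3)] LL_rel[OF cl_gam(1)[OF F] cl_gam(1)[OF G] z(1)] r z(2) ct_0(1)[OF ok2 yD(3) xD(3)]
    by (cases d) simp_all
qed (use LL_unit in blast)

lemma cliff_RR: "cliff EE (map RR (c_gam X)) (map RR (c_gamd X))"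
proof (rule cliff_transport[OF xD(6) EE_idem])
  note z = pr.Hm_hzero[OF xD(2,2), of False]
  fix F G d assume F: "F \<in> set (c_gam X) \<union> set (c_gamd X)" and G: "G \<in> set (c_gam X) \<union> set (c_gamd X)"
    and r: "eta mx mx F * eta mx mx G + eta mx mx G * eta mx mx F = (if d then eI X else 0)"
  show "RR F * RR G + RR G * RR F = (if d then EE else 0)"
    using RR_rel[OF cl_gam'(1)[OF F] cl_gam'(1)[OF G] xD(3)] RR_rel[OF cl_gam'(1)[OF F] cl_gam'(1)[OF G] z(1)] r z(2) ct_0(2)[OF ok2 yD(3) xD(3)]
    by (cases d) simp_all
qed (use RR_unit in blast)

text \<open>Both products are \<open>F | G\<close> up to sign: the interchange law gives no sign in
  one order and the Koszul sign of two odd maps in the other.\<close>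

lemma LL_RR:
  assumes F: "F \<in> set (c_gam Y) \<union> set (c_gamd Y)" and G: "G \<in> set (c_gam X) \<union> set (c_gamd X)"
  shows "LL F * RR G + RR G * LL F = 0"
proof -
  have "LL F * RR G = ct True True my my mx mx F G"
    using ct_mult_eta[OF ok3 yD(3) cl_gam(1)[OF F] cl_gam(1)[OF F] cl_gam(3)[OF F] cl_gam'(1)[OF G] xD(3) cl_gam'(1)[OF G] cl_gam'(2)[OF G]] by simp
  moreover have "RR G * LL F = - ct True True my my mx mx F G"
    using ct_mult_eta[OF ok3 cl_gam(1)[OF F] yD(3) cl_gam(1)[OF F] cl_gam(2)[OF F] xD(3) cl_gam'(1)[OF G] cl_gam'(1)[OF G] cl_gam'(3)[OF G]] by simp
  ultimately show ?thesis by simp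
qed

text \<open>Naturality concerns the generators before they are cut down. The factor
  \<open>EE\<close> is harmless because \<open>x\<close> absorbs it on both sides.\<close>

lemma AS_anticommute:
  assumes x: "EE * x = x" "x * EE = x" "\<And>i. i < length ys ==> atY i * x = - (x * atY i)" "\<And>i. i < length ys ==> gdi i * x = - (x * gdi i)"
    and y: "y \<in> set AS \<union> set GS"
  shows "x * y + y * x = 0"
proof -
  have *: "x * (EE * a) + EE * a * x = 0" if "a * x = - (x * a)" for a
  proof -
    have "x * (EE * a) = x * a" using x(2) by (simp flip: mult.assoc)
    moreover have "EE * a * x = - (EE * x * a)" using that by (simp add: mult.assoc)
    ultimately show ?thesis using x(1) by simp
  qed
  show ?thesis using y x(3,4) * by auto
qed

lemma LL_AS: "F \<in> set (c_gam Y) \<union> set (c_gamd Y) ==> y \<in> set AS \<union> set GS ==> LL F * y + y * LL F = 0"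
  by (rule AS_anticommute) (use LL_unit ct_nat[OF ok2 cl_gam(1) xD(3)] in auto)

lemma RR_AS: "F \<in> set (c_gam X) \<union> set (c_gamd X) ==> y \<in> set AS \<union> set GS ==> RR F * y + y * RR F = 0"
  by (rule AS_anticommute) (use RR_unit ct_nat[OF ok2 yD(3) cl_gam'(1)] in auto)

abbreviation "ZZ \<equiv> cut_obj R ys V bs \<sigma> Y X"

lemma ZZ_simps: "c_mf ZZ = mz" "eta mz mz (c_idem ZZ) = EE"
  "map (eta mz mz) (c_gam ZZ) = map LL (c_gam Y) @ AS @ map RR (c_gam X)"
  "map (eta mz mz) (c_gamd ZZ) = map LL (c_gamd Y) @ GS @ map RR (c_gamd X)"
  using cut_left_eta(2) cut_right_eta(2) by (simp_all add: cut_obj_def cut_idem_ct(2) cut_gams_eta(2,3))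

lemma cliff_ZZ: "cliff (eI ZZ) (ga ZZ) (gb ZZ)"
  unfolding ZZ_simps
proof (rule cliff_append[OF cliff_LL cliff_append[OF cliff_mid cliff_RR]])
  fix x y assume "x \<in> set AS \<union> set GS" "y \<in> set (map RR (c_gam X)) \<union> set (map RR (c_gamd X))"
  then show "x * y + y * x = 0" using RR_AS[of _ x] by (auto simp: add.commute)
next
  fix x y assume "x \<in> set (map LL (c_gam Y)) \<union> set (map LL (c_gamd Y))"
    "y \<in> set (AS @ map RR (c_gam X)) \<union> set (GS @ map RR (c_gamd X))"
  then obtain F where F: "F \<in> set (c_gam Y) \<union> set (c_gamd Y)" "x = LL F"
    and y: "y \<in> set AS \<union> set GS \<or> (\<exists>G. G \<in> set (c_gam X) \<union> set (c_gamd X) \<and> y = RR G)" by auto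
  show "x * y + y * x = 0" using y LL_AS[OF F(1)] LL_RR[OF F(1)] unfolding F(2) by blast
qed

lemma cut_obj_ob: "ZZ \<in> ob CZ"
  unfolding thick_ob
proof (intro conjI)
  show "matrix_factorisation R (U - W) (c_mf ZZ)" unfolding ZZ_simps(1) by (rule mc_factorisation[OF yD(1) xD(1)])
  show "c_idem ZZ \<in> Hm R False (c_mf ZZ) (c_mf ZZ)" unfolding ZZ_simps(1) using cut_idem_ct(1) by (simp add: cut_obj_def)
  show "set (c_gam ZZ) \<union> set (c_gamd ZZ) \<subseteq> Hm R True (c_mf ZZ) (c_mf ZZ)"
    unfolding ZZ_simps(1) using cut_left_eta(1) cut_right_eta(1) cut_gams_eta(1) by (auto simp: cut_obj_def)
qed (rule cliff_ZZ)

abbreviation "Em \<equiv> cliff_idem EE AS GS"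

lemma Em_class:
  defines "C \<equiv> clifford_idem R mz (cut_idem R ys V bs Y X) (cut_gams R ys V bs \<sigma> Y X) (cut_gamds R ys V bs \<sigma> Y X)"
  shows "C \<in> Hm R False mz mz" "eta mz mz C = Em"
proof -
  have "length (cut_gams R ys V bs \<sigma> Y X) = length (cut_gamds R ys V bs \<sigma> Y X)" by (simp add: cut_gams_def cut_gamds_def Let_def)
  then show "C \<in> Hm R False mz mz" "eta mz mz C = Em"
    using clifford_idem_eta[OF mz_mf cut_idem_ct(1), of "cut_gams R ys V bs \<sigma> Y X" "cut_gamds R ys V bs \<sigma> Y X"] cut_gams_eta
    by (simp_all add: C_def cut_idem_ct(2))
qed

lemma Em_absorb:
  "\<And>x. x * EE = x ==> \<forall>b\<in>set GS. x * b = 0 ==> x * Em = x"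
  "\<And>x. EE * x = x ==> \<forall>a\<in>set AS. a * x = 0 ==> Em * x = x"
  "\<forall>b\<in>set GS. Em * b = 0" "\<forall>a\<in>set AS. a * Em = 0" "EE * Em = Em" "Em * EE = Em"
  using cliff_idem_props[OF hm_two[OF rat] cliff_mid] cliff_idem_unit[OF cliff_mid] by blast+

lemma Em_idem: "Em * Em = Em"
  using Em_absorb(1)[OF Em_absorb(6,3)] .

text \<open>The outer generators anticommute with each middle one, and the middle idempotent is a
  product of evenly many of them.\<close>

lemma Em_commute: "x \<in> set (map LL (c_gam Y)) \<union> set (map LL (c_gamd Y)) \<union> set (map RR (c_gam X)) \<union> set (map RR (c_gamd X)) ==> x * Em = Em * x"
proof (rule cliff_idem_commute[OF cliff_mid])
  assume x: "x \<in> set (map LL (c_gam Y)) \<union> set (map LL (c_gamd Y)) \<union> set (map RR (c_gam X)) \<union> set (map RR (c_gamd X))"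
  then show "x * EE = EE * x" using LL_unit RR_unit by auto
  show "x * y + y * x = 0" if "y \<in> set AS \<union> set GS" for y using x LL_AS[OF _ that] RR_AS[OF _ that] by auto
qed

end

section \<open>The cut of two morphisms\<close>

context
  fixes Y Y' X X' :: "('v, 'k) mpol cobj"
  assumes Yo: "Y \<in> ob CY" "Y' \<in> ob CY" and Xo: "X \<in> ob CX" "X' \<in> ob CX"
begin

lemmas YD = thick_obD[OF Yo(1)] and YD' = thick_obD[OF Yo(2)] and XD = thick_obD[OF Xo(1)] and XD' = thick_obD[OF Xo(2)]
lemmas OK = YD(1) YD'(1) XD(1) XD'(1)

abbreviation "CT \<psi> \<phi> \<equiv> ct False False (c_mf Y) (c_mf Y') (c_mf X) (c_mf X') \<psi> \<phi>"
abbreviation "MOR \<psi> \<phi> \<equiv> cut_mor R ys V bs \<sigma> Y Y' X X' \<psi> \<phi>"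

context
  fixes \<psi> \<phi>
  assumes psi: "\<psi> \<in> carrier (hom_mod CY Y Y')" and phi: "\<phi> \<in> carrier (hom_mod CX X X')"
begin

lemmas ps = psi[unfolded thick_hom_iff[OF Yo]] and ph = phi[unfolded thick_hom_iff[OF Xo]]

lemma psH: "\<psi> \<in> Hm R1 False (c_mf Y) (c_mf Y')" "\<phi> \<in> Hm R2 False (c_mf X) (c_mf X')"
  using ps ph by auto

lemma CT_EE: "CT \<psi> \<phi> * EE Y X = CT \<psi> \<phi>" "EE Y' X' * CT \<psi> \<phi> = CT \<psi> \<phi>"
  using ct_mult_eta[OF YD(1,1) YD'(1) XD(1,1) XD'(1) YD(3) psH(1,1) _ XD(3) psH(2,2)]
    ct_mult_eta[OF YD(1) YD'(1,1) XD(1) XD'(1,1) psH(1) YD'(3) psH(1) _ psH(2) XD'(3) psH(2)] ps ph by simp_all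

lemma CT_nat: "i < length ys ==> atY Y' X' i * CT \<psi> \<phi> = CT \<psi> \<phi> * atY Y X i" "i < length ys ==> gdi Y' X' i * CT \<psi> \<phi> = CT \<psi> \<phi> * gdi Y X i"
  using ct_nat[OF OK psH] by simp_all

lemma CT_gens:
  "i < length ys ==> EE Y' X' * atY Y' X' i * CT \<psi> \<phi> = CT \<psi> \<phi> * (EE Y X * atY Y X i)"
  "i < length ys ==> EE Y' X' * gdi Y' X' i * CT \<psi> \<phi> = CT \<psi> \<phi> * (EE Y X * gdi Y X i)"
proof -
  assume i: "i < length ys"
  have *: "EE Y' X' * a' * CT \<psi> \<phi> = CT \<psi> \<phi> * (EE Y X * a)" if "a' * CT \<psi> \<phi> = CT \<psi> \<phi> * a" for a a'
  proof -
    have "EE Y' X' * a' * CT \<psi> \<phi> = EE Y' X' * CT \<psi> \<phi> * a" by (simp only: mult.assoc that)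
    also have "\<dots> = CT \<psi> \<phi> * EE Y X * a" by (simp only: CT_EE)
    finally show ?thesis by (simp only: mult.assoc)
  qed
  show "EE Y' X' * atY Y' X' i * CT \<psi> \<phi> = CT \<psi> \<phi> * (EE Y X * atY Y X i)" "EE Y' X' * gdi Y' X' i * CT \<psi> \<phi> = CT \<psi> \<phi> * (EE Y X * gdi Y X i)"
    by (rule *[OF CT_nat(1)[OF i]], rule *[OF CT_nat(2)[OF i]])
qed

lemma CT_Em: "Em Y' X' * CT \<psi> \<phi> = CT \<psi> \<phi> * Em Y X"
proof -
  \<comment> \<open>One numbering for all factors of the idempotent: the Atiyah operators come
    first, their partners follow with an offset of \<open>length ys\<close>, and \<open>J\<close>
    lists the numbers in the order of the product.\<close>
  define a' where "a' i = (if i < length ys then EE Y' X' * atY Y' X' i else EE Y' X' * gdi Y' X' (i - length ys))" for i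
  define a where "a i = (if i < length ys then EE Y X * atY Y X i else EE Y X * gdi Y X (i - length ys))" for i
  define J where "J = [0..<length ys] @ map (\<lambda>i. i + length ys) (rev [0..<length ys])"
  have "AS Y' X' @ rev (GS Y' X') = map a' J" "AS Y X @ rev (GS Y X) = map a J"
    by (simp_all add: J_def a_def a'_def rev_map)
  moreover have "rprod (EE Y' X') (map a' J) * CT \<psi> \<phi> = CT \<psi> \<phi> * rprod (EE Y X) (map a J)"
  proof (rule rprod_intertwine[where m = "2 * length ys"])
    show "EE Y' X' * CT \<psi> \<phi> = CT \<psi> \<phi> * EE Y X" by (simp only: CT_EE)
    show "a' i * CT \<psi> \<phi> = CT \<psi> \<phi> * a i" if "i < 2 * length ys" for i
      using CT_gens(1)[of i] CT_gens(2)[of "i - length ys"] that by (simp add: a_def a'_def)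
    show "set J \<subseteq> {..<2 * length ys}" by (auto simp: J_def)
  qed
  ultimately show ?thesis by (simp only: cliff_idem_def)
qed

lemma MOR_eta: "MOR \<psi> \<phi> \<in> Hm R False (mz Y X) (mz Y' X')" "eta (mz Y X) (mz Y' X') (MOR \<psi> \<phi>) = CT \<psi> \<phi> * Em Y X"
  using pr.Hm_hcomp[OF mz_mf[OF Yo(1) Xo(1)] mz_mf[OF Yo(1) Xo(1)] mz_mf[OF Yo(2) Xo(2)] Em_class(1)[OF Yo(1) Xo(1)] pc_Hm(3)[OF OK psH refl], of False]
    Em_class(2)[OF Yo(1) Xo(1)] by (simp_all add: cut_mor_def pc_def)

lemma CT_LL:
  "F \<in> set (c_gamd Y) ==> CT \<psi> \<phi> * LL Y X F = 0" "F \<in> set (c_gam Y') ==> LL Y' X' F * CT \<psi> \<phi> = 0"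
proof -
  note z = pr.Hm_hzero[OF YD(2) YD'(2), of True]
  note z0 = ct_0(1)[OF OK z(1) psH(2)]
  show "CT \<psi> \<phi> * LL Y X F = 0" if "F \<in> set (c_gamd Y)"
    using ct_mult_eta[OF YD(1,1) YD'(1) XD(1,1) XD'(1) YD(5)[OF that] psH(1) z(1) _ XD(3) psH(2,2)] z(2) z0 ps ph that
    by simp
  show "LL Y' X' F * CT \<psi> \<phi> = 0" if "F \<in> set (c_gam Y')"
    using ct_mult_eta[OF YD(1) YD'(1,1) XD(1) XD'(1,1) psH(1) YD'(4)[OF that] z(1) _ psH(2) XD'(3) psH(2)] z(2) z0 ps ph that
    by simp
qed

lemma CT_RR:
  "F \<in> set (c_gamd X) ==> CT \<psi> \<phi> * RR Y X F = 0" "F \<in> set (c_gam X') ==> RR Y' X' F * CT \<psi> \<phi> = 0"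
proof -
  note z = pr.Hm_hzero[OF XD(2) XD'(2), of True]
  note z0 = ct_0(2)[OF OK psH(1) z(1)]
  show "CT \<psi> \<phi> * RR Y X F = 0" if "F \<in> set (c_gamd X)"
    using ct_mult_eta[OF YD(1,1) YD'(1) XD(1,1) XD'(1) YD(3) psH(1,1) _ XD(5)[OF that] psH(2) z(1)] z(2) z0 ps ph that
    by simp
  show "RR Y' X' F * CT \<psi> \<phi> = 0" if "F \<in> set (c_gam X')"
    using ct_mult_eta[OF YD(1) YD'(1,1) XD(1) XD'(1,1) psH(1) YD'(3) psH(1) _ psH(2) XD'(4)[OF that] z(1)] z(2) z0 ps ph that
    by simp
qed

text \<open>Outer generators are killed by \<open>\<psi>\<close> and \<open>\<phi>\<close>
  themselves, after commuting with the middle idempotent where necessary; middle generators are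
  killed by that idempotent, after intertwining with the cut map where necessary.\<close>

lemma MOR_kill:
  "b \<in> set (map (LL Y X) (c_gamd Y) @ GS Y X @ map (RR Y X) (c_gamd X)) ==> CT \<psi> \<phi> * Em Y X * b = 0"
  "a \<in> set (map (LL Y' X') (c_gam Y') @ AS Y' X' @ map (RR Y' X') (c_gam X')) ==> a * (CT \<psi> \<phi> * Em Y X) = 0"
proof -
  assume b: "b \<in> set (map (LL Y X) (c_gamd Y) @ GS Y X @ map (RR Y X) (c_gamd X))"
  then consider "b \<in> set (GS Y X)" | "b \<in> set (map (LL Y X) (c_gamd Y)) \<union> set (map (RR Y X) (c_gamd X))" by auto
  then show "CT \<psi> \<phi> * Em Y X * b = 0"
  proof cases
    case 1
    then have "Em Y X * b = 0" using Em_absorb(3)[OF Yo(1) Xo(1)] by blast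
    then show ?thesis by (simp only: mult.assoc mult_zero_right)
  next
    case 2
    have "b * Em Y X = Em Y X * b" by (rule Em_commute[OF Yo(1) Xo(1)]) (use 2 in blast)
    then have "CT \<psi> \<phi> * Em Y X * b = CT \<psi> \<phi> * b * Em Y X" by (simp only: mult.assoc)
    moreover have "CT \<psi> \<phi> * b = 0" using 2 CT_LL(1) CT_RR(1) by auto
    ultimately show ?thesis by (simp only: mult_zero_left)
  qed
next
  assume a: "a \<in> set (map (LL Y' X') (c_gam Y') @ AS Y' X' @ map (RR Y' X') (c_gam X'))"
  then consider i where "i < length ys" "a = EE Y' X' * atY Y' X' i" | "a \<in> set (map (LL Y' X') (c_gam Y')) \<union> set (map (RR Y' X') (c_gam X'))" by auto
  then show "a * (CT \<psi> \<phi> * Em Y X) = 0"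
  proof cases
    case 1
    then have "EE Y X * atY Y X i * Em Y X = 0" using Em_absorb(4)[OF Yo(1) Xo(1)] by auto
    then show ?thesis unfolding 1(2) mult.assoc[symmetric] CT_gens(1)[OF 1(1)] by (simp only: mult.assoc mult_zero_right)
  next
    case 2
    have "a * CT \<psi> \<phi> = 0" using 2 CT_LL(2) CT_RR(2) by auto
    then show ?thesis by (simp only: mult.assoc[symmetric] mult_zero_left)
  qed
qed

lemma MOR_hom: "MOR \<psi> \<phi> \<in> carrier (hom_mod CZ (ZZ Y X) (ZZ Y' X'))"
  unfolding thick_hom_iff[OF cut_obj_ob[OF Yo(1) Xo(1)] cut_obj_ob[OF Yo(2) Xo(2)]]
    ZZ_simps[OF Yo(1) Xo(1)] ZZ_simps[OF Yo(2) Xo(2)] MOR_eta(2)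
proof (intro conjI ballI)
  show "MOR \<psi> \<phi> \<in> Hm R False (mz Y X) (mz Y' X')" by (rule MOR_eta(1))
  show "CT \<psi> \<phi> * Em Y X * EE Y X = CT \<psi> \<phi> * Em Y X" by (simp only: mult.assoc Em_absorb(6)[OF Yo(1) Xo(1)])
  show "EE Y' X' * (CT \<psi> \<phi> * Em Y X) = CT \<psi> \<phi> * Em Y X" by (simp only: mult.assoc[symmetric] CT_EE)
qed (erule MOR_kill)+

end

end

end

section \<open>Identities, bilinearity and composition\<close>

context cut_full
begin

context
  fixes Y X :: "('v, 'k) mpol cobj"
  assumes Yo: "Y \<in> ob CY" and Xo: "X \<in> ob CX"
begin

text \<open>Only even maps occur in the right-hand factor, so the interchange law produces no signs
  and the cut of a product with the idempotent \<open>e_X\<close> is the product of the cuts. In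
  \<open>RR_rprod\<close> the left-hand factor is the even idempotent \<open>e_Y\<close>, with the
  same effect.\<close>

lemma LL_rprod:
  assumes "set gs \<subseteq> set (c_gam Y) \<union> set (c_gamd Y)"
  shows "ct (odd (length gs)) False (c_mf Y) (c_mf Y) (c_mf X) (c_mf X) (odd_prod R1 (c_mf Y) (c_idem Y) gs) (c_idem X) = rprod (EE Y X) (map (LL Y X) gs)"
  using assms
proof (induction gs)
  case (Cons g gs)
  have sub: "set gs \<subseteq> Hm R1 True (c_mf Y) (c_mf Y)" "set (g # gs) \<subseteq> Hm R1 True (c_mf Y) (c_mf Y)"
    using Cons.prems cl_gam(1)[OF Yo Xo] by (auto simp del: Un_iff)
  note o = odd_prod_eta[OF yD(2,3)[OF Yo Xo] sub(1)] and o' = odd_prod_eta[OF yD(2,3)[OF Yo Xo] sub(2)]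
  have e: "eta (c_mf Y) (c_mf Y) g * eta (c_mf Y) (c_mf Y) (odd_prod R1 (c_mf Y) (c_idem Y) gs) = eta (c_mf Y) (c_mf Y) (odd_prod R1 (c_mf Y) (c_idem Y) (g # gs))"
    using o o' by simp
  have "LL Y X g * ct (odd (length gs)) False (c_mf Y) (c_mf Y) (c_mf X) (c_mf X) (odd_prod R1 (c_mf Y) (c_idem Y) gs) (c_idem X)
    = ct (odd (length (g # gs))) False (c_mf Y) (c_mf Y) (c_mf X) (c_mf X) (odd_prod R1 (c_mf Y) (c_idem Y) (g # gs)) (c_idem X)"
    using ct_mult_eta[OF ok3[OF Yo Xo] conjunct1[OF o] _ conjunct1[OF o'] e xD(3,3,3)[OF Yo Xo] xD(7)[OF Yo Xo], of True] sub(2) by simp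
  then show ?case using Cons by simp
qed simp

lemma RR_rprod:
  assumes "set gs \<subseteq> set (c_gam X) \<union> set (c_gamd X)"
  shows "ct False (odd (length gs)) (c_mf Y) (c_mf Y) (c_mf X) (c_mf X) (c_idem Y) (odd_prod R2 (c_mf X) (c_idem X) gs) = rprod (EE Y X) (map (RR Y X) gs)"
  using assms
proof (induction gs)
  case (Cons g gs)
  have sub: "set gs \<subseteq> Hm R2 True (c_mf X) (c_mf X)" "set (g # gs) \<subseteq> Hm R2 True (c_mf X) (c_mf X)"
    using Cons.prems cl_gam'(1)[OF Yo Xo] by (auto simp del: Un_iff)
  note o = odd_prod_eta[OF xD(2,3)[OF Yo Xo] sub(1)] and o' = odd_prod_eta[OF xD(2,3)[OF Yo Xo] sub(2)]
  have e: "eta (c_mf X) (c_mf X) g * eta (c_mf X) (c_mf X) (odd_prod R2 (c_mf X) (c_idem X) gs) = eta (c_mf X) (c_mf X) (odd_prod R2 (c_mf X) (c_idem X) (g # gs))"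
    using o o' by simp
  have "RR Y X g * ct False (odd (length gs)) (c_mf Y) (c_mf Y) (c_mf X) (c_mf X) (c_idem Y) (odd_prod R2 (c_mf X) (c_idem X) gs)
    = ct False (odd (length (g # gs))) (c_mf Y) (c_mf Y) (c_mf X) (c_mf X) (c_idem Y) (odd_prod R2 (c_mf X) (c_idem X) (g # gs))"
    using ct_mult_eta[OF ok3[OF Yo Xo] yD(3,3,3)[OF Yo Xo] yD(7)[OF Yo Xo] conjunct1[OF o] _ conjunct1[OF o'] e, of True] sub(2) by simp
  then show ?case using Cons by simp
qed simp

text \<open>Write M for the cut of the identities. The product \<open>?Q * M\<close> is evaluated
  twice. It equals \<open>?Q\<close>, because \<open>?Q\<close> is killed on the right by every
  dagger generator and hence absorbs each of the three idempotents composing M. It equals M, because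
  M is a morphism and hence killed on the left by every \<open>\<gamma>\<close>.\<close>

lemma MOR_id: "cut_mor R ys V bs \<sigma> Y Y X X (idt CY Y) (idt CX X) = idt CZ (ZZ Y X)"
proof -
  note iY = thick_id_hom[OF rat Yo] and iX = thick_id_hom[OF rat Xo]
  note zo = cut_obj_ob[OF Yo Xo]
  note mh = MOR_hom[OF Yo Yo Xo Xo iY iX] and me = MOR_eta[OF Yo Yo Xo Xo iY iX]
  let ?Q = "cliff_idem (EE Y X) (map (LL Y X) (c_gam Y) @ AS Y X @ map (RR Y X) (c_gam X)) (map (LL Y X) (c_gamd Y) @ GS Y X @ map (RR Y X) (c_gamd X))"
  let ?C = "ct False False (c_mf Y) (c_mf Y) (c_mf X) (c_mf X)" and ?E = "EE Y X"
  have Q: "eta (mz Y X) (mz Y X) (idt CZ (ZZ Y X)) = ?Q"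
    using thick_id(2)[OF zo] unfolding ZZ_simps[OF Yo Xo] .
  have len: "length (c_gam Y) = length (c_gamd Y)" "length (c_gam X) = length (c_gamd X)"
    using thick_obD(6)[OF Yo] thick_obD(6)[OF Xo] by (simp_all add: cliff_def)
  have cl: "cliff ?E (map (LL Y X) (c_gam Y) @ AS Y X @ map (RR Y X) (c_gam X)) (map (LL Y X) (c_gamd Y) @ GS Y X @ map (RR Y X) (c_gamd X))"
    using cliff_ZZ[OF Yo Xo] unfolding ZZ_simps[OF Yo Xo] .
  note Qp = cliff_idem_props[OF hm_two[OF rat] cl] and Qu = cliff_idem_unit[OF cl]
  have kill: "?Q * b = 0" if "b \<in> set (map (LL Y X) (c_gamd Y) @ GS Y X @ map (RR Y X) (c_gamd X))" for b using Qp that by blast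
  have QEm: "?Q * Em Y X = ?Q" by (rule Em_absorb(1)[OF Yo Xo Qu(2)]) (use kill in auto)
  have QL: "?Q * cliff_idem ?E (map (LL Y X) (c_gam Y)) (map (LL Y X) (c_gamd Y)) = ?Q"
    using cliff_idem_props[OF hm_two[OF rat] cliff_LL[OF Yo Xo]] Qu(2) kill by auto
  have QR: "?Q * cliff_idem ?E (map (RR Y X) (c_gam X)) (map (RR Y X) (c_gamd X)) = ?Q"
    using cliff_idem_props[OF hm_two[OF rat] cliff_RR[OF Yo Xo]] Qu(2) kill by auto
  have L: "?C (idt CY Y) (c_idem X) = cliff_idem ?E (map (LL Y X) (c_gam Y)) (map (LL Y X) (c_gamd Y))"
    using LL_rprod[of "c_gam Y @ rev (c_gamd Y)"] len by (simp add: thickening_def clifford_idem_def cliff_idem_def rev_map)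
  have Rr: "?C (c_idem Y) (idt CX X) = cliff_idem ?E (map (RR Y X) (c_gam X)) (map (RR Y X) (c_gamd X))"
    using RR_rprod[of "c_gam X @ rev (c_gamd X)"] len by (simp add: thickening_def clifford_idem_def cliff_idem_def rev_map)
  have u: "eta (c_mf Y) (c_mf Y) (idt CY Y) * eI Y = eta (c_mf Y) (c_mf Y) (idt CY Y)"
     "eI X * eta (c_mf X) (c_mf X) (idt CX X) = eta (c_mf X) (c_mf X) (idt CX X)"
    using iY[unfolded thick_hom_iff[OF Yo Yo]] iX[unfolded thick_hom_iff[OF Xo Xo]] by blast+
  \<comment> \<open>The cut of the two identities factors into a left and a right idempotent, which
    \<open>?Q\<close> can absorb one after the other.\<close>
  have "?C (idt CY Y) (c_idem X) * ?C (c_idem Y) (idt CX X) = ?C (idt CY Y) (idt CX X)"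
    using ct_mult_eta[OF ok3[OF Yo Xo] yD(3)[OF Yo Xo] thick_id(1)[OF Yo] thick_id(1)[OF Yo] u(1) thick_id(1)[OF Xo] xD(3)[OF Yo Xo] thick_id(1)[OF Xo] u(2)] by simp
  then have "?Q * ?C (idt CY Y) (idt CX X) = ?Q * ?C (idt CY Y) (c_idem X) * ?C (c_idem Y) (idt CX X)" by (simp only: mult.assoc)
  then have QC: "?Q * ?C (idt CY Y) (idt CX X) = ?Q" by (simp only: L Rr QL QR)
  have P1: "?Q * (?C (idt CY Y) (idt CX X) * Em Y X) = ?Q" by (simp only: mult.assoc[symmetric] QC QEm)
  have P2: "?Q * (?C (idt CY Y) (idt CX X) * Em Y X) = ?C (idt CY Y) (idt CX X) * Em Y X"
    using mh[unfolded thick_hom_iff[OF zo zo] ZZ_simps[OF Yo Xo] me(2)] Qp by blast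
  note PQ = trans[OF P2[symmetric] P1]
  show ?thesis
    by (rule thick_hom_eqI[OF zo zo mh thick_id_hom[OF rat zo]]) (simp only: ZZ_simps(1)[OF Yo Xo] Q me(2) PQ)
qed

end

context
  fixes Y Y' X X' :: "('v, 'k) mpol cobj"
  assumes Yo: "Y \<in> ob CY" "Y' \<in> ob CY" and Xo: "X \<in> ob CX" "X' \<in> ob CX"
begin

abbreviation "MR \<psi> \<phi> \<equiv> cut_mor R ys V bs \<sigma> Y Y' X X' \<psi> \<phi>"

lemma MOR_bilinear:
  assumes psi: "\<psi> \<in> carrier (hom_mod CY Y Y')" "\<psi>' \<in> carrier (hom_mod CY Y Y')"
    and phi: "\<phi> \<in> carrier (hom_mod CX X X')" "\<phi>' \<in> carrier (hom_mod CX X X')"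
  defines "H \<equiv> hom_mod CZ (ZZ Y X) (ZZ Y' X')"
  shows "MR (\<psi> \<oplus>\<^bsub>hom_mod CY Y Y'\<^esub> \<psi>') \<phi> = MR \<psi> \<phi> \<oplus>\<^bsub>H\<^esub> MR \<psi>' \<phi>"
    "MR \<psi> (\<phi> \<oplus>\<^bsub>hom_mod CX X X'\<^esub> \<phi>') = MR \<psi> \<phi> \<oplus>\<^bsub>H\<^esub> MR \<psi> \<phi>'"
    "MR (c \<odot>\<^bsub>hom_mod CY Y Y'\<^esub> \<psi>) \<phi> = c \<odot>\<^bsub>H\<^esub> MR \<psi> \<phi>"
    "MR \<psi> (c \<odot>\<^bsub>hom_mod CX X X'\<^esub> \<phi>) = c \<odot>\<^bsub>H\<^esub> MR \<psi> \<phi>"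
proof -
  note zo = cut_obj_ob[OF Yo(1) Xo(1)] cut_obj_ob[OF Yo(2) Xo(2)]
  note mh = MOR_hom[OF Yo Xo] and me = MOR_eta(2)[OF Yo Xo]
  note zs = ZZ_simps(1)[OF Yo(1) Xo(1)] ZZ_simps(1)[OF Yo(2) Xo(2)]
  note py = thick_ops[OF Yo psi] and px = thick_ops[OF Xo phi]
  note ok = thick_obD(1)[OF Yo(1)] thick_obD(1)[OF Yo(2)] thick_obD(1)[OF Xo(1)] thick_obD(1)[OF Xo(2)]
  have h: "\<psi> \<in> Hm R1 False (c_mf Y) (c_mf Y')" "\<psi>' \<in> Hm R1 False (c_mf Y) (c_mf Y')" "\<phi> \<in> Hm R2 False (c_mf X) (c_mf X')" "\<phi>' \<in> Hm R2 False (c_mf X) (c_mf X')"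
    using psi phi unfolding thick_hom_iff[OF Yo] thick_hom_iff[OF Xo] by blast+
  note l = ct_add[OF ok h]
  note ca = thick_ops(1,2)[OF zo] and cs = thick_ops(3,4)[OF zo _ mh[OF psi(1) phi(1)]]
  show "MR (\<psi> \<oplus>\<^bsub>hom_mod CY Y Y'\<^esub> \<psi>') \<phi> = MR \<psi> \<phi> \<oplus>\<^bsub>H\<^esub> MR \<psi>' \<phi>"
    unfolding H_def
    by (rule thick_hom_eqI[OF zo mh[OF py(1) phi(1)] ca(1)[OF mh[OF psi(1) phi(1)] mh[OF psi(2) phi(1)]]])
      (simp only: ca(2)[OF mh[OF psi(1) phi(1)] mh[OF psi(2) phi(1)]], simp only: zs me[OF py(1) phi(1)] me[OF psi(1) phi(1)] me[OF psi(2) phi(1)], simp only: thick_hom_simps(2,3) l(1) distrib_right)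
  show "MR \<psi> (\<phi> \<oplus>\<^bsub>hom_mod CX X X'\<^esub> \<phi>') = MR \<psi> \<phi> \<oplus>\<^bsub>H\<^esub> MR \<psi> \<phi>'"
    unfolding H_def
    by (rule thick_hom_eqI[OF zo mh[OF psi(1) px(1)] ca(1)[OF mh[OF psi(1) phi(1)] mh[OF psi(1) phi(2)]]])
      (simp only: ca(2)[OF mh[OF psi(1) phi(1)] mh[OF psi(1) phi(2)]], simp only: zs me[OF psi(1) px(1)] me[OF psi(1) phi(1)] me[OF psi(1) phi(2)], simp only: thick_hom_simps(2,3) l(2) distrib_right)
  show "MR (c \<odot>\<^bsub>hom_mod CY Y Y'\<^esub> \<psi>) \<phi> = c \<odot>\<^bsub>H\<^esub> MR \<psi> \<phi>"
    unfolding H_def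
    by (rule thick_hom_eqI[OF zo mh[OF py(3) phi(1)] cs(1)[OF mh[OF psi(1) phi(1)]]])
      (simp only: cs(2)[OF mh[OF psi(1) phi(1)]], simp only: zs me[OF py(3) phi(1)] me[OF psi(1) phi(1)], simp only: thick_hom_simps(2,3) l(3) scl_props(5))
  show "MR \<psi> (c \<odot>\<^bsub>hom_mod CX X X'\<^esub> \<phi>) = c \<odot>\<^bsub>H\<^esub> MR \<psi> \<phi>"
    unfolding H_def
    by (rule thick_hom_eqI[OF zo mh[OF psi(1) px(3)] cs(1)[OF mh[OF psi(1) phi(1)]]])
      (simp only: cs(2)[OF mh[OF psi(1) phi(1)]], simp only: zs me[OF psi(1) px(3)] me[OF psi(1) phi(1)], simp only: thick_hom_simps(2,3) l(4) scl_props(5))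
qed

end

lemma MOR_comp:
  assumes Yo: "Y \<in> ob CY" "Y' \<in> ob CY" "Y'' \<in> ob CY" and Xo: "X \<in> ob CX" "X' \<in> ob CX" "X'' \<in> ob CX"
    and psi: "\<psi> \<in> carrier (hom_mod CY Y Y')" "\<psi>' \<in> carrier (hom_mod CY Y' Y'')"
    and phi: "\<phi> \<in> carrier (hom_mod CX X X')" "\<phi>' \<in> carrier (hom_mod CX X' X'')"
  shows "cut_mor R ys V bs \<sigma> Y Y'' X X'' (cmp CY Y Y' Y'' \<psi>' \<psi>) (cmp CX X X' X'' \<phi>' \<phi>) =
    cmp CZ (ZZ Y X) (ZZ Y' X') (ZZ Y'' X'') (cut_mor R ys V bs \<sigma> Y' Y'' X' X'' \<psi>' \<phi>') (cut_mor R ys V bs \<sigma> Y Y' X X' \<psi> \<phi>)"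
proof -
  note zo = cut_obj_ob[OF Yo(1) Xo(1)] cut_obj_ob[OF Yo(2) Xo(2)] cut_obj_ob[OF Yo(3) Xo(3)]
  note cy = thick_cmp(1)[OF Yo psi] and cx = thick_cmp(1)[OF Xo phi]
  note m1 = MOR_hom[OF Yo(1,2) Xo(1,2) psi(1) phi(1)] MOR_eta(2)[OF Yo(1,2) Xo(1,2) psi(1) phi(1)]
  note m2 = MOR_hom[OF Yo(2,3) Xo(2,3) psi(2) phi(2)] MOR_eta(2)[OF Yo(2,3) Xo(2,3) psi(2) phi(2)]
  note m3 = MOR_hom[OF Yo(1,3) Xo(1,3) cy cx] MOR_eta(2)[OF Yo(1,3) Xo(1,3) cy cx]
  note zs = ZZ_simps(1)[OF Yo(1) Xo(1)] ZZ_simps(1)[OF Yo(2) Xo(2)] ZZ_simps(1)[OF Yo(3) Xo(3)]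
  let ?C1 = "ct False False (c_mf Y) (c_mf Y') (c_mf X) (c_mf X') \<psi> \<phi>" and ?C2 = "ct False False (c_mf Y') (c_mf Y'') (c_mf X') (c_mf X'') \<psi>' \<phi>'"
  have h: "\<psi> \<in> Hm R1 False (c_mf Y) (c_mf Y')" "\<psi>' \<in> Hm R1 False (c_mf Y') (c_mf Y'')" "\<phi> \<in> Hm R2 False (c_mf X) (c_mf X')" "\<phi>' \<in> Hm R2 False (c_mf X') (c_mf X'')"
    using psi phi unfolding thick_hom_iff[OF Yo(1,2)] thick_hom_iff[OF Yo(2,3)] thick_hom_iff[OF Xo(1,2)] thick_hom_iff[OF Xo(2,3)] by blast+
  have C: "?C2 * ?C1 = ct False False (c_mf Y) (c_mf Y'') (c_mf X) (c_mf X'') (cmp CY Y Y' Y'' \<psi>' \<psi>) (cmp CX X X' X'' \<phi>' \<phi>)"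
    using ct_mult[OF thick_obD(1)[OF Yo(1)] thick_obD(1)[OF Yo(2)] thick_obD(1)[OF Yo(3)] thick_obD(1)[OF Xo(1)] thick_obD(1)[OF Xo(2)] thick_obD(1)[OF Xo(3)] h, of False False]
    by (simp add: thick_hom_simps)
  \<comment> \<open>The inner idempotent is moved past the first cut map by naturality and merges
    with the outer one.\<close>
  have "?C2 * Em Y' X' * (?C1 * Em Y X) = ?C2 * (Em Y' X' * ?C1) * Em Y X" by (simp only: mult.assoc)
  also have "\<dots> = ?C2 * ?C1 * (Em Y X * Em Y X)" unfolding CT_Em[OF Yo(1,2) Xo(1,2) psi(1) phi(1)] by (simp only: mult.assoc)
  also have "\<dots> = ?C2 * ?C1 * Em Y X" by (simp only: Em_idem[OF Yo(1) Xo(1)])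
  finally have e: "?C2 * Em Y' X' * (?C1 * Em Y X) = ?C2 * ?C1 * Em Y X" .
  show ?thesis
    by (rule thick_hom_eqI[OF zo(1,3) m3(1) thick_cmp(1)[OF zo m1(1) m2(1)]])
      (simp only: thick_cmp(2)[OF zo m1(1) m2(1)], simp only: zs m1(2) m2(2) m3(2) e C)
qed

end

theorem proposition3p13:
  fixes W V U :: "('v, 'k::comm_ring_1) mpol"
    and xs ys zs :: "'v list"
    and bs :: "('v, 'k) mpol list"
    and \<sigma> :: "('v, 'k) mpol \<Rightarrow> nat \<Rightarrow> ('v, 'k) mpol"
  assumes "noetherian_ring (ring_of_type_algebra :: 'k ring)"
    and "rat_algebra TYPE('k)"
    and "distinct (xs @ ys @ zs)"
    and "potential xs W" and "potential ys V" and "potential zs U"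
    and "jac_basis ys V bs"
    and "jac_section ys V \<sigma>"
  shows "\<exists>F. linear_functor (tensor_category (CC ys V zs U) (CC xs W ys V)) (CC xs W zs U)
      (\<lambda>(Y, X). cut_obj (poly_in (set xs \<union> set zs)) ys V bs \<sigma> Y X) F \<and>
    (\<forall>Y\<in>ob (CC ys V zs U). \<forall>Y'\<in>ob (CC ys V zs U). \<forall>X\<in>ob (CC xs W ys V). \<forall>X'\<in>ob (CC xs W ys V).
      \<forall>\<psi>\<in>carrier (hom_mod (CC ys V zs U) Y Y'). \<forall>\<phi>\<in>carrier (hom_mod (CC xs W ys V) X X').
        F (Y, X) (Y', X')
          (pure_tensor (hom_mod (CC ys V zs U) Y Y') (hom_mod (CC xs W ys V) X X') \<psi> \<phi>)
        = cut_mor (poly_in (set xs \<union> set zs)) ys V bs \<sigma> Y Y' X X' \<psi> \<phi>)"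
proof -
  interpret cut_full ys V bs \<sigma> xs zs W U
    by unfold_locales (use assms in \<open>auto simp: potential_def\<close>)
  \<comment> \<open>The tensor product of categories is entered only here: the properties of the cut
    are fed into the criterion, whose map \<open>F\<close> is the extension from pure
    tensors.\<close>
  interpret bilinear_functor CY CX CZ "\<lambda>(Y, X). cut_obj R ys V bs \<sigma> Y X"
    "\<lambda>A B. cut_mor R ys V bs \<sigma> (fst A) (fst B) (snd A) (snd B)"
    by (unfold_locales; (unfold mem_Times_iff split_beta)?; (elim conjE)?)
      (rule thick_linear_category[OF rat] cut_obj_ob MOR_hom MOR_bilinear MOR_id MOR_comp; assumption)+
  show ?thesis
    unfolding CC_def using F_functor F_pure[unfolded obT] by (intro exI[of _ F]) auto
qed

end
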